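(* Assuming the Strong Exponential Time Hypothesis, for every $\varepsilon>0$ there is a constant $c$ such that verifying whether a given perfect matching is stable in the boolean $d$-attribute model with $d=c\log n$ requires time $\Omega(n^{2-\varepsilon})$.
   Context: The Strong Exponential Time Hypothesis (SETH) states that for every $\varepsilon>0$ there is a $k$ such that $k$-SAT on $n$ variables requires time $\Omega(2^{(1-\varepsilon)n})$. A matching market has $n$ men and $n$ women. In the boolean $d$-attribute model each participant $p$ has attribute vector $A(p)\in\{0,1\}^d$ and weight vector $\alpha(p)\in\{0,1\}^d$; a man $m$ values woman $w$ by $\langle\alpha(m),A(w)\rangle$ and prefers larger values, symmetrically for women. A perfect matching $\mu$ is (weakly) stable if there is no pair $(m,w)\notin\mu$ in which $m$ strictly prefers $w$ to $\mu(m)$ and $w$ strictly prefers $m$ to $\mu(w)$. *)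

theory Defs
  imports Complex_Main "HOL-Library.Discrete_Functions" "HOL-Library.Landau_Symbols"
begin

section \<open>Machine model\<close>

text \<open>
  Deterministic random access machine with the logarithmic cost measure: a program has registers,
  addressed by constants, and an unbounded memory, addressed through register contents; both
  hold natural numbers. Every instruction is charged the bit lengths of the numbers and
  memory addresses it handles. Since register indices are constants of the program, charging for
  them as well would only change the running time by a constant factor. On numbers that are
  polynomial in the input size, the measure agrees with the unit cost of a word RAM up to a
  logarithmic factor, and no bound on the word length has to be fixed in advance.
\<close>

datatype instr =
    Const nat nat     \<comment> \<open>\<open>r\<^sub>i := c\<close>\<close>
  | Add nat nat nat   \<comment> \<open>\<open>r\<^sub>i := r\<^sub>j + r\<^sub>k\<close>\<close>
  | Sub nat nat nat   \<comment> \<open>truncated at 0\<close>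
  | Mul nat nat nat
  | Div nat nat nat   \<comment> \<open>division by 0 yields 0\<close>
  | Load nat nat      \<comment> \<open>\<open>r\<^sub>i := mem[r\<^sub>j]\<close>\<close>
  | Store nat nat     \<comment> \<open>\<open>mem[r\<^sub>i] := r\<^sub>j\<close>\<close>
  | JumpZero nat nat  \<comment> \<open>go to the given program line if \<open>r\<^sub>i = 0\<close>\<close>
  | Jump nat

type_synonym program = "instr list"

record config =
  pc :: nat
  reg :: "nat \<Rightarrow> nat"
  mem :: "nat \<Rightarrow> nat"

definition bit_length :: "nat \<Rightarrow> nat" where
  "bit_length x = Suc (floor_log x)"

fun exec_instr :: "instr \<Rightarrow> config \<Rightarrow> config" where
  "exec_instr (Const i c) s = s\<lparr>pc := Suc (pc s), reg := (reg s)(i := c)\<rparr>"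
| "exec_instr (Add i j k) s = s\<lparr>pc := Suc (pc s), reg := (reg s)(i := reg s j + reg s k)\<rparr>"
| "exec_instr (Sub i j k) s = s\<lparr>pc := Suc (pc s), reg := (reg s)(i := reg s j - reg s k)\<rparr>"
| "exec_instr (Mul i j k) s = s\<lparr>pc := Suc (pc s), reg := (reg s)(i := reg s j * reg s k)\<rparr>"
| "exec_instr (Div i j k) s = s\<lparr>pc := Suc (pc s), reg := (reg s)(i := reg s j div reg s k)\<rparr>"
| "exec_instr (Load i j) s = s\<lparr>pc := Suc (pc s), reg := (reg s)(i := mem s (reg s j))\<rparr>"
| "exec_instr (Store i j) s = s\<lparr>pc := Suc (pc s), mem := (mem s)(reg s i := reg s j)\<rparr>"
| "exec_instr (JumpZero i l) s = s\<lparr>pc := (if reg s i = 0 then l else Suc (pc s))\<rparr>"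
| "exec_instr (Jump l) s = s\<lparr>pc := l\<rparr>"

fun instr_cost :: "instr \<Rightarrow> config \<Rightarrow> nat" where
  "instr_cost (Const i c) s = bit_length c"
| "instr_cost (Add i j k) s = bit_length (reg s j) + bit_length (reg s k)"
| "instr_cost (Sub i j k) s = bit_length (reg s j) + bit_length (reg s k)"
| "instr_cost (Mul i j k) s = bit_length (reg s j) + bit_length (reg s k)"
| "instr_cost (Div i j k) s = bit_length (reg s j) + bit_length (reg s k)"
| "instr_cost (Load i j) s = bit_length (reg s j) + bit_length (mem s (reg s j))"
| "instr_cost (Store i j) s = bit_length (reg s i) + bit_length (reg s j)"
| "instr_cost (JumpZero i l) s = bit_length (reg s i)"
| "instr_cost (Jump l) s = 1"

text \<open>The machine halts when the program counter leaves the program; halted configurations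
  are fixed points of \<open>step\<close> and cost nothing.\<close>

definition halted :: "program \<Rightarrow> config \<Rightarrow> bool" where
  "halted p s \<longleftrightarrow> length p \<le> pc s"

definition step :: "program \<Rightarrow> config \<Rightarrow> config" where
  "step p s = (if halted p s then s else exec_instr (p ! pc s) s)"

definition step_cost :: "program \<Rightarrow> config \<Rightarrow> nat" where
  "step_cost p s = (if halted p s then 0 else instr_cost (p ! pc s) s)"

definition init :: "nat list \<Rightarrow> config" where
  "init xs = \<lparr>pc = 0, reg = (\<lambda>_. 0), mem = (\<lambda>a. if a < length xs then xs ! a else 0)\<rparr>"

definition run_cost :: "program \<Rightarrow> nat list \<Rightarrow> nat \<Rightarrow> nat" where
  "run_cost p xs k = (\<Sum>i<k. step_cost p ((step p ^^ i) (init xs)))"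

text \<open>A halting run accepts if register 0 finally holds a nonzero number.\<close>

definition decides_input :: "program \<Rightarrow> nat list \<Rightarrow> nat \<Rightarrow> bool \<Rightarrow> bool" where
  "decides_input p xs t b \<longleftrightarrow>
     (\<exists>k. halted p ((step p ^^ k) (init xs)) \<and> run_cost p xs k \<le> t \<and>
          (reg ((step p ^^ k) (init xs)) 0 \<noteq> 0 \<longleftrightarrow> b))"


section \<open>Decision problems and lower bounds\<close>

text \<open>The instances are graded by the parameter in which running times are measured (number of
  variables, number of men).\<close>

record 'a problem =
  instances :: "nat \<Rightarrow> 'a set"
  encoding :: "nat \<Rightarrow> 'a \<Rightarrow> nat list"
  positive :: "nat \<Rightarrow> 'a \<Rightarrow> bool"

definition decides_in_time :: "program \<Rightarrow> 'a problem \<Rightarrow> (nat \<Rightarrow> nat) \<Rightarrow> bool" where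
  "decides_in_time p P T \<longleftrightarrow>
     (\<forall>n. \<forall>x \<in> instances P n. decides_input p (encoding P n x) (T n) (positive P n x))"

text \<open>\<open>T\<close> ranges over all upper bounds on the worst-case running time of \<open>p\<close>, hence in
  particular over the worst-case running time itself whenever that is finite.\<close>

definition requires_time :: "'a problem \<Rightarrow> (nat \<Rightarrow> real) \<Rightarrow> bool" where
  "requires_time P f \<longleftrightarrow>
     (\<forall>p T. decides_in_time p P T \<longrightarrow> (\<lambda>n. real (T n)) \<in> \<Omega>(f))"


section \<open>\<open>k\<close>-SAT and the Strong Exponential Time Hypothesis\<close>

type_synonym literal = "nat \<times> bool"
type_synonym clause = "literal list"
type_synonym cnf = "clause list"

text \<open>Repeated clauses are excluded: there are then only finitely many formulas over \<open>n\<close>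
  variables, all of size polynomial in \<open>n\<close>, so that time can be measured in \<open>n\<close>.\<close>

definition k_cnf :: "nat \<Rightarrow> nat \<Rightarrow> cnf set" where
  "k_cnf k n = {\<phi>. distinct \<phi> \<and> (\<forall>C \<in> set \<phi>. length C \<le> k \<and> (\<forall>l \<in> set C. fst l < n))}"

definition satisfiable :: "cnf \<Rightarrow> bool" where
  "satisfiable \<phi> \<longleftrightarrow> (\<exists>\<sigma> :: nat \<Rightarrow> bool. \<forall>C \<in> set \<phi>. \<exists>l \<in> set C. \<sigma> (fst l) = snd l)"

definition encode_literal :: "literal \<Rightarrow> nat" where
  "encode_literal l = 2 * fst l + of_bool (snd l)"

definition encode_cnf :: "nat \<Rightarrow> cnf \<Rightarrow> nat list" where
  "encode_cnf n \<phi> =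
     [n, length \<phi>] @ concat (map (\<lambda>C. length C # map encode_literal C) \<phi>)"

definition k_SAT :: "nat \<Rightarrow> cnf problem" where
  "k_SAT k = \<lparr>instances = k_cnf k, encoding = encode_cnf, positive = (\<lambda>_. satisfiable)\<rparr>"

definition SETH :: bool where
  "SETH \<longleftrightarrow>
     (\<forall>\<epsilon>::real. \<epsilon> > 0 \<longrightarrow> (\<exists>k. requires_time (k_SAT k) (\<lambda>n. 2 powr ((1 - \<epsilon>) * real n))))"


section \<open>Stable matchings in the boolean attribute model\<close>

text \<open>Men and women are both indexed by \<open>{..<n}\<close>; the \<open>j\<close>-th coordinate (\<open>j < d\<close>) of the vector
  of participant \<open>i\<close> is the value at \<open>i j\<close>.\<close>

record market =
  man_attr :: "nat \<Rightarrow> nat \<Rightarrow> nat"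
  man_weight :: "nat \<Rightarrow> nat \<Rightarrow> nat"
  woman_attr :: "nat \<Rightarrow> nat \<Rightarrow> nat"
  woman_weight :: "nat \<Rightarrow> nat \<Rightarrow> nat"

definition boolean_vectors :: "nat \<Rightarrow> nat \<Rightarrow> (nat \<Rightarrow> nat \<Rightarrow> nat) \<Rightarrow> bool" where
  "boolean_vectors n d V \<longleftrightarrow> (\<forall>i<n. \<forall>j<d. V i j \<in> {0, 1})"

definition boolean_market :: "nat \<Rightarrow> nat \<Rightarrow> market \<Rightarrow> bool" where
  "boolean_market n d M \<longleftrightarrow>
     boolean_vectors n d (man_attr M) \<and> boolean_vectors n d (man_weight M) \<and>
     boolean_vectors n d (woman_attr M) \<and> boolean_vectors n d (woman_weight M)"

definition dot :: "nat \<Rightarrow> (nat \<Rightarrow> nat) \<Rightarrow> (nat \<Rightarrow> nat) \<Rightarrow> nat" where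
  "dot d u v = (\<Sum>j<d. u j * v j)"

definition man_value :: "nat \<Rightarrow> market \<Rightarrow> nat \<Rightarrow> nat \<Rightarrow> nat" where
  "man_value d M m w = dot d (man_weight M m) (woman_attr M w)"

definition woman_value :: "nat \<Rightarrow> market \<Rightarrow> nat \<Rightarrow> nat \<Rightarrow> nat" where
  "woman_value d M w m = dot d (woman_weight M w) (man_attr M m)"

text \<open>A perfect matching is the bijection sending each man to his partner.\<close>

definition perfect_matching :: "nat \<Rightarrow> (nat \<Rightarrow> nat) \<Rightarrow> bool" where
  "perfect_matching n \<mu> \<longleftrightarrow> bij_betw \<mu> {..<n} {..<n}"

definition blocking_pair ::
    "nat \<Rightarrow> nat \<Rightarrow> market \<Rightarrow> (nat \<Rightarrow> nat) \<Rightarrow> nat \<Rightarrow> nat \<Rightarrow> bool" where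
  "blocking_pair n d M \<mu> m w \<longleftrightarrow>
     m < n \<and> w < n \<and> \<mu> m \<noteq> w \<and>
     man_value d M m w > man_value d M m (\<mu> m) \<and>
     woman_value d M w m > woman_value d M w (inv_into {..<n} \<mu> w)"

definition stable :: "nat \<Rightarrow> nat \<Rightarrow> market \<Rightarrow> (nat \<Rightarrow> nat) \<Rightarrow> bool" where
  "stable n d M \<mu> \<longleftrightarrow> (\<nexists>m w. blocking_pair n d M \<mu> m w)"

definition encode_vectors :: "nat \<Rightarrow> nat \<Rightarrow> (nat \<Rightarrow> nat \<Rightarrow> nat) \<Rightarrow> nat list" where
  "encode_vectors n d V = concat (map (\<lambda>i. map (V i) [0..<d]) [0..<n])"

definition encode_matching_instance ::
    "nat \<Rightarrow> nat \<Rightarrow> market \<times> (nat \<Rightarrow> nat) \<Rightarrow> nat list" where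
  "encode_matching_instance n d = (\<lambda>(M, \<mu>).
     [n, d] @ encode_vectors n d (man_attr M) @ encode_vectors n d (man_weight M) @
     encode_vectors n d (woman_attr M) @ encode_vectors n d (woman_weight M) @
     map \<mu> [0..<n])"

text \<open>The dimension is a function of the number \<open>n\<close> of men.\<close>

definition stable_verification :: "(nat \<Rightarrow> nat) \<Rightarrow> (market \<times> (nat \<Rightarrow> nat)) problem" where
  "stable_verification D =
     \<lparr>instances = (\<lambda>n. {(M, \<mu>). boolean_market n (D n) M \<and> perfect_matching n \<mu>}),
      encoding = (\<lambda>n. encode_matching_instance n (D n)),
      positive = (\<lambda>n (M, \<mu>). stable n (D n) M \<mu>)\<rparr>"

end

theory Submission
  imports Defs
begin

text \<open>
  Let \<open>p\<close> verify matchings of \<open>N\<close> pairs in time \<open>T N < N\<^sup>2\<^sup>-\<^sup>\<epsilon>\<close> for infinitely many \<open>N\<close>. Split the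
  \<open>n = 3 q\<close> variables of a \<open>k\<close>-CNF into three blocks. A sparsification in the style of Impagliazzo,
  Paturi and Zane (branch on a sunflower: add either its heart or all its petals) followed by
  branching on the third block turns the formula into at most \<open>2\<^sup>q\<^sup>+\<^sup>\<delta>\<^sup>n\<close> formulas with \<open>O(n)\<close> clauses. For
  each of them, the men and the women of a market are the assignments of the first two blocks; two
  coordinates per clause make \<open>x\<close> and \<open>y\<close> block a fixed matching with dummies exactly if they
  jointly satisfy all clauses. Hence \<open>p\<close> decides satisfiability in time about
  \<open>2\<^sup>q \<cdot> 2\<^sup>q\<^sup>(\<^sup>2\<^sup>-\<^sup>\<epsilon>\<^sup>)\<close> up to a factor \<open>2\<^sup>\<delta>\<^sup>n\<close>, against SETH.

  Since \<open>p\<close> is fast only for infinitely many \<open>N\<close>, all sizes \<open>2 \<cdot> 2\<^sup>q \<le> N < 4 \<cdot> 2\<^sup>q\<close> are tried in turn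
  with a clocked simulation of \<open>p\<close>; the clock is doubled when all sizes have run out of time. As a
  run that succeeds settles its formula, time-outs happen only until the best size is reached with
  a sufficient clock, and their number does not multiply with the number of formulas.
\<close>

section \<open>Structured programs\<close>

text \<open>The third block pays for the search for a good size. The search wastes about
  \<open>2^q\<close> runs, each of up to roughly \<open>2^(q(2-e))\<close> steps. With two blocks of
  \<open>n / 2\<close> variables these failures alone would take more than \<open>2^n\<close> steps
  for small \<open>e\<close>; with blocks of \<open>n / 3\<close> variables they cost no more than
  the useful runs, one for each of the roughly \<open>2^q\<close> leaves. Sparsification is forced
  by the dimension: a \<open>k\<close>-CNF may have about \<open>n^k\<close> clauses, while a
  dimension \<open>c log N\<close> has room for O(n) coordinates only, where \<open>c\<close> may
  depend on epsilon but not on \<open>n\<close>. Since the machine model is concrete, the reduction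
  must be an actual program. Its polynomial parts are functions on trees, treated by a calculus that
  counts operations and bounds the numbers in use; its exponential parts (writing an instance,
  simulating \<open>p\<close>, the worklist) are coded directly, with cost invariants. A program can
  be stopped early only by interpreting it, and its numbers may be as long as its running time, so
  the interpreter has to be nearly linear in the logarithmic cost.\<close>

datatype com =
    Blk "instr list"
  | Seq com com  (infixr ";;" 60)
  | Ite nat com com
  | While nat com

fun straight :: "instr => bool" where
  "straight (JumpZero _ _) = False"
| "straight (Jump _) = False"
| "straight _ = True"

fun blk_cost :: "instr list => config => nat" where
  "blk_cost [] s = 0"
| "blk_cost (i # is) s = instr_cost i s + blk_cost is (exec_instr i s)"

fun blk_exec :: "instr list => config => config" where
  "blk_exec [] s = s"
| "blk_exec (i # is) s = blk_exec is (exec_instr i s)"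

text \<open>The costs are those of the compiled code: a test is a \<open>JumpZero\<close>, charged
  the bit length of the tested register, and the extra \<open>1\<close> in \<open>IteT\<close> and
  \<open>WhileT\<close> is the \<open>Jump\<close> that skips the other branch or returns to the
  test. A register holding 0 has bit length 1.\<close>

inductive exec :: "com => config => nat => config => bool" where
  Blk: "list_all straight is ==> exec (Blk is) s (blk_cost is s) (blk_exec is s)"
| Seq: "exec c1 s k1 s1 ==> exec c2 s1 k2 s2 ==> exec (c1 ;; c2) s (k1 + k2) s2"
| IteT: "reg s r ~= 0 ==> exec c1 s k s' ==> exec (Ite r c1 c2) s (bit_length (reg s r) + 1 + k) s'"
| IteF: "reg s r = 0 ==> exec c2 s k s' ==> exec (Ite r c1 c2) s (1 + k) s'"
| WhileF: "reg s r = 0 ==> exec (While r c) s 1 s"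
| WhileT: "reg s r ~= 0 ==> exec c s k1 s1 ==> exec (While r c) s1 k2 s2 ==>
    exec (While r c) s (bit_length (reg s r) + 1 + k1 + k2) s2"

fun clen :: "com => nat" where
  "clen (Blk is) = length is"
| "clen (c1 ;; c2) = clen c1 + clen c2"
| "clen (Ite r c1 c2) = clen c1 + clen c2 + 2"
| "clen (While r c) = clen c + 2"

text \<open>Jump targets are absolute, so the line \<open>l\<close> at which the code will stand has
  to be known.\<close>

fun compile :: "nat => com => program" where
  "compile l (Blk is) = is"
| "compile l (c1 ;; c2) = compile l c1 @ compile (l + clen c1) c2"
| "compile l (Ite r c1 c2) =
     [JumpZero r (l + 2 + clen c1)] @ compile (l + 1) c1 @
     [Jump (l + 2 + clen c1 + clen c2)] @ compile (l + 2 + clen c1) c2"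
| "compile l (While r c) = [JumpZero r (l + 2 + clen c)] @ compile (l + 1) c @ [Jump l]"

lemma length_compile [simp]: "length (compile l c) = clen c"
  by (induction c arbitrary: l) auto

definition code_at :: "program => nat => program => bool" where
  "code_at p l q \<longleftrightarrow> (EX xs ys. p = xs @ q @ ys & length xs = l)"

lemma code_at_append:
  "code_at p l (q1 @ q2) \<longleftrightarrow> code_at p l q1 & code_at p (l + length q1) q2"
proof
  assume "code_at p l (q1 @ q2)"
  then obtain xs ys where *: "p = xs @ q1 @ q2 @ ys" "length xs = l" by (auto simp: code_at_def)
  have "p = (xs @ q1) @ q2 @ ys" "length (xs @ q1) = l + length q1" using * by auto
  then show "code_at p l q1 & code_at p (l + length q1) q2" using * unfolding code_at_def by blast
next
  assume "code_at p l q1 & code_at p (l + length q1) q2"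
  then obtain xs ys xs' ys' where "p = xs @ q1 @ ys" "length xs = l"
    "p = xs' @ q2 @ ys'" "length xs' = l + length q1" unfolding code_at_def by blast
  then have "xs @ q1 @ ys = xs' @ q2 @ ys'" "length (xs @ q1) = length xs'" by auto
  then have "xs' = xs @ q1" by (metis append_assoc append_eq_append_conv)
  then have "p = xs @ (q1 @ q2) @ ys'" using \<open>p = xs' @ q2 @ ys'\<close> by simp
  then show "code_at p l (q1 @ q2)" using \<open>length xs = l\<close> unfolding code_at_def by blast
qed

lemma code_at_Cons: "code_at p l (i # q) \<longleftrightarrow> l < length p & p ! l = i & code_at p (Suc l) q"
proof
  assume "code_at p l (i # q)"
  then obtain xs ys where *: "p = xs @ (i # q) @ ys" "length xs = l" unfolding code_at_def by blast
  then have "p = (xs @ [i]) @ q @ ys" "length (xs @ [i]) = Suc l" by auto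
  then have "code_at p (Suc l) q" unfolding code_at_def by blast
  with * show "l < length p & p ! l = i & code_at p (Suc l) q"
    by (auto simp: nth_append)
next
  assume a: "l < length p & p ! l = i & code_at p (Suc l) q"
  then obtain xs ys where *: "p = xs @ q @ ys" "length xs = Suc l" by (auto simp: code_at_def)
  obtain x xs' where xs: "xs = xs' @ [x]" using *(2) by (metis length_Suc_conv_rev)
  have "p ! l = x" using * xs by (simp add: nth_append)
  then have "p = xs' @ (i # q) @ ys" "length xs' = l" using a * xs by auto
  then show "code_at p l (i # q)" unfolding code_at_def by blast
qed

definition reach :: "program => config => nat => config => bool" where
  "reach p s K s' \<longleftrightarrow> (EX k. (step p ^^ k) s = s' & (\<Sum>i<k. step_cost p ((step p ^^ i) s)) = K)"

lemma reach_refl: "reach p s 0 s"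
  unfolding reach_def by (rule exI[of _ 0]) auto

lemma reach_trans:
  assumes "reach p s K1 s1" "reach p s1 K2 s2" shows "reach p s (K1 + K2) s2"
proof -
  obtain k1 where k1: "(step p ^^ k1) s = s1" "(\<Sum>i<k1. step_cost p ((step p ^^ i) s)) = K1"
    using assms(1) unfolding reach_def by blast
  obtain k2 where k2: "(step p ^^ k2) s1 = s2" "(\<Sum>i<k2. step_cost p ((step p ^^ i) s1)) = K2"
    using assms(2) unfolding reach_def by blast
  have *: "(step p ^^ (k1 + j)) s = (step p ^^ j) s1" for j
    using k1(1) by (metis add.commute comp_apply funpow_add)
  have "(\<Sum>i<k1 + k2. step_cost p ((step p ^^ i) s)) =
    (\<Sum>i<k1. step_cost p ((step p ^^ i) s)) + (\<Sum>i<k2. step_cost p ((step p ^^ (k1 + i)) s))"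
    by (induction k2) auto
  also have "... = K1 + K2" using k1 k2 * by simp
  finally show ?thesis unfolding reach_def using * k2(1) by blast
qed

lemma reach_step:
  assumes "pc s < length p" "exec_instr (p ! pc s) s = s'" "instr_cost (p ! pc s) s = K"
  shows "reach p s K s'"
  unfolding reach_def
  by (rule exI[of _ 1]) (use assms in \<open>auto simp: step_def step_cost_def halted_def\<close>)

lemma exec_instr_straight:
  "straight i ==> exec_instr i (s\<lparr>pc := l\<rparr>) = (exec_instr i s)\<lparr>pc := Suc l\<rparr>"
  "straight i ==> instr_cost i (s\<lparr>pc := l\<rparr>) = instr_cost i s"
  by (cases i; simp)+

lemma reach_Blk:
  "list_all straight is ==> code_at p l is ==>
    reach p (s\<lparr>pc := l\<rparr>) (blk_cost is s) ((blk_exec is s)\<lparr>pc := l + length is\<rparr>)"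
proof (induction "is" arbitrary: s l)
  case Nil
  then show ?case by (simp add: reach_refl)
next
  case (Cons i js)
  then have *: "straight i" "list_all straight js" "l < length p" "p ! l = i" "code_at p (Suc l) js"
    by (auto simp: code_at_Cons)
  have "reach p (s\<lparr>pc := l\<rparr>) (instr_cost i s) ((exec_instr i s)\<lparr>pc := Suc l\<rparr>)"
    by (rule reach_step) (use * in \<open>auto simp: exec_instr_straight\<close>)
  from reach_trans[OF this Cons.IH[OF *(2,5)]] show ?case by simp
qed

text \<open>The program counter in the states of \<open>exec\<close> carries no information, as
  straight-line instructions only increment it; both ends are therefore overwritten with the actual
  lines.\<close>

theorem compile_correct:
  "exec c s K s' ==> code_at p l (compile l c) ==>
    reach p (s\<lparr>pc := l\<rparr>) K (s'\<lparr>pc := l + clen c\<rparr>)"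
proof (induction arbitrary: l rule: exec.induct)
  case (Blk "is" s)
  then show ?case using reach_Blk by simp
next
  case (Seq c1 s k1 s1 c2 k2 s2)
  then have "reach p (s\<lparr>pc := l\<rparr>) k1 (s1\<lparr>pc := l + clen c1\<rparr>)"
    "reach p (s1\<lparr>pc := l + clen c1\<rparr>) k2 (s2\<lparr>pc := l + clen c1 + clen c2\<rparr>)"
    by (auto simp: code_at_append)
  from reach_trans[OF this] show ?case by (simp add: add.assoc)
next
  case (IteT s r c1 k s' c2)
  then have c: "l < length p" "p ! l = JumpZero r (l + 2 + clen c1)" "code_at p (Suc l) (compile (Suc l) c1)"
    "Suc l + clen c1 < length p" "p ! (Suc l + clen c1) = Jump (l + 2 + clen c1 + clen c2)"
    by (auto simp: code_at_append code_at_Cons)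
  have 1: "reach p (s\<lparr>pc := l\<rparr>) (bit_length (reg s r)) (s\<lparr>pc := Suc l\<rparr>)"
    by (rule reach_step) (use c IteT in auto)
  have 2: "reach p (s\<lparr>pc := Suc l\<rparr>) k (s'\<lparr>pc := Suc l + clen c1\<rparr>)"
    by (rule IteT.IH) (use c in auto)
  have 3: "reach p (s'\<lparr>pc := Suc l + clen c1\<rparr>) 1 (s'\<lparr>pc := l + 2 + clen c1 + clen c2\<rparr>)"
    by (rule reach_step) (use c in auto)
  from reach_trans[OF reach_trans[OF 1 2] 3] show ?case by (simp add: ac_simps)
next
  case (IteF s r c2 k s' c1)
  then have c: "l < length p" "p ! l = JumpZero r (l + 2 + clen c1)"
    "code_at p (l + 2 + clen c1) (compile (l + 2 + clen c1) c2)"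
    by (auto simp: code_at_append code_at_Cons)
  have 1: "reach p (s\<lparr>pc := l\<rparr>) 1 (s\<lparr>pc := l + 2 + clen c1\<rparr>)"
    by (rule reach_step) (use c IteF in \<open>auto simp: bit_length_def\<close>)
  have 2: "reach p (s\<lparr>pc := l + 2 + clen c1\<rparr>) k (s'\<lparr>pc := l + 2 + clen c1 + clen c2\<rparr>)"
    by (rule IteF.IH) (use c in auto)
  from reach_trans[OF 1 2] show ?case by (simp add: ac_simps)
next
  case (WhileF s r c)
  then have c: "l < length p" "p ! l = JumpZero r (l + 2 + clen c)"
    by (auto simp: code_at_append code_at_Cons)
  show ?case
    by (rule reach_step) (use c WhileF in \<open>auto simp: bit_length_def\<close>)
next
  case (WhileT s r c k1 s1 k2 s2)
  then have c: "l < length p" "p ! l = JumpZero r (l + 2 + clen c)" "code_at p (Suc l) (compile (Suc l) c)"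
    "Suc l + clen c < length p" "p ! (Suc l + clen c) = Jump l"
    by (auto simp: code_at_append code_at_Cons)
  have 1: "reach p (s\<lparr>pc := l\<rparr>) (bit_length (reg s r)) (s\<lparr>pc := Suc l\<rparr>)"
    by (rule reach_step) (use c WhileT in auto)
  have 2: "reach p (s\<lparr>pc := Suc l\<rparr>) k1 (s1\<lparr>pc := Suc l + clen c\<rparr>)"
    by (rule WhileT.IH) (use c in auto)
  have 3: "reach p (s1\<lparr>pc := Suc l + clen c\<rparr>) 1 (s1\<lparr>pc := l\<rparr>)"
    by (rule reach_step) (use c in auto)
  have 4: "reach p (s1\<lparr>pc := l\<rparr>) k2 (s2\<lparr>pc := l + clen (While r c)\<rparr>)"
    by (rule WhileT.IH) (use WhileT in auto)
  from reach_trans[OF reach_trans[OF reach_trans[OF 1 2] 3] 4] show ?case by (simp add: ac_simps)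
qed

lemma exec_decides:
  assumes "exec c (init xs) K s'" "K <= t" "reg s' 0 ~= 0 \<longleftrightarrow> b"
  shows "decides_input (compile 0 c) xs t b"
proof -
  have "code_at (compile 0 c) 0 (compile 0 c)" unfolding code_at_def by (rule exI[of _ "[]"]) auto
  from compile_correct[OF assms(1) this]
  have "reach (compile 0 c) (init xs) K (s'\<lparr>pc := clen c\<rparr>)" by (simp add: init_def)
  then obtain k where "(step (compile 0 c) ^^ k) (init xs) = s'\<lparr>pc := clen c\<rparr>"
    "run_cost (compile 0 c) xs k = K" unfolding reach_def run_cost_def by blast
  then show ?thesis unfolding decides_input_def
    by (intro exI[of _ k]) (use assms in \<open>auto simp: halted_def\<close>)
qed

section \<open>Total correctness with a bound on the cost\<close>

definition runs :: "com => config => nat => (config => bool) => bool" where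
  "runs c s b Q \<longleftrightarrow> (EX K s'. exec c s K s' & K <= b & Q s')"

lemma runs_mono: "runs c s b Q ==> b <= b' ==> (!!s'. Q s' ==> Q' s') ==> runs c s b' Q'"
  unfolding runs_def by (meson le_trans)

lemma runs_Blk: "list_all straight is ==> blk_cost is s <= b ==> Q (blk_exec is s) ==> runs (Blk is) s b Q"
  unfolding runs_def using exec.Blk by blast

lemma runs_Seq:
  assumes "runs c1 s b1 Q1" "!!s1. Q1 s1 ==> runs c2 s1 b2 Q" "b1 + b2 <= b"
  shows "runs (c1 ;; c2) s b Q"
proof -
  obtain K1 s1 where 1: "exec c1 s K1 s1" "K1 <= b1" "Q1 s1" using assms(1) unfolding runs_def by blast
  obtain K2 s2 where 2: "exec c2 s1 K2 s2" "K2 <= b2" "Q s2" using assms(2)[OF 1(3)] unfolding runs_def by blast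
  show ?thesis unfolding runs_def using exec.Seq[OF 1(1) 2(1)] 1 2 assms(3)
    by (meson add_le_mono le_trans)
qed

lemma runs_Ite:
  assumes "reg s r ~= 0 ==> runs c1 s b1 Q" "reg s r = 0 ==> runs c2 s b1 Q"
    "bit_length (reg s r) + 1 + b1 <= b"
  shows "runs (Ite r c1 c2) s b Q"
proof (cases "reg s r = 0")
  case True
  with assms obtain K s' where "exec c2 s K s'" "K <= b1" "Q s'" unfolding runs_def by blast
  with exec.IteF[OF True this(1)] show ?thesis using assms(3) unfolding runs_def
    by (metis (no_types, lifting) add.commute add_le_mono le_add2 le_trans)
next
  case False
  with assms obtain K s' where "exec c1 s K s'" "K <= b1" "Q s'" unfolding runs_def by blast
  with exec.IteT[OF False this(1)] show ?thesis using assms(3) unfolding runs_def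
    by (meson add_le_mono le_refl le_trans)
qed

text \<open>\<open>I i s\<close> says that at most \<open>i\<close> further iterations follow.\<close>

lemma runs_While:
  assumes "I i s"
    and body: "!!i s. I i s ==> reg s r ~= 0 ==>
      bit_length (reg s r) + 1 <= g & runs c s b (%s'. EX j<i. I j s')"
    and exit: "!!i s. I i s ==> reg s r = 0 ==> Q s"
  shows "runs (While r c) s (i * (g + b) + 1) Q"
  using assms(1)
proof (induction i arbitrary: s rule: less_induct)
  case (less i)
  show ?case
  proof (cases "reg s r = 0")
    case True
    then show ?thesis using exec.WhileF[OF True] exit[OF less.prems True] unfolding runs_def by fastforce
  next
    case False
    obtain K1 s1 j where 1: "exec c s K1 s1" "K1 <= b" "j < i" "I j s1" "bit_length (reg s r) + 1 <= g"
      using body[OF less.prems False] unfolding runs_def by blast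
    obtain K2 s2 where 2: "exec (While r c) s1 K2 s2" "K2 <= j * (g + b) + 1" "Q s2"
      using less.IH[OF 1(3,4)] unfolding runs_def by blast
    have "(j + 1) * (g + b) <= i * (g + b)" using 1(3) by (intro mult_le_mono) auto
    then have "bit_length (reg s r) + 1 + K1 + K2 <= i * (g + b) + 1" using 1 2 by simp
    with exec.WhileT[OF False 1(1) 2(1)] 2(3) show ?thesis unfolding runs_def by blast
  qed
qed

section \<open>Computing with trees on a heap\<close>

lemma bit_length_mono: "x <= y ==> bit_length x <= bit_length y"
  unfolding bit_length_def using floor_log_mono by (simp add: monoD)

lemma bit_length_pos [simp]: "1 <= bit_length x" "Suc 0 <= bit_length x" "0 < bit_length x"
  by (auto simp: bit_length_def)

section \<open>Finite trees and their representation in memory\<close>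

datatype data = At nat | Pr data data

fun dsize :: "data => nat" where
  "dsize (At _) = 1"
| "dsize (Pr u v) = dsize u + dsize v + 1"

class heap_data =
  fixes enc :: "'a => data"

instantiation nat :: heap_data begin
definition "enc_nat (n::nat) = At n"
instance ..
end

instantiation bool :: heap_data begin
definition "enc_bool (b::bool) = At (of_bool b)"
instance ..
end

instantiation prod :: (heap_data, heap_data) heap_data begin
definition "enc_prod p = Pr (enc (fst p)) (enc (snd p))"
instance ..
end

text \<open>Pairs have positive addresses, so with the atom 0 for the empty list a test for 0 tells
  the two kinds of lists apart.\<close>

instantiation list :: (heap_data) heap_data begin
primrec enc_list :: "'a list => data" where
  "enc_list [] = At 0"
| "enc_list (x # xs) = Pr (enc x) (enc_list xs)"
instance ..
end

text \<open>An atom counts 1 whatever its value: magnitudes are accounted for separately, through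
  the bound \<open>V\<close>.\<close>

definition sz :: "'a::heap_data => nat" where "sz x = dsize (enc x)"

lemma dsize_pos: "1 <= dsize d" by (cases d) auto

lemma sz_simps [simp]:
  "sz (n::nat) = 1" "sz (b::bool) = 1" "sz (x, y) = sz x + sz y + 1"
  "sz [] = 1" "sz (z # zs) = sz z + sz zs + 1"
  by (auto simp: sz_def enc_nat_def enc_bool_def enc_prod_def)

lemma sz_pair: "sz p = sz (fst p) + sz (snd p) + 1" by (cases p) simp

lemma sz_pos: "1 <= sz x" unfolding sz_def by (rule dsize_pos)

text \<open>A pair occupies the two even cells \<open>a\<close>, \<open>a + 2\<close>; \<open>h\<close> is the first free cell. The odd
  cells are left to other purposes.\<close>

fun rep :: "(nat => nat) => nat => data => nat => bool" where
  "rep m h (At x) a \<longleftrightarrow> a = x"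
| "rep m h (Pr u v) a \<longleftrightarrow> 0 < a & even a & a + 2 < h & rep m h u (m a) & rep m h v (m (a + 2))"

text \<open>Allocated cells are never overwritten, so a tree stays represented while the heap
  grows.\<close>

lemma rep_mono:
  "rep m h d a ==> h <= h' ==> (!!i. i < h ==> even i ==> m' i = m i) ==> rep m' h' d a"
  by (induction d arbitrary: a) auto

text \<open>Register 0 is the heap pointer. \<open>V\<close> bounds all numbers in use.\<close>

definition hp_ok :: "config => nat => bool" where
  "hp_ok s V \<longleftrightarrow> 0 < reg s 0 & even (reg s 0) & reg s 0 <= V &
     (ALL a<reg s 0. even a --> mem s a <= V)"

definition holds :: "config => nat => 'a::heap_data => nat => bool" where
  "holds s k x V \<longleftrightarrow> reg s k <= V & rep (mem s) (reg s 0) (enc x) (reg s k)"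

text \<open>The calling convention: code with base register \<open>k\<close> finds its argument and
  leaves its result in register \<open>k\<close>, and may use all higher registers as scratch. A
  caller keeps what it still needs below the base register of the callee.\<close>

definition ext :: "nat => config => config => bool" where
  "ext k s s' \<longleftrightarrow> reg s 0 <= reg s' 0 & (ALL i. 0 < i & i < k --> reg s' i = reg s i) &
     (ALL a. odd a | a < reg s 0 --> mem s' a = mem s a)"

definition post :: "nat => config => 'a::heap_data => nat => config => bool" where
  "post k s y V s' \<longleftrightarrow> ext k s s' & hp_ok s' V & holds s' k y V"

text \<open>Costs are measured in units of \<open>bit_length V\<close>, an upper bound for the price
  of one operand, so that \<open>t\<close> counts operations.\<close>

definition xc :: "com => config => nat => nat => config => bool" where
  "xc c s t V s' \<longleftrightarrow> (EX K. exec c s K s' & K <= t * bit_length V)"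

lemma xc_mono: "xc c s t V s' ==> t <= t' ==> V <= V' ==> xc c s t' V' s'"
  unfolding xc_def using bit_length_mono[of V V'] by (meson le_trans mult_le_mono)

lemma xc_Seq: "xc c1 s t1 V s1 ==> xc c2 s1 t2 V s2 ==> xc (c1 ;; c2) s (t1 + t2) V s2"
  unfolding xc_def by (metis exec.Seq add_le_mono distrib_right)

lemma xc_Blk:
  "list_all straight is ==> blk_cost is s <= t * bit_length V ==> xc (Blk is) s t V (blk_exec is s)"
  unfolding xc_def using exec.Blk by blast

lemma xc_WhileF: "reg s r = 0 ==> xc (While r c) s 1 V s"
  unfolding xc_def using exec.WhileF[of s r c] bit_length_pos(1)[of V] by (metis mult_1)

lemma xc_WhileT:
  assumes "reg s r ~= 0" "reg s r <= V" "xc c s t1 V s1" "xc (While r c) s1 t2 V s2"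
  shows "xc (While r c) s (2 + t1 + t2) V s2"
proof -
  obtain K1 K2 where "exec c s K1 s1" "K1 <= t1 * bit_length V"
    "exec (While r c) s1 K2 s2" "K2 <= t2 * bit_length V" using assms(3,4) unfolding xc_def by blast
  moreover have "bit_length (reg s r) <= bit_length V" "1 <= bit_length V"
    using assms(2) bit_length_mono by auto
  ultimately have "exec (While r c) s (bit_length (reg s r) + 1 + K1 + K2) s2"
    "bit_length (reg s r) + 1 + K1 + K2 <= (2 + t1 + t2) * bit_length V"
    using exec.WhileT[OF assms(1)] unfolding distrib_right by (blast, linarith)
  then show ?thesis unfolding xc_def by blast
qed

lemma xc_IteT:
  assumes "reg s r ~= 0" "reg s r <= V" "xc c1 s t V s'"
  shows "xc (Ite r c1 c2) s (2 + t) V s'"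
proof -
  obtain K where "exec c1 s K s'" "K <= t * bit_length V" using assms(3) unfolding xc_def by blast
  moreover have "bit_length (reg s r) <= bit_length V" "1 <= bit_length V"
    using assms(2) bit_length_mono by auto
  ultimately have "exec (Ite r c1 c2) s (bit_length (reg s r) + 1 + K) s'"
    "bit_length (reg s r) + 1 + K <= (2 + t) * bit_length V"
    using exec.IteT[OF assms(1)] unfolding distrib_right by (blast, linarith)
  then show ?thesis unfolding xc_def by blast
qed

lemma xc_IteF:
  assumes "reg s r = 0" "xc c2 s t V s'"
  shows "xc (Ite r c1 c2) s (2 + t) V s'"
proof -
  obtain K where "exec c2 s K s'" "K <= t * bit_length V" using assms(2) unfolding xc_def by blast
  moreover have "1 <= bit_length V" by auto
  ultimately have "exec (Ite r c1 c2) s (1 + K) s'" "1 + K <= (2 + t) * bit_length V"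
    using exec.IteF[OF assms(1)] unfolding distrib_right by (blast, linarith)
  then show ?thesis unfolding xc_def by blast
qed

lemma ext_refl: "ext k s s" by (auto simp: ext_def)

lemma ext_trans: "ext k s s1 ==> ext k s1 s2 ==> ext k s s2"
  unfolding ext_def by (metis le_trans less_le_trans)

lemma ext_mono: "ext k s s' ==> k' <= k ==> ext k' s s'"
  unfolding ext_def by auto

lemma hp_ok_mono: "hp_ok s V ==> V <= V' ==> hp_ok s V'"
  unfolding hp_ok_def by (meson le_trans)

lemma holds_ext:
  assumes "holds s i x V" "ext k s s'" "0 < i" "i < k" "V <= V'" shows "holds s' i x V'"
  using assms rep_mono[of "mem s" "reg s 0" "enc x" "reg s i" "reg s' 0" "mem s'"]
  by (auto simp: holds_def ext_def)

lemma holds_mono: "holds s i x V ==> V <= V' ==> holds s i x V'"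
  by (auto simp: holds_def)

lemma post_mono: "post k s y V s' ==> V <= V' ==> post k s y V' s'"
  unfolding post_def using hp_ok_mono holds_mono by blast

lemma post_ext: "ext k s0 s ==> post k s y V s' ==> post k s0 y V s'"
  unfolding post_def using ext_trans by blast

lemma holds_Pr:
  assumes "holds s k p V" "hp_ok s V"
  shows "0 < reg s k" "even (reg s k)" "reg s k + 2 < reg s 0" "reg s k + 2 <= V"
    "mem s (reg s k) <= V" "mem s (reg s k + 2) <= V"
    "rep (mem s) (reg s 0) (enc (fst p)) (mem s (reg s k))"
    "rep (mem s) (reg s 0) (enc (snd p)) (mem s (reg s k + 2))"
  using assms by (auto simp: holds_def hp_ok_def enc_prod_def)

definition MOV :: "nat => nat => com" where
  "MOV i j = Blk [Const i 0, Add i i j]"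

lemma bit_length_0 [simp]: "bit_length 0 = 1" by (simp add: bit_length_def)

lemma bit_length_1 [simp]: "bit_length (Suc 0) = 1" by (simp add: bit_length_def)

lemma bit_length_2 [simp]: "bit_length 2 = 2"
  by (simp add: bit_length_def floor_log.simps[of 2])

lemma MOV_rule:
  assumes "hp_ok s V" "holds s j x V" "i ~= j" "0 < i" "0 < j"
  shows "EX s'. xc (MOV i j) s 4 V s' & post i s x V s'"
proof -
  have "bit_length (reg s j) <= bit_length V" using assms by (intro bit_length_mono) (auto simp: holds_def)
  moreover have "1 <= bit_length V" by simp
  ultimately have "xc (MOV i j) s 4 V (blk_exec [Const i 0, Add i i j] s)" unfolding MOV_def
    by (intro xc_Blk) (use assms(3) in \<open>auto simp del: bit_length_pos\<close>)
  then show ?thesis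
    by (intro exI conjI) (use assms in \<open>auto simp: post_def ext_def hp_ok_def holds_def\<close>)
qed

text \<open>Allocates the pair of the contents of registers \<open>i\<close> and \<open>j\<close>; \<open>u\<close> is a scratch register.\<close>

definition ALLOC :: "nat => nat => nat => nat => com" where
  "ALLOC k i j u = Blk [Store 0 i, Const u 2, Add 0 0 u, Store 0 j, Sub k 0 u, Add 0 0 u]"

text \<open>The bound rises to \<open>V + 4\<close> because the heap pointer moves by 4; the
  contents of the new cells were already bounded by \<open>V\<close>.\<close>

lemma ALLOC_rule:
  assumes "hp_ok s V" "holds s i x V" "holds s j y V"
    "0 < i" "0 < j" "0 < k" "k < u" "i ~= u" "j ~= u"
  shows "EX s'. xc (ALLOC k i j u) s 16 (V + 4) s' & post k s (x, y) (V + 4) s'"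
proof -
  let ?is = "[Store 0 i, Const u 2, Add 0 0 u, Store 0 j, Sub k 0 u, Add 0 0 u]"
  let ?h = "reg s 0"
  have h: "0 < ?h" "even ?h" "?h <= V" and m: "!!a. a < ?h ==> even a ==> mem s a <= V"
    and r: "reg s i <= V" "reg s j <= V"
    using assms by (auto simp: hp_ok_def holds_def)
  have "bit_length ?h <= bit_length (V + 4)" "bit_length (?h + 2) <= bit_length (V + 4)"
    "bit_length (reg s i) <= bit_length (V + 4)" "bit_length (reg s j) <= bit_length (V + 4)"
    "bit_length 2 <= bit_length (V + 4)"
    using h r by (intro bit_length_mono; simp)+
  then have "blk_cost ?is s <= 16 * bit_length (V + 4)"
    using assms(4-) by simp
  then have 1: "xc (ALLOC k i j u) s 16 (V + 4) (blk_exec ?is s)" unfolding ALLOC_def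
    by (intro xc_Blk) auto
  let ?s = "blk_exec ?is s"
  have r0: "reg ?s 0 = ?h + 4" "reg ?s k = ?h" and rr: "!!n. 0 < n ==> n < k ==> reg ?s n = reg s n"
    and ms: "mem ?s = (mem s)(?h := reg s i, ?h + 2 := reg s j)"
    using assms(4-) by auto
  have "ext k s ?s" using h rr unfolding ext_def ms r0 by auto
  moreover have "hp_ok ?s (V + 4)" unfolding hp_ok_def ms r0
  proof (intro conjI allI impI)
    fix a assume "a < ?h + 4" "even a"
    then have "a < ?h | a = ?h | a = ?h + 2" using h by presburger
    then show "((mem s)(?h := reg s i, ?h + 2 := reg s j)) a <= V + 4"
      using m[of a] \<open>even a\<close> r by auto
  qed (use h in auto)
  moreover have "holds ?s k (x, y) (V + 4)"
  proof -
    have "rep (mem ?s) (?h + 4) (enc x) (reg s i)" "rep (mem ?s) (?h + 4) (enc y) (reg s j)"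
      using assms(2,3) unfolding holds_def ms by (auto elim!: rep_mono)
    then show ?thesis unfolding holds_def r0 ms using h by (auto simp: enc_prod_def)
  qed
  ultimately show ?thesis using 1 unfolding post_def by blast
qed

text \<open>\<open>CT f t\<close>: the function \<open>f\<close> on heap data is computable with at most \<open>t x\<close> operations, each
  of which increases the largest number in use only additively.\<close>

definition CT :: "('a::heap_data => 'b::heap_data) => ('a => nat) => bool" where
  "CT f t \<longleftrightarrow> (ALL k>0. EX c. ALL s x V. hp_ok s V --> holds s k x V -->
     (EX s'. xc c s (t x) (V + t x) s' & post k s (f x) (V + t x) s'))"

lemma CT_E:
  assumes "CT f t" "0 < k"
  obtains c where "!!s x V. hp_ok s V ==> holds s k x V ==>
     EX s'. xc c s (t x) (V + t x) s' & post k s (f x) (V + t x) s'"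
  using assms unfolding CT_def by blast

lemma CT_mono: "CT f t ==> (!!x. t x <= t' x) ==> CT f t'"
  unfolding CT_def by (meson xc_mono post_mono add_le_mono le_refl)

section \<open>Closure properties of computable tree functions\<close>

lemma CT_id: "CT (%x. x) (%_. 0)"
  unfolding CT_def
proof (intro allI impI)
  fix k :: nat assume "0 < k"
  have "xc (Blk []) s 0 (V + 0) s" for s V using xc_Blk[of "[]" s 0 V] by simp
  moreover have "hp_ok s V ==> holds s k x V ==> post k s x (V + 0) s" for s x V
    by (simp add: post_def ext_refl)
  ultimately show "EX c. ALL s x V. hp_ok s V --> holds s k x V -->
     (EX s'. xc c s 0 (V + 0) s' & post k s x (V + 0) s')" by blast
qed

lemma CT_comp:
  fixes g :: "'a::heap_data => 'b::heap_data" and f :: "'b => 'c::heap_data"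
  assumes "CT g tg" "CT f tf"
  shows "CT (%x. f (g x)) (%x. tg x + tf (g x))"
  unfolding CT_def
proof (intro allI impI)
  fix k :: nat assume k: "0 < k"
  obtain cg where cg: "!!s x V. hp_ok s V ==> holds s k x V ==>
     EX s'. xc cg s (tg x) (V + tg x) s' & post k s (g x) (V + tg x) s'" using CT_E[OF assms(1) k] by blast
  obtain cf where cf: "!!s x V. hp_ok s V ==> holds s k x V ==>
     EX s'. xc cf s (tf x) (V + tf x) s' & post k s (f x) (V + tf x) s'" using CT_E[OF assms(2) k] by blast
  show "EX c. ALL s x V. hp_ok s V --> holds s k x V -->
    (EX s'. xc c s (tg x + tf (g x)) (V + (tg x + tf (g x))) s' & post k s (f (g x)) (V + (tg x + tf (g x))) s')"
  proof (intro exI[of _ "cg ;; cf"] allI impI)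
    fix s V and x :: 'a assume s: "hp_ok s V" "holds s k x V"
    obtain s1 where 1: "xc cg s (tg x) (V + tg x) s1" "post k s (g x) (V + tg x) s1"
      using cg[OF s] by blast
    obtain s2 where 2: "xc cf s1 (tf (g x)) (V + tg x + tf (g x)) s2"
      "post k s1 (f (g x)) (V + tg x + tf (g x)) s2" using cf 1(2) unfolding post_def by blast
    have "xc (cg ;; cf) s (tg x + tf (g x)) (V + (tg x + tf (g x))) s2"
      by (rule xc_Seq[OF xc_mono[OF 1(1)] xc_mono[OF 2(1)]]) auto
    moreover have "post k s (f (g x)) (V + (tg x + tf (g x))) s2"
      by (rule post_mono[OF post_ext[OF _ 2(2)]]) (use 1(2) in \<open>auto simp: post_def\<close>)
    ultimately show "EX s'. xc (cg ;; cf) s (tg x + tf (g x)) (V + (tg x + tf (g x))) s' &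
      post k s (f (g x)) (V + (tg x + tf (g x))) s'" by blast
  qed
qed

lemma CT_pair:
  fixes f :: "'a::heap_data => 'b::heap_data" and g :: "'a => 'c::heap_data"
  assumes "CT f tf" "CT g tg"
  shows "CT (%x. (f x, g x)) (%x. tf x + tg x + 24)"
  unfolding CT_def
proof (intro allI impI)
  fix k :: nat assume k: "0 < k"
  obtain cf where cf: "!!s x V. hp_ok s V ==> holds s (k+1) x V ==>
     EX s'. xc cf s (tf x) (V + tf x) s' & post (k+1) s (f x) (V + tf x) s'"
    using CT_E[OF assms(1), of "k+1"] by auto
  obtain cg where cg: "!!s x V. hp_ok s V ==> holds s (k+2) x V ==>
     EX s'. xc cg s (tg x) (V + tg x) s' & post (k+2) s (g x) (V + tg x) s'"
    using CT_E[OF assms(2), of "k+2"] by auto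
  \<comment> \<open>The argument stays in register \<open>k\<close> during both calls, and the first
    result is safe in \<open>k + 1\<close> because the second call has base register
    \<open>k + 2\<close>.\<close>
  let ?c = "MOV (k+1) k ;; cf ;; MOV (k+2) k ;; cg ;; ALLOC k (k+1) (k+2) (k+3)"
  show "EX c. ALL s x V. hp_ok s V --> holds s k x V -->
    (EX s'. xc c s (tf x + tg x + 24) (V + (tf x + tg x + 24)) s' &
      post k s (f x, g x) (V + (tf x + tg x + 24)) s')"
  proof (intro exI[of _ ?c] allI impI)
    fix s V and x :: 'a assume s: "hp_ok s V" "holds s k x V"
    let ?W = "V + (tf x + tg x + 24)"
    obtain s1 where 1: "xc (MOV (k+1) k) s 4 V s1" "post (k+1) s x V s1"
      using MOV_rule[OF s, of "k+1"] k by auto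
    have e1: "ext (k+1) s s1" using 1 by (simp add: post_def)
    obtain s2 where 2: "xc cf s1 (tf x) (V + tf x) s2" "post (k+1) s1 (f x) (V + tf x) s2"
      using cf 1(2) unfolding post_def by blast
    have e2: "ext (k+1) s s2" using e1 2 ext_trans by (auto simp: post_def)
    have h2: "hp_ok s2 (V + tf x)" "holds s2 k x (V + tf x)" "holds s2 (k+1) (f x) (V + tf x)"
      using 2 holds_ext[OF s(2) e2] k by (auto simp: post_def)
    obtain s3 where 3: "xc (MOV (k+2) k) s2 4 (V + tf x) s3" "post (k+2) s2 x (V + tf x) s3"
      using MOV_rule[OF h2(1,2), of "k+2"] k by auto
    obtain s4 where 4: "xc cg s3 (tg x) (V + tf x + tg x) s4" "post (k+2) s3 (g x) (V + tf x + tg x) s4"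
      using cg 3(2) unfolding post_def by blast
    have e4: "ext (k+2) s2 s4" using 3 4 ext_trans by (auto simp: post_def)
    have h4: "hp_ok s4 (V + tf x + tg x)" "holds s4 (k+1) (f x) (V + tf x + tg x)"
      "holds s4 (k+2) (g x) (V + tf x + tg x)"
      using 4 holds_ext[OF h2(3) e4] k by (auto simp: post_def)
    obtain s5 where 5: "xc (ALLOC k (k+1) (k+2) (k+3)) s4 16 (V + tf x + tg x + 4) s5"
      "post k s4 (f x, g x) (V + tf x + tg x + 4) s5"
      using ALLOC_rule[OF h4, of k "k+3"] k by auto
    have "xc ?c s (4 + (tf x + (4 + (tg x + 16)))) ?W s5"
      by (intro xc_Seq) (rule xc_mono, rule 1 2 3 4 5, simp, simp)+
    then have "xc ?c s (tf x + tg x + 24) ?W s5" by (simp add: ac_simps)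
    moreover have "ext k s s4"
      using ext_trans[OF ext_mono[OF e2, of k] ext_mono[OF e4, of k]] by simp
    then have "post k s (f x, g x) ?W s5"
      by (intro post_mono[OF post_ext[OF _ 5(2)]]) auto
    ultimately show "EX s'. xc ?c s (tf x + tg x + 24) ?W s' & post k s (f x, g x) ?W s'" by blast
  qed
qed

lemma CT_BlkI:
  fixes f :: "'a::heap_data => 'b::heap_data"
  assumes "!!k. 0 < k ==> list_all straight (is k)"
    and "!!k s (x::'a) V. 0 < k ==> hp_ok s V ==> holds s k x V ==>
      blk_cost (is k) s <= T * bit_length (V + T) &
      reg (blk_exec (is k) s) 0 = reg s 0 & (ALL i<k. reg (blk_exec (is k) s) i = reg s i) &
      mem (blk_exec (is k) s) = mem s & reg (blk_exec (is k) s) k <= V + T &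
      rep (mem s) (reg s 0) (enc (f x)) (reg (blk_exec (is k) s) k)"
  shows "CT f (%_. T)"
  unfolding CT_def
proof (intro allI impI)
  fix k :: nat assume k: "0 < k"
  show "EX c. ALL s x V. hp_ok s V --> holds s k x V -->
    (EX s'. xc c s T (V + T) s' & post k s (f x) (V + T) s')"
  proof (intro exI[of _ "Blk (is k)"] allI impI)
    fix s V and x :: 'a assume s: "hp_ok s V" "holds s k x V"
    note a = assms(2)[OF k s]
    have "hp_ok (blk_exec (is k) s) (V + T)"
      using hp_ok_mono[OF s(1), of "V + T"] a by (auto simp: hp_ok_def)
    then show "EX s'. xc (Blk (is k)) s T (V + T) s' & post k s (f x) (V + T) s'"
      by (intro exI[of _ "blk_exec (is k) s"] conjI xc_Blk)
        (use a assms(1)[OF k] in \<open>auto simp: post_def ext_def holds_def\<close>)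
  qed
qed

lemma CT_const_nat: "CT (%_. c::nat) (%_. c + 1)"
proof (rule CT_BlkI[where ?is = "%k. [Const k c]"])
  fix k s V and x :: 'a
  have "bit_length c <= bit_length (V + (c + 1))" by (rule bit_length_mono) simp
  then show "blk_cost [Const k c] s <= (c + 1) * bit_length (V + (c + 1)) &
      reg (blk_exec [Const k c] s) 0 = reg s 0 & (ALL i<k. reg (blk_exec [Const k c] s) i = reg s i) &
      mem (blk_exec [Const k c] s) = mem s & reg (blk_exec [Const k c] s) k <= V + (c + 1) &
      rep (mem s) (reg s 0) (enc c) (reg (blk_exec [Const k c] s) k)"
    if "0 < k" using that by (auto simp: enc_nat_def)
qed auto

lemma CT_fst: "CT fst (%_. 2)"
proof (rule CT_BlkI[where ?is = "%k. [Load k k]"])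
  fix k s V and x :: "'a \<times> 'b" assume k: "0 < k" and s: "hp_ok s V" "holds s k x V"
  have "bit_length (reg s k) <= bit_length (V + 2)" "bit_length (mem s (reg s k)) <= bit_length (V + 2)"
    using holds_Pr[OF s(2,1)] by (intro bit_length_mono; simp)+
  then show "blk_cost [Load k k] s <= 2 * bit_length (V + 2) &
      reg (blk_exec [Load k k] s) 0 = reg s 0 & (ALL i<k. reg (blk_exec [Load k k] s) i = reg s i) &
      mem (blk_exec [Load k k] s) = mem s & reg (blk_exec [Load k k] s) k <= V + 2 &
      rep (mem s) (reg s 0) (enc (fst x)) (reg (blk_exec [Load k k] s) k)"
    using k holds_Pr[OF s(2,1)] by auto
qed auto

lemma CT_snd: "CT snd (%_. 6)"
proof (rule CT_BlkI[where ?is = "%k. [Const (k+1) 2, Add k k (k+1), Load k k]"])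
  fix k s V and x :: "'a \<times> 'b" assume k: "0 < k" and s: "hp_ok s V" "holds s k x V"
  let ?is = "[Const (k+1) 2, Add k k (k+1), Load k k]"
  have "bit_length (reg s k) <= bit_length (V + 6)" "bit_length 2 <= bit_length (V + 6)"
    "bit_length (reg s k + 2) <= bit_length (V + 6)"
    "bit_length (mem s (reg s k + 2)) <= bit_length (V + 6)"
    using holds_Pr[OF s(2,1)] by (intro bit_length_mono; simp)+
  then show "blk_cost ?is s <= 6 * bit_length (V + 6) &
      reg (blk_exec ?is s) 0 = reg s 0 & (ALL i<k. reg (blk_exec ?is s) i = reg s i) &
      mem (blk_exec ?is s) = mem s & reg (blk_exec ?is s) k <= V + 6 &
      rep (mem s) (reg s 0) (enc (snd x)) (reg (blk_exec ?is s) k)"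
    using k holds_Pr[OF s(2,1)] by (auto simp del: add_2_eq_Suc')
qed auto

lemma CT_Suc: "CT Suc (%_. 4)"
proof (rule CT_BlkI[where ?is = "%k. [Const (k+1) 1, Add k k (k+1)]"])
  fix k s V and x :: nat assume k: "0 < k" and s: "hp_ok s V" "holds s k x V"
  let ?is = "[Const (k+1) 1, Add k k (k+1)]"
  have "bit_length (reg s k) <= bit_length (V + 4)" "1 <= bit_length (V + 4)"
    using s by (auto intro!: bit_length_mono simp: holds_def)
  then show "blk_cost ?is s <= 4 * bit_length (V + 4) &
      reg (blk_exec ?is s) 0 = reg s 0 & (ALL i<k. reg (blk_exec ?is s) i = reg s i) &
      mem (blk_exec ?is s) = mem s & reg (blk_exec ?is s) k <= V + 4 &
      rep (mem s) (reg s 0) (enc (Suc x)) (reg (blk_exec ?is s) k)"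
    using k s by (auto simp: holds_def enc_nat_def simp del: bit_length_pos)
qed auto

lemma CT_binop:
  assumes f: "(op = Sub & f = (-)) | (op = Div & f = (div))"
  shows "CT (%p. f (fst p) (snd p) :: nat) (%_. 12)"
proof (rule CT_BlkI[where ?is = "%k. [Load (k+1) k, Const (k+2) 2, Add k k (k+2), Load k k, op k (k+1) k]"])
  fix k s V and x :: "nat \<times> nat" assume k: "0 < k" and s: "hp_ok s V" "holds s k x V"
  let ?is = "[Load (k+1) k, Const (k+2) 2, Add k k (k+2), Load k k, op k (k+1) k]"
  note p = holds_Pr[OF s(2,1)]
  have b: "bit_length (reg s k) <= bit_length (V + 12)" "bit_length 2 <= bit_length (V + 12)"
    "bit_length (mem s (reg s k)) <= bit_length (V + 12)"
    "bit_length (reg s k + 2) <= bit_length (V + 12)"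
    "bit_length (mem s (reg s k + 2)) <= bit_length (V + 12)"
    using p by (intro bit_length_mono; simp)+
  have x: "fst x = mem s (reg s k)" "snd x = mem s (reg s k + 2)"
    using p(7,8) by (auto simp: enc_nat_def)
  have le: "f (fst x) (snd x) <= V + 12"
    using f p(5) unfolding x by (auto intro: le_trans[OF div_le_dividend])
  have "reg (blk_exec ?is s) k = f (fst x) (snd x)"
    using f k unfolding x by (auto simp del: add_2_eq_Suc')
  moreover have "blk_cost ?is s <= 12 * bit_length (V + 12)"
    using f k b by (auto simp del: add_2_eq_Suc')
  moreover have "reg (blk_exec ?is s) 0 = reg s 0 & (ALL i<k. reg (blk_exec ?is s) i = reg s i) &
      mem (blk_exec ?is s) = mem s"
    using f k by (auto simp del: add_2_eq_Suc')
  ultimately show "blk_cost ?is s <= 12 * bit_length (V + 12) &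
      reg (blk_exec ?is s) 0 = reg s 0 & (ALL i<k. reg (blk_exec ?is s) i = reg s i) &
      mem (blk_exec ?is s) = mem s & reg (blk_exec ?is s) k <= V + 12 &
      rep (mem s) (reg s 0) (enc (f (fst x) (snd x))) (reg (blk_exec ?is s) k)"
    using le by (simp add: enc_nat_def del: blk_exec.simps)
qed (use f in auto)

lemma CT_mod: "CT (%p. fst p mod snd p :: nat) (%_. 16)"
proof (rule CT_BlkI[where ?is = "%k. [Load (k+1) k, Const (k+2) 2, Add k k (k+2), Load k k,
    Div (k+2) (k+1) k, Mul (k+2) (k+2) k, Sub k (k+1) (k+2)]"])
  fix k s V and x :: "nat \<times> nat" assume k: "0 < k" and s: "hp_ok s V" "holds s k x V"
  let ?is = "[Load (k+1) k, Const (k+2) 2, Add k k (k+2), Load k k,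
    Div (k+2) (k+1) k, Mul (k+2) (k+2) k, Sub k (k+1) (k+2)]"
  note p = holds_Pr[OF s(2,1)]
  let ?a = "mem s (reg s k)" and ?b = "mem s (reg s k + 2)"
  \<comment> \<open>The intermediate product does not exceed the dividend, so this use of
    \<open>Mul\<close> respects the additive growth.\<close>
  have "?a div ?b * ?b <= V + 16" "?a div ?b <= V + 16"
    using p(5) div_times_less_eq_dividend[of ?a ?b] div_le_dividend[of ?a ?b] by linarith+
  then have b: "bit_length (reg s k) <= bit_length (V + 16)" "bit_length 2 <= bit_length (V + 16)"
    "bit_length ?a <= bit_length (V + 16)" "bit_length (reg s k + 2) <= bit_length (V + 16)"
    "bit_length ?b <= bit_length (V + 16)" "bit_length (?a div ?b) <= bit_length (V + 16)"
    "bit_length (?a div ?b * ?b) <= bit_length (V + 16)"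
    using p by (intro bit_length_mono; simp)+
  have x: "fst x = ?a" "snd x = ?b" using p(7,8) by (auto simp: enc_nat_def)
  have le: "fst x mod snd x <= V + 16"
    using p(5) mod_less_eq_dividend[of ?a ?b] unfolding x by linarith
  have "reg (blk_exec ?is s) k = fst x mod snd x"
    using k unfolding x by (auto simp: minus_div_mult_eq_mod simp del: add_2_eq_Suc')
  moreover have "blk_cost ?is s <= 16 * bit_length (V + 16)"
    using k b by (auto simp del: add_2_eq_Suc')
  moreover have "reg (blk_exec ?is s) 0 = reg s 0 & (ALL i<k. reg (blk_exec ?is s) i = reg s i) &
      mem (blk_exec ?is s) = mem s"
    using k by (auto simp del: add_2_eq_Suc')
  ultimately show "blk_cost ?is s <= 16 * bit_length (V + 16) &
      reg (blk_exec ?is s) 0 = reg s 0 & (ALL i<k. reg (blk_exec ?is s) i = reg s i) &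
      mem (blk_exec ?is s) = mem s & reg (blk_exec ?is s) k <= V + 16 &
      rep (mem s) (reg s 0) (enc (fst x mod snd x)) (reg (blk_exec ?is s) k)"
    using le by (simp add: enc_nat_def del: blk_exec.simps)
qed auto

text \<open>\<open>CT\<close> sees values only through their encodings, so the code for numbers
  serves for every atom. \<open>CT_Cons\<close> rests on the same principle for pairs and list
  cells.\<close>

lemma CT_const:
  assumes "enc y = At c" shows "CT (%_. y) (%_. c + 1)"
  using CT_const_nat[of c] assms unfolding CT_def post_def holds_def by (simp add: enc_nat_def)

lemma CT_If:
  fixes f g :: "'a::heap_data => 'b::heap_data"
  assumes "CT b tb" "CT f tf" "CT g tg"
  shows "CT (%x. if b x then f x else g x) (%x. tb x + tf x + tg x + 6)"
  unfolding CT_def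
proof (intro allI impI)
  fix k :: nat assume k: "0 < k"
  obtain cb where cb: "!!s x V. hp_ok s V ==> holds s (k+1) x V ==>
     EX s'. xc cb s (tb x) (V + tb x) s' & post (k+1) s (b x) (V + tb x) s'"
    using CT_E[OF assms(1), of "k+1"] by auto
  obtain cf where cf: "!!s x V. hp_ok s V ==> holds s k x V ==>
     EX s'. xc cf s (tf x) (V + tf x) s' & post k s (f x) (V + tf x) s'" using CT_E[OF assms(2) k] by blast
  obtain cg where cg: "!!s x V. hp_ok s V ==> holds s k x V ==>
     EX s'. xc cg s (tg x) (V + tg x) s' & post k s (g x) (V + tg x) s'" using CT_E[OF assms(3) k] by blast
  let ?c = "MOV (k+1) k ;; cb ;; Ite (k+1) cf cg"
  show "EX c. ALL s x V. hp_ok s V --> holds s k x V -->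
    (EX s'. xc c s (tb x + tf x + tg x + 6) (V + (tb x + tf x + tg x + 6)) s' &
      post k s (if b x then f x else g x) (V + (tb x + tf x + tg x + 6)) s')"
  proof (intro exI[of _ ?c] allI impI)
    fix s V and x :: 'a assume s: "hp_ok s V" "holds s k x V"
    let ?W = "V + (tb x + tf x + tg x + 6)"
    obtain s1 where 1: "xc (MOV (k+1) k) s 4 V s1" "post (k+1) s x V s1"
      using MOV_rule[OF s, of "k+1"] k by auto
    have e1: "ext (k+1) s s1" using 1 by (simp add: post_def)
    obtain s2 where 2: "xc cb s1 (tb x) (V + tb x) s2" "post (k+1) s1 (b x) (V + tb x) s2"
      using cb 1(2) unfolding post_def by blast
    have e2: "ext (k+1) s s2" using e1 2 ext_trans by (auto simp: post_def)
    have h2: "hp_ok s2 (V + tb x)" "holds s2 k x (V + tb x)" "holds s2 (k+1) (b x) (V + tb x)"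
      using 2 holds_ext[OF s(2) e2] k by (auto simp: post_def)
    have r: "reg s2 (k+1) = of_bool (b x)" "reg s2 (k+1) <= ?W"
      using h2(3) by (auto simp: holds_def enc_bool_def)
    have e: "ext k s s2" using ext_mono[OF e2] by simp
    have "EX s3. xc (Ite (k+1) cf cg) s2 (2 + (tf x + tg x)) ?W s3 &
      post k s2 (if b x then f x else g x) ?W s3"
    proof (cases "b x")
      case True
      obtain s3 where 3: "xc cf s2 (tf x) (V + tb x + tf x) s3" "post k s2 (f x) (V + tb x + tf x) s3"
        using cf[OF h2(1,2)] by blast
      have "xc (Ite (k+1) cf cg) s2 (2 + (tf x + tg x)) ?W s3"
        by (rule xc_IteT[OF _ r(2)]) (use True r xc_mono[OF 3(1)] in auto)
      moreover have "post k s2 (f x) ?W s3" using post_mono[OF 3(2)] by simp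
      ultimately show ?thesis using True by auto
    next
      case False
      obtain s3 where 3: "xc cg s2 (tg x) (V + tb x + tg x) s3" "post k s2 (g x) (V + tb x + tg x) s3"
        using cg[OF h2(1,2)] by blast
      have "xc (Ite (k+1) cf cg) s2 (2 + (tf x + tg x)) ?W s3"
        by (rule xc_IteF) (use False r xc_mono[OF 3(1)] in auto)
      moreover have "post k s2 (g x) ?W s3" using post_mono[OF 3(2)] by simp
      ultimately show ?thesis using False by auto
    qed
    then obtain s3 where 3: "xc (Ite (k+1) cf cg) s2 (2 + (tf x + tg x)) ?W s3"
      "post k s2 (if b x then f x else g x) ?W s3" by blast
    have "xc ?c s (4 + (tb x + (2 + (tf x + tg x)))) ?W s3"
      by (intro xc_Seq) (rule xc_mono, rule 1 2 3, simp, simp)+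
    then have "xc ?c s (tb x + tf x + tg x + 6) ?W s3" by (simp add: ac_simps)
    with post_ext[OF e 3(2)] show "EX s'. xc ?c s (tb x + tf x + tg x + 6) ?W s' &
      post k s (if b x then f x else g x) ?W s'" by blast
  qed
qed

lemma CT_is0: "CT (%x::nat. x = 0) (%_. 6)"
proof -
  have "EX c. ALL s x V. hp_ok s V --> holds s k (x::nat) V -->
    (EX s'. xc c s 6 (V + 6) s' & post k s (x = 0) (V + 6) s')" if k: "0 < k" for k
  proof (intro exI[of _ "Ite k (Blk [Const k 0]) (Blk [Const k 1])"] allI impI)
    fix s V and x :: nat assume s: "hp_ok s V" "holds s k x V"
    have x: "reg s k = x" "x <= V + 6" using s by (auto simp: holds_def enc_nat_def)
    have b: "xc (Blk [Const k c]) s 4 (V + 6) (blk_exec [Const k c] s)"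
      "post k s (b::bool) (V + 6) (blk_exec [Const k c] s)" if "c = of_bool b" for c b
    proof -
      have "bit_length c = 1" using that by (cases b) auto
      then have "bit_length c <= 4 * bit_length (V + 6)"
        using bit_length_pos(1)[of "V + 6"] by linarith
      then show "xc (Blk [Const k c]) s 4 (V + 6) (blk_exec [Const k c] s)"
        by (intro xc_Blk) auto
      show "post k s b (V + 6) (blk_exec [Const k c] s)"
        using s k that hp_ok_mono[OF s(1), of "V + 6"]
        by (auto simp: post_def ext_def hp_ok_def holds_def enc_bool_def)
    qed
    show "EX s'. xc (Ite k (Blk [Const k 0]) (Blk [Const k 1])) s 6 (V + 6) s' &
      post k s (x = 0) (V + 6) s'"
    proof (cases "x = 0")
      case True
      with xc_IteF[OF _ b(1)[of 1 True], of k "Blk [Const k 0]"] b(2)[of 1 True] x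
      show ?thesis by auto
    next
      case False
      with xc_IteT[OF _ _ b(1)[of 0 False], of k "Blk [Const k 1]"] b(2)[of 0 False] x
      show ?thesis by auto
    qed
  qed
  then show ?thesis unfolding CT_def by blast
qed

lemma CT_Cons: "CT f tf ==> CT g tg ==> CT (%x. f x # g x) (%x. tf x + tg x + 24)"
  using CT_pair[of f tf g tg] unfolding CT_def post_def holds_def by (simp add: enc_prod_def)

primrec loop_time :: "('a => 'x => 'a) => ('a => 'x => nat) => 'a => 'x list => nat" where
  "loop_time f t a [] = 1"
| "loop_time f t a (x # xs) = 60 + t a x + loop_time f t (f a x) xs"

text \<open>The only form of iteration in the calculus. The environment \<open>e\<close> stays in
  register \<open>k\<close>, the accumulator in \<open>k + 1\<close> and the remaining list in
  \<open>k + 2\<close>; each pass allocates the argument triple of the step function in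
  \<open>k + 3\<close>.\<close>

lemma CT_foldl:
  fixes f :: "'e::heap_data => 'a::heap_data => 'x::heap_data => 'a"
  assumes "CT a ta" "CT g tg" "CT (%z. f (fst z) (fst (snd z)) (snd (snd z))) tf"
  shows "CT (%e. foldl (f e) (a e) (g e))
    (%e. ta e + tg e + 12 + loop_time (f e) (%a x. tf (e, a, x)) (a e) (g e))"
  unfolding CT_def
proof (intro allI impI)
  fix k :: nat assume k: "0 < k"
  obtain ca where ca: "!!s x V. hp_ok s V ==> holds s (k+1) x V ==>
     EX s'. xc ca s (ta x) (V + ta x) s' & post (k+1) s (a x) (V + ta x) s'"
    using CT_E[OF assms(1), of "k+1"] by auto
  obtain cg where cg: "!!s x V. hp_ok s V ==> holds s (k+2) x V ==>
     EX s'. xc cg s (tg x) (V + tg x) s' & post (k+2) s (g x) (V + tg x) s'"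
    using CT_E[OF assms(2), of "k+2"] by auto
  obtain cf where cf: "!!s z V. hp_ok s V ==> holds s (k+3) z V ==>
     EX s'. xc cf s (tf z) (V + tf z) s' &
       post (k+3) s (f (fst z) (fst (snd z)) (snd (snd z))) (V + tf z) s'"
    using CT_E[OF assms(3), of "k+3"] by auto
  define next_is where "next_is = [Const (k+1) 0, Add (k+1) (k+1) (k+3), Const (k+4) 2,
    Add (k+2) (k+2) (k+4), Load (k+2) (k+2)]"
  define body where "body = Blk [Load (k+3) (k+2)] ;; ALLOC (k+3) (k+1) (k+3) (k+4) ;;
    ALLOC (k+3) k (k+3) (k+4) ;; cf ;; Blk next_is"
  have loop: "EX s'. xc (While (k+2) body) s (loop_time (f e) (%a x. tf (e, a, x)) acc xs)
        (V + loop_time (f e) (%a x. tf (e, a, x)) acc xs) s' & ext (k+1) s s' &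
      hp_ok s' (V + loop_time (f e) (%a x. tf (e, a, x)) acc xs) &
      holds s' (k+1) (foldl (f e) acc xs) (V + loop_time (f e) (%a x. tf (e, a, x)) acc xs)"
    if "hp_ok s V" "holds s k e V" "holds s (k+1) acc V" "holds s (k+2) xs V" for s V and e :: 'e and acc xs
    using that
  proof (induction xs arbitrary: s V acc)
    case Nil
    then have "reg s (k+2) = 0" by (simp add: holds_def)
    from xc_WhileF[of s "k+2" body "V + 1", OF this] show ?case
      using Nil hp_ok_mono holds_mono by (intro exI[of _ s]) (auto simp: ext_refl intro: hp_ok_mono holds_mono)
  next
    case (Cons x xs)
    note s = Cons.prems
    have lst: "holds s (k+2) (x, xs) V" using s(4) by (simp add: holds_def enc_prod_def)
    note p = holds_Pr[OF lst s(1)]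
    define s1 where "s1 = blk_exec [Load (k+3) (k+2)] s"
    have s1: "reg s1 = (reg s)(k+3 := mem s (reg s (k+2)))" "mem s1 = mem s" by (auto simp: s1_def)
    have "bit_length (reg s (k+2)) <= bit_length V" "bit_length (mem s (reg s (k+2))) <= bit_length V"
      using p by (intro bit_length_mono; simp)+
    then have x1: "xc (Blk [Load (k+3) (k+2)]) s 2 V s1" unfolding s1_def by (intro xc_Blk) auto
    have h1: "hp_ok s1 V" "holds s1 (k+1) acc V" "holds s1 (k+3) x V" "holds s1 k e V"
      using s p k by (auto simp: hp_ok_def holds_def s1)
    have e1: "ext (k+3) s s1" by (auto simp: ext_def s1)
    obtain s2 where 2: "xc (ALLOC (k+3) (k+1) (k+3) (k+4)) s1 16 (V+4) s2"
      "post (k+3) s1 (acc, x) (V+4) s2"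
      using ALLOC_rule[OF h1(1,2,3), of "k+3" "k+4"] by auto
    have e2: "ext (k+3) s1 s2" using 2 by (simp add: post_def)
    have h2: "hp_ok s2 (V+4)" "holds s2 k e (V+4)" "holds s2 (k+3) (acc, x) (V+4)"
      using 2 holds_ext[OF h1(4) e2] k by (auto simp: post_def)
    obtain s3 where 3: "xc (ALLOC (k+3) k (k+3) (k+4)) s2 16 (V+8) s3"
      "post (k+3) s2 (e, acc, x) (V+8) s3"
      using ALLOC_rule[OF h2, of "k+3" "k+4"] k by (auto simp: numeral_eq_Suc)
    let ?t = "tf (e, acc, x)"
    obtain s4 where 4: "xc cf s3 ?t (V + 8 + ?t) s4" "post (k+3) s3 (f e acc x) (V + 8 + ?t) s4"
      using cf[of s3 "V+8" "(e, acc, x)"] 3(2) unfolding post_def by auto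
    let ?V = "V + 8 + ?t"
    have e4: "ext (k+3) s s4" using ext_trans[OF e1 ext_trans[OF e2 ext_trans[of "k+3" s2 s3 s4]]] 3 4
      by (auto simp: post_def)
    have h4: "hp_ok s4 ?V" "holds s4 k e ?V" "holds s4 (k+2) (x, xs) ?V" "holds s4 (k+3) (f e acc x) ?V"
      using 4 holds_ext[OF s(2) e4] holds_ext[OF lst e4] k by (auto simp: post_def)
    note p4 = holds_Pr[OF h4(3,1)]
    define s5 where "s5 = blk_exec next_is s4"
    have s5: "reg s5 = (reg s4)(k+1 := reg s4 (k+3), k+2 := mem s4 (reg s4 (k+2) + 2), k+4 := 2)"
      "mem s5 = mem s4" by (auto simp: s5_def next_is_def fun_eq_iff simp del: add_2_eq_Suc')
    have "bit_length (reg s4 (k+3)) <= bit_length ?V" "bit_length 2 <= bit_length ?V"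
      "bit_length (reg s4 (k+2)) <= bit_length ?V" "bit_length (reg s4 (k+2) + 2) <= bit_length ?V"
      "bit_length (mem s4 (reg s4 (k+2) + 2)) <= bit_length ?V" "bit_length 0 <= bit_length ?V"
      using p4 h4 by (intro bit_length_mono; simp add: holds_def)+
    then have x5: "xc (Blk next_is) s4 9 ?V s5" unfolding s5_def
      by (intro xc_Blk) (auto simp: next_is_def simp del: add_2_eq_Suc' bit_length_0)
    have h5: "hp_ok s5 ?V" "holds s5 k e ?V" "holds s5 (k+1) (f e acc x) ?V" "holds s5 (k+2) xs ?V"
      using h4 p4 k by (auto simp: hp_ok_def holds_def s5 simp del: add_2_eq_Suc')
    have e5: "ext (k+1) s s5" using e4 by (auto simp: ext_def s5)
    let ?L = "loop_time (f e) (%a x. tf (e, a, x)) (f e acc x) xs"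
    let ?M = "loop_time (f e) (%a x. tf (e, a, x)) acc (x # xs)"
    obtain s6 where 6: "xc (While (k+2) body) s5 ?L (?V + ?L) s6" "ext (k+1) s5 s6"
      "hp_ok s6 (?V + ?L)" "holds s6 (k+1) (foldl (f e) (f e acc x) xs) (?V + ?L)"
      using Cons.IH[OF h5] by blast
    have xb: "xc body s (2 + (16 + (16 + (?t + 9)))) (V + ?M) s5"
      unfolding body_def by (intro xc_Seq) (rule xc_mono, rule x1 2 3 4 x5, simp, simp)+
    have "xc (While (k+2) body) s (2 + (2 + (16 + (16 + (?t + 9)))) + ?L) (V + ?M) s6"
      by (rule xc_WhileT[OF _ _ xb xc_mono[OF 6(1)]]) (use p in auto)
    then have "xc (While (k+2) body) s ?M (V + ?M) s6" by (rule xc_mono) auto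
    then show ?case using ext_trans[OF e5 6(2)] hp_ok_mono[OF 6(3)] holds_mono[OF 6(4)]
      by (intro exI[of _ s6]) auto
  qed
  let ?c = "MOV (k+1) k ;; ca ;; MOV (k+2) k ;; cg ;; While (k+2) body ;; MOV k (k+1)"
  show "EX c. ALL s e V. hp_ok s V --> holds s k e V -->
    (EX s'. xc c s (ta e + tg e + 12 + loop_time (f e) (%a x. tf (e, a, x)) (a e) (g e))
      (V + (ta e + tg e + 12 + loop_time (f e) (%a x. tf (e, a, x)) (a e) (g e))) s' &
     post k s (foldl (f e) (a e) (g e))
      (V + (ta e + tg e + 12 + loop_time (f e) (%a x. tf (e, a, x)) (a e) (g e))) s')"
  proof (intro exI[of _ ?c] allI impI)
    fix s V and e :: 'e assume s: "hp_ok s V" "holds s k e V"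
    let ?L = "loop_time (f e) (%a x. tf (e, a, x)) (a e) (g e)"
    let ?W = "V + (ta e + tg e + 12 + ?L)"
    obtain s1 where 1: "xc (MOV (k+1) k) s 4 V s1" "post (k+1) s e V s1"
      using MOV_rule[OF s, of "k+1"] k by auto
    have e1: "ext (k+1) s s1" using 1 by (simp add: post_def)
    obtain s2 where 2: "xc ca s1 (ta e) (V + ta e) s2" "post (k+1) s1 (a e) (V + ta e) s2"
      using ca 1(2) unfolding post_def by blast
    have e2: "ext (k+1) s s2" using e1 2 ext_trans by (auto simp: post_def)
    have h2: "hp_ok s2 (V + ta e)" "holds s2 k e (V + ta e)" "holds s2 (k+1) (a e) (V + ta e)"
      using 2 holds_ext[OF s(2) e2] k by (auto simp: post_def)
    obtain s3 where 3: "xc (MOV (k+2) k) s2 4 (V + ta e) s3" "post (k+2) s2 e (V + ta e) s3"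
      using MOV_rule[OF h2(1,2), of "k+2"] k by auto
    obtain s4 where 4: "xc cg s3 (tg e) (V + ta e + tg e) s4" "post (k+2) s3 (g e) (V + ta e + tg e) s4"
      using cg 3(2) unfolding post_def by blast
    have e4: "ext (k+2) s2 s4" using 3 4 ext_trans by (auto simp: post_def)
    have h4: "hp_ok s4 (V + ta e + tg e)" "holds s4 k e (V + ta e + tg e)"
      "holds s4 (k+1) (a e) (V + ta e + tg e)" "holds s4 (k+2) (g e) (V + ta e + tg e)"
      using 4 holds_ext[OF h2(3) e4] holds_ext[OF h2(2) e4] k by (auto simp: post_def)
    obtain s5 where 5: "xc (While (k+2) body) s4 ?L (V + ta e + tg e + ?L) s5" "ext (k+1) s4 s5"
      "hp_ok s5 (V + ta e + tg e + ?L)"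
      "holds s5 (k+1) (foldl (f e) (a e) (g e)) (V + ta e + tg e + ?L)"
      using loop[OF h4] by blast
    obtain s6 where 6: "xc (MOV k (k+1)) s5 4 (V + ta e + tg e + ?L) s6"
      "post k s5 (foldl (f e) (a e) (g e)) (V + ta e + tg e + ?L) s6"
      using MOV_rule[OF 5(3,4), of k] k by auto
    have "xc ?c s (4 + (ta e + (4 + (tg e + (?L + 4))))) ?W s6"
      by (intro xc_Seq) (rule xc_mono, rule 1 2 3 4 5 6, simp, simp)+
    then have "xc ?c s (ta e + tg e + 12 + ?L) ?W s6" by (simp add: ac_simps)
    moreover have "ext k s s5"
      using ext_trans[OF ext_mono[OF e2, of k] ext_trans[OF ext_mono[OF e4, of k] ext_mono[OF 5(2), of k]]]
      by simp
    then have "post k s (foldl (f e) (a e) (g e)) ?W s6"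
      by (intro post_mono[OF post_ext[OF _ 6(2)]]) auto
    ultimately show "EX s'. xc ?c s (ta e + tg e + 12 + ?L) ?W s' &
      post k s (foldl (f e) (a e) (g e)) ?W s'" by blast
  qed
qed

section \<open>Tree functions with polynomially many operations\<close>

definition polyb :: "('a::heap_data => nat) => bool" where
  "polyb t \<longleftrightarrow> (EX C. ALL x. t x <= C * sz x ^ C)"

lemma polybI: "(!!x. t x <= a * sz x ^ b) ==> polyb t"
  unfolding polyb_def
proof (intro exI[of _ "max a b"] allI)
  fix x assume "!!x. t x <= a * sz x ^ b"
  then have "t x <= a * sz x ^ b" .
  also have "... <= max a b * sz x ^ max a b"
    by (intro mult_le_mono power_increasing) (use sz_pos[of x] in auto)
  finally show "t x <= max a b * sz x ^ max a b" .
qed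

lemma polyb_le: "polyb t ==> (!!x. t' x <= t x) ==> polyb t'"
  unfolding polyb_def by (meson le_trans)

lemma polyb_const [intro]: "polyb (%_. c)" by (rule polybI[of _ c 0]) simp

lemma polyb_sz [intro]: "polyb sz" by (rule polybI[of _ 1 1]) simp

lemma polyb_add [intro]:
  assumes "polyb t" "polyb u" shows "polyb (%x. t x + u x)"
proof -
  obtain C D where C: "!!x. t x <= C * sz x ^ C" and D: "!!x. u x <= D * sz x ^ D"
    using assms unfolding polyb_def by blast
  show ?thesis
  proof (rule polybI)
    fix x
    have "t x + u x <= C * sz x ^ (C + D) + D * sz x ^ (C + D)"
      by (intro add_le_mono order.trans[OF C] order.trans[OF D] mult_le_mono power_increasing)
        (use sz_pos[of x] in auto)
    then show "t x + u x <= (C + D) * sz x ^ (C + D)" by (simp add: distrib_right)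
  qed
qed

lemma polyb_mult [intro]:
  assumes "polyb t" "polyb u" shows "polyb (%x. t x * u x)"
proof -
  obtain C D where C: "!!x. t x <= C * sz x ^ C" and D: "!!x. u x <= D * sz x ^ D"
    using assms unfolding polyb_def by blast
  show ?thesis
  proof (rule polybI)
    fix x
    have "t x * u x <= (C * sz x ^ C) * (D * sz x ^ D)" by (intro mult_le_mono C D)
    then show "t x * u x <= (C * D) * sz x ^ (C + D)" by (simp add: power_add ac_simps)
  qed
qed

lemma polyb_comp:
  assumes "polyb t" "polyb (%x. sz (f x))" shows "polyb (%x. t (f x))"
proof -
  obtain C D where C: "!!x. t x <= C * sz x ^ C" and D: "!!x. sz (f x) <= D * sz x ^ D"
    using assms unfolding polyb_def by blast
  show ?thesis
  proof (rule polybI)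
    fix x
    have "t (f x) <= C * (D * sz x ^ D) ^ C"
      by (intro order.trans[OF C] mult_le_mono power_mono D) auto
    then show "t (f x) <= (C * D ^ C) * sz x ^ (D * C)"
      by (simp only: power_mult_distrib power_mult mult.assoc)
  qed
qed

lemma polyb_sz_pair [intro]:
  "polyb (%x. sz (f x)) ==> polyb (%x. sz (g x)) ==> polyb (%x. sz (f x, g x))"
  using polyb_add[OF polyb_add[OF _ _] polyb_const[of 1]] by fastforce

text \<open>The size of the result is bounded in addition to the time, because pairs share subtrees:
  constantly many operations can double the size of a tree.\<close>

definition PT :: "('a::heap_data => 'b::heap_data) => bool" where
  "PT f \<longleftrightarrow> (EX t. CT f t & polyb t) & polyb (%x. sz (f x))"

lemma PTI: "CT f t ==> polyb t ==> polyb (%x. sz (f x)) ==> PT f"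
  unfolding PT_def by blast

lemma PT_szD: "PT f ==> polyb (%x. sz (f x))" unfolding PT_def by blast

lemma PT_id: "PT (%x. x)"
  using CT_id polyb_const polyb_sz by (rule PTI)

lemma PT_comp:
  assumes "PT f" "PT g" shows "PT (%x. f (g x))"
proof -
  obtain tf tg where *: "CT f tf" "polyb tf" "CT g tg" "polyb tg" using assms unfolding PT_def by blast
  show ?thesis
    by (rule PTI[OF CT_comp[OF *(3,1)]])
      (intro polyb_add * polyb_comp[OF *(2) PT_szD[OF assms(2)]]
        polyb_comp[OF PT_szD[OF assms(1)] PT_szD[OF assms(2)]])+
qed

lemma PT_pair:
  assumes "PT f" "PT g" shows "PT (%x. (f x, g x))"
proof -
  obtain tf tg where *: "CT f tf" "polyb tf" "CT g tg" "polyb tg" using assms unfolding PT_def by blast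
  show ?thesis
    by (rule PTI[OF CT_pair[OF *(1,3)]])
      (intro polyb_add polyb_const polyb_sz_pair * PT_szD assms)+
qed

lemma PT_const_atom: "enc y = At c ==> PT (%_. y)"
  by (rule PTI[OF CT_const]) (auto intro: polyb_const)

lemma PT_nat: "PT (%_. c::nat)" by (rule PT_const_atom) (simp add: enc_nat_def)
lemma PT_bool: "PT (%_. b::bool)" by (rule PT_const_atom) (simp add: enc_bool_def)
lemma PT_Nil: "PT (%_. [])" by (rule PT_const_atom) simp

lemma PT_fst0: "PT fst"
  by (rule PTI[OF CT_fst polyb_const]) (rule polyb_le[OF polyb_sz], simp add: sz_pair)
lemma PT_snd0: "PT snd"
  by (rule PTI[OF CT_snd polyb_const]) (rule polyb_le[OF polyb_sz], simp add: sz_pair)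

lemma PT_fst: "PT f ==> PT (%x. fst (f x))" by (rule PT_comp[OF PT_fst0])
lemma PT_snd: "PT f ==> PT (%x. snd (f x))" by (rule PT_comp[OF PT_snd0])

lemma PT_Suc: "PT f ==> PT (%x. Suc (f x))"
  by (rule PT_comp[of Suc]) (rule PTI[OF CT_Suc polyb_const], auto)

lemma PT_minus: "PT f ==> PT g ==> PT (%x. f x - g x :: nat)"
  using PT_comp[OF PTI[OF CT_binop[of Sub "(-)"] polyb_const] PT_pair, of f g] by auto

lemma PT_div: "PT f ==> PT g ==> PT (%x. f x div g x :: nat)"
  using PT_comp[OF PTI[OF CT_binop[of Div "(div)"] polyb_const] PT_pair, of f g] by auto

lemma PT_mod: "PT f ==> PT g ==> PT (%x. f x mod g x :: nat)"
  using PT_comp[OF PTI[OF CT_mod polyb_const] PT_pair, of f g] by auto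

lemma PT_If:
  assumes "PT b" "PT f" "PT g" shows "PT (%x. if b x then f x else g x)"
proof -
  obtain tb tf tg where *: "CT b tb" "polyb tb" "CT f tf" "polyb tf" "CT g tg" "polyb tg"
    using assms unfolding PT_def by blast
  show ?thesis
  proof (rule PTI[OF CT_If[OF *(1,3,5)]])
    show "polyb (%x. tb x + tf x + tg x + 6)" using * by (intro polyb_add polyb_const)
    show "polyb (%x. sz (if b x then f x else g x))"
      by (rule polyb_le[OF polyb_add[OF PT_szD[OF assms(2)] PT_szD[OF assms(3)]]]) auto
  qed
qed

lemma PT_is0: "PT f ==> PT (%x. f x = (0::nat))"
  by (rule PT_comp[of "%x. x = 0"]) (rule PTI[OF CT_is0 polyb_const], auto)

lemma PT_not: assumes "PT f" shows "PT (%x. ~ f x)"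
proof -
  have eq: "(%x. ~ f x) = (%x. if f x then False else True)" by auto
  show ?thesis unfolding eq by (rule PT_If[OF assms PT_bool PT_bool])
qed

lemma PT_conj: assumes "PT f" "PT g" shows "PT (%x. f x & g x)"
proof -
  have eq: "(%x. f x & g x) = (%x. if f x then g x else False)" by auto
  show ?thesis unfolding eq by (rule PT_If[OF assms PT_bool])
qed

lemma PT_disj: assumes "PT f" "PT g" shows "PT (%x. f x | g x)"
proof -
  have eq: "(%x. f x | g x) = (%x. if f x then True else g x)" by auto
  show ?thesis unfolding eq by (rule PT_If[OF assms(1) PT_bool assms(2)])
qed

lemma PT_le: "PT f ==> PT g ==> PT (%x. f x <= (g x :: nat))"
  using PT_is0[OF PT_minus, of f g] by (simp only: diff_is_0_eq)

lemma PT_less: "PT f ==> PT g ==> PT (%x. f x < (g x :: nat))"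
  using PT_le[OF PT_Suc, of f g] by (simp only: Suc_le_eq)

lemma PT_eq: "PT f ==> PT g ==> PT (%x. f x = (g x :: nat))"
  using PT_conj[OF PT_le PT_le, of f g g f] by (simp only: order_eq_iff)

lemma PT_Cons: "PT f ==> PT g ==> PT (%x. f x # g x)"
proof -
  assume assms: "PT f" "PT g"
  then obtain tf tg where *: "CT f tf" "polyb tf" "CT g tg" "polyb tg" unfolding PT_def by blast
  show ?thesis
  proof (rule PTI[OF CT_Cons[OF *(1,3)]])
    show "polyb (%x. tf x + tg x + 24)" by (intro polyb_add polyb_const *)
    show "polyb (%x. sz (f x # g x))"
      using polyb_sz_pair[OF PT_szD[OF assms(1)] PT_szD[OF assms(2)]] by simp
  qed
qed

lemma PT_const_list: "(!!x. PT (%_::'e::heap_data. x::'a::heap_data)) ==> PT (%_::'e. xs::'a list)"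
  by (induction xs) (auto intro: PT_Nil PT_Cons)

lemma sz_list_ge_length: "length xs < sz xs" by (induction xs) auto

lemma sz_list_append: "sz (xs @ ys) + 1 = sz xs + sz ys" by (induction xs) auto

lemma loop_time_le:
  assumes "!!ys x zs. xs = ys @ x # zs ==> t (foldl f a ys) x <= B"
  shows "loop_time f t a xs <= length xs * (60 + B) + 1"
  using assms
proof (induction xs arbitrary: a)
  case (Cons x xs)
  have "t a x <= B" using Cons.prems[of "[]" x xs] by simp
  moreover have "loop_time f t (f a x) xs <= length xs * (60 + B) + 1"
    by (rule Cons.IH) (use Cons.prems[of "x # _"] in auto)
  ultimately show ?case by simp
qed simp

text \<open>A step of polynomial growth may still explode when iterated, so a polynomial bound
  \<open>b\<close> on all intermediate accumulators has to be supplied.\<close>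

lemma PT_foldl:
  fixes f :: "'e::heap_data => 'a::heap_data => 'x::heap_data => 'a"
  assumes "PT a" "PT g" "PT (%z. f (fst z) (fst (snd z)) (snd (snd z)))" "polyb b"
    and bound: "!!e ys zs. g e = ys @ zs ==> sz (foldl (f e) (a e) ys) <= b e"
  shows "PT (%e. foldl (f e) (a e) (g e))"
proof -
  obtain ta tg tf where *: "CT a ta" "polyb ta" "CT g tg" "polyb tg"
    "CT (%z. f (fst z) (fst (snd z)) (snd (snd z))) tf" "polyb tf" using assms unfolding PT_def by blast
  obtain C where C: "!!x. tf x <= C * sz x ^ C" using *(6) unfolding polyb_def by blast
  \<comment> \<open>Bounds one call of the step function: its argument consists of the environment,
    an accumulator of size at most \<open>b e\<close>, an element of the list, and two pair
    nodes.\<close>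
  define B where "B e = C * (sz e + b e + sz (g e) + 2) ^ C" for e
  have pg: "polyb (%e. sz (g e))" by (rule PT_szD[OF assms(2)])
  have "polyb (%e. (sz e + b e + sz (g e) + 2) ^ i)" for i
    by (induction i) (auto intro!: polyb_const polyb_mult polyb_add polyb_sz assms(4) pg)
  then have pB: "polyb B" unfolding B_def by (intro polyb_mult polyb_const)
  have lt: "loop_time (f e) (%a x. tf (e, a, x)) (a e) (g e) <= sz (g e) * (60 + B e) + 1" for e
  proof -
    have "loop_time (f e) (%a x. tf (e, a, x)) (a e) (g e) <= length (g e) * (60 + B e) + 1"
    proof (rule loop_time_le)
      fix ys x zs assume g: "g e = ys @ x # zs"
      have "sz x <= sz (g e)" unfolding g using sz_list_append[of ys "x # zs"] sz_pos[of ys] by simp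
      moreover have "sz (foldl (f e) (a e) ys) <= b e" by (rule bound[OF g])
      ultimately show "tf (e, foldl (f e) (a e) ys, x) <= B e" unfolding B_def
        by (intro order.trans[OF C] mult_le_mono power_mono) auto
    qed
    also have "... <= sz (g e) * (60 + B e) + 1"
      using sz_list_ge_length[of "g e"] by (intro add_le_mono mult_le_mono) auto
    finally show ?thesis .
  qed
  show ?thesis
  proof (rule PTI[OF CT_mono[OF CT_foldl[OF *(1,3,5)]]])
    show "ta x + tg x + 12 + loop_time (f x) (%a xa. tf (x, a, xa)) (a x) (g x) <=
      ta x + tg x + 12 + (sz (g x) * (60 + B x) + 1)" for x using lt by simp
    show "polyb (%x. ta x + tg x + 12 + (sz (g x) * (60 + B x) + 1))"
      by (intro polyb_add polyb_mult polyb_const pB pg *)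
    show "polyb (%x. sz (foldl (f x) (a x) (g x)))"
      by (rule polyb_le[OF assms(4)]) (rule bound, simp)
  qed
qed

section \<open>Sparsification\<close>

text \<open>Clauses are never removed from \<open>F\<close>; a clause that contains a smaller one is
  implied by it and merely leaves \<open>mins F\<close>. Hence the number of clauses added so far
  can only grow, which makes it usable as a potential.\<close>

definition mins :: "nat set set => nat set set" where
  "mins F = {C \<in> F. ~ (EX D:F. D \<subset> C)}"

definition supers :: "nat set set => nat => nat set => nat set set" where
  "supers F c G = {C \<in> mins F. card C = c & G \<subseteq> C}"

text \<open>A weak sunflower with heart \<open>H\<close> among the minimal clauses of size \<open>c\<close>; the order in which
  sunflowers are chosen (small clauses first, then large hearts) bounds the degrees created by
  a step.\<close>

definition sunflower :: "(nat => nat) => nat set set => nat => nat set => bool" where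
  "sunflower \<theta> F c H \<longleftrightarrow> H ~= {} & finite H & card H < c & \<theta> (c - card H) <= card (supers F c H)"

definition first_sunflower :: "(nat => nat) => nat => nat set set => nat => nat set => bool" where
  "first_sunflower \<theta> k F c H \<longleftrightarrow> sunflower \<theta> F c H & c <= k &
     (ALL c' G. sunflower \<theta> F c' G --> c <= c' & (c' = c --> card G <= card H))"

definition petals :: "nat set set => nat => nat set => nat set set" where
  "petals F c H = (%C. C - H) ` supers F c H"

text \<open>\<open>n * sparse_const A i\<close> will bound the number of clauses of size
  \<open>i\<close> ever added along a branch. The recurrence is dictated by the induction in
  \<open>ad_bound\<close>; the start value makes all values at least 2, which covers the at most
  \<open>2 * n\<close> unit clauses.\<close>

primrec sparse_const :: "nat => nat => nat" where
  "sparse_const A 0 = 2"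
| "sparse_const A (Suc i) = 2 * A * (i + 3) * (sparse_const A i)\<^sup>2"

text \<open>A petal step adds at least \<open>A * sparse_const A i\<close> clauses of one size
  \<open>i\<close>, while at most \<open>n * sparse_const A i\<close> of this size can ever be
  added. So a branch contains at most \<open>n / A\<close> petal steps per size, few if
  \<open>A\<close> is large.\<close>

definition thresh :: "nat => nat => nat" where
  "thresh A i = A * sparse_const A i"

locale sparsification =
  fixes A k n :: nat and Lit :: "nat set" and F0 :: "nat set set"
  assumes A: "1 <= A" and Lit: "finite Lit" "card Lit <= 2 * n"
begin

abbreviation "b \<equiv> sparse_const A"
abbreviation "\<theta> \<equiv> thresh A"

lemma b_ge: "2 <= b i"
proof (induction i)
  case (Suc i)
  have "2 * 1 * 1 * 1 <= 2 * A * (i + 3) * (b i)\<^sup>2"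
    using A Suc by (intro mult_le_mono) auto
  then show ?case by simp
qed simp

lemma theta_pos: "1 <= \<theta> i"
  unfolding thresh_def using A b_ge[of i] by (simp add: Suc_le_eq)

lemma b_Suc: "b i <= b (Suc i)"
proof -
  have "1 * 1 * b i <= (2 * A) * (i + 3) * (b i * b i)"
    using A b_ge[of i] by (intro mult_le_mono) auto
  then show ?thesis by (simp add: power2_eq_square)
qed

lemma b_mono: "i <= j ==> b i <= b j"
  using b_Suc by (rule lift_Suc_mono_le)

section \<open>Bounding the number of added clauses\<close>

definition ad :: "nat set set => nat => nat" where
  "ad F i = card {C \<in> F - F0. card C = i}"

text \<open>The first of the two numerical bounds limits how many live added clauses of size
  \<open>i\<close> contain a given nonempty \<open>G\<close>. The second charges every added clause
  that has died to an added clause of some smaller size \<open>j\<close> inside it, at most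
  \<open>2 * \<theta> (i - j)\<close> dead clauses to each.\<close>

definition inv :: "nat set set => bool" where
  "inv F \<longleftrightarrow> F0 \<subseteq> F & F \<subseteq> Pow Lit & (ALL C:F - F0. C ~= {} & card C < k) &
     (ALL i G. G ~= {} --> card G < i --> G \<subseteq> Lit -->
        card {C \<in> mins F - F0. card C = i & G \<subseteq> C} <= 2 * \<theta> (i - card G)) &
     (ALL i. card {C \<in> F - F0 - mins F. card C = i} <= (\<Sum>j=1..<i. ad F j * (2 * \<theta> (i - j))))"

lemma finite_sub_Lit: "F \<subseteq> Pow Lit ==> finite F"
  using Lit by (metis finite_Pow_iff finite_subset)

lemma mins_sub: "mins F \<subseteq> F" by (auto simp: mins_def)

lemma inv_init: "F0 \<subseteq> Pow Lit ==> inv F0"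
proof -
  assume "F0 \<subseteq> Pow Lit"
  have e: "mins F0 - F0 = {}" "F0 - F0 - mins F0 = {}" using mins_sub by blast+
  show ?thesis using \<open>F0 \<subseteq> Pow Lit\<close> unfolding inv_def e by simp
qed

lemma inv_deg:
  "inv F ==> G ~= {} ==> card G < i ==> G \<subseteq> Lit ==>
    card {C \<in> mins F - F0. card C = i & G \<subseteq> C} <= 2 * \<theta> (i - card G)"
  unfolding inv_def by blast

text \<open>By induction on the size. A live added clause contains one of the at most
  \<open>2 * n\<close> literals, and the degree bound applies to each literal; the dead ones are
  charged to added clauses of smaller size, of which there are few by induction.\<close>

lemma ad_bound:
  assumes F: "inv F" shows "1 <= i ==> ad F i <= n * b i"
proof (induction i rule: less_induct)
  case (less i)
  have fin: "finite F" using F finite_sub_Lit by (auto simp: inv_def)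
  let ?live = "{C \<in> mins F - F0. card C = i}" and ?dead = "{C \<in> F - F0 - mins F. card C = i}"
  show ?case
  proof (cases "i = 1")
    case True
    have "{C \<in> F - F0. card C = i} \<subseteq> (%l. {l}) ` Lit"
      using True F by (auto simp: inv_def card_1_singleton_iff)
    then have "ad F i <= card Lit" unfolding ad_def by (rule surj_card_le[OF Lit(1)])
    also have "... <= n * b i" using Lit(2) mult_le_mono2[OF b_ge[of i], of n] by linarith
    finally show ?thesis .
  next
    case False
    then have i: "2 <= i" using less.prems by auto
    then obtain i' where i': "i = Suc i'" "1 <= i'" by (cases i) auto
    have "?live \<subseteq> (\<Union>l\<in>Lit. {C \<in> mins F - F0. card C = i & {l} \<subseteq> C})"
    proof
      fix C assume C: "C \<in> ?live"
      then have "C ~= {}" using i by auto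
      moreover have "C \<in> F" using C mins_sub by blast
      then have "C \<subseteq> Lit" using F unfolding inv_def by blast
      ultimately show "C \<in> (\<Union>l\<in>Lit. {C \<in> mins F - F0. card C = i & {l} \<subseteq> C})" using C by auto
    qed
    moreover have "finite (\<Union>l\<in>Lit. {C \<in> mins F - F0. card C = i & {l} \<subseteq> C})"
      by (rule finite_subset[of _ F]) (use fin mins_sub in auto)
    ultimately have "card ?live <= card (\<Union>l\<in>Lit. {C \<in> mins F - F0. card C = i & {l} \<subseteq> C})"
      by (rule card_mono[rotated])
    also have "... <= (\<Sum>l\<in>Lit. card {C \<in> mins F - F0. card C = i & {l} \<subseteq> C})"
      by (rule card_UN_le[OF Lit(1)])
    also have "... <= (\<Sum>l\<in>Lit. 2 * \<theta> (i - card {l}))"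
    proof (rule sum_mono)
      fix l assume "l \<in> Lit"
      then show "card {C \<in> mins F - F0. card C = i & {l} \<subseteq> C} <= 2 * \<theta> (i - card {l})"
        by (intro inv_deg[OF F]) (use i in auto)
    qed
    also have "... = card Lit * (2 * \<theta> i')" using i' by simp
    also have "... <= n * (4 * A * b i')" using Lit(2) by (simp add: thresh_def)
    also have "... <= n * (2 * A * (b i')\<^sup>2)"
      using b_ge[of i'] by (simp add: power2_eq_square)
    finally have live: "card ?live <= n * (2 * A * (b i')\<^sup>2)" .
    have "card ?dead <= (\<Sum>j=1..<i. ad F j * (2 * \<theta> (i - j)))" using F by (auto simp: inv_def)
    also have "... <= (\<Sum>j=1..<i. n * (2 * A * (b i')\<^sup>2))"
    proof (rule sum_mono)
      fix j assume j: "j \<in> {1..<i}"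
      have "ad F j * (2 * \<theta> (i - j)) <= (n * b i') * (2 * (A * b i'))"
        unfolding thresh_def using less.IH[of j] j i' b_mono[of j i'] b_mono[of "i - j" i']
        by (intro mult_le_mono) (auto intro: le_trans)
      then show "ad F j * (2 * \<theta> (i - j)) <= n * (2 * A * (b i')\<^sup>2)"
        by (simp add: power2_eq_square ac_simps)
    qed
    also have "... = i' * (n * (2 * A * (b i')\<^sup>2))" using i' by simp
    finally have dead: "card ?dead <= i' * (n * (2 * A * (b i')\<^sup>2))" .
    have "{C \<in> F - F0. card C = i} = ?live \<union> ?dead" using mins_sub by auto
    then have "ad F i <= card ?live + card ?dead" unfolding ad_def by (simp only: card_Un_le)
    also have "... <= (i' + 1) * (n * (2 * A * (b i')\<^sup>2))" using live dead by simp
    also have "... <= (i' + 3) * (n * (2 * A * (b i')\<^sup>2))" by (intro mult_le_mono) auto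
    also have "... = n * b i" unfolding i' by (simp add: algebra_simps)
    finally show ?thesis .
  qed
qed

text \<open>The common core of both branches, with \<open>N\<close> consisting of the heart or of
  the petals. The factor 2 in the degree bound arises here: fewer than \<open>\<theta>\<close> old
  minimal clauses of size \<open>i0\<close> contain \<open>G\<close>, and at most
  \<open>\<theta>\<close> new ones join them.\<close>

lemma inv_extend:
  assumes F: "inv F" and N: "N \<subseteq> Pow Lit" "!!C. C \<in> N ==> card C = i0" "1 <= i0" "i0 < k"
    and new: "!!C D. C \<in> N ==> D \<in> F ==> ~ D \<subseteq> C"
    and sparse: "!!G. G ~= {} ==> G \<subseteq> Lit ==> card G < i0 ==> card (supers F i0 G) < \<theta> (i0 - card G)"
    and deg: "!!G. G ~= {} ==> G \<subseteq> Lit ==> card G < i0 ==> card {C \<in> N. G \<subseteq> C} <= \<theta> (i0 - card G)"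
  shows "inv (F \<union> N)" and "!!i. ad (F \<union> N) i = ad F i + (if i = i0 then card N else 0)"
proof -
  let ?F = "F \<union> N"
  have finF: "finite F" using F finite_sub_Lit by (auto simp: inv_def)
  have finN: "finite N" using N(1) finite_sub_Lit by auto
  have FL: "F \<subseteq> Pow Lit" "F0 \<subseteq> F" using F by (auto simp: inv_def)
  have disj: "N \<inter> F = {}" using new by blast
  have finC: "C \<in> N ==> finite C" for C using N(1) Lit(1) finite_subset by blast
  have Nmin: "N \<subseteq> mins ?F"
  proof
    fix C assume C: "C \<in> N"
    have "~ D \<subset> C" if "D \<in> ?F" for D
    proof
      assume DC: "D \<subset> C"
      then have "D \<in> N" using that new C by blast
      then have "card D = card C" using N(2) C by auto
      then show False using psubset_card_mono[OF finC[OF C] DC] by simp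
    qed
    then show "C \<in> mins ?F" using C by (auto simp: mins_def)
  qed
  have minsF: "mins ?F - N \<subseteq> mins F" by (auto simp: mins_def)
  show ad: "ad ?F i = ad F i + (if i = i0 then card N else 0)" for i
  proof -
    have "{C \<in> ?F - F0. card C = i} = {C \<in> F - F0. card C = i} \<union> (if i = i0 then N else {})"
      using N(2) disj FL by auto
    then show ?thesis unfolding ad_def using finF finN disj by (auto intro!: card_Un_disjoint)
  qed
  have "card {C \<in> mins ?F - F0. card C = i & G \<subseteq> C} <= 2 * \<theta> (i - card G)"
    if G: "G ~= {}" "card G < i" "G \<subseteq> Lit" for i G
  proof (cases "i = i0")
    case True
    have "{C \<in> mins ?F - F0. card C = i & G \<subseteq> C} \<subseteq> supers F i0 G \<union> {C \<in> N. G \<subseteq> C}"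
      using minsF True by (auto simp: supers_def)
    moreover have "finite (supers F i0 G)" using finF mins_sub
      by (auto simp: supers_def intro: finite_subset[of _ F])
    ultimately have "card {C \<in> mins ?F - F0. card C = i & G \<subseteq> C} <=
      card (supers F i0 G \<union> {C \<in> N. G \<subseteq> C})" using finN by (intro card_mono) auto
    also have "... <= card (supers F i0 G) + card {C \<in> N. G \<subseteq> C}" by (rule card_Un_le)
    also have "... <= 2 * \<theta> (i - card G)"
      using sparse[of G] deg[of G] G True by simp
    finally show ?thesis .
  next
    case False
    then have "{C \<in> mins ?F - F0. card C = i & G \<subseteq> C} \<subseteq> {C \<in> mins F - F0. card C = i & G \<subseteq> C}"
      using minsF N(2) by auto
    moreover have "finite {C \<in> mins F - F0. card C = i & G \<subseteq> C}"
      by (rule finite_subset[OF _ finF]) (use mins_sub in auto)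
    ultimately have "card {C \<in> mins ?F - F0. card C = i & G \<subseteq> C} <=
      card {C \<in> mins F - F0. card C = i & G \<subseteq> C}" by (rule card_mono[rotated])
    then show ?thesis using inv_deg[OF F G] by simp
  qed
  moreover have "card {C \<in> ?F - F0 - mins ?F. card C = i} <= (\<Sum>j=1..<i. ad ?F j * (2 * \<theta> (i - j)))" for i
  proof -
    let ?old = "{C \<in> F - F0 - mins F. card C = i}"
    have old: "card ?old <= (\<Sum>j=1..<i. ad F j * (2 * \<theta> (i - j)))" using F by (auto simp: inv_def)
    \<comment> \<open>A clause that dies now was minimal before and properly contains a clause
      \<open>D\<close> of \<open>N\<close>. By the degree bound with \<open>G = D\<close>, each
      \<open>D\<close> kills at most \<open>2 * \<theta> (i - i0)\<close> added clauses of size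
      \<open>i\<close>.\<close>
    have sub: "{C \<in> ?F - F0 - mins ?F. card C = i} \<subseteq>
      ?old \<union> (\<Union>D\<in>N. {C \<in> mins F - F0. card C = i & D \<subset> C})" (is "?l \<subseteq> _ \<union> ?U")
    proof
      fix C assume C: "C \<in> ?l"
      then have CF: "C \<in> F" using Nmin by auto
      show "C \<in> ?old \<union> ?U"
      proof (cases "C \<in> mins F")
        case True
        obtain D where D: "D \<in> ?F" "D \<subset> C" using C CF by (auto simp: mins_def)
        then have "D \<in> N" using True by (auto simp: mins_def)
        then show ?thesis using D C True by blast
      next
        case False then show ?thesis using C CF by auto
      qed
    qed
    have finU: "finite ?U" by (rule finite_subset[of _ F]) (use mins_sub finF in auto)
    show ?thesis
    proof (cases "i0 < i")
      case True
      have "card ?U <= (\<Sum>D\<in>N. card {C \<in> mins F - F0. card C = i & D \<subset> C})"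
        by (rule card_UN_le[OF finN])
      also have "... <= (\<Sum>D\<in>N. 2 * \<theta> (i - i0))"
      proof (rule sum_mono)
        fix D assume D: "D \<in> N"
        have "card {C \<in> mins F - F0. card C = i & D \<subset> C} <= card {C \<in> mins F - F0. card C = i & D \<subseteq> C}"
          by (rule card_mono) (use mins_sub in \<open>auto intro: finite_subset[OF _ finF]\<close>)
        also have "... <= 2 * \<theta> (i - card D)"
        proof -
          have "D ~= {}" using N(2)[OF D] N(3) by auto
          then show ?thesis by (intro inv_deg[OF F]) (use N(1) N(2)[OF D] True D in auto)
        qed
        finally show "card {C \<in> mins F - F0. card C = i & D \<subset> C} <= 2 * \<theta> (i - i0)"
          using N(2)[OF D] by simp
      qed
      finally have U: "card ?U <= card N * (2 * \<theta> (i - i0))" by simp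
      have "card ?l <= card (?old \<union> ?U)" by (rule card_mono[OF _ sub]) (use finF finU in auto)
      also have "... <= card ?old + card ?U" by (rule card_Un_le)
      also have "... <= (\<Sum>j=1..<i. ad F j * (2 * \<theta> (i - j))) + card N * (2 * \<theta> (i - i0))"
        using old U by simp
      also have "... = (\<Sum>j=1..<i. ad F j * (2 * \<theta> (i - j))) +
          (\<Sum>j=1..<i. if j = i0 then card N * (2 * \<theta> (i - j)) else 0)"
        using True N(3) by (simp add: sum.delta)
      also have "... = (\<Sum>j=1..<i. ad ?F j * (2 * \<theta> (i - j)))"
        unfolding sum.distrib[symmetric] ad by (rule sum.cong) (auto simp: distrib_right)
      finally show ?thesis .
    next
      case False
      have "?U = {}"
      proof (rule ccontr)
        assume "?U ~= {}"
        then obtain C D where CD: "D \<in> N" "C \<in> mins F" "card C = i" "D \<subset> C" by blast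
        then have "C \<in> F" using mins_sub by blast
        then have "finite C" using FL(1) Lit(1) finite_subset by blast
        then have "card D < card C" using CD(4) by (rule psubset_card_mono)
        then show False using N(2)[OF CD(1)] False CD by simp
      qed
      then have "?l \<subseteq> ?old" using sub by (simp only: Un_empty_right)
      then have "card ?l <= card ?old" by (rule card_mono[rotated]) (use finF in auto)
      also have "... <= (\<Sum>j=1..<i. ad F j * (2 * \<theta> (i - j)))" by (rule old)
      also have "... <= (\<Sum>j=1..<i. ad ?F j * (2 * \<theta> (i - j)))"
        by (intro sum_mono mult_le_mono) (auto simp: ad)
      finally show ?thesis .
    qed
  qed
  moreover have "C ~= {} & card C < k" if C: "C \<in> ?F - F0" for C
  proof (cases "C \<in> N")
    case True then show ?thesis using N(2)[OF True] N(3,4) by auto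
  next
    case False then show ?thesis using C F unfolding inv_def by blast
  qed
  moreover have "F0 \<subseteq> ?F" "?F \<subseteq> Pow Lit" using FL N(1) by auto
  ultimately show "inv ?F" unfolding inv_def by simp
qed

text \<open>The priority among sunflowers provides what \<open>inv_extend\<close> needs. The heart
  and the petals are smaller than \<open>c\<close>, and smaller sizes have no sunflower, so few old
  clauses contain a given \<open>G\<close>. Among the petals, too many containing \<open>G\<close>
  would yield a larger heart. No old clause lies inside a new one, since heart and petals are proper
  parts of minimal clauses.\<close>

lemma step:
  assumes F: "inv F" and S: "first_sunflower \<theta> k F c H" and F0: "F0 \<subseteq> Pow Lit"
  shows "inv (insert H F)" "inv (F \<union> petals F c H)"
    "!!i. ad (insert H F) i = ad F i + (if i = card H then 1 else 0)"
    "!!i. ad (F \<union> petals F c H) i = ad F i + (if i = c - card H then card (supers F c H) else 0)"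
    "\<theta> (c - card H) <= card (supers F c H)" "1 <= card H" "card H < c" "c <= k"
    "H \<notin> F" "petals F c H \<inter> F = {}"
proof -
  have H: "H ~= {}" "finite H" "card H < c" "\<theta> (c - card H) <= card (supers F c H)" "c <= k"
    using S by (auto simp: first_sunflower_def sunflower_def)
  have FL: "F \<subseteq> Pow Lit" using F by (auto simp: inv_def)
  have finF: "finite F" using FL finite_sub_Lit by auto
  have small: "card (supers F c' G) < \<theta> (c' - card G)"
    if "G ~= {}" "G \<subseteq> Lit" "card G < c'" "c' < c | c' = c & card H < card G" for c' G
  proof (rule ccontr)
    assume "~ card (supers F c' G) < \<theta> (c' - card G)"
    then have "sunflower \<theta> F c' G" using that finite_subset[OF _ Lit(1)] by (auto simp: sunflower_def)
    then have "c <= c'" "c' = c --> card G <= card H" using S unfolding first_sunflower_def by blast+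
    then show False using that(4) by linarith
  qed
  have "supers F c H ~= {}" using H(4) theta_pos[of "c - card H"] by auto
  then obtain C0 where C0: "C0 \<in> mins F" "card C0 = c" "H \<subseteq> C0" by (auto simp: supers_def)
  have "C0 \<in> F" using C0(1) mins_sub by blast
  then have HL: "H \<subseteq> Lit" using C0(3) FL by blast
  have "H ~= C0" using C0 H by auto
  then have newH: "~ D \<subseteq> H" if "D \<in> F" for D using C0 that by (auto simp: mins_def)
  show "1 <= card H" using H(1,2) by (simp add: Suc_le_eq card_gt_0_iff)
  then have h1: "1 <= card H" .
  have i1: "inv (F \<union> {H}) & (ALL i. ad (F \<union> {H}) i = ad F i + (if i = card H then card {H} else 0))"
  proof -
    have 1: "{H} \<subseteq> Pow Lit" using HL by auto
    have 2: "C = H ==> card C = card H" for C by simp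
    have deg: "card {C \<in> {H}. G \<subseteq> C} <= \<theta> (card H - card G)" for G
    proof -
      have "card {C \<in> {H}. G \<subseteq> C} <= card {H}" by (rule card_mono) auto
      then show ?thesis using theta_pos[of "card H - card G"] by simp
    qed
    show ?thesis
      using inv_extend[OF F 1, of "card H"] h1 H newH small deg by auto
  qed
  then show "inv (insert H F)" "!!i. ad (insert H F) i = ad F i + (if i = card H then 1 else 0)" by auto
  show "H \<notin> F" using newH by blast
  let ?N = "petals F c H" and ?S = "supers F c H"
  have inj: "inj_on (%C. C - H) ?S" by (rule inj_onI) (auto simp: supers_def)
  then have cN: "card ?N = card ?S" unfolding petals_def by (rule card_image)
  have finS: "finite ?S" by (rule finite_subset[OF _ finF]) (use mins_sub in \<open>auto simp: supers_def\<close>)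
  have SL: "?S \<subseteq> Pow Lit" using mins_sub FL by (auto simp: supers_def)
  have newN: "~ D \<subseteq> C" if C: "C \<in> ?N" and D: "D \<in> F" for C D
  proof
    assume DC: "D \<subseteq> C"
    obtain E where E: "E \<in> ?S" "C = E - H" using C by (auto simp: petals_def)
    then have "D \<subset> E" using DC H(1) by (auto simp: supers_def)
    then show False using E D by (auto simp: supers_def mins_def)
  qed
  then show "?N \<inter> F = {}" by blast
  have cardN: "card C = c - card H" if "C \<in> ?N" for C
    using that H(2) by (auto simp: petals_def supers_def card_Diff_subset)
  have deg: "card {C \<in> ?N. G \<subseteq> C} <= \<theta> (c - card H - card G)"
    if G: "G ~= {}" "G \<subseteq> Lit" "card G < c - card H" for G
  proof (cases "G \<inter> H = {}")
    case True
    have finG: "finite G" using G(2) Lit(1) finite_subset by blast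
    have "{C \<in> ?N. G \<subseteq> C} \<subseteq> (%C. C - H) ` supers F c (H \<union> G)"
      by (auto simp: petals_def supers_def)
    then have "card {C \<in> ?N. G \<subseteq> C} <= card (supers F c (H \<union> G))"
      by (rule surj_card_le[rotated]) (rule finite_subset[OF _ finS], auto simp: supers_def)
    \<comment> \<open>Otherwise \<open>H \<union> G\<close> would be the heart of a sunflower of the
      same clause size, larger than \<open>H\<close>.\<close>
    also have "... < \<theta> (c - card (H \<union> G))"
    proof (rule small)
      have "card (H \<union> G) = card H + card G" using True H(2) finG by (simp add: card_Un_disjoint Int_commute)
      moreover have "card G ~= 0" using finG G(1) by simp
      ultimately show "card (H \<union> G) < c" "c < c | c = c & card H < card (H \<union> G)" using G(3) by auto
    qed (use H G HL in auto)
    also have "c - card (H \<union> G) = c - card H - card G"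
      using True H(2) finG by (simp add: card_Un_disjoint Int_commute)
    finally show ?thesis by simp
  next
    case False
    then have "{C \<in> ?N. G \<subseteq> C} = {}" by (auto simp: petals_def)
    then show ?thesis by (metis card.empty le0)
  qed
  have NL: "?N \<subseteq> Pow Lit" using SL by (auto simp: petals_def)
  have i2: "inv (F \<union> ?N) & (ALL i. ad (F \<union> ?N) i = ad F i + (if i = c - card H then card ?N else 0))"
  proof -
    have 1: "1 <= c - card H" "c - card H < k" using H h1 by auto
    have 2: "card (supers F (c - card H) G) < \<theta> (c - card H - card G)"
      if "G ~= {}" "G \<subseteq> Lit" "card G < c - card H" for G
      by (rule small) (use that h1 H in auto)
    show ?thesis using inv_extend[OF F NL cardN 1 newN 2 deg] by blast
  qed
  then show "inv (F \<union> ?N)" by simp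
  show "ad (F \<union> ?N) i = ad F i + (if i = c - card H then card ?S else 0)" for i using i2 cN by auto
qed (use S in \<open>auto simp: first_sunflower_def sunflower_def\<close>)

text \<open>Hearts consisting of one literal suffice: if none of them forms a sunflower, each of the
  \<open>2 * n\<close> literals lies in fewer than \<open>\<theta> (i - 1)\<close> minimal clauses
  of size \<open>i\<close>. The remaining summands allow for the empty clause and the unit
  clauses.\<close>

lemma leaf_bound:
  assumes F: "F \<subseteq> Pow Lit" "!!C. C \<in> F ==> card C <= k"
    and none: "!!c H. 2 <= c ==> c <= k ==> ~ sunflower \<theta> F c H"
  shows "card (mins F) <= 1 + 2 * n + k * (2 * n * \<theta> k)"
proof -
  have th_mono: "\<theta> i <= \<theta> j" if "i <= j" for i j using b_mono[OF that] by (simp add: thresh_def)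
  have finF: "finite F" using F finite_sub_Lit by auto
  have fin: "finite (mins F)" using finF mins_sub finite_subset by blast
  let ?M = "%i. {C \<in> mins F. card C = i}"
  have "mins F \<subseteq> {{}} \<union> ((%l. {l}) ` Lit) \<union> (\<Union>i\<in>{2..k}. ?M i)"
  proof
    fix C assume C: "C \<in> mins F"
    have "C \<in> F" using C mins_sub by blast
    then have "C \<subseteq> Lit" "card C <= k" using F by auto
    moreover have "finite C" using \<open>C \<subseteq> Lit\<close> Lit(1) finite_subset by blast
    moreover consider "card C = 0" | "card C = 1" | "2 <= card C" by linarith
    ultimately show "C \<in> {{}} \<union> ((%l. {l}) ` Lit) \<union> (\<Union>i\<in>{2..k}. ?M i)"
      using C by cases (auto simp: card_1_singleton_iff)
  qed
  then have "card (mins F) <= card ({{}} \<union> ((%l. {l}) ` Lit) \<union> (\<Union>i\<in>{2..k}. ?M i))"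
    by (rule card_mono[rotated]) (use fin Lit in auto)
  also have "... <= card {{}::nat set} + card ((%l. {l}) ` Lit) + card (\<Union>i\<in>{2..k}. ?M i)"
    by (meson card_Un_le add_le_mono1 le_trans)
  also have "card ((%l. {l}) ` Lit) <= 2 * n" using card_image_le[OF Lit(1)] Lit(2) le_trans by blast
  also have "card (\<Union>i\<in>{2..k}. ?M i) <= (\<Sum>i\<in>{2..k}. card (?M i))" by (rule card_UN_le) simp
  also have "... <= (\<Sum>i\<in>{2..k}. 2 * n * \<theta> k)"
  proof (rule sum_mono)
    fix i assume i: "i \<in> {2..k}"
    have "?M i \<subseteq> (\<Union>l\<in>Lit. supers F i {l})"
    proof
      fix C assume C: "C \<in> ?M i"
      then have "C ~= {}" "C \<subseteq> Lit" using i F mins_sub by auto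
      then show "C \<in> (\<Union>l\<in>Lit. supers F i {l})" using C by (auto simp: supers_def)
    qed
    moreover have "finite (\<Union>l\<in>Lit. supers F i {l})"
      by (rule finite_subset[OF _ fin]) (auto simp: supers_def)
    ultimately have "card (?M i) <= card (\<Union>l\<in>Lit. supers F i {l})" by (rule card_mono[rotated])
    also have "... <= (\<Sum>l\<in>Lit. card (supers F i {l}))" by (rule card_UN_le[OF Lit(1)])
    also have "... <= (\<Sum>l\<in>Lit. \<theta> k)"
    proof (rule sum_mono)
      fix l assume "l \<in> Lit"
      have "card (supers F i {l}) < \<theta> (i - 1)"
        using none[of i "{l}"] i by (auto simp: sunflower_def)
      also have "... <= \<theta> k" using i by (intro th_mono) auto
      finally show "card (supers F i {l}) <= \<theta> k" by simp
    qed
    also have "... <= 2 * n * \<theta> k" using Lit(2) by simp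
    finally show "card (?M i) <= 2 * n * \<theta> k" .
  qed
  also have "... <= k * (2 * n * \<theta> k)" by simp
  finally show ?thesis by simp
qed

section \<open>The potential of a branch\<close>

definition psi :: "real => real => nat set set => real" where
  "psi wH wP F = (\<Sum>i=1..<k. real (ad F i) * (wH + wP / real (\<theta> i)))"

definition psi_max :: "real => real => real" where
  "psi_max wH wP = (\<Sum>i=1..<k. real (n * b i) * (wH + wP / real (\<theta> i)))"

lemma psi_le: "inv F ==> 0 <= wH ==> 0 <= wP ==> psi wH wP F <= psi_max wH wP"
  unfolding psi_def psi_max_def
  by (intro sum_mono mult_right_mono) (use ad_bound in \<open>auto simp del: of_nat_mult\<close>)

lemma psi_step:
  assumes "!!i. ad F' i = ad F i + (if i = i0 then m else 0)" "1 <= i0" "i0 < k"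
  shows "psi wH wP F' = psi wH wP F + real m * (wH + wP / real (\<theta> i0))"
proof -
  have "psi wH wP F' = (\<Sum>i=1..<k. real (ad F i) * (wH + wP / real (\<theta> i)) +
      (if i = i0 then real m * (wH + wP / real (\<theta> i)) else 0))"
    unfolding psi_def assms(1) by (rule sum.cong) (auto simp: distrib_right)
  then show ?thesis using assms(2,3) by (simp add: sum.distrib psi_def)
qed

text \<open>The weight \<open>wH + wP / \<theta> i\<close> of an added clause is made for this: one
  heart gains at least \<open>wH\<close>, and the petals, of which there are at least
  \<open>\<theta> i\<close>, together gain at least \<open>wP\<close>.\<close>

lemma psi_heart:
  assumes "inv F" "first_sunflower \<theta> k F c H" "F0 \<subseteq> Pow Lit" "0 <= wH" "0 <= wP"
  shows "psi wH wP F + wH <= psi wH wP (insert H F)"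
    and "psi wH wP F + wP <= psi wH wP (F \<union> petals F c H)"
proof -
  note st = step[OF assms(1-3)]
  have "psi wH wP (insert H F) = psi wH wP F + real 1 * (wH + wP / real (\<theta> (card H)))"
    by (rule psi_step) (use st in auto)
  then show "psi wH wP F + wH <= psi wH wP (insert H F)" using assms(4,5) by simp
  let ?i = "c - card H" and ?m = "card (supers F c H)"
  have "psi wH wP (F \<union> petals F c H) = psi wH wP F + real ?m * (wH + wP / real (\<theta> ?i))"
    by (rule psi_step) (use st in auto)
  moreover have "wP <= real ?m * (wH + wP / real (\<theta> ?i))"
  proof -
    have t: "0 < real (\<theta> ?i)" using theta_pos[of ?i] by simp
    have "wP = real (\<theta> ?i) * (wP / real (\<theta> ?i))" using t by simp
    also have "... <= real ?m * (wH + wP / real (\<theta> ?i))"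
      using st(5) assms(4,5) t by (intro mult_mono) auto
    finally show ?thesis .
  qed
  ultimately show "psi wH wP F + wP <= psi wH wP (F \<union> petals F c H)" by simp
qed

end

section \<open>Lists on the heap\<close>

lemma CT_case_list:
  fixes l :: "'e::heap_data => 'x::heap_data list" and a :: "'e => 'b::heap_data"
  assumes "CT l tq" "CT a ta" "CT (%z. f (fst z) (fst (snd z)) (snd (snd z))) tf"
  shows "CT (%e. case l e of [] => a e | x # xs => f e x xs)
    (%e. tq e + ta e + (case l e of [] => 0 | x # xs => tf (e, x, xs)) + 24)"
  (is "CT ?g ?t")
  unfolding CT_def
proof (intro allI impI)
  fix k :: nat assume k: "0 < k"
  obtain cl where cl: "!!s x V. hp_ok s V ==> holds s (k+1) x V ==>
     EX s'. xc cl s (tq x) (V + tq x) s' & post (k+1) s (l x) (V + tq x) s'"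
    using CT_E[OF assms(1), of "k+1"] by auto
  obtain ca where ca: "!!s x V. hp_ok s V ==> holds s k x V ==>
     EX s'. xc ca s (ta x) (V + ta x) s' & post k s (a x) (V + ta x) s'" using CT_E[OF assms(2) k] by blast
  obtain cf where cf: "!!s z V. hp_ok s V ==> holds s k z V ==>
     EX s'. xc cf s (tf z) (V + tf z) s' &
       post k s (f (fst z) (fst (snd z)) (snd (snd z))) (V + tf z) s'" using CT_E[OF assms(3) k] by blast
  let ?I = "Ite (k+1) (ALLOC k k (k+1) (k+2) ;; cf) ca"
  let ?c = "MOV (k+1) k ;; cl ;; ?I"
  show "EX c. ALL s e V. hp_ok s V --> holds s k e V -->
    (EX s'. xc c s (?t e) (V + ?t e) s' & post k s (?g e) (V + ?t e) s')"
  proof (intro exI[of _ ?c] allI impI)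
    fix s V and e :: 'e assume s: "hp_ok s V" "holds s k e V"
    let ?W = "V + ?t e"
    define tc where "tc = (case l e of [] => 0 | x # xs => tf (e, x, xs))"
    have W: "?W = V + (tq e + ta e + tc + 24)" by (simp add: tc_def)
    obtain s1 where 1: "xc (MOV (k+1) k) s 4 V s1" "post (k+1) s e V s1"
      using MOV_rule[OF s, of "k+1"] k by auto
    have e1: "ext (k+1) s s1" using 1 by (simp add: post_def)
    obtain s2 where 2: "xc cl s1 (tq e) (V + tq e) s2" "post (k+1) s1 (l e) (V + tq e) s2"
      using cl 1(2) unfolding post_def by blast
    have e2: "ext (k+1) s s2" using e1 2 ext_trans by (auto simp: post_def)
    have h2: "hp_ok s2 (V + tq e)" "holds s2 k e (V + tq e)" "holds s2 (k+1) (l e) (V + tq e)"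
      using 2 holds_ext[OF s(2) e2] k by (auto simp: post_def)
    have e: "ext k s s2" using ext_mono[OF e2] by simp
    have r: "reg s2 (k+1) <= ?W" using h2(3) by (simp add: holds_def)
    have "EX s3. xc ?I s2 (18 + ta e + tc) ?W s3 & post k s2 (?g e) ?W s3"
    proof (cases "l e")
      case Nil
      obtain s3 where 3: "xc ca s2 (ta e) (V + tq e + ta e) s3" "post k s2 (a e) (V + tq e + ta e) s3"
        using ca[OF h2(1,2)] by blast
      have "reg s2 (k+1) = 0" using h2(3) Nil by (simp add: holds_def)
      from xc_IteF[OF this xc_mono[OF 3(1), of _ ?W]] have "xc ?I s2 (2 + ta e) ?W s3" by simp
      then have "xc ?I s2 (18 + ta e + tc) ?W s3" by (rule xc_mono) auto
      moreover have "post k s2 (?g e) ?W s3" using post_mono[OF 3(2)] Nil by simp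
      ultimately show ?thesis by blast
    next
      case (Cons x xs)
      have h: "holds s2 (k+1) (x, xs) (V + tq e)" using h2(3) Cons by (simp add: holds_def enc_prod_def)
      then have nz: "reg s2 (k+1) ~= 0" using holds_Pr(1)[OF h h2(1)] by simp
      obtain s3 where 3: "xc (ALLOC k k (k+1) (k+2)) s2 16 (V + tq e + 4) s3"
        "post k s2 (e, x, xs) (V + tq e + 4) s3"
        using ALLOC_rule[OF h2(1,2) h, of k "k+2"] k by auto
      obtain s4 where 4: "xc cf s3 tc (V + tq e + 4 + tc) s4"
        "post k s3 (f e x xs) (V + tq e + 4 + tc) s4"
        using cf[of s3 "V + tq e + 4" "(e, x, xs)"] 3(2) Cons unfolding post_def tc_def by auto
      have "xc (ALLOC k k (k+1) (k+2) ;; cf) s2 (16 + tc) ?W s4"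
        unfolding W by (rule xc_Seq[OF xc_mono[OF 3(1)] xc_mono[OF 4(1)]]) auto
      from xc_IteT[OF nz r this] have "xc ?I s2 (2 + (16 + tc)) ?W s4" .
      then have "xc ?I s2 (18 + ta e + tc) ?W s4" by (rule xc_mono) auto
      moreover have "post k s2 (?g e) ?W s4"
        using post_mono[OF post_ext[OF _ 4(2)], of s2 ?W] 3(2) Cons unfolding W by (simp add: post_def)
      ultimately show ?thesis by blast
    qed
    then obtain s3 where 3: "xc ?I s2 (18 + ta e + tc) ?W s3" "post k s2 (?g e) ?W s3" by blast
    have "xc ?c s (4 + (tq e + (18 + ta e + tc))) ?W s3"
      by (intro xc_Seq) (rule xc_mono, rule 1 2 3, simp, simp)+
    then have "xc ?c s (?t e) ?W s3" by (rule xc_mono) (auto simp: tc_def)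
    with post_ext[OF e 3(2)] show "EX s'. xc ?c s (?t e) ?W s' & post k s (?g e) ?W s'" by blast
  qed
qed

lemma sz_mem: "x \<in> set xs ==> sz x < sz xs"
  by (induction xs) auto

lemma polyb_power [intro]: "polyb t ==> polyb (%x. t x ^ i)"
  by (induction i) (auto intro: polyb_const polyb_mult)

lemma polyb_elem:
  assumes "polyb (t :: 'e::heap_data \<times> 'x::heap_data => nat)" "PT (l :: 'e => 'x list)"
  obtains B where "polyb B" "!!e x. x \<in> set (l e) ==> t (e, x) <= B e"
proof -
  obtain C where C: "!!p. t p <= C * sz p ^ C" using assms(1) unfolding polyb_def by blast
  show thesis
  proof (rule that)
    show "polyb (%e. C * (sz e + sz (l e) + 1) ^ C)"
      by (intro polyb_mult polyb_const polyb_power polyb_add polyb_sz PT_szD[OF assms(2)])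
    fix e x assume "x \<in> set (l e)"
    then have "sz x < sz (l e)" by (rule sz_mem)
    then show "t (e, x) <= C * (sz e + sz (l e) + 1) ^ C"
      by (intro order.trans[OF C] mult_le_mono power_mono) auto
  qed
qed

lemma PT_case_list:
  fixes l :: "'e::heap_data => 'x::heap_data list" and a :: "'e => 'b::heap_data"
  assumes "PT l" "PT a" "PT (%z. f (fst z) (fst (snd z)) (snd (snd z)))"
  shows "PT (%e. case l e of [] => a e | x # xs => f e x xs)"
proof -
  let ?f = "%z. f (fst z) (fst (snd z)) (snd (snd z))"
  obtain tq ta tf where *: "CT l tq" "polyb tq" "CT a ta" "polyb ta" "CT ?f tf" "polyb tf"
    using assms unfolding PT_def by blast
  have *: "EX B. polyb B & (ALL e x xs. l e = x # xs --> t (e, x, xs) <= B e)" if t: "polyb t" for t :: "_ => nat"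
  proof -
    obtain C where C: "!!p. t p <= C * sz p ^ C" using t unfolding polyb_def by blast
    have "polyb (%e. C * (sz e + sz (l e) + 1) ^ C)"
      by (intro polyb_mult polyb_const polyb_power polyb_add polyb_sz PT_szD[OF assms(1)])
    moreover have "t (e, x, xs) <= C * (sz e + sz (l e) + 1) ^ C" if "l e = x # xs" for e x xs
      using that by (intro order.trans[OF C] mult_le_mono power_mono) auto
    ultimately show ?thesis by blast
  qed
  obtain B1 where B1: "polyb B1" "!!e x xs. l e = x # xs ==> tf (e, x, xs) <= B1 e"
    using *[of tf] \<open>polyb tf\<close> by blast
  obtain B2 where B2: "polyb B2" "!!e x xs. l e = x # xs ==> sz (f e x xs) <= B2 e"
    using *[OF PT_szD[OF assms(3)]] by auto
  show ?thesis
  proof (rule PTI[OF CT_mono[OF CT_case_list]])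
    show "CT l tq" "CT a ta" "CT ?f tf" by fact+
    show "tq e + ta e + (case l e of [] => 0 | x # xs => tf (e, x, xs)) + 24 <= tq e + ta e + B1 e + 24" for e
      using B1(2) by (auto split: list.split)
    show "polyb (%e. tq e + ta e + B1 e + 24)"
      by (intro polyb_add polyb_const B1) fact+
    show "polyb (%e. sz (case l e of [] => a e | x # xs => f e x xs))"
    proof (rule polyb_le[OF polyb_add[OF PT_szD[OF assms(2)] B2(1)]])
      fix e show "sz (case l e of [] => a e | x # xs => f e x xs) <= sz (a e) + B2 e"
        by (cases "l e") (use B2(2) in \<open>auto intro: trans_le_add2\<close>)
    qed
  qed
qed

lemma PT_rev: "PT l ==> PT (%e. rev (l e :: 'x::heap_data list))"
proof -
  assume l: "PT l"
  have eq: "rev xs = foldl (%a x. x # a) [] xs" for xs :: "'x list"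
    by (simp add: foldl_conv_fold fold_Cons_rev)
  have sz: "sz (rev xs) = sz xs" for xs :: "'x list"
  proof (induction xs)
    case (Cons x xs) then show ?case using sz_list_append[of "rev xs" "[x]"] by simp
  qed simp
  show ?thesis unfolding eq
  proof (rule PT_foldl[OF PT_Nil l _ PT_szD[OF l]])
    show "PT (%z. snd (snd z) # fst (snd z))" by (intro PT_Cons PT_fst PT_snd PT_id)
    fix e ys zs assume "l e = ys @ zs"
    then show "sz (foldl (%a x. x # a) [] ys) <= sz (l e)"
      using sz_list_append[of ys zs] sz_pos[of zs] by (simp add: eq[symmetric] sz)
  qed
qed

lemma PT_append: "PT l ==> PT r ==> PT (%e. l e @ r e :: 'x::heap_data list)"
proof -
  assume l: "PT l" and r: "PT r"
  have eq: "xs @ ys = foldl (%a x. x # a) ys (rev xs)" for xs ys :: "'x list"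
    by (simp add: foldl_conv_fold fold_Cons_rev)
  have sz: "sz (foldl (%a x. x # a) ys xs) + 1 = sz ys + sz xs" for xs ys :: "'x list"
    by (induction xs arbitrary: ys) auto
  show ?thesis unfolding eq
  proof (rule PT_foldl[OF r PT_rev[OF l] _ polyb_add[OF PT_szD[OF r] PT_szD[OF PT_rev[OF l]]]])
    show "PT (%z. snd (snd z) # fst (snd z))" by (intro PT_Cons PT_fst PT_snd PT_id)
    fix e ys zs assume "rev (l e) = ys @ zs"
    then show "sz (foldl (%a x. x # a) (r e) ys) <= sz (r e) + sz (rev (l e))"
      using sz[of "r e" ys] sz_list_append[of ys zs] sz_pos[of zs] by simp
  qed
qed

lemma PT_bex:
  fixes l :: "'e::heap_data => 'x::heap_data list"
  assumes "PT l" "PT (%z. p (fst z) (snd z))"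
  shows "PT (%e. EX x:set (l e). p e x)"
proof -
  have "foldl (%a x. a | q x) b xs \<longleftrightarrow> b | (EX x:set xs. q x)" for q b and xs :: "'x list"
    by (induction xs arbitrary: b) auto
  then have eq: "(EX x:set xs. q x) = foldl (%a x. a | q x) False xs" for q and xs :: "'x list" by simp
  have "PT (%z :: 'e \<times> bool \<times> 'x. p (fst z) (snd (snd z)))"
    by (rule PT_comp[OF assms(2), of "%z. (fst z, snd (snd z))", simplified])
      (intro PT_pair PT_fst PT_snd PT_id)
  then show ?thesis unfolding eq
    by (intro PT_foldl[where b = "%_. 1"] PT_bool assms PT_disj PT_fst PT_snd PT_id polyb_const) auto
qed

lemma PT_ball:
  fixes l :: "'e::heap_data => 'x::heap_data list"
  assumes "PT l" "PT (%z. p (fst z) (snd z))"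
  shows "PT (%e. ALL x:set (l e). p e x)"
proof -
  have eq: "(ALL x:A. q x) = (~ (EX x:A. ~ q x))" for A :: "'x set" and q by auto
  show ?thesis unfolding eq by (intro PT_not PT_bex assms)
qed

lemma PT_mem: "PT (f :: 'a::heap_data => _) ==> PT l ==> PT (%e. (f e :: nat) \<in> set (l e))"
proof -
  assume *: "PT f" "PT l"
  have eq: "x \<in> A \<longleftrightarrow> (EX y:A. y = x)" for A and x :: nat by auto
  have "PT (%z :: 'a \<times> nat. f (fst z))" by (intro PT_comp[OF *(1)] PT_fst PT_id)
  then show ?thesis unfolding eq[of "f _"] by (intro PT_bex * PT_eq PT_snd PT_id)
qed

lemma PT_subset: "PT (f :: 'a::heap_data => _) ==> PT l ==> PT (%e. set (f e :: nat list) \<subseteq> set (l e))"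
proof -
  assume *: "PT f" "PT l"
  have "PT (%z :: 'a \<times> nat. l (fst z))" by (intro PT_comp[OF *(2)] PT_fst PT_id)
  then show ?thesis unfolding subset_iff Ball_def[symmetric]
    by (intro PT_ball * PT_mem PT_snd PT_id)
qed

lemma PT_length: "PT l ==> PT (%e. length (l e :: 'x::heap_data list))"
proof -
  assume l: "PT l"
  have "foldl (%a x. Suc a) b xs = b + length xs" for b and xs :: "'x list"
    by (induction xs arbitrary: b) auto
  then have eq: "length xs = foldl (%a x. Suc a) 0 xs" for xs :: "'x list" by simp
  show ?thesis unfolding eq
    by (intro PT_foldl[where b = "%_. 1"] PT_nat l PT_Suc PT_fst PT_snd PT_id polyb_const) auto
qed

lemma PT_map:
  fixes l :: "'e::heap_data => 'x::heap_data list" and h :: "'e => 'x => 'y::heap_data"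
  assumes "PT (%z. h (fst z) (snd z))" "PT l"
  shows "PT (%e. map (h e) (l e))"
proof -
  have fl: "foldl (%a x. g x # a) b xs = rev (map g xs) @ b" for g :: "'x => 'y" and b xs
    by (induction xs arbitrary: b) auto
  then have eq: "map g xs = rev (foldl (%a x. g x # a) [] xs)" for g :: "'x => 'y" and xs by simp
  obtain B where B: "polyb B" "!!e x. x \<in> set (l e) ==> sz (h e x) <= B e"
    using polyb_elem[OF PT_szD[OF assms(1)] assms(2)] by (auto simp del: split_paired_All)
  have sz: "sz (foldl (%a x. g x # a) b xs) <= sz b + length xs * (D + 1)"
    if "!!x. x \<in> set xs ==> sz (g x) <= D" for g :: "'x => 'y" and b xs D
    using that
  proof (induction xs arbitrary: b)
    case (Cons x xs)
    have "sz (g x) <= D" using Cons.prems by auto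
    moreover have "sz (foldl (%a x. g x # a) (g x # b) xs) <= sz (g x # b) + length xs * (D + 1)"
      by (rule Cons.IH) (use Cons.prems in auto)
    ultimately show ?case by simp
  qed simp
  have h': "PT (%z :: 'e \<times> 'y list \<times> 'x. h (fst z) (snd (snd z)))"
    by (rule PT_comp[OF assms(1), of "%z. (fst z, snd (snd z))", simplified])
      (intro PT_pair PT_fst PT_snd PT_id)
  show ?thesis unfolding eq
  proof (rule PT_rev, rule PT_foldl[OF PT_Nil assms(2)])
    show "PT (%z. h (fst z) (snd (snd z)) # fst (snd z))"
      by (intro PT_Cons h' PT_fst PT_snd PT_id)
    show "polyb (%e. 1 + sz (l e) * (B e + 1))"
      by (intro polyb_add polyb_mult polyb_const PT_szD[OF assms(2)] B)
    fix e ys zs assume l: "l e = ys @ zs"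
    have "sz (foldl (%a x. h e x # a) [] ys) <= sz ([] :: 'y list) + length ys * (B e + 1)"
      by (rule sz, rule B) (use l in auto)
    also have "... <= 1 + sz (l e) * (B e + 1)"
      using sz_list_ge_length[of "l e"] l by (intro add_le_mono mult_le_mono) auto
    finally show "sz (foldl (%a x. h e x # a) [] ys) <= 1 + sz (l e) * (B e + 1)" .
  qed
qed

lemma PT_filter:
  fixes l :: "'e::heap_data => 'x::heap_data list"
  assumes "PT (%z. p (fst z) (snd z))" "PT l"
  shows "PT (%e. filter (p e) (l e))"
proof -
  have fl: "foldl (%a x. if q x then x # a else a) b xs = rev (filter q xs) @ b" for q and b xs :: "'x list"
    by (induction xs arbitrary: b) auto
  then have eq: "filter q xs = rev (foldl (%a x. if q x then x # a else a) [] xs)" for q and xs :: "'x list" by simp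
  have sz: "sz (foldl (%a x. if q x then x # a else a) b xs) + 1 <= sz b + sz xs" for q and b xs :: "'x list"
  proof (induction xs arbitrary: b)
    case (Cons x xs)
    show ?case using Cons[of "x # b"] Cons[of b] by auto
  qed simp
  have h': "PT (%z :: 'e \<times> 'x list \<times> 'x. p (fst z) (snd (snd z)))"
    by (rule PT_comp[OF assms(1), of "%z. (fst z, snd (snd z))", simplified])
      (intro PT_pair PT_fst PT_snd PT_id)
  show ?thesis unfolding eq
  proof (rule PT_rev, rule PT_foldl[OF PT_Nil assms(2)])
    show "PT (%z. if p (fst z) (snd (snd z)) then snd (snd z) # fst (snd z) else fst (snd z))"
      by (intro PT_If PT_Cons h' PT_fst PT_snd PT_id)
    show "polyb (%e. sz (l e))" by (rule PT_szD[OF assms(2)])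
    fix e ys zs assume l: "l e = ys @ zs"
    show "sz (foldl (%a x. if p e x then x # a else a) [] ys) <= sz (l e)"
      using sz[of "p e" "[]" ys] sz_list_append[of ys zs] sz_pos[of zs] l by simp
  qed
qed

lemma PT_concat: "PT l ==> PT (%e. concat (l e :: 'x::heap_data list list))"
proof -
  assume l: "PT l"
  have "foldl (@) b xs = b @ concat xs" for b and xs :: "'x list list"
    by (induction xs arbitrary: b) auto
  then have eq: "concat xs = foldl (@) [] xs" for xs :: "'x list list" by simp
  have sz: "sz (concat xs) <= sz xs" for xs :: "'x list list"
  proof (induction xs)
    case (Cons x xs) then show ?case using sz_list_append[of x "concat xs"] by simp
  qed simp
  show ?thesis unfolding eq
  proof (rule PT_foldl[OF PT_Nil l _ PT_szD[OF l]])
    show "PT (%z. fst (snd z) @ snd (snd z))" by (intro PT_append PT_fst PT_snd PT_id)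
    fix e ys zs assume "l e = ys @ zs"
    then show "sz (foldl (@) [] ys) <= sz (l e)"
      using sz[of ys] sz_list_append[of ys zs] sz_pos[of zs] by (simp add: eq[symmetric])
  qed
qed

lemmas PT_rules = PT_id PT_fst PT_snd PT_pair PT_nat PT_bool PT_Nil PT_Suc PT_minus PT_div PT_mod
  PT_If PT_not PT_conj PT_disj PT_le PT_less PT_eq PT_Cons PT_rev PT_append PT_bex PT_ball PT_mem
  PT_subset PT_length PT_map PT_filter PT_concat

section \<open>The branching step\<close>

definition live :: "nat list list => nat list list" where
  "live F = filter (%C. ~ (EX D:set F. set D \<subseteq> set C & ~ set C \<subseteq> set D)) F"

definition above :: "nat list list => nat => nat list => nat list list" where
  "above L c H = filter (%D. length D = c & set H \<subseteq> set D) L"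

text \<open>All sublists, provided there are at most \<open>K\<close> of them.\<close>

definition subs :: "nat => nat list => nat list list" where
  "subs K C = foldl (%acc x. if K < length acc then acc else acc @ map (%H. H @ [x]) acc) [[]] C"

text \<open>The triple \<open>p\<close> consists of clause size, heart size and threshold. A heart
  lies inside a minimal clause, so the sublists of live clauses are enough candidates.\<close>

definition hearts :: "nat => nat list list => nat \<times> nat \<times> nat => nat list list" where
  "hearts K L p = concat (map (%C. filter (%H. length C = fst p & length H = fst (snd p) &
     snd (snd p) <= length (above L (fst p) H)) (subs K C)) L)"

text \<open>The result inherits the order of \<open>ps\<close>, so its head is a sunflower of
  highest priority.\<close>

definition flowers :: "nat => (nat \<times> nat \<times> nat) list => nat list list => (nat \<times> nat list) list" where
  "flowers K ps F = concat (map (%p. map (%H. (fst p, H)) (hearts K (live F) p)) ps)"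

text \<open>The clauses, the variables of the third block still to be branched on, each given as its
  pair of literals, and the literals chosen so far.\<close>

type_synonym item = "nat list list \<times> (nat \<times> nat) list \<times> nat list"

text \<open>Sunflowers take precedence over variables, so an item without children has neither a
  sunflower nor a variable left.\<close>

definition expand :: "nat => (nat \<times> nat \<times> nat) list => item => item list" where
  "expand K ps = (%i. case flowers K ps (fst i) of
      [] => (case fst (snd i) of
        [] => []
      | v # vs => [(fst i, vs, fst v # snd (snd i)), (fst i, vs, snd v # snd (snd i))])
    | f # _ => [(snd f # fst i, snd i),
        (map (%D. filter (%l. l \<notin> set (snd f)) D) (above (live (fst i)) (fst f) (snd f)) @ fst i, snd i)])"

lemma PT_live: "PT f ==> PT (%e. live (f e))"
  by (rule PT_comp[of live]) (unfold live_def, intro PT_rules)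

lemma PT_above:
  assumes "PT f" "PT g" "PT h" shows "PT (%e. above (f e) (g e) (h e))"
proof -
  have "PT (%z. above (fst z) (fst (snd z)) (snd (snd z)))"
    unfolding above_def by (intro PT_rules)
  from PT_comp[OF this PT_pair[OF assms(1) PT_pair[OF assms(2,3)]]] show ?thesis by simp
qed

lemma subs_snoc: "subs K (C @ [x]) = (if K < length (subs K C) then subs K C
    else subs K C @ map (%H. H @ [x]) (subs K C))"
  by (simp add: subs_def)

text \<open>The cutoff in \<open>subs\<close> keeps the accumulator at \<open>2 * K + 1\<close>
  lists or fewer on every argument, including long lists that are not clauses; this is what makes
  the function polynomial.\<close>

lemma PT_subs: "PT f ==> PT (%e. subs K (f e))"
proof (rule PT_comp[of "subs K"])
  have len: "length (subs K ys) <= 2 * K + 1" for ys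
    unfolding subs_def by (induction ys rule: rev_induct) auto
  have sz: "ALL H:set (subs K ys). sz H <= sz ys" for ys
  proof (induction ys rule: rev_induct)
    case (snoc x ys)
    have "sz (H @ [x]) = sz H + 2" for H using sz_list_append[of H "[x]"] by simp
    moreover have "sz (ys @ [x]) = sz ys + 2" using sz_list_append[of ys "[x]"] by simp
    ultimately show ?case using snoc by (auto simp: subs_snoc intro: trans_le_add1)
  qed (simp add: subs_def)
  have tot: "sz xs <= 1 + length xs * (B + 1)" if "ALL x:set xs. sz x <= B" for xs :: "nat list list" and B
    using that by (induction xs) auto
  show "PT (subs K)" unfolding subs_def
  proof (rule PT_foldl[where a = "%_. [[]]" and g = "%x. x" and
        f = "%_ acc x. if K < length acc then acc else acc @ map (%H. H @ [x]) acc"])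
    show "PT (%z. if K < length (fst (snd z)) then fst (snd z)
       else fst (snd z) @ map (%H. H @ [snd (snd z)]) (fst (snd z)))"
      by (intro PT_rules)
    show "polyb (%e::nat list. 1 + (2 * K + 1) * (sz e + 1))"
      by (intro polyb_add polyb_mult polyb_const polyb_sz)
    fix e ys zs :: "nat list" assume e: "e = ys @ zs"
    have "sz ys <= sz e" using sz_list_append[of ys zs] sz_pos[of zs] e by simp
    then have "sz (subs K ys) <= 1 + length (subs K ys) * (sz e + 1)"
      using sz[of ys] by (intro tot) auto
    also have "... <= 1 + (2 * K + 1) * (sz e + 1)" using len by (intro add_le_mono mult_le_mono) auto
    finally show "sz (foldl (%acc x. if K < length acc then acc else acc @ map (%H. H @ [x]) acc) [[]] ys)
      <= 1 + (2 * K + 1) * (sz e + 1)" by (simp add: subs_def)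
  qed (intro PT_rules)+
qed

lemma PT_hearts:
  assumes "PT f" "PT g" shows "PT (%e. hearts K (f e) (g e))"
proof -
  have "PT (%z. hearts K (fst z) (snd z))"
    unfolding hearts_def by (intro PT_rules PT_above PT_subs)
  from PT_comp[OF this PT_pair[OF assms]] show ?thesis by simp
qed

lemma PT_flowers: "PT f ==> PT (%e. flowers K ps (f e))"
proof (rule PT_comp[of "flowers K ps"])
  have ps: "PT (%_::nat list list. ps)" by (rule PT_const_list) (simp only: split_paired_all, intro PT_rules)
  show "PT (flowers K ps)"
    unfolding flowers_def by (intro PT_rules PT_hearts PT_live ps)
qed

lemma PT_expand: "PT (expand K ps)"
  unfolding expand_def
  by (intro PT_case_list PT_flowers PT_rules PT_above PT_live)

lemma subs_spec:
  "2 ^ length C <= K ==> sorted_wrt (<) C ==>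
    length (subs K C) = 2 ^ length C & (ALL H:set (subs K C). sorted_wrt (<) H & set H \<subseteq> set C) &
    (ALL S. S \<subseteq> set C --> (EX H:set (subs K C). set H = S))"
proof (induction C rule: rev_induct)
  case Nil
  then show ?case by (simp add: subs_def)
next
  case (snoc x C)
  have IH: "length (subs K C) = 2 ^ length C"
    "!!H. H \<in> set (subs K C) ==> sorted_wrt (<) H & set H \<subseteq> set C"
    "!!S. S \<subseteq> set C ==> EX H:set (subs K C). set H = S"
    using snoc by (auto simp: sorted_wrt_append)
  have eq: "subs K (C @ [x]) = subs K C @ map (%H. H @ [x]) (subs K C)"
    using snoc.prems(1) IH(1) by (simp add: subs_snoc)
  have x: "ALL y:set C. y < x" using snoc.prems by (simp add: sorted_wrt_append)
  show ?case
  proof (intro conjI ballI allI impI)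
    show "length (subs K (C @ [x])) = 2 ^ length (C @ [x])" using IH(1) by (simp add: eq)
    fix H assume "H \<in> set (subs K (C @ [x]))"
    then obtain H' where "H' \<in> set (subs K C)" "H = H' | H = H' @ [x]" by (auto simp: eq)
    then show "sorted_wrt (<) H" "set H \<subseteq> set (C @ [x])"
      using IH(2)[of H'] x by (fastforce simp: sorted_wrt_append)+
  next
    fix S assume S: "S \<subseteq> set (C @ [x])"
    show "EX H:set (subs K (C @ [x])). set H = S"
    proof (cases "x \<in> S")
      case True
      obtain H where H: "H \<in> set (subs K C)" "set H = S - {x}" using IH(3)[of "S - {x}"] S by auto
      have "H @ [x] \<in> set (subs K (C @ [x]))" using H(1) by (auto simp: eq)
      moreover have "set (H @ [x]) = S" using H(2) True by auto
      ultimately show ?thesis by blast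
    next
      case False
      then obtain H where "H \<in> set (subs K C)" "set H = S" using IH(3)[of S] S by auto
      then show ?thesis by (auto simp: eq)
    qed
  qed
qed

section \<open>Lists of sorted clauses as set systems\<close>

definition clauses :: "nat list list => nat set set" where "clauses F = set ` set F"

text \<open>A set of literals has only one strictly sorted list, so distinct lists are distinct
  clauses and lengths are cardinalities.\<close>

definition wf_clauses :: "nat list list => bool" where
  "wf_clauses F \<longleftrightarrow> distinct F & (ALL C:set F. sorted_wrt (<) C)"

lemma wf_inj: "wf_clauses F ==> inj_on set (set F)"
  unfolding wf_clauses_def inj_on_def by (metis strict_sorted_equal)

lemma sorted_card: "sorted_wrt (<) (C :: nat list) ==> card (set C) = length C"
  by (simp add: distinct_card strict_sorted_iff)

lemma clauses_live: "clauses (live F) = mins (clauses F)"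
  unfolding clauses_def mins_def live_def by (auto simp: psubset_eq)

lemma mins_clauses: "mins (clauses F) = set ` set (live F)"
  using clauses_live unfolding clauses_def by simp

lemma wf_live: "wf_clauses F ==> wf_clauses (live F)"
  unfolding wf_clauses_def live_def by auto

lemma live_subset: "set (live F) \<subseteq> set F" unfolding live_def by auto

lemma clauses_above:
  assumes "wf_clauses F"
  shows "clauses (above (live F) c H) = supers (clauses F) c (set H)"
proof -
  have "length C = card (set C)" if "C \<in> set (live F)" for C
    using that wf_live[OF assms] sorted_card by (auto simp: wf_clauses_def)
  then show ?thesis unfolding supers_def mins_clauses unfolding above_def clauses_def by auto
qed

lemma length_above:
  assumes "wf_clauses F"
  shows "length (above (live F) c H) = card (supers (clauses F) c (set H))"
proof -
  have "wf_clauses (above (live F) c H)"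
    using wf_live[OF assms] by (auto simp: wf_clauses_def above_def)
  then have "length (above (live F) c H) = card (clauses (above (live F) c H))"
    unfolding clauses_def using card_image[OF wf_inj] distinct_card by (simp add: wf_clauses_def distinct_card)
  then show ?thesis unfolding clauses_above[OF assms] .
qed

text \<open>Increasing in the clause size and, for equal clause size, decreasing in the heart size:
  the priority required by \<open>first_sunflower\<close>.\<close>

definition params :: "(nat => nat) => nat => (nat \<times> nat \<times> nat) list" where
  "params \<theta> k = concat (map (%c. map (%h. (c, h, \<theta> (c - h))) (rev [1..<c])) [2..<Suc k])"

lemma set_params: "set (params \<theta> k) = {(c, h, \<theta> (c - h)) | c h. 1 <= h & h < c & c <= k}"
proof -
  have "set (params \<theta> k) = (\<Union>c\<in>{2..<Suc k}. (%h. (c, h, \<theta> (c - h))) ` {1..<c})"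
    unfolding params_def by (simp del: upt_Suc)
  also have "... = {(c, h, \<theta> (c - h)) | c h. 1 <= h & h < c & c <= k}" by fastforce
  finally show ?thesis .
qed

lemma sorted_params:
  "sorted_wrt (%p q. fst p < fst q | fst p = fst q & fst (snd q) < fst (snd p)) (params \<theta> k)"
proof (induction k)
  case (Suc k)
  show ?case
  proof (cases "2 <= Suc k")
    case True
    have "sorted_wrt (%a b. b < a) (rev [1..<c])" for c :: nat
      by (simp add: sorted_wrt_rev)
    then have "sorted_wrt (%p q. fst p < fst q | fst p = fst q & fst (snd q) < fst (snd p))
      (map (%h. (c, h, \<theta> (c - h))) (rev [1..<c]))" for c
      by (simp add: sorted_wrt_map)
    moreover have "params \<theta> (Suc k) = params \<theta> k @ map (%h. (Suc k, h, \<theta> (Suc k - h))) (rev [1..<Suc k])"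
      using True by (simp add: params_def)
    ultimately show ?thesis using Suc
      by (simp only: sorted_wrt_append) (auto simp: set_params)
  qed (simp add: params_def)
qed (simp add: params_def)

lemma concat_map_ConsE:
  assumes "concat (map f ps) = y # ys"
  obtains pre p suf where "ps = pre @ p # suf" "y \<in> set (f p)" "!!q. q \<in> set pre ==> f q = []"
  using assms
proof (induction ps arbitrary: thesis)
  case (Cons p ps)
  show ?case
  proof (cases "f p")
    case Nil
    then have "concat (map f ps) = y # ys" using Cons.prems(2) by simp
    then obtain pre q suf where "ps = pre @ q # suf" "y \<in> set (f q)" "!!q. q \<in> set pre ==> f q = []"
      using Cons.IH by blast
    then show ?thesis using Cons.prems(1)[of "p # pre" q suf] Nil by auto
  next
    case (Cons z zs)
    then show ?thesis using Cons.prems(1)[of "[]" p ps] Cons.prems(2) by auto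
  qed
qed simp

context sparsification begin

lemma hearts_sound:
  assumes F: "wf_clauses F" "!!C. C \<in> set F ==> length C <= k" and K: "2 ^ k <= K"
    and p: "(c, h, t) \<in> set (params \<theta> k)" and H: "H \<in> set (hearts K (live F) (c, h, t))"
  shows "sunflower \<theta> (clauses F) c (set H)" "card (set H) = h" "sorted_wrt (<) H" "c <= k"
    "set H \<subseteq> \<Union> (clauses F)"
proof -
  obtain C where C: "C \<in> set (live F)" "H \<in> set (subs K C)" "length C = c" "length H = h"
    "t <= length (above (live F) c H)" using H unfolding hearts_def by auto
  have CF: "C \<in> set F" using C(1) live_subset by blast
  then have sC: "sorted_wrt (<) C" "length C <= k" using F by (auto simp: wf_clauses_def)
  have "(2::nat) ^ length C <= K" using sC(2) K by (meson le_trans one_le_numeral power_increasing)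
  from subs_spec[OF this sC(1)] C(2) have sH: "sorted_wrt (<) H" "set H \<subseteq> set C" by auto
  show "sorted_wrt (<) H" by fact
  show ch: "card (set H) = h" using sorted_card[OF sH(1)] C(4) by simp
  have p': "1 <= h" "h < c" "c <= k" "t = \<theta> (c - h)" using p by (auto simp: set_params)
  show "c <= k" by fact
  show "set H \<subseteq> \<Union> (clauses F)" using sH(2) CF by (auto simp: clauses_def)
  show "sunflower \<theta> (clauses F) c (set H)"
    unfolding sunflower_def using ch p' C(5) length_above[OF F(1)] by auto
qed

lemma hearts_complete:
  assumes F: "wf_clauses F" "!!C. C \<in> set F ==> length C <= k" and K: "2 ^ k <= K"
    and S: "sunflower \<theta> (clauses F) c G"
  shows "(c, card G, \<theta> (c - card G)) \<in> set (params \<theta> k)"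
    and "hearts K (live F) (c, card G, \<theta> (c - card G)) ~= []"
proof -
  have S: "G ~= {}" "finite G" "card G < c" "\<theta> (c - card G) <= card (supers (clauses F) c G)"
    using S by (auto simp: sunflower_def)
  have "supers (clauses F) c G ~= {}" using S(4) theta_pos[of "c - card G"] by auto
  then obtain C where C: "C \<in> set (live F)" "card (set C) = c" "G \<subseteq> set C"
    unfolding supers_def mins_clauses by auto
  have CF: "C \<in> set F" using C(1) live_subset by blast
  then have sC: "sorted_wrt (<) C" "length C <= k" using F by (auto simp: wf_clauses_def)
  have lC: "length C = c" using sorted_card[OF sC(1)] C(2) by simp
  have "(2::nat) ^ length C <= K" using sC(2) K by (meson le_trans one_le_numeral power_increasing)
  from subs_spec[OF this sC(1)] C(3) obtain H where
    H: "H \<in> set (subs K C)" "set H = G" "sorted_wrt (<) H" by blast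
  have "length H = card G" using sorted_card[OF H(3)] H(2) by simp
  then have "H \<in> set (hearts K (live F) (c, card G, \<theta> (c - card G)))"
    unfolding hearts_def using H C(1) lC S(4) length_above[OF F(1), of c H] by auto
  then show "hearts K (live F) (c, card G, \<theta> (c - card G)) ~= []" by auto
  show "(c, card G, \<theta> (c - card G)) \<in> set (params \<theta> k)"
    using S lC sC(2) by (auto simp: set_params Suc_le_eq card_gt_0_iff)
qed

lemma flowers_Nil:
  assumes F: "wf_clauses F" "!!C. C \<in> set F ==> length C <= k" and K: "2 ^ k <= K"
    and N: "flowers K (params \<theta> k) F = []"
  shows "~ sunflower \<theta> (clauses F) c G"
proof
  assume "sunflower \<theta> (clauses F) c G"
  from hearts_complete[OF F K this] N show False unfolding flowers_def by auto
qed

lemma flowers_Cons: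
  assumes F: "wf_clauses F" "!!C. C \<in> set F ==> length C <= k" and K: "2 ^ k <= K"
    and N: "flowers K (params \<theta> k) F = (c, H) # fs"
  shows "first_sunflower \<theta> k (clauses F) c (set H)" "sorted_wrt (<) H" "set H \<subseteq> \<Union> (clauses F)"
proof -
  obtain pre p suf where p: "params \<theta> k = pre @ p # suf"
    "(c, H) \<in> set (map (%H. (fst p, H)) (hearts K (live F) p))"
    "!!q. q \<in> set pre ==> map (%H. (fst q, H)) (hearts K (live F) q) = []"
    using N unfolding flowers_def by (rule concat_map_ConsE) blast
  obtain h t where pt: "p = (c, h, t)" "H \<in> set (hearts K (live F) (c, h, t))"
    using p(2) by (cases p) auto
  have "(c, h, t) \<in> set (params \<theta> k)" using p(1) pt(1) by simp
  note H = hearts_sound[OF F K this pt(2)]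
  show "sorted_wrt (<) H" "set H \<subseteq> \<Union> (clauses F)" using H(3,5) by auto
  have "c <= c' & (c' = c --> card G <= card (set H))" if "sunflower \<theta> (clauses F) c' G" for c' G
  proof -
    note hc = hearts_complete[OF F K that]
    let ?q = "(c', card G, \<theta> (c' - card G))"
    \<comment> \<open>The parameters before \<open>p\<close> produced no heart, whereas by
      completeness those of any sunflower do; so every sunflower comes at \<open>p\<close> or later
      in the order.\<close>
    have "?q \<notin> set pre" using hc(2) p(3)[of ?q] by auto
    then have "?q = p | ?q \<in> set suf" using hc(1) p(1) by auto
    then show ?thesis
      using sorted_params[of \<theta> k] pt(1) H(2) unfolding p(1) sorted_wrt_append by auto
  qed
  then show "first_sunflower \<theta> k (clauses F) c (set H)"
    unfolding first_sunflower_def using H by blast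
qed

end

section \<open>The branching tree\<close>

text \<open>Literal \<open>2 v + b\<close> is the variable \<open>v\<close> with sign \<open>b\<close>.\<close>

definition lit_true :: "(nat => bool) => nat => bool" where
  "lit_true \<sigma> l \<longleftrightarrow> \<sigma> (l div 2) = odd l"

definition item_sat :: "item => bool" where
  "item_sat i \<longleftrightarrow> (EX \<sigma>. (ALL C:set (fst i). EX l:set C. lit_true \<sigma> l) &
     (ALL l:set (snd (snd i)). lit_true \<sigma> l))"

definition var_pair :: "nat => nat \<times> nat" where
  "var_pair v = (2 * v, 2 * v + 1)"

text \<open>The binary digits of \<open>x\<close> choose one literal from each pair. In this way the
  numbers below \<open>2 ^ length vs\<close>, used as indices of men and women, stand for partial
  assignments.\<close>

primrec lits :: "(nat \<times> nat) list => nat => nat list" where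
  "lits [] x = []"
| "lits (v # vs) x = (if x mod 2 = 0 then fst v else snd v) # lits vs (x div 2)"

lemma PT_lits:
  assumes "PT f" "PT g" shows "PT (%e. lits (f e) (g e))"
proof -
  let ?st = "%s v. (fst s div 2, (if fst s mod 2 = (0::nat) then fst v else snd v :: nat) # snd s)"
  have fl: "snd (foldl ?st (x, acc) vs) = rev (lits vs x) @ acc" for x acc vs
    by (induction vs arbitrary: x acc) auto
  have eq: "lits vs x = rev (snd (foldl ?st (x, []) vs))" for vs x by (simp add: fl)
  have sz: "sz (foldl ?st s vs) <= sz s + sz vs" for s vs
  proof (induction vs arbitrary: s)
    case (Cons v vs)
    have "sz (foldl ?st (?st s v) vs) <= sz (?st s v) + sz vs" by (rule Cons.IH)
    also have "sz (?st s v) <= sz s + 2" by (cases s) auto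
    finally show ?case using sz_pos[of v] by simp
  qed simp
  have "PT (%z. lits (fst z) (snd z))" unfolding eq
  proof (intro PT_rev PT_snd, rule PT_foldl)
    show "PT (%z :: ((nat \<times> nat) list \<times> nat) \<times> (nat \<times> nat list) \<times> (nat \<times> nat). ?st (fst (snd z)) (snd (snd z)))"
      by (intro PT_rules)
    show "polyb (%e :: (nat \<times> nat) list \<times> nat. 3 + sz (fst e))"
      by (intro polyb_add polyb_const PT_szD PT_rules)
    fix e :: "(nat \<times> nat) list \<times> nat" and ys zs assume e: "fst e = ys @ zs"
    have "sz (foldl ?st (snd e, []) ys) <= sz (snd e, [] :: nat list) + sz ys" by (rule sz)
    also have "... <= 3 + sz (fst e)" using e sz_list_append[of ys zs] sz_pos[of zs] by simp
    finally show "sz (foldl ?st (snd e, []) ys) <= 3 + sz (fst e)" .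
  qed (intro PT_rules)+
  from PT_comp[OF this PT_pair[OF assms]] show ?thesis by simp
qed

lemma map_lits: "map (%l. l div 2) (lits (map var_pair vs) x) = vs"
  by (induction vs arbitrary: x) (auto simp: var_pair_def)

lemma lits_surj: "EX x<2 ^ length vs. ALL l:set (lits (map var_pair vs) x). lit_true \<sigma> l"
proof (induction vs)
  case (Cons v vs)
  then obtain x where x: "x < 2 ^ length vs" "ALL l:set (lits (map var_pair vs) x). lit_true \<sigma> l" by blast
  define b where "b = (if \<sigma> v then 1 else 0 :: nat)"
  have "(2 * x + b) mod 2 = b" "(2 * x + b) div 2 = x" by (auto simp: b_def)
  then have "lits (map var_pair (v # vs)) (2 * x + b) = (2 * v + b) # lits (map var_pair vs) x"
    by (auto simp: var_pair_def b_def)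
  moreover have "lit_true \<sigma> (2 * v + b)" by (auto simp: lit_true_def b_def)
  moreover have "2 * x + b < 2 ^ length (v # vs)" using x(1) by (auto simp: b_def)
  ultimately show ?case using x(2) by (intro exI[of _ "2 * x + b"]) simp
qed simp

text \<open>Two true literals of the same variable have the same sign, hence are equal.\<close>

lemma true_iff_mem:
  assumes "ALL l:set ts. lit_true \<sigma> l" "l div 2 \<in> (%l. l div 2) ` set ts"
  shows "lit_true \<sigma> l \<longleftrightarrow> l \<in> set ts"
proof
  assume l: "lit_true \<sigma> l"
  obtain l' where l': "l' \<in> set ts" "l' div 2 = l div 2" using assms(2) by auto
  then have "odd l' = odd l" using l assms(1) unfolding lit_true_def by metis
  then have "l' mod 2 = l mod 2" by presburger
  then have "l' = l" using l'(2) by (metis div_mult_mod_eq)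
  then show "l \<in> set ts" using l'(1) by simp
qed (use assms in auto)

lemma choice_assignment:
  assumes "distinct (map (%l. l div 2) ts)"
  obtains \<sigma> where "ALL l:set ts. lit_true \<sigma> l"
proof
  show "ALL l:set ts. lit_true (%v. 2 * v + 1 \<in> set ts) l"
  proof
    fix l :: nat assume l: "l \<in> set ts"
    show "lit_true (%v. 2 * v + 1 \<in> set ts) l"
    proof (cases "odd l")
      case True
      then have "2 * (l div 2) + 1 = l" by presburger
      then show ?thesis using l True by (simp add: lit_true_def)
    next
      case False
      have "2 * (l div 2) + 1 \<notin> set ts"
      proof
        assume "2 * (l div 2) + 1 \<in> set ts"
        then have "2 * (l div 2) + 1 = l"
          using assms l by (auto simp: distinct_map inj_on_def)
        then show False using False by presburger
      qed
      then show ?thesis using False by (simp add: lit_true_def)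
    qed
  qed
qed

text \<open>Every clause contains a minimal one, by finiteness, and is satisfied with it.\<close>

lemma live_sat: "(ALL C:set (live F). EX l:set C. P l) \<longleftrightarrow> (ALL C:set F. EX l:set C. P l)"
proof
  assume L: "ALL C:set (live F). EX l:set C. P l"
  show "ALL C:set F. EX l:set C. P l"
  proof
    fix C assume "C \<in> set F"
    then have "set C \<in> clauses F" "finite (clauses F)" by (auto simp: clauses_def)
    then obtain M where M: "M \<in> clauses F" "M \<subseteq> set C" "ALL B:clauses F. B \<subseteq> M --> M = B"
      using finite_has_minimal2[of "clauses F" "set C"] by blast
    then have "M \<in> mins (clauses F)" by (auto simp: mins_def)
    then obtain D where "D \<in> set (live F)" "set D = M" by (auto simp: mins_clauses)
    then show "EX l:set C. P l" using L M(2) by blast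
  qed
qed (use live_subset in blast)

text \<open>Inner nodes are counted as well, since each of them costs a pass of the main loop. As
  the relation is inductive, having a size includes that the branching terminates.\<close>

inductive tree :: "('s => 's list) => 's => nat => bool" for ex where
  leaf: "ex s = [] ==> tree ex s 1"
| node: "ex s = [a, b] ==> tree ex a m ==> tree ex b m' ==> tree ex s (m + m' + 1)"

section \<open>The items of a formula and the size of their tree\<close>

locale items = sparsification A k n "{..<2 * n}" F0 for A k n :: nat and F0 :: "nat set set" +
  fixes K q :: nat
  assumes K: "2 ^ k <= K" and F0: "F0 \<subseteq> Pow {..<2 * n}" and q: "2 * q <= n"
begin

abbreviation "ex \<equiv> expand K (params \<theta> k)"

text \<open>\<open>m\<close> is the next variable of the third block, which runs from
  \<open>2 * q\<close> to \<open>n - 1\<close>; the chosen literals are listed latest first.\<close>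

definition item_inv :: "item => bool" where
  "item_inv i \<longleftrightarrow> wf_clauses (fst i) & (ALL C:set (fst i). length C <= k) & inv (clauses (fst i)) &
     (EX m. 2 * q <= m & m <= n & fst (snd i) = map var_pair [m..<n] &
       map (%l. l div 2) (snd (snd i)) = rev [2 * q..<m])"

lemma item_invI:
  assumes "wf_clauses F" "!!C. C \<in> set F ==> length C <= k" "inv (clauses F)" "2 * q <= m" "m <= n"
    "V = map var_pair [m..<n]" "map (%l. l div 2) zs = rev [2 * q..<m]"
  shows "item_inv (F, V, zs)"
  unfolding item_inv_def fst_conv snd_conv by (intro conjI exI[of _ m] ballI assms)

lemma expand_cases:
  assumes i: "item_inv (F, V, zs)"
  obtains (leaf) "ex (F, V, zs) = []" "V = []" "!!c H. ~ sunflower \<theta> (clauses F) c H"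
  | (flower) c H P where "ex (F, V, zs) = [(H # F, V, zs), (P @ F, V, zs)]"
      "first_sunflower \<theta> k (clauses F) c (set H)" "clauses P = petals (clauses F) c (set H)"
      "item_inv (H # F, V, zs)" "item_inv (P @ F, V, zs)"
  | (var) v W where "V = var_pair v # W" "ex (F, V, zs) = [(F, W, 2 * v # zs), (F, W, (2 * v + 1) # zs)]"
      "item_inv (F, W, 2 * v # zs)" "item_inv (F, W, (2 * v + 1) # zs)"
proof -
  have F: "wf_clauses F" "!!C. C \<in> set F ==> length C <= k" "inv (clauses F)"
    using i by (auto simp: item_inv_def)
  obtain m where m: "2 * q <= m" "m <= n" "V = map var_pair [m..<n]"
    "map (%l. l div 2) zs = rev [2 * q..<m]" using i by (auto simp: item_inv_def)
  show thesis
  proof (cases "flowers K (params \<theta> k) F")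
    case Nil
    show thesis
    proof (cases V)
      case [simp]: Nil
      show thesis by (rule leaf) (use \<open>flowers K _ F = []\<close> flowers_Nil[OF F(1,2) K] in \<open>auto simp: expand_def\<close>)
    next
      case (Cons p W)
      have mn: "m < n" using Cons m(3) by (cases "m < n") auto
      then have *: "p = var_pair m" "W = map var_pair [Suc m..<n]"
        using m(3) Cons by (auto simp: upt_conv_Cons)
      show thesis
      proof (rule var[of m W])
        show "V = var_pair m # W" using Cons *(1) by simp
        show "ex (F, V, zs) = [(F, W, 2 * m # zs), (F, W, (2 * m + 1) # zs)]"
          by (simp add: expand_def \<open>flowers K (params \<theta> k) F = []\<close> Cons *(1) var_pair_def)
        have "rev [2 * q..<Suc m] = m # rev [2 * q..<m]" using m(1) by simp
        then show "item_inv (F, W, 2 * m # zs)" "item_inv (F, W, (2 * m + 1) # zs)"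
          using m mn * by (auto intro!: item_invI[OF F, where m = "Suc m"] simp del: upt_Suc)
      qed
    qed
  next
    case (Cons f fs)
    obtain c H where f: "f = (c, H)" by (cases f)
    note fl = flowers_Cons[OF F(1,2) K Cons[unfolded f]]
    define P where "P = map (%D. filter (%l. l \<notin> set H) D) (above (live F) c H)"
    have cP: "clauses P = petals (clauses F) c (set H)"
    proof -
      have "supers (clauses F) c (set H) = set ` set (above (live F) c H)"
        using clauses_above[OF F(1), of c H] unfolding clauses_def by simp
      then show ?thesis unfolding petals_def P_def by (simp add: clauses_def image_image set_diff_eq)
    qed
    note st = step[OF F(3) fl(1) F0]
    have LF: "!!C. C \<in> set F ==> finite (set C)" by simp
    have lenH: "length H <= k" using st(7,8) sorted_card[OF fl(2)] by simp
    have HF: "H \<notin> set F" using st(9) by (auto simp: clauses_def)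
    have i1: "item_inv (H # F, V, zs)"
    proof -
      have "clauses (H # F) = insert (set H) (clauses F)" by (simp add: clauses_def)
      then show ?thesis using F st(1) fl(2) lenH HF
        by (intro item_invI[OF _ _ _ m]) (auto simp: wf_clauses_def)
    qed
    have sP: "sorted_wrt (<) C & length C <= k" if CP: "C \<in> set P" for C
    proof -
      obtain D where "D \<in> set (live F)" and DC: "C = filter (%l. l \<notin> set H) D"
        using CP unfolding P_def above_def by auto
      then have D: "D \<in> set F" "C = filter (%l. l \<notin> set H) D" using live_subset by blast+
      have "length C <= k" unfolding D(2) by (rule le_trans[OF length_filter_le F(2)[OF D(1)]])
      then show ?thesis using D F(1) by (auto simp: wf_clauses_def intro: sorted_wrt_filter)
    qed
    have dP: "distinct P"
    proof -
      have ws: "wf_clauses (above (live F) c H)"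
        using wf_live[OF F(1)] by (auto simp: wf_clauses_def above_def)
      have "inj_on (%D. filter (%l. l \<notin> set H) D) (set (above (live F) c H))"
      proof (rule inj_onI)
        fix D E assume D: "D \<in> set (above (live F) c H)" and E: "E \<in> set (above (live F) c H)"
          and eq: "filter (%l. l \<notin> set H) D = filter (%l. l \<notin> set H) E"
        have "set D - set H = set E - set H" using arg_cong[OF eq, of set] by auto
        moreover have "set H \<subseteq> set D" "set H \<subseteq> set E" using D E by (auto simp: above_def)
        ultimately have "set D = set E" by blast
        then show "D = E" using wf_inj[OF ws] D E by (auto simp: inj_on_def)
      qed
      then show ?thesis using ws by (simp add: P_def distinct_map wf_clauses_def)
    qed
    have "set P \<inter> set F = {}" using st(10) cP by (auto simp: clauses_def)
    then have i2: "item_inv (P @ F, V, zs)"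
    proof -
      have "clauses (P @ F) = clauses F \<union> petals (clauses F) c (set H)"
        unfolding cP[symmetric] by (auto simp: clauses_def)
      then show ?thesis using F st(2) sP dP \<open>set P \<inter> set F = {}\<close>
        by (intro item_invI[OF _ _ _ m]) (auto simp: wf_clauses_def)
    qed
    show thesis
      by (rule flower[OF _ fl(1) cP i1 i2]) (simp add: expand_def Cons f P_def)
  qed
qed

lemma expand_sat:
  assumes i: "item_inv i" "ex i = [i1, i2]"
  shows "item_inv i1" "item_inv i2" "item_sat i \<longleftrightarrow> item_sat i1 | item_sat i2"
proof -
  obtain F V zs where [simp]: "i = (F, V, zs)" by (cases i)
  have "item_inv i1 & item_inv i2 & (item_sat i \<longleftrightarrow> item_sat i1 | item_sat i2)"
    using i(1)[simplified]
  proof (cases rule: expand_cases)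
    case leaf then show ?thesis using i by simp
  next
    case (flower c H P)
    then have ab: "i1 = (H # F, V, zs)" "i2 = (P @ F, V, zs)" using i by auto
    have P: "set ` set P = (%C. C - set H) ` (supers (clauses F) c (set H))"
      using flower(3) by (simp add: petals_def clauses_def)
    define sat where "sat \<sigma> C \<longleftrightarrow> (EX l:set C. lit_true \<sigma> l)" for \<sigma> C
    \<comment> \<open>An assignment that falsifies the heart and some petal falsifies the clause of
      \<open>F\<close> that these two make up.\<close>
    have key: "sat \<sigma> H | (ALL C:set P. sat \<sigma> C)"
      if F: "ALL C:set F. sat \<sigma> C" for \<sigma>
    proof (rule ccontr)
      assume "~ ?thesis"
      then obtain C where C: "C \<in> set P" "ALL l:set C. ~ lit_true \<sigma> l" "ALL l:set H. ~ lit_true \<sigma> l"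
        unfolding sat_def by blast
      then have "set C \<in> (%C. C - set H) ` (supers (clauses F) c (set H))" unfolding P[symmetric] by simp
      then obtain D where D: "D \<in> supers (clauses F) c (set H)" "set C = D - set H" by blast
      then have "D \<in> clauses F" using mins_sub by (auto simp: supers_def)
      then have "EX l:D. lit_true \<sigma> l" using F by (auto simp: clauses_def sat_def)
      then show False using C D(2) by blast
    qed
    have "item_sat i1 \<longleftrightarrow> (EX \<sigma>. sat \<sigma> H & (ALL C:set F. sat \<sigma> C) & (ALL l:set zs. lit_true \<sigma> l))"
      "item_sat i2 \<longleftrightarrow> (EX \<sigma>. (ALL C:set P. sat \<sigma> C) & (ALL C:set F. sat \<sigma> C) & (ALL l:set zs. lit_true \<sigma> l))"
      "item_sat i \<longleftrightarrow> (EX \<sigma>. (ALL C:set F. sat \<sigma> C) & (ALL l:set zs. lit_true \<sigma> l))"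
      unfolding ab item_sat_def sat_def by (simp_all add: ball_Un conj_assoc)
    then have "item_sat i \<longleftrightarrow> item_sat i1 | item_sat i2" using key by blast
    then show ?thesis using flower(4,5) unfolding ab by blast
  next
    case (var v W)
    then have ab: "i1 = (F, W, 2 * v # zs)" "i2 = (F, W, (2 * v + 1) # zs)" using i by auto
    have "lit_true \<sigma> (2 * v) | lit_true \<sigma> (2 * v + 1)" for \<sigma> by (auto simp: lit_true_def)
    then have "item_sat i \<longleftrightarrow> item_sat i1 | item_sat i2"
      unfolding ab item_sat_def by simp blast
    then show ?thesis using var(3,4) unfolding ab by blast
  qed
  then show "item_inv i1" "item_inv i2" "item_sat i \<longleftrightarrow> item_sat i1 | item_sat i2" by blast+
qed

lemma expand_length: "item_inv i ==> ex i = [] | (EX i1 i2. ex i = [i1, i2])"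
  by (cases i) (auto elim: expand_cases)

text \<open>The potential still available is an exponent of the bound. A sunflower step multiplies
  the bound by \<open>2 powr - wH\<close> in one child and by \<open>2 powr - wP\<close> in the
  other, which sum to at most 1; a variable step halves it in both children. The summand
  \<open>- 1\<close> pays for the inner node itself.\<close>

lemma tree_bound:
  assumes w: "0 < wH" "0 < wP" "2 powr - wH + 2 powr - wP <= 1"
  shows "item_inv i ==> EX m. tree ex i m &
    real m <= 2 powr (psi_max wH wP - psi wH wP (clauses (fst i))) * 2 ^ (length (fst (snd i)) + 1) - 1"
proof -
  define w where "w = min wH wP"
  have w0: "0 < w" using w by (simp add: w_def)
  let ?M = "psi_max wH wP"
  \<comment> \<open>Termination: every step either raises the potential by at least \<open>w\<close>
    or uses up a variable, so the real number compared with \<open>N\<close> drops by at least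
    1.\<close>
  have "EX m. tree ex i m &
      real m <= 2 powr (?M - psi wH wP (clauses (fst i))) * 2 ^ (length (fst (snd i)) + 1) - 1"
    if "item_inv i" "(?M - psi wH wP (clauses (fst i))) / w + real (length (fst (snd i))) < real N" for N i
    using that
  proof (induction N arbitrary: i)
    case 0
    have "psi wH wP (clauses (fst i)) <= ?M"
      using 0 w by (intro psi_le) (auto simp: item_inv_def)
    then have "0 <= (?M - psi wH wP (clauses (fst i))) / w" using w0 by simp
    then show ?case using 0 by linarith
  next
    case (Suc N)
    obtain F V zs where [simp]: "i = (F, V, zs)" by (cases i)
    let ?p = "psi wH wP (clauses F)"
    have pM: "?p <= ?M" using Suc w by (intro psi_le) (auto simp: item_inv_def)
    have lt: "(?M - ?p) / w + real (length V) < real N + 1" using Suc.prems(2) by simp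
    show ?case using Suc.prems(1)[simplified]
    proof (cases rule: expand_cases)
      case leaf
      have "1 <= 2 powr (?M - ?p)" using pM by (intro ge_one_powr_ge_zero) auto
      moreover have "tree ex i 1" by (rule tree.leaf) (use leaf in simp)
      ultimately show ?thesis using leaf by (intro exI[of _ 1]) simp
    next
      case (flower c H P)
      let ?a = "(H # F, V, zs)" and ?b = "(P @ F, V, zs)"
      have ca: "clauses (H # F) = insert (set H) (clauses F)"
        and cb: "clauses (P @ F) = clauses F \<union> petals (clauses F) c (set H)"
        unfolding flower(3)[symmetric] by (auto simp: clauses_def)
      have invF: "inv (clauses F)" using Suc.prems(1) by (simp add: item_inv_def)
      have pa: "?p + wH <= psi wH wP (clauses (H # F))" and pb: "?p + wP <= psi wH wP (clauses (P @ F))"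
        unfolding ca cb using psi_heart[OF invF flower(2) F0, of wH wP] w by auto
      have le: "(?M - p') / w + real (length V) < real N" if "?p + w <= p'" for p'
      proof -
        have "(?M - p') / w <= (?M - ?p - w) / w" using that w0 by (intro divide_right_mono) auto
        also have "... = (?M - ?p) / w - 1" using w0 by (simp add: field_simps)
        finally show ?thesis using lt by linarith
      qed
      obtain m1 where m1: "tree ex ?a m1"
        "real m1 <= 2 powr (?M - psi wH wP (clauses (H # F))) * 2 ^ (length V + 1) - 1"
        using Suc.IH[OF flower(4)] le pa unfolding w_def by fastforce
      obtain m2 where m2: "tree ex ?b m2"
        "real m2 <= 2 powr (?M - psi wH wP (clauses (P @ F))) * 2 ^ (length V + 1) - 1"
        using Suc.IH[OF flower(5)] le pb unfolding w_def by fastforce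
      have t: "tree ex i (m1 + m2 + 1)" using tree.node[of ex i ?a ?b m1 m2] flower(1) m1 m2 by simp
      let ?E = "2 ^ (length V + 1) :: real"
      have "2 powr (?M - psi wH wP (clauses (H # F))) <= 2 powr (?M - ?p) * 2 powr - wH"
        unfolding powr_add[symmetric] using pa by (intro powr_mono) auto
      then have a1: "2 powr (?M - psi wH wP (clauses (H # F))) * ?E <= 2 powr (?M - ?p) * 2 powr - wH * ?E"
        by (intro mult_right_mono) auto
      have "2 powr (?M - psi wH wP (clauses (P @ F))) <= 2 powr (?M - ?p) * 2 powr - wP"
        unfolding powr_add[symmetric] using pb by (intro powr_mono) auto
      then have a2: "2 powr (?M - psi wH wP (clauses (P @ F))) * ?E <= 2 powr (?M - ?p) * 2 powr - wP * ?E"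
        by (intro mult_right_mono) auto
      have "2 powr (?M - ?p) * 2 powr - wH * ?E + 2 powr (?M - ?p) * 2 powr - wP * ?E
        = (2 powr (?M - ?p) * ?E) * (2 powr - wH + 2 powr - wP)" by (simp add: algebra_simps)
      also have "... <= (2 powr (?M - ?p) * ?E) * 1" by (rule mult_left_mono[OF w(3)]) simp
      finally have "real m1 + real m2 + 1 <= 2 powr (?M - ?p) * ?E - 1" using m1(2) m2(2) a1 a2 by linarith
      then have "real (m1 + m2 + 1) <= 2 powr (?M - ?p) * ?E - 1" by simp
      then show ?thesis using t by auto
    next
      case (var v W)
      let ?a = "(F, W, 2 * v # zs)" and ?b = "(F, W, (2 * v + 1) # zs)"
      have le: "(?M - ?p) / w + real (length W) < real N" using lt var(1) by simp
      obtain m1 where m1: "tree ex ?a m1" "real m1 <= 2 powr (?M - ?p) * 2 ^ (length W + 1) - 1"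
        using Suc.IH[OF var(3)] le by auto
      obtain m2 where m2: "tree ex ?b m2" "real m2 <= 2 powr (?M - ?p) * 2 ^ (length W + 1) - 1"
        using Suc.IH[OF var(4)] le by auto
      have t: "tree ex i (m1 + m2 + 1)" using tree.node[of ex i ?a ?b m1 m2] var(2) m1 m2 by simp
      show ?thesis using t m1(2) m2(2) var(1) by (intro exI[of _ "m1 + m2 + 1"]) simp
    qed
  qed
  then show "item_inv i ==> ?thesis" using reals_Archimedean2 by blast
qed

definition item_size :: nat where
  "item_size = 1 + ((k + 1) * (2 * n + 1) ^ k) * (2 * k + 2) + (1 + 4 * n) + (1 + 2 * n) + 2"

text \<open>The clauses of an item are distinct lists of at most \<open>k\<close> literals, so for
  fixed \<open>k\<close> there are only polynomially many, however deep the item lies in the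
  tree.\<close>

lemma sz_item: "item_inv i ==> sz i <= item_size"
proof -
  assume i: "item_inv i"
  obtain F V zs where [simp]: "i = (F, V, zs)" by (cases i)
  have szl: "sz C = 2 * length C + 1" for C :: "nat list" by (induction C) auto
  have szV: "sz (map var_pair xs) = 1 + 4 * length xs" for xs by (induction xs) (auto simp: var_pair_def)
  have szF: "sz G <= 1 + length G * (2 * k + 2)" if "ALL C:set G. length C <= k" for G :: "nat list list"
    using that by (induction G) (auto simp: szl)
  have F: "wf_clauses F" "ALL C:set F. length C <= k" "clauses F \<subseteq> Pow {..<2 * n}"
    using i by (auto simp: item_inv_def inv_def)
  have "set F \<subseteq> {xs. set xs \<subseteq> {..<2 * n} & length xs <= k}" using F by (auto simp: clauses_def)
  then have "card (set F) <= card {xs. set xs \<subseteq> {..<2 * n} & length xs <= k}"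
    by (rule card_mono[rotated]) (simp add: finite_lists_length_le)
  also have "... = (\<Sum>j\<le>k. (2 * n) ^ j)" by (simp add: card_lists_length_le)
  also have "... <= (\<Sum>j\<le>k. (2 * n + 1) ^ k)"
  proof (rule sum_mono)
    fix j assume "j \<in> {..k}"
    then have "(2 * n) ^ j <= (2 * n + 1) ^ j" "(2 * n + 1) ^ j <= (2 * n + 1) ^ k"
      using power_mono[of "2 * n" "2 * n + 1" j] power_increasing[of j k "2 * n + 1"] by auto
    then show "(2 * n) ^ j <= (2 * n + 1) ^ k" by (rule le_trans)
  qed
  also have "... = (k + 1) * (2 * n + 1) ^ k" by simp
  finally have "length F <= (k + 1) * (2 * n + 1) ^ k"
    using F(1) by (simp add: wf_clauses_def distinct_card)
  then have "sz F <= 1 + ((k + 1) * (2 * n + 1) ^ k) * (2 * k + 2)"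
    using szF[OF F(2)] by (meson add_le_cancel_left le_trans mult_le_mono1)
  moreover obtain m where m: "m <= n" "V = map var_pair [m..<n]" "map (%l. l div 2) zs = rev [2 * q..<m]"
    using i by (auto simp: item_inv_def)
  have "sz V <= 1 + 4 * n" using m(1,2) by (simp add: szV)
  moreover have "length zs = m - 2 * q" using arg_cong[OF m(3), of length] by simp
  then have "sz zs <= 1 + 2 * n" using m(1) by (simp add: szl)
  ultimately show ?thesis by (simp add: item_size_def)
qed

lemma job_live:
  assumes "item_inv i" "ex i = []"
  shows "length (live (fst i)) <= 1 + 2 * n + k * (2 * n * \<theta> k)"
proof -
  obtain F V zs where [simp]: "i = (F, V, zs)" by (cases i)
  have F: "wf_clauses F" "ALL C:set F. length C <= k" "clauses F \<subseteq> Pow {..<2 * n}"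
    using assms by (auto simp: item_inv_def inv_def)
  have no: "~ sunflower \<theta> (clauses F) c H" for c H
    using assms(1)[simplified] by (cases rule: expand_cases) (use assms in auto)
  have "card (mins (clauses F)) <= 1 + 2 * n + k * (2 * n * \<theta> k)"
    by (rule leaf_bound[OF F(3)]) (use F no sorted_card in \<open>auto simp: clauses_def wf_clauses_def\<close>)
  moreover have "card (mins (clauses F)) = length (live F)"
    unfolding mins_clauses using card_image[OF wf_inj[OF wf_live[OF F(1)]]] wf_live[OF F(1)]
    by (simp add: wf_clauses_def distinct_card)
  ultimately show ?thesis by simp
qed

text \<open>The chosen literals together with those selected by \<open>x\<close> and
  \<open>y\<close> contain exactly one literal of each of the \<open>n\<close> variables. So they
  determine the assignment, and a literal is true under it exactly if it occurs among them.\<close>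

lemma job_sat:
  assumes i: "item_inv i" "ex i = []"
  shows "item_sat i \<longleftrightarrow> (EX x<2 ^ q. EX y<2 ^ q. ALL C:set (live (fst i)).
    (EX l:set C. l \<in> set (snd (snd i)) | l \<in> set (lits (map var_pair [0..<q]) x)) |
    (EX l:set C. l \<in> set (lits (map var_pair [q..<2 * q]) y)))"
proof -
  obtain F V zs where [simp]: "i = (F, V, zs)" by (cases i)
  have V: "V = []" using i(1)[simplified] by (cases rule: expand_cases) (use i in auto)
  have F: "clauses F \<subseteq> Pow {..<2 * n}" using i by (auto simp: item_inv_def inv_def)
  obtain m where m: "2 * q <= m" "m <= n" "V = map var_pair [m..<n]" "map (%l. l div 2) zs = rev [2 * q..<m]"
    using i by (auto simp: item_inv_def)
  have "~ m < n" using V m(3) by auto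
  then have mn: "m = n" using m(2) by simp
  define ts where "ts x y = zs @ lits (map var_pair [0..<q]) x @ lits (map var_pair [q..<2 * q]) y" for x y
  have mts: "map (%l. l div 2) (ts x y) = rev [2 * q..<n] @ [0..<q] @ [q..<2 * q]" for x y
    using m(4) mn by (simp add: ts_def map_lits)
  have dts: "distinct (map (%l. l div 2) (ts x y))" for x y unfolding mts by auto
  have "(%l. l div 2) ` set (ts x y) = set (map (%l. l div 2) (ts x y))" for x y by simp
  then have cov: "(%l. l div 2) ` set (ts x y) = {..<n}" for x y
    unfolding mts using q by auto
  define P where "P x y \<longleftrightarrow> (ALL C:set (live F). (EX l:set C. l \<in> set zs | l \<in> set (lits (map var_pair [0..<q]) x)) |
      (EX l:set C. l \<in> set (lits (map var_pair [q..<2 * q]) y)))" for x y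
  have rhs: "P x y \<longleftrightarrow> (ALL C:set F. EX l:set C. l \<in> set (ts x y))" for x y
    using live_sat[of F "%l. l \<in> set (ts x y)"] unfolding ts_def P_def set_append Un_iff bex_disj_distrib
    by (simp add: disj_assoc)
  have eq: "(ALL C:set F. EX l:set C. l \<in> set (ts x y)) \<longleftrightarrow> (ALL C:set F. EX l:set C. lit_true \<sigma> l)"
    if "ALL l:set (ts x y). lit_true \<sigma> l" for x y \<sigma>
  proof -
    have "l \<in> set (ts x y) \<longleftrightarrow> lit_true \<sigma> l" if "C \<in> set F" "l \<in> set C" for C l
    proof -
      have "l < 2 * n" using that F by (auto simp: clauses_def)
      then have "l div 2 \<in> (%l. l div 2) ` set (ts x y)" unfolding cov by auto
      with true_iff_mem[OF \<open>ALL l:set (ts x y). lit_true \<sigma> l\<close> this] show ?thesis by simp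
    qed
    then show ?thesis by blast
  qed
  have "item_sat i \<longleftrightarrow> (EX x<2 ^ q. EX y<2 ^ q. P x y)"
  proof
    assume "item_sat i"
    then obtain \<sigma> where s: "ALL C:set F. EX l:set C. lit_true \<sigma> l" "ALL l:set zs. lit_true \<sigma> l"
      unfolding item_sat_def by auto
    obtain x where x: "x < 2 ^ q" "ALL l:set (lits (map var_pair [0..<q]) x). lit_true \<sigma> l"
      using lits_surj[of "[0..<q]" \<sigma>] by auto
    obtain y where y: "y < 2 ^ q" "ALL l:set (lits (map var_pair [q..<2 * q]) y). lit_true \<sigma> l"
      using lits_surj[of "[q..<2 * q]" \<sigma>] by auto
    have "ALL l:set (ts x y). lit_true \<sigma> l" using s(2) x(2) y(2) unfolding ts_def set_append by blast
    then have "P x y" unfolding rhs using eq s(1) by blast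
    then show "EX x<2 ^ q. EX y<2 ^ q. P x y" using x(1) y(1) by blast
  next
    assume "EX x<2 ^ q. EX y<2 ^ q. P x y"
    then obtain x y where xy: "ALL C:set F. EX l:set C. l \<in> set (ts x y)" unfolding rhs by blast
    obtain \<sigma> where s: "ALL l:set (ts x y). lit_true \<sigma> l" using choice_assignment[OF dts] by blast
    have "ALL C:set F. EX l:set C. lit_true \<sigma> l" using eq[OF s] xy by blast
    moreover have "ALL l:set zs. lit_true \<sigma> l" using s unfolding ts_def set_append by blast
    ultimately show "item_sat i" unfolding item_sat_def by auto
  qed
  then show ?thesis unfolding P_def by simp
qed

end

section \<open>The market of a leaf\<close>

definition clause_sat :: "nat list => (nat \<times> nat) list => nat => nat list => bool" where
  "clause_sat zs V x C \<longleftrightarrow> (EX l:set C. l \<in> set zs | l \<in> set (lits V x))"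

text \<open>The initial value \<open>True\<close> is returned for positions beyond the list. The
  dimension may exceed twice the number of clauses, and the surplus coordinates then behave like
  satisfied clauses.\<close>

definition sat_idx :: "nat list => (nat \<times> nat) list => nat => nat => nat list list => bool" where
  "sat_idx zs V x c L = snd (foldl (%s C. (Suc (fst s), if fst s = c then clause_sat zs V x C else snd s)) (0, True) L)"

lemma sat_idx: "sat_idx zs V x c L \<longleftrightarrow> (c < length L --> clause_sat zs V x (L ! c))"
proof -
  have "foldl (%s C. (Suc (fst s), if fst s = c then p C else snd s)) (0, True) L =
      (length L, c < length L --> p (L ! c))" for p
    by (induction L rule: rev_induct) (auto simp: nth_append less_Suc_eq)
  then show ?thesis by (simp add: sat_idx_def)
qed

lemma PT_sat_idx:
  assumes "PT f" "PT g" "PT h" "PT i" "PT j"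
  shows "PT (%e. sat_idx (f e) (g e) (h e) (i e) (j e))"
proof -
  have "PT (%z. sat_idx (fst z) (fst (snd z)) (fst (snd (snd z))) (fst (snd (snd (snd z)))) (snd (snd (snd (snd z)))))"
    unfolding sat_idx_def clause_sat_def
  proof (rule PT_snd, rule PT_foldl)
    show "polyb (%e. 3)" by (rule polyb_const)
    show "sz (foldl (f x) (0 :: nat, True) ys) <= 3" for f x and ys :: "nat list list"
      by (metis One_nat_def numeral_3_eq_3 add.commute le_refl plus_1_eq_Suc prod.exhaust sz_simps(1,2,3) one_add_one numeral_2_eq_2)
  qed (intro PT_rules PT_lits)+
  from PT_comp[OF this PT_pair[OF assms(1) PT_pair[OF assms(2) PT_pair[OF assms(3) PT_pair[OF assms(4,5)]]]]]
  show ?thesis by simp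
qed

text \<open>The men \<open>x < R\<close> and the women \<open>y < R\<close> stand for the partial assignments. The clause \<open>c\<close>
  owns the coordinates \<open>2 c\<close> and \<open>2 c + 1\<close>, which contribute \<open>s + (1 - s) t\<close> to the value of
  \<open>y\<close> for \<open>x\<close>, where \<open>s\<close> and \<open>t\<close> tell whether \<open>x\<close> and \<open>y\<close> satisfy the clause. Each \<open>x\<close> is
  matched with a dummy woman worth one less than the number of clauses, and each \<open>y\<close> with a
  worthless dummy man.\<close>

definition job_man_weight where
  "job_man_weight R zs Vx L i j =
     (if i < R & (if j mod 2 = 0 then sat_idx zs Vx i (j div 2) L else ~ sat_idx zs Vx i (j div 2) L)
      then 1 else 0 :: nat)"

text \<open>A man \<open>x < R\<close> has weight 1 in exactly one of the two coordinates of each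
  clause. A dummy woman has attribute 1 in all coordinates but the two of clause 0, so she earns one
  point for every clause except that one.\<close>

definition job_woman_attr where
  "job_woman_attr R R2 Vy L i j =
     (if (if i < R then j mod 2 = 0 | sat_idx [] Vy i (j div 2) L else i < R2 & 2 <= j)
      then 1 else 0 :: nat)"

definition job_market :: "nat => nat list => (nat \<times> nat) list => (nat \<times> nat) list => nat list list => market" where
  "job_market R zs Vx Vy L = \<lparr>man_attr = (%i j. if i < R then 1 else 0),
     man_weight = job_man_weight R zs Vx L,
     woman_attr = job_woman_attr R (2 * R) Vy L,
     woman_weight = (%i j. if i < R then 1 else 0)\<rparr>"

text \<open>With \<open>R2 = 2 * R\<close> the first case is \<open>i + R\<close>, written without a
  sum so that it is computable in the tree calculus.\<close>

definition job_match :: "nat => nat => nat => nat" where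
  "job_match R R2 i = (if i < R then R2 - (R - i) else if i < R2 then i - R else i)"

lemma job_market_boolean: "boolean_market N d (job_market R zs Vx Vy L)"
  by (auto simp: boolean_market_def boolean_vectors_def job_market_def job_man_weight_def job_woman_attr_def)

lemma job_match_simps:
  "i < R ==> job_match R (2 * R) i = i + R"
  "R <= i ==> i < 2 * R ==> job_match R (2 * R) i = i - R"
  "2 * R <= i ==> job_match R (2 * R) i = i"
  by (auto simp: job_match_def)

lemma job_match_involution: "job_match R (2 * R) (job_match R (2 * R) i) = i"
  by (auto simp: job_match_def)

lemma job_match_perfect: "2 * R <= N ==> perfect_matching N (job_match R (2 * R))"
  unfolding perfect_matching_def
  by (rule bij_betw_byWitness[where f' = "job_match R (2 * R)"])
    (auto simp: job_match_involution, auto simp: job_match_def)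

lemma sum_pairs: "(\<Sum>j<2 * (D :: nat). f j) = (\<Sum>c<D. f (2 * c) + f (2 * c + 1) :: nat)"
  by (induction D) auto

text \<open>The prescribed dimension may be odd, in which case one coordinate is left over by the
  pairs.\<close>

lemma sum_dim: "(\<Sum>j<(d :: nat). f j) = (\<Sum>c<d div 2. f (2 * c) + f (2 * c + 1)) + (if even d then 0 else f (d - 1) :: nat)"
proof (cases "even d")
  case True
  then have "d = 2 * (d div 2)" by simp
  then show ?thesis using True sum_pairs[of f "d div 2"] by simp
next
  case False
  then have d: "d = Suc (2 * (d div 2))" by presburger
  then have "(\<Sum>j<d. f j) = (\<Sum>j<2 * (d div 2). f j) + f (2 * (d div 2))" by (metis sum.lessThan_Suc)
  moreover have "d - 1 = 2 * (d div 2)" using d by presburger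
  ultimately show ?thesis using False sum_pairs[of f "d div 2"] by simp
qed

text \<open>Only \<open>x, y < R\<close> can block, since all other participants value everybody at
  0. Woman \<open>y\<close> values \<open>x\<close> at \<open>d\<close> and her dummy at 0, so she
  always agrees. Man \<open>x\<close> counts the clauses satisfied by \<open>x\<close> or
  \<open>y\<close>, surplus ones included, and compares with his dummy, who has one point less than
  the maximum; he prefers \<open>y\<close> exactly if no clause fails.\<close>

lemma job_stable:
  assumes R: "2 * R <= N" and d: "2 * length L <= d" "2 <= d"
  shows "stable N d (job_market R zs Vx Vy L) (job_match R (2 * R)) \<longleftrightarrow>
    ~ (EX x<R. EX y<R. ALL C:set L. clause_sat zs Vx x C | clause_sat [] Vy y C)"
proof -
  let ?M = "job_market R zs Vx Vy L" and ?\<mu> = "job_match R (2 * R)"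
  let ?s = "%x c. sat_idx zs Vx x c L" and ?t = "%y c. sat_idx [] Vy y c L"
  define D where "D = d div 2"
  have D: "1 <= D" "length L <= D" using d by (auto simp: D_def)
  have inv: "inv_into {..<N} ?\<mu> w = ?\<mu> w" if "w < N" for w
  proof (rule inv_into_f_eq)
    show "inj_on ?\<mu> {..<N}" using job_match_perfect[OF R] by (simp add: perfect_matching_def bij_betw_def)
    show "?\<mu> w \<in> {..<N}" using job_match_perfect[OF R] that by (auto simp: perfect_matching_def bij_betw_def)
  qed (rule job_match_involution)
  \<comment> \<open>For odd \<open>d\<close> the last coordinate belongs to a position beyond the
    list. It counts as satisfied and is worth 1 with \<open>y\<close> and with the dummy alike, so
    it does not affect the comparison.\<close>
  have odd_s: "?s x ((d - 1) div 2)" if "odd d" for x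
  proof -
    have "length L <= (d - 1) div 2" using that d by presburger
    then show ?thesis by (simp add: sat_idx)
  qed
  have val: "man_value d ?M x y = (\<Sum>c<D. of_bool (?s x c | ?t y c)) + (if even d then 0 else 1)"
    if "x < R" "y < R" for x y
  proof -
    let ?f = "%j. man_weight ?M x j * woman_attr ?M y j"
    have "(\<Sum>c<D. ?f (2 * c) + ?f (2 * c + 1)) = (\<Sum>c<D. of_bool (?s x c | ?t y c))"
      by (rule sum.cong)
        (use that in \<open>simp_all add: job_market_def job_man_weight_def job_woman_attr_def\<close>)
    moreover have "?f (d - 1) = 1" if od: "odd d"
    proof -
      have "(d - 1) mod 2 = 0" using od by presburger
      then show ?thesis using \<open>x < R\<close> \<open>y < R\<close> odd_s[OF od, of x]
        by (simp add: job_market_def job_man_weight_def job_woman_attr_def)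
    qed
    ultimately show ?thesis unfolding man_value_def dot_def sum_dim[of _ d, folded D_def] by simp
  qed
  have dummy: "man_value d ?M x (x + R) = (D - 1) + (if even d then 0 else 1)" if "x < R" for x
  proof -
    let ?f = "%j. man_weight ?M x j * woman_attr ?M (x + R) j"
    have "(\<Sum>c<D. ?f (2 * c) + ?f (2 * c + 1)) = (\<Sum>c<D. of_bool (c ~= 0))"
      by (rule sum.cong)
        (use that in \<open>auto simp: job_market_def job_man_weight_def job_woman_attr_def\<close>)
    moreover have "?f (d - 1) = 1" if od: "odd d"
    proof -
      have "(d - 1) mod 2 = 0" "2 <= d - 1" using od d(2) by presburger+
      then show ?thesis using \<open>x < R\<close> odd_s[OF od, of x]
        by (simp add: job_market_def job_man_weight_def job_woman_attr_def)
    qed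
    ultimately have "man_value d ?M x (x + R) = (\<Sum>c<D. of_bool (c ~= 0)) + (if even d then 0 else 1)"
      unfolding man_value_def dot_def sum_dim[of _ d, folded D_def] by simp
    also have "(\<Sum>c<D. of_bool (c ~= 0)) = D - 1"
    proof -
      have "(\<Sum>c<Suc m. of_bool (c ~= 0) :: nat) = m" for m by (induction m) auto
      from this[of "D - 1"] show ?thesis using D(1) by simp
    qed
    finally show ?thesis .
  qed
  have full: "D - 1 < (\<Sum>c<D. of_bool (P c) :: nat) \<longleftrightarrow> (ALL c<D. P c)" for P
  proof -
    let ?S = "{..<D} \<inter> {c. P c}"
    have "(\<Sum>c<D. of_bool (P c) :: nat) = card ?S" by simp
    moreover have "card ?S <= D" using card_mono[of "{..<D}" ?S] by simp
    moreover have "card ?S = D \<longleftrightarrow> ?S = {..<D}"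
    proof
      assume "card ?S = D"
      then show "?S = {..<D}" by (intro card_subset_eq) auto
    next
      assume "?S = {..<D}"
      then show "card ?S = D" by (simp only: card_lessThan)
    qed
    moreover have "?S = {..<D} \<longleftrightarrow> (ALL c<D. P c)" by auto
    moreover have "D - 1 < card ?S \<longleftrightarrow> card ?S = D" using D(1) \<open>card ?S <= D\<close> by linarith
    ultimately show ?thesis by (simp only:)
  qed
  have all: "(ALL c<D. ?s x c | ?t y c) \<longleftrightarrow> (ALL C:set L. clause_sat zs Vx x C | clause_sat [] Vy y C)" for x y
  proof -
    have "(ALL c<D. ?s x c | ?t y c) \<longleftrightarrow> (ALL c<length L. clause_sat zs Vx x (L ! c) | clause_sat [] Vy y (L ! c))"
      using D(2) unfolding sat_idx by (meson less_le_trans)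
    also have "... \<longleftrightarrow> (ALL C:set L. clause_sat zs Vx x C | clause_sat [] Vy y C)"
      by (simp only: all_set_conv_all_nth)
    finally show ?thesis .
  qed
  have better: "man_value d ?M x (x + R) < man_value d ?M x y \<longleftrightarrow>
      (ALL C:set L. clause_sat zs Vx x C | clause_sat [] Vy y C)" if "x < R" "y < R" for x y
    unfolding val[OF that] dummy[OF that(1)] all[symmetric] full[symmetric] by (simp only: add_less_cancel_right)
  have block: "blocking_pair N d ?M ?\<mu> m w \<longleftrightarrow>
      m < R & w < R & (ALL C:set L. clause_sat zs Vx m C | clause_sat [] Vy w C)" for m w
  proof
    assume B: "blocking_pair N d ?M ?\<mu> m w"
    have m: "m < R"
    proof (rule ccontr)
      assume "~ m < R"
      then have "man_value d ?M m w = 0" by (simp add: man_value_def dot_def job_market_def job_man_weight_def)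
      then show False using B by (simp add: blocking_pair_def)
    qed
    have w: "w < R"
    proof (rule ccontr)
      assume "~ w < R"
      then have "woman_value d ?M w m = 0" by (simp add: woman_value_def dot_def job_market_def)
      then show False using B by (simp add: blocking_pair_def)
    qed
    have "man_value d ?M m w > man_value d ?M m (m + R)"
      using B m by (simp add: blocking_pair_def job_match_simps)
    then show "m < R & w < R & (ALL C:set L. clause_sat zs Vx m C | clause_sat [] Vy w C)"
      using m w better by blast
  next
    assume a: "m < R & w < R & (ALL C:set L. clause_sat zs Vx m C | clause_sat [] Vy w C)"
    then have mw: "m < R" "w < R" by auto
    have "man_value d ?M m w > man_value d ?M m (?\<mu> m)"
      unfolding job_match_simps(1)[OF mw(1)] using a better[OF mw] by blast
    moreover have "woman_value d ?M w m = d" using mw by (simp add: woman_value_def dot_def job_market_def)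
    moreover have "woman_value d ?M w (inv_into {..<N} ?\<mu> w) = 0"
      using mw R inv[of w] by (simp add: woman_value_def dot_def job_market_def job_match_simps)
    ultimately show "blocking_pair N d ?M ?\<mu> m w"
      using mw R d by (simp add: blocking_pair_def job_match_simps)
  qed
  show ?thesis unfolding stable_def block by blast
qed

text \<open>\<open>Nd\<close>, \<open>Nd4\<close> and \<open>R2\<close> stand for
  \<open>N * d\<close>, \<open>4 * (N * d)\<close> and \<open>2 * R\<close>. They are part of the
  data because the tree calculus has no products; the driver computes them once per run.\<close>

type_synonym job_ctx = "(nat \<times> nat) list \<times> (nat \<times> nat) list \<times> nat \<times> nat \<times> nat \<times> nat \<times> nat \<times> nat"

text \<open>Blocks 0 and 3, the attributes of the men and the weights of the women, are given by the
  same formula and share the last case.\<close>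

definition cell :: "nat => nat => nat => item => job_ctx => nat" where
  "cell blk i j it = (%(Vx, Vy, N, d, Nd, Nd4, R, R2).
     if blk = 1 then job_man_weight R (snd (snd it)) Vx (live (fst it)) i j
     else if blk = 2 then job_woman_attr R R2 Vy (live (fst it)) i j
     else if i < R then 1 else 0)"

text \<open>The symbol at position \<open>a\<close> of the encoded instance.\<close>

definition entry :: "nat \<times> item \<times> job_ctx => nat" where
  "entry = (%(a, it, Vx, Vy, N, d, Nd, Nd4, R, R2).
     if a = 0 then N else if a = 1 then d
     else if a - 2 < Nd4 then cell ((a - 2) div Nd) (((a - 2) mod Nd) div d) (((a - 2) mod Nd) mod d)
       it (Vx, Vy, N, d, Nd, Nd4, R, R2)
     else job_match R R2 (a - 2 - Nd4))"

lemma PT_entry: "PT entry"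
  unfolding entry_def cell_def job_man_weight_def job_woman_attr_def job_match_def case_prod_unfold fst_conv snd_conv
  by (intro PT_rules PT_sat_idx PT_live)

lemma length_encode_vectors: "length (encode_vectors n d V) = n * d"
  by (induction n) (auto simp: encode_vectors_def)

lemma nth_encode_vectors: "r < n * d ==> encode_vectors n d V ! r = V (r div d) (r mod d)"
proof (induction n)
  case (Suc n)
  have eq: "encode_vectors (Suc n) d V = encode_vectors n d V @ map (V n) [0..<d]"
    by (simp add: encode_vectors_def)
  show ?case
  proof (cases "r < n * d")
    case True
    then show ?thesis using Suc.IH by (simp add: eq nth_append length_encode_vectors)
  next
    case False
    then have r: "r - n * d < d" "r = n * d + (r - n * d)" using Suc.prems by auto
    then have "r div d = n" "r mod d = r - n * d"
      by (metis add.commute add_0 div_less div_mult_self1 less_zeroE not_less0 gr_implies_not0, metis mod_less mod_mult_self3)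
    then show ?thesis using False r by (simp add: eq nth_append length_encode_vectors)
  qed
qed simp

lemma length_encode_instance: "length (encode_matching_instance N d (M, \<mu>)) = 2 + 4 * (N * d) + N"
  by (simp add: encode_matching_instance_def length_encode_vectors)

lemma nth_encode_instance:
  assumes a: "a < 2 + 4 * (N * d) + N" and d: "0 < d"
  shows "encode_matching_instance N d
      (job_market R (snd (snd it)) Vx Vy (live (fst it)), job_match R (2 * R)) ! a =
    entry (a, it, Vx, Vy, N, d, N * d, 4 * (N * d), R, 2 * R)"
proof -
  let ?M = "job_market R (snd (snd it)) Vx Vy (live (fst it))"
  let ?E = "%V. encode_vectors N d V"
  consider "a = 0" | "a = 1" | "2 <= a" "a - 2 < 4 * (N * d)" | "2 <= a" "4 * (N * d) <= a - 2" by linarith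
  then show ?thesis
  proof cases
    case 3
    define r where "r = a - 2"
    have a2: "a = Suc (Suc r)" using 3 by (simp add: r_def)
    have r: "r < 4 * (N * d)" using 3 by (simp add: r_def)
    then have Nd: "0 < N * d" by (cases "N * d") auto
    have blk: "r div (N * d) < 4" using r Nd by (simp add: less_mult_imp_div_less)
    define b where "b = r div (N * d)"
    define u where "u = r mod (N * d)"
    have ru: "r = b * (N * d) + u" "u < N * d"
      using Nd unfolding b_def u_def by (simp only: div_mult_mod_eq, simp)
    have "encode_matching_instance N d (?M, job_match R (2 * R)) ! a =
      (?E (man_attr ?M) @ ?E (man_weight ?M) @ ?E (woman_attr ?M) @ ?E (woman_weight ?M) @
        map (job_match R (2 * R)) [0..<N]) ! r" by (simp add: encode_matching_instance_def a2)
    also have "... = (if b = 0 then man_attr ?M else if b = 1 then man_weight ?M else if b = 2 then woman_attr ?M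
        else woman_weight ?M) (u div d) (u mod d)"
    proof -
      consider "b = 0" | "b = 1" | "b = 2" | "b = 3" using blk b_def by linarith
      then show ?thesis
        by cases (use ru in \<open>auto simp: nth_append length_encode_vectors nth_encode_vectors\<close>)
    qed
    also have "... = cell b (u div d) (u mod d) it (Vx, Vy, N, d, N * d, 4 * (N * d), R, 2 * R)"
      by (simp add: cell_def job_market_def)
    finally show ?thesis using 3 unfolding entry_def by (simp add: b_def u_def r_def)
  next
    case 4
    define r where "r = a - 2 - 4 * (N * d)"
    have a2: "a = Suc (Suc (4 * (N * d) + r))" "r < N" using 4 a by (auto simp: r_def)
    have "encode_matching_instance N d (?M, job_match R (2 * R)) ! a = job_match R (2 * R) r"
      by (simp add: encode_matching_instance_def a2 nth_append length_encode_vectors)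
    then show ?thesis using 4 unfolding entry_def by (simp add: r_def)
  qed (simp_all add: encode_matching_instance_def entry_def)
qed

lemma entry_le:
  assumes "2 * R <= N" "N <= Nd + N"
  shows "entry (a, it, Vx, Vy, N, d, Nd, Nd4, R, 2 * R) <= N + d + a + 1"
  using assms unfolding entry_def cell_def job_man_weight_def job_woman_attr_def job_match_def by auto

section \<open>Clocked simulation\<close>

lemma bit_length_le_iff: "1 <= m ==> bit_length x <= m \<longleftrightarrow> x < 2 ^ m"
proof
  assume m: "1 <= m" and "bit_length x <= m"
  then have "x < 2 * 2 ^ floor_log x" "Suc (floor_log x) <= m"
    using floor_log_exp2_gt by (auto simp: bit_length_def)
  moreover have "(2::nat) * 2 ^ floor_log x <= 2 ^ m"
    using power_increasing[of "Suc (floor_log x)" m "2::nat"] calculation(2) by simp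
  ultimately show "x < 2 ^ m" by linarith
next
  assume m: "1 <= m" and x: "x < 2 ^ m"
  show "bit_length x <= m"
  proof (cases "x = 0")
    case False
    then have "2 ^ floor_log x <= x" by (simp add: floor_log_exp2_le)
    then have "(2::nat) ^ floor_log x < 2 ^ m" using x by linarith
    then have "floor_log x < m" by (simp add: power_strict_increasing_iff)
    then show ?thesis by (simp add: bit_length_def)
  qed (use m in simp)
qed

lemma less_exp_bit_length: "x < 2 ^ bit_length x"
  using bit_length_le_iff[of "bit_length x" x] by simp

lemma bit_length_add: "bit_length (x + y) <= bit_length x + bit_length y"
proof -
  have 1: "x + 1 <= 2 ^ bit_length x" "y + 1 <= 2 ^ bit_length y"
    using less_exp_bit_length[of x] less_exp_bit_length[of y] by auto
  have "x + y < (x + 1) * (y + 1)" by simp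
  also have "... <= 2 ^ (bit_length x + bit_length y)" unfolding power_add using 1 by (rule mult_le_mono)
  finally show ?thesis using bit_length_le_iff[of "bit_length x + bit_length y"] bit_length_pos(1)[of x]
    by (simp del: bit_length_pos)
qed

lemma bit_length_mult: "bit_length (x * y) <= bit_length x + bit_length y"
proof -
  have 1: "x <= 2 ^ bit_length x" "y < 2 ^ bit_length y"
    using less_exp_bit_length[of x] less_exp_bit_length[of y] by auto
  have "x * y < 2 ^ (bit_length x + bit_length y)"
  proof (cases "x = 0")
    case False
    then have "x * y < x * 2 ^ bit_length y" using 1 by simp
    also have "... <= 2 ^ (bit_length x + bit_length y)" unfolding power_add using 1 by (intro mult_le_mono) auto
    finally show ?thesis .
  qed simp
  then show ?thesis using bit_length_le_iff[of "bit_length x + bit_length y"] bit_length_pos(1)[of x]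
    by (simp del: bit_length_pos)
qed

lemma bit_length_le_self: "1 <= x ==> bit_length x <= x"
  by (subst bit_length_le_iff) auto

text \<open>The cells used by run \<open>r\<close> of the simulated machine are disjoint from those of the other
  runs, and odd.\<close>

definition addr :: "nat => nat => nat => nat" where
  "addr Z r a = 2 * ((a + r) * (a + r) + a + Z) + 1"

text \<open>\<open>(a + r) * (a + r) + a\<close> lies below the next square, so it determines
  \<open>a + r\<close> and then \<open>a\<close>.\<close>

lemma addr_inj: "addr Z r a = addr Z r' a' ==> r = r' & a = a'"
proof -
  assume "addr Z r a = addr Z r' a'"
  then have eq: "(a + r) * (a + r) + a = (a' + r') * (a' + r') + a'" by (simp add: addr_def)
  have *: "(u * u + c) < v * v" if "u < v" "c <= u" for u v c :: nat
  proof -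
    have "u * u + c < (u + 1) * (u + 1)" using that(2) by simp
    also have "... <= v * v" using that(1) by (intro mult_le_mono) auto
    finally show ?thesis .
  qed
  have "a + r = a' + r'"
  proof (rule ccontr)
    assume "a + r ~= a' + r'"
    then consider "a + r < a' + r'" | "a' + r' < a + r" by linarith
    then show False using *[of "a + r" "a' + r'" a] *[of "a' + r'" "a + r" a'] eq by cases auto
  qed
  then show ?thesis using eq by simp
qed

lemma addr_odd: "odd (addr Z r a)" by (simp add: addr_def)

text \<open>The pairing is quadratic, so it lengthens addresses by a constant factor only and a
  simulated memory access keeps its logarithmic price.\<close>

lemma bit_length_addr: "bit_length (addr Z r a) <= 10 * (bit_length a + bit_length r + bit_length Z)"
proof -
  have "addr Z r a = (((a + r) * (a + r) + a + Z) + ((a + r) * (a + r) + a + Z)) + 1" by (simp add: addr_def)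
  then have "bit_length (addr Z r a) <= 2 * bit_length ((a + r) * (a + r) + a + Z) + 1"
    using bit_length_add[of "((a + r) * (a + r) + a + Z) + ((a + r) * (a + r) + a + Z)" 1]
      bit_length_add[of "(a + r) * (a + r) + a + Z" "(a + r) * (a + r) + a + Z"] by simp
  moreover have "bit_length ((a + r) * (a + r) + a + Z) <= bit_length ((a + r) * (a + r)) + bit_length a + bit_length Z"
    using bit_length_add[of "(a + r) * (a + r) + a" Z] bit_length_add[of "(a + r) * (a + r)" a] by simp
  moreover have "bit_length ((a + r) * (a + r)) <= 2 * (bit_length a + bit_length r)"
    using bit_length_mult[of "a + r" "a + r"] bit_length_add[of a r] by simp
  moreover have "1 <= bit_length Z" by auto
  ultimately show ?thesis unfolding distrib_left[of 2] distrib_left[of 10] by linarith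
qed

definition next_pc :: "instr list" where
  "next_pc = [Const 9 1, Add 4 4 9]"

text \<open>Register 1 holds \<open>Z\<close> and register 2 the number of the run; the address is
  left in register 8.\<close>

definition addr_code :: "nat => instr list" where
  "addr_code j = [Add 8 j 2, Mul 8 8 8, Add 8 8 j, Add 8 8 1, Add 8 8 8, Const 9 1, Add 8 8 9]"

lemma addr_code:
  assumes "12 <= j"
  shows "blk_cost (addr_code j @ js) s <=
      60 * (bit_length (reg s j) + bit_length (reg s 2) + bit_length (reg s 1)) +
      blk_cost js (blk_exec (addr_code j) s)"
    "reg (blk_exec (addr_code j) s) = (reg s)(8 := addr (reg s 1) (reg s 2) (reg s j), 9 := 1)"
    "mem (blk_exec (addr_code j) s) = mem s"
    "blk_exec (addr_code j @ js) s = blk_exec js (blk_exec (addr_code j) s)"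
    "list_all straight (addr_code j)"
proof -
  let ?x = "reg s j" and ?r = "reg s 2" and ?z = "reg s 1"
  have ap: "blk_exec (xs @ ys) s = blk_exec ys (blk_exec xs s)" for xs ys and s by (induction xs arbitrary: s) auto
  then show "blk_exec (addr_code j @ js) s = blk_exec js (blk_exec (addr_code j) s)" .
  have cp: "blk_cost (xs @ ys) s = blk_cost xs s + blk_cost ys (blk_exec xs s)" for xs ys and s
    by (induction xs arbitrary: s) auto
  show "reg (blk_exec (addr_code j) s) = (reg s)(8 := addr (reg s 1) (reg s 2) (reg s j), 9 := 1)"
    "mem (blk_exec (addr_code j) s) = mem s" "list_all straight (addr_code j)"
    using assms by (auto simp: addr_code_def addr_def fun_eq_iff algebra_simps)
  define y1 where "y1 = ?x + ?r"
  define y2 where "y2 = y1 * y1"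
  define y3 where "y3 = y2 + ?x"
  define y4 where "y4 = y3 + ?z"
  define y5 where "y5 = y4 + y4"
  have b: "bit_length y1 <= bit_length ?x + bit_length ?r" "bit_length y2 <= bit_length y1 + bit_length y1"
    "bit_length y3 <= bit_length y2 + bit_length ?x" "bit_length y4 <= bit_length y3 + bit_length ?z"
    "bit_length y5 <= bit_length y4 + bit_length y4"
    unfolding y1_def y2_def y3_def y4_def y5_def by (intro bit_length_add bit_length_mult)+
  have "blk_cost (addr_code j) s = (bit_length ?x + bit_length ?r) + 2 * bit_length y1 +
      (bit_length y2 + bit_length ?x) + (bit_length y3 + bit_length ?z) + 2 * bit_length y4 + 1 + (bit_length y5 + 1)"
    using assms by (simp add: addr_code_def y5_def y4_def y3_def y2_def y1_def)
  also have "... <= 60 * (bit_length ?x + bit_length ?r + bit_length ?z)"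
    using b bit_length_pos(1)[of ?x] unfolding distrib_left by linarith
  finally show "blk_cost (addr_code j @ js) s <= 60 * (bit_length ?x + bit_length ?r + bit_length ?z) +
      blk_cost js (blk_exec (addr_code j) s)" by (simp add: cp)
qed

text \<open>Adds to register 7 a power of two between the bit length of register \<open>j\<close> and its double,
  found by repeated squaring.\<close>

definition charge_reg :: "nat => com" where
  "charge_reg j = Blk [Const 11 1, Const 10 2, Const 9 1, Add 8 j 9, Sub 8 8 10] ;;
     While 8 (Blk [Mul 10 10 10, Add 11 11 11, Const 9 1, Add 8 j 9, Sub 8 8 10]) ;;
     Blk [Add 7 7 11]"

text \<open>Repeated squaring takes no more rounds than the bit length has bits, and each round
  costs a constant multiple of the bit length. Halving would take one division per bit, hence
  quadratic time, which is too much because the numbers of the simulated program may be as long as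
  its running time.\<close>

lemma charge_reg:
  assumes j: "12 <= j" and x: "x = reg s j"
    and B: "bit_length (bit_length x) <= B" "bit_length (reg s 7) <= B"
  shows "runs (charge_reg j) s (80 * bit_length x * B) (%s'. mem s' = mem s &
    (ALL i. i \<notin> {7..11} --> reg s' i = reg s i) &
    (EX e. reg s' 7 = reg s 7 + e & bit_length x <= e & e <= 2 * bit_length x))"
proof -
  let ?b = "bit_length x" and ?m = "bit_length (bit_length x)"
  define frame where "frame (s' :: config) \<longleftrightarrow> mem s' = mem s & (ALL i. i \<notin> {8..11} --> reg s' i = reg s i)" for s'
  define I where "I i s' \<longleftrightarrow> frame s' & (EX l. reg s' 11 = 2 ^ l & reg s' 10 = 2 ^ 2 ^ l &
    (l > 0 --> 2 ^ 2 ^ (l - 1) <= x) & l + i = ?m & reg s' 8 = (x + 1) - 2 ^ 2 ^ l)" for i and s' :: config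
  have lt: "?b < 2 ^ ?m" by (rule less_exp_bit_length)
  have B1: "1 <= B" using B(1) bit_length_pos(1) le_trans by blast
  have b1: "1 <= ?b" "1 <= ?m" by auto
  \<comment> \<open>While the loop goes on, the counter \<open>2 ^ l\<close> is still below the bit
    length; so the last doubling overshoots by a factor of at most 2.\<close>
  have cont: "2 ^ l < ?b" if "2 ^ 2 ^ l <= x" for l
  proof (rule ccontr)
    assume "~ 2 ^ l < ?b"
    then have "?b <= 2 ^ l" by simp
    then have "x < 2 ^ 2 ^ l" by (subst (asm) bit_length_le_iff) auto
    then show False using that by simp
  qed
  have bx1: "bit_length (x + 1) <= ?b + 1" using bit_length_add[of x 1] by simp
  have 1: "runs (Blk [Const 11 1, Const 10 2, Const 9 1, Add 8 j 9, Sub 8 8 10]) s (10 * ?b) (I ?m)"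
  proof (rule runs_Blk)
    have "blk_cost [Const 11 1, Const 10 2, Const 9 1, Add 8 j 9, Sub 8 8 10] s = 1 + 2 + 1 + (?b + 1) + (bit_length (x + 1) + 2)"
      using j by (simp add: x)
    then show "blk_cost [Const 11 1, Const 10 2, Const 9 1, Add 8 j 9, Sub 8 8 10] s <= 10 * ?b"
      using bx1 b1 by linarith
    show "I ?m (blk_exec [Const 11 1, Const 10 2, Const 9 1, Add 8 j 9, Sub 8 8 10] s)"
      unfolding I_def frame_def using j by (auto simp: x intro!: exI[of _ 0])
  qed auto
  let ?body = "[Mul 10 10 10, Add 11 11 11, Const 9 1, Add 8 j 9, Sub 8 8 10]"
  have 2: "runs (While 8 (Blk ?body)) s1 (?m * ((?b + 3) + 14 * ?b) + 1) (%s'. I 0 s' | (EX i. I i s' & reg s' 8 = 0))"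
    if "I ?m s1" for s1
  proof (rule runs_While[where I = I, OF that])
    fix i s' assume I: "I i s'" and nz: "reg s' 8 ~= 0"
    obtain l where l: "reg s' 11 = 2 ^ l" "reg s' 10 = 2 ^ 2 ^ l" "l + i = ?m" "reg s' 8 = (x + 1) - 2 ^ 2 ^ l"
      and fr: "frame s'" using I unfolding I_def by blast
    have yx: "2 ^ 2 ^ l <= x" using nz l(4) by simp
    have lb: "2 ^ l < ?b" using cont[OF yx] .
    then have "(2::nat) ^ l < 2 ^ ?m" using lt by linarith
    then have lm: "l < ?m" by (simp add: power_strict_increasing_iff)
    then obtain i' where i': "i = Suc i'" using l(3) by (cases i) auto
    have rj: "reg s' j = x" using fr j x by (simp add: frame_def)
    have "blk_cost ?body s' = 2 * bit_length (2 ^ 2 ^ l) + 2 * bit_length (2 ^ l) + 1 + (?b + 1) +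
        (bit_length (x + 1) + bit_length (2 ^ 2 ^ l * 2 ^ 2 ^ l))"
      using j l rj by simp
    also have "... <= 14 * ?b"
    proof -
      have "bit_length (2 ^ 2 ^ l) <= ?b" using yx by (rule bit_length_mono)
      moreover have "(2::nat) ^ l <= 2 ^ 2 ^ l" by (simp add: less_imp_le)
      then have "bit_length (2 ^ l) <= ?b" using yx by (intro bit_length_mono) linarith
      moreover have "bit_length (2 ^ 2 ^ l * 2 ^ 2 ^ l) <= bit_length (2 ^ 2 ^ l) + bit_length (2 ^ 2 ^ l)"
        by (rule bit_length_mult)
      ultimately show ?thesis using bx1 b1 by linarith
    qed
    finally have c: "blk_cost ?body s' <= 14 * ?b" .
    have "bit_length (reg s' 8) <= bit_length (x + 1)" using l(4) by (intro bit_length_mono) simp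
    then have g: "bit_length (reg s' 8) + 1 <= ?b + 3" using bx1 by linarith
    have sq: "(2::nat) ^ 2 ^ l * 2 ^ 2 ^ l = 2 ^ 2 ^ Suc l" by (simp add: power_add[symmetric] mult_2)
    have "I i' (blk_exec ?body s')"
      unfolding I_def
    proof (intro conjI exI[of _ "Suc l"])
      show "frame (blk_exec ?body s')" using fr j unfolding frame_def by auto
      show "reg (blk_exec ?body s') 11 = 2 ^ Suc l" using l by simp
      show "reg (blk_exec ?body s') 10 = 2 ^ 2 ^ Suc l" using l sq by simp
      show "0 < Suc l --> 2 ^ 2 ^ (Suc l - 1) <= x" using yx by simp
      show "Suc l + i' = ?m" using l(3) i' by simp
      show "reg (blk_exec ?body s') 8 = x + 1 - 2 ^ 2 ^ Suc l" using l rj j sq by simp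
    qed
    then have "runs (Blk ?body) s' (14 * ?b) (%s'. EX j<i. I j s')"
      using c i' by (intro runs_Blk) auto
    then show "bit_length (reg s' 8) + 1 <= ?b + 3 & runs (Blk ?body) s' (14 * ?b) (%s'. EX j<i. I j s')"
      using g by blast
  qed blast
  have 3: "runs (Blk [Add 7 7 11]) s2 (B + 2 * ?b) (%s'. mem s' = mem s &
    (ALL i. i \<notin> {7..11} --> reg s' i = reg s i) &
    (EX e. reg s' 7 = reg s 7 + e & bit_length x <= e & e <= 2 * bit_length x))"
    if I0: "I 0 s2 | (EX i. I i s2 & reg s2 8 = 0)" for s2
  proof -
    obtain l i where l: "reg s2 11 = 2 ^ l" "l > 0 --> 2 ^ 2 ^ (l - 1) <= x" "l + i = ?m"
      "reg s2 8 = (x + 1) - 2 ^ 2 ^ l" "i = 0 | reg s2 8 = 0" and fr: "frame s2"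
      using I0 unfolding I_def by blast
    have e1: "?b <= 2 ^ l"
    proof (cases "i = 0")
      case True then show ?thesis using l(3) lt by simp
    next
      case False
      then have "x < 2 ^ 2 ^ l" using l(4,5) by auto
      then show ?thesis by (subst bit_length_le_iff) auto
    qed
    have e2: "2 ^ l <= 2 * ?b"
    proof (cases l)
      case 0 then show ?thesis using b1 by simp
    next
      case (Suc l')
      then have "2 ^ l' < ?b" using l(2) cont by simp
      then show ?thesis using Suc by simp
    qed
    have "bit_length (2 ^ l) <= 2 ^ l" by (rule bit_length_le_self) simp
    then have "blk_cost [Add 7 7 11] s2 <= B + 2 * ?b"
      using l(1) fr B(2) e2 by (simp add: frame_def)
    then show ?thesis using fr l(1) e1 e2 by (intro runs_Blk) (auto simp: frame_def)
  qed
  show ?thesis unfolding charge_reg_def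
  proof (rule runs_Seq[OF 1])
    fix s1 assume "I ?m s1"
    from runs_Seq[OF 2[OF this] 3 le_refl]
    show "runs (While 8 (Blk ?body) ;; Blk [Add 7 7 11]) s1
        (?m * ((?b + 3) + 14 * ?b) + 1 + (B + 2 * ?b)) (%s'. mem s' = mem s &
      (ALL i. i \<notin> {7..11} --> reg s' i = reg s i) &
      (EX e. reg s' 7 = reg s 7 + e & bit_length x <= e & e <= 2 * bit_length x))" by blast
  next
    have "?m * ((?b + 3) + 14 * ?b) <= B * (18 * ?b)" using B(1) b1 by (intro mult_le_mono) auto
    moreover have "B <= B * ?b" "?b <= B * ?b" "1 <= B * ?b" using b1 B1 by (auto simp: Suc_le_eq)
    moreover have "B * (18 * ?b) = 18 * (B * ?b)" "80 * ?b * B = 80 * (B * ?b)" by simp_all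
    ultimately show "10 * ?b + (?m * ((?b + 3) + 14 * ?b) + 1 + (B + 2 * ?b)) <= 80 * ?b * B"
      by linarith
  qed
qed

section \<open>Simulation of one instruction\<close>

fun instr_regs :: "instr => nat set" where
  "instr_regs (Const i c) = {i}"
| "instr_regs (Add i j k) = {i, j, k}"
| "instr_regs (Sub i j k) = {i, j, k}"
| "instr_regs (Mul i j k) = {i, j, k}"
| "instr_regs (Div i j k) = {i, j, k}"
| "instr_regs (Load i j) = {i, j}"
| "instr_regs (Store i j) = {i, j}"
| "instr_regs (JumpZero i l) = {i}"
| "instr_regs (Jump l) = {}"

fun instr_num :: "instr => nat" where
  "instr_num (Const i c) = c"
| "instr_num (JumpZero i l) = l"
| "instr_num (Jump l) = l"
| "instr_num _ = 0"

definition charge_two :: "nat => nat => com" where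
  "charge_two j k = Blk [Const 7 0] ;; charge_reg (40 + j) ;; charge_reg (40 + k)"

text \<open>Leaves in register 7 a number between the cost of the instruction and twice that cost.
  The operand of a \<open>Load\<close> has to be fetched to be charged and is left in register 12
  for \<open>execute\<close>.\<close>

fun charge :: "instr => com" where
  "charge (Const i c) = Blk [Const 7 (bit_length c)]"
| "charge (Add i j k) = charge_two j k"
| "charge (Sub i j k) = charge_two j k"
| "charge (Mul i j k) = charge_two j k"
| "charge (Div i j k) = charge_two j k"
| "charge (Load i j) = Blk [Const 7 0] ;; charge_reg (40 + j) ;;
     Blk (addr_code (40 + j) @ [Load 12 8]) ;; charge_reg 12"
| "charge (Store i j) = charge_two i j"
| "charge (JumpZero i l) = Blk [Const 7 0] ;; charge_reg (40 + i)"
| "charge (Jump l) = Blk [Const 7 1]"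

fun execute :: "instr => com" where
  "execute (Const i c) = Blk (Const (40 + i) c # next_pc)"
| "execute (Add i j k) = Blk (Add (40 + i) (40 + j) (40 + k) # next_pc)"
| "execute (Sub i j k) = Blk (Sub (40 + i) (40 + j) (40 + k) # next_pc)"
| "execute (Mul i j k) = Blk (Mul (40 + i) (40 + j) (40 + k) # next_pc)"
| "execute (Div i j k) = Blk (Div (40 + i) (40 + j) (40 + k) # next_pc)"
| "execute (Load i j) = Blk (Const 9 0 # Add (40 + i) 12 9 # next_pc)"
| "execute (Store i j) = Blk (addr_code (40 + i) @ (Store 8 (40 + j) # next_pc))"
| "execute (JumpZero i l) = Ite (40 + i) (Blk next_pc) (Blk [Const 4 l])"
| "execute (Jump l) = Blk [Const 4 l]"

text \<open>Register 3 is the remaining clock and register 5 the time-out flag. The charge is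
  compared with the clock before the instruction is executed, so nothing is executed that the clock
  cannot pay for.\<close>

definition sim_instr :: "instr => com" where
  "sim_instr i = charge i ;; Blk [Sub 8 7 3] ;;
     Ite 8 (Blk [Const 5 1]) (Blk [Sub 3 3 7] ;; execute i)"

text \<open>Linear search for the current program line, a constant number of tests for a fixed
  program. The sum of the two truncated differences is 0 exactly at equality.\<close>

fun dispatch :: "nat => instr list => com" where
  "dispatch l [] = Blk []"
| "dispatch l (i # is) = Blk [Const 8 l, Sub 9 4 8, Sub 8 8 4, Add 8 8 9] ;;
     Ite 8 (dispatch (Suc l) is) (sim_instr i)"

definition sim_rel :: "nat => nat => nat => config => config => bool" where
  "sim_rel nr Z r cfg s \<longleftrightarrow> reg s 1 = Z & reg s 2 = r & reg s 4 = pc cfg &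
     (ALL i<nr. reg s (40 + i) = reg cfg i) & (ALL a. mem s (addr Z r a) = mem cfg a)"

definition sim_frame :: "nat => nat => nat => config => config => bool" where
  "sim_frame nr Z r s s' \<longleftrightarrow>
     (ALL j. j \<notin> {3..12} \<union> {40..<40 + nr} --> reg s' j = reg s j) &
     (ALL A. A \<notin> range (addr Z r) --> mem s' A = mem s A)"

lemma sim_frame_refl: "sim_frame nr Z r s s" by (simp add: sim_frame_def)

lemma sim_frame_trans: "sim_frame nr Z r s s1 ==> sim_frame nr Z r s1 s2 ==> sim_frame nr Z r s s2"
  by (simp add: sim_frame_def)

lemma charge_reg':
  assumes "12 <= j" "bit_length (reg s j) <= L" "bit_length (4 * L) <= B" "reg s 7 <= 2 * L"
  shows "runs (charge_reg j) s (80 * (L * B)) (%s'. mem s' = mem s &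
    (ALL i. i \<notin> {7..11} --> reg s' i = reg s i) &
    (EX e. reg s' 7 = reg s 7 + e & bit_length (reg s j) <= e & e <= 2 * bit_length (reg s j)))"
proof -
  have "bit_length (bit_length (reg s j)) <= bit_length (4 * L)" "bit_length (reg s 7) <= bit_length (4 * L)"
    using assms by (intro bit_length_mono; simp)+
  then have *: "bit_length (bit_length (reg s j)) <= B" "bit_length (reg s 7) <= B" using assms(3) by linarith+
  have "80 * bit_length (reg s j) * B <= 80 * (L * B)" using assms(2) by simp
  from runs_mono[OF charge_reg[OF assms(1) refl *] this] show ?thesis .
qed

definition charged :: "config => nat => config => bool" where
  "charged s L s' \<longleftrightarrow> mem s' = mem s & (ALL i. i \<notin> {7..12} --> reg s' i = reg s i) &
     L <= reg s' 7 & reg s' 7 <= 2 * L"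

lemma charge_two:
  assumes L: "L = bit_length (reg s (40 + j)) + bit_length (reg s (40 + k))" and B: "bit_length (4 * L) <= B"
  shows "runs (charge_two j k) s (161 * (L * B)) (charged s L)"
proof -
  let ?x = "reg s (40 + j)" and ?y = "reg s (40 + k)"
  let ?s1 = "blk_exec [Const 7 0] s"
  have r1: "mem ?s1 = mem s" "reg ?s1 = (reg s)(7 := 0)" by auto
  have 1: "runs (Blk [Const 7 0]) s 1 (%s'. s' = ?s1)" by (rule runs_Blk) auto
  have L1: "bit_length ?x <= L" "bit_length ?y <= L" "1 <= L" using L bit_length_pos(1)[of ?x] by linarith+
  have B1: "1 <= B" using B bit_length_pos(1) le_trans by blast
  have 2: "runs (charge_reg (40 + j)) ?s1 (80 * (L * B)) (%s'. mem s' = mem s &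
    (ALL i. i \<notin> {7..11} --> reg s' i = reg s i) & bit_length ?x <= reg s' 7 & reg s' 7 <= 2 * bit_length ?x)"
    by (rule runs_mono[OF charge_reg'[where L = L]]) (use L1 B r1 in auto)
  have 3: "runs (charge_reg (40 + k)) s2 (80 * (L * B)) (charged s L)"
    if s2: "mem s2 = mem s & (ALL i. i \<notin> {7..11} --> reg s2 i = reg s i) & bit_length ?x <= reg s2 7 &
      reg s2 7 <= 2 * bit_length ?x" for s2
  proof -
    have y: "reg s2 (40 + k) = ?y" using s2 by simp
    have r7: "reg s2 7 <= 2 * L" using s2 L1 by linarith
    show ?thesis
      by (rule runs_mono[OF charge_reg'[where L = L, OF _ _ B r7]])
        (use L1 y s2 L in \<open>auto simp: charged_def\<close>)
  qed
  show ?thesis unfolding charge_two_def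
  proof (rule runs_Seq[OF 1])
    fix s1 assume "s1 = ?s1"
    then show "runs (charge_reg (40 + j) ;; charge_reg (40 + k)) s1 (160 * (L * B)) (charged s L)"
      by (intro runs_Seq[OF 2[folded \<open>s1 = ?s1\<close>] 3]) auto
  next
    have "1 * 1 <= L * B" by (rule mult_le_mono[OF L1(3) B1])
    then show "1 + 160 * (L * B) <= 161 * (L * B)" by linarith
  qed
qed

lemma charge:
  assumes rel: "sim_rel nr Z r cfg s" and i: "instr_regs i \<subseteq> {..<nr}" and L: "L = instr_cost i cfg"
    and B: "bit_length (4 * L) <= B" "bit_length Z <= B" "bit_length r <= B"
  shows "runs (charge i) s (600 * (L * B)) (%s'. charged s L s' &
    (ALL a b. i = Load a b --> reg s' 12 = mem cfg (reg cfg b)))"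
proof -
  have B1: "1 <= B" using B bit_length_pos(1) le_trans by blast
  have L1: "1 <= L" unfolding L by (cases i) (auto simp: Suc_le_eq)
  define M where "M = L * B"
  have LB: "1 <= M" "L <= M" "B <= M"
    using mult_le_mono[OF L1 B1] mult_le_mono1[OF L1, of B] mult_le_mono2[OF B1, of L] unfolding M_def by auto
  note cr = charge_reg'[where L = L and B = B, folded M_def]
  have two: "runs (charge_two j k) s (600 * M) (charged s L)"
    if "L = bit_length (reg cfg j) + bit_length (reg cfg k)" "j < nr" "k < nr" for j k
    by (rule runs_mono[OF charge_two[where L = L and B = B, folded M_def]]) (use that rel B in \<open>auto simp: sim_rel_def\<close>)
  have one: "runs (Blk [Const 7 c]) s (600 * M) (charged s L)"
    if "c = L" for c
  proof (rule runs_Blk)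
    have "bit_length c <= L" unfolding that using L1 by (rule bit_length_le_self)
    then show "blk_cost [Const 7 c] s <= 600 * M" using LB by simp
  qed (use that in \<open>auto simp: charged_def\<close>)
  have "runs (charge i) s (600 * M) (%s'. charged s L s' &
    (ALL a b. i = Load a b --> reg s' 12 = mem cfg (reg cfg b)))"
  proof (cases i)
    case (Load a b)
    let ?x = "reg cfg b" and ?v = "mem cfg (reg cfg b)"
    have b: "b < nr" and Lv: "L = bit_length ?x + bit_length ?v" using i Load L by auto
    have L2: "bit_length ?x <= L" "bit_length ?v <= L" using Lv by auto
    let ?s1 = "blk_exec [Const 7 0] s"
    have r1: "mem ?s1 = mem s" "reg ?s1 = (reg s)(7 := 0)" by auto
    have x: "reg s (40 + b) = ?x" using rel b by (auto simp: sim_rel_def)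
    have 1: "runs (Blk [Const 7 0]) s 1 (%s'. s' = ?s1)" by (rule runs_Blk) auto
    define Q2 where "Q2 s' \<longleftrightarrow> mem s' = mem s & (ALL i. i \<notin> {7..11} --> reg s' i = reg s i) &
      bit_length ?x <= reg s' 7 & reg s' 7 <= 2 * bit_length ?x" for s' :: config
    have 2: "runs (charge_reg (40 + b)) ?s1 (80 * M) Q2"
      by (rule runs_mono[OF cr]) (use L2 B r1 x in \<open>auto simp: Q2_def\<close>)
    define Q3 where "Q3 s' \<longleftrightarrow> mem s' = mem s & (ALL i. i \<notin> {7..12} --> reg s' i = reg s i) &
      bit_length ?x <= reg s' 7 & reg s' 7 <= 2 * bit_length ?x & reg s' 12 = ?v" for s' :: config
    have 3: "runs (Blk (addr_code (40 + b) @ [Load 12 8])) s2 (220 * M) Q3" if s2: "Q2 s2" for s2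
    proof -
      have r2: "reg s2 (40 + b) = ?x" "reg s2 1 = Z" "reg s2 2 = r" "mem s2 = mem s"
        using s2 x rel unfolding Q2_def by (auto simp: sim_rel_def)
      have j12: "12 <= 40 + b" by simp
      note ac = addr_code(1)[OF j12, where js = "[Load 12 8]" and s = s2, unfolded r2]
        addr_code(2)[OF j12, where s = s2, unfolded r2] addr_code(3)[OF j12, where s = s2, unfolded r2]
        addr_code(4)[OF j12, where js = "[Load 12 8]" and s = s2, unfolded r2] addr_code(5)[OF j12]
      have v: "mem s (addr Z r ?x) = ?v" using rel by (auto simp: sim_rel_def)
      show ?thesis
      proof (rule runs_Blk)
        show "list_all straight (addr_code (40 + b) @ [Load 12 8])" using ac(5) by simp
        have "blk_cost (addr_code (40 + b) @ [Load 12 8]) s2 <= 60 * (bit_length ?x + bit_length r + bit_length Z) +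
            (bit_length (addr Z r ?x) + bit_length ?v)" using ac(1,2,3) v by simp
        also have "... <= 70 * (bit_length ?x + bit_length r + bit_length Z) + bit_length ?v"
          using bit_length_addr[of Z r ?x] by simp
        also have "... <= 70 * (M + M + M) + M"
          by (intro add_le_mono mult_le_mono2) (use L2 B LB in linarith)+
        finally show "blk_cost (addr_code (40 + b) @ [Load 12 8]) s2 <= 220 * M" by simp
        show "Q3 (blk_exec (addr_code (40 + b) @ [Load 12 8]) s2)"
          using s2 ac(2-4) v r2 unfolding Q2_def Q3_def by auto
      qed
    qed
    have 4: "runs (charge_reg 12) s3 (80 * M) (%s'. charged s L s' & reg s' 12 = ?v)" if s3: "Q3 s3" for s3
    proof -
      have v3: "reg s3 12 = ?v" and r7: "reg s3 7 <= 2 * L" using s3 L2 unfolding Q3_def by auto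
      have b3: "bit_length (reg s3 12) <= L" using v3 L2 by simp
      show ?thesis
        by (rule runs_mono[OF cr[OF _ b3 B(1) r7]])
          (use s3 v3 Lv in \<open>auto simp: charged_def Q3_def\<close>)
    qed
    have "runs (charge i) s (600 * M) (%s'. charged s L s' & reg s' 12 = ?v)"
      unfolding Load charge.simps
    proof (rule runs_Seq[OF 1])
      fix s1 assume s1: "s1 = ?s1"
      show "runs (charge_reg (40 + b) ;; Blk (addr_code (40 + b) @ [Load 12 8]) ;; charge_reg 12) s1
          (380 * M) (%s'. charged s L s' & reg s' 12 = ?v)"
        unfolding s1
      proof (rule runs_Seq[OF 2])
        fix s2 assume "Q2 s2"
        from runs_Seq[OF 3[OF this] 4 le_refl]
        show "runs (Blk (addr_code (40 + b) @ [Load 12 8]) ;; charge_reg 12) s2 (220 * M + 80 * M)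
          (%s'. charged s L s' & reg s' 12 = ?v)" by blast
      qed simp
    qed (use LB in linarith)
    then show ?thesis by (rule runs_mono) (auto simp: Load)
  next
    case (JumpZero a l)
    let ?s1 = "blk_exec [Const 7 0] s"
    have r1: "mem ?s1 = mem s" "reg ?s1 = (reg s)(7 := 0)" by auto
    have x: "reg s (40 + a) = reg cfg a" using rel i JumpZero by (auto simp: sim_rel_def)
    have 1: "runs (Blk [Const 7 0]) s 1 (%s'. s' = ?s1)" by (rule runs_Blk) auto
    have 2: "runs (charge_reg (40 + a)) ?s1 (80 * M) (charged s L)"
      by (rule runs_mono[OF cr]) (use B r1 x L JumpZero in \<open>auto simp: charged_def\<close>)
    have "runs (charge i) s (600 * M) (charged s L)"
      unfolding JumpZero charge.simps
      by (rule runs_Seq[OF 1, where ?b2.0 = "80 * M"]) (use 2 LB in auto)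
    then show ?thesis by (rule runs_mono) (auto simp: JumpZero)
  next
    case (Const a c)
    then show ?thesis using one[of "bit_length c"] L by (auto intro: runs_mono)
  next
    case (Jump l)
    then show ?thesis using one[of 1] L by (auto intro: runs_mono)
  qed (use two i L in \<open>auto intro: runs_mono\<close>)
  then show ?thesis by (simp add: M_def)
qed

lemma execute:
  assumes rel: "sim_rel nr Z r cfg s" and i: "instr_regs i \<subseteq> {..<nr}" and L: "L = instr_cost i cfg"
    and B: "bit_length Z <= B" "bit_length r <= B" "bit_length (pc cfg) <= B" "bit_length (instr_num i) <= B"
    and load: "!!a b. i = Load a b ==> reg s 12 = mem cfg (reg cfg b)"
  shows "runs (execute i) s (300 * (L * B)) (%s'. sim_rel nr Z r (exec_instr i cfg) s' &
    sim_frame nr Z r s s' & reg s' 3 = reg s 3 & reg s' 5 = reg s 5)"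
    (is "runs _ _ _ ?Q")
proof -
  have B1: "1 <= B" using B bit_length_pos(1) le_trans by blast
  have L1: "1 <= L" unfolding L by (cases i) (auto simp: Suc_le_eq)
  define M where "M = L * B"
  have LB: "1 <= M" "L <= M" "B <= M"
    using mult_le_mono[OF L1 B1] mult_le_mono1[OF L1, of B] mult_le_mono2[OF B1, of L] unfolding M_def by auto
  have R: "reg s 1 = Z" "reg s 2 = r" "reg s 4 = pc cfg" "!!i. i < nr ==> reg s (40 + i) = reg cfg i"
    "!!a. mem s (addr Z r a) = mem cfg a" using rel by (auto simp: sim_rel_def)
  have small: "runs (Blk (op # next_pc)) s (300 * M) ?Q"
    if "straight op" "instr_cost op s <= 2 * M" "?Q (blk_exec (op # next_pc) s)"
      "reg (exec_instr op s) 4 = reg s 4" for op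
  proof (rule runs_Blk)
    show "blk_cost (op # next_pc) s <= 300 * M" using that B LB R by (simp add: next_pc_def)
  qed (use that in \<open>auto simp: next_pc_def\<close>)
  note defs = sim_rel_def sim_frame_def next_pc_def
  have "runs (execute i) s (300 * M) ?Q"
  proof (cases i)
    case (Const a c)
    have ex: "execute i = Blk (Const (40 + a) c # next_pc)" by (simp add: Const)
    show ?thesis unfolding ex M_def[symmetric]
      by (rule small) (use rel i Const L LB in \<open>auto simp: defs\<close>)
  next
    case (Add a b c)
    have ex: "execute i = Blk (Add (40 + a) (40 + b) (40 + c) # next_pc)" by (simp add: Add)
    show ?thesis unfolding ex M_def[symmetric]
      by (rule small) (use rel i Add L LB in \<open>auto simp: defs\<close>)
  next
    case (Sub a b c)
    have ex: "execute i = Blk (Sub (40 + a) (40 + b) (40 + c) # next_pc)" by (simp add: Sub)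
    show ?thesis unfolding ex M_def[symmetric]
      by (rule small) (use rel i Sub L LB in \<open>auto simp: defs\<close>)
  next
    case (Mul a b c)
    have ex: "execute i = Blk (Mul (40 + a) (40 + b) (40 + c) # next_pc)" by (simp add: Mul)
    show ?thesis unfolding ex M_def[symmetric]
      by (rule small) (use rel i Mul L LB in \<open>auto simp: defs\<close>)
  next
    case (Div a b c)
    have ex: "execute i = Blk (Div (40 + a) (40 + b) (40 + c) # next_pc)" by (simp add: Div)
    show ?thesis unfolding ex M_def[symmetric]
      by (rule small) (use rel i Div L LB in \<open>auto simp: defs\<close>)
  next
    case (Load a b)
    have v: "reg s 12 = mem cfg (reg cfg b)" "bit_length (mem cfg (reg cfg b)) <= L" using load Load L by auto
    show ?thesis unfolding M_def[symmetric] Load execute.simps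
    proof (rule runs_Blk)
      show "blk_cost (Const 9 0 # Add (40 + a) 12 9 # next_pc) s <= 300 * M"
        using v B LB R by (simp add: next_pc_def)
    qed (use rel i Load v in \<open>auto simp: defs\<close>)
  next
    case (Store a b)
    have ab: "a < nr" "b < nr" "L = bit_length (reg cfg a) + bit_length (reg cfg b)" using i Store L by auto
    have j12: "12 <= 40 + a" by simp
    note ac = addr_code(1)[OF j12, where js = "Store 8 (40 + b) # next_pc" and s = s, unfolded R(1,2) R(4)[OF ab(1)]]
      addr_code(2)[OF j12, where s = s, unfolded R(1,2) R(4)[OF ab(1)]] addr_code(3)[OF j12, where s = s, unfolded R(1,2) R(4)[OF ab(1)]]
      addr_code(4)[OF j12, where js = "Store 8 (40 + b) # next_pc" and s = s, unfolded R(1,2) R(4)[OF ab(1)]] addr_code(5)[OF j12]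
    let ?s = "blk_exec (addr_code (40 + a)) s"
    show ?thesis unfolding M_def[symmetric] Store execute.simps
    proof (rule runs_Blk)
      show "list_all straight (addr_code (40 + a) @ Store 8 (40 + b) # next_pc)"
        using ac(5) by (simp add: next_pc_def)
      have "blk_cost (Store 8 (40 + b) # next_pc) ?s = bit_length (addr Z r (reg cfg a)) + bit_length (reg cfg b) +
          (1 + (bit_length (pc cfg) + 1))" using ac(2) R ab by (simp add: next_pc_def)
      then have "blk_cost (addr_code (40 + a) @ Store 8 (40 + b) # next_pc) s <=
          70 * (bit_length (reg cfg a) + bit_length r + bit_length Z) + (bit_length (reg cfg b) + (bit_length (pc cfg) + 2))"
        using ac(1) bit_length_addr[of Z r "reg cfg a"] by simp
      also have "... <= 70 * (M + M + M) + (M + (M + 2 * M))"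
        by (intro add_le_mono mult_le_mono2) (use ab(3) B LB in linarith)+
      finally show "blk_cost (addr_code (40 + a) @ Store 8 (40 + b) # next_pc) s <= 300 * M" by simp
      have eq: "reg (blk_exec (addr_code (40 + a) @ Store 8 (40 + b) # next_pc) s) =
          (reg s)(8 := addr Z r (reg cfg a), 9 := 1, 4 := pc cfg + 1)"
        "mem (blk_exec (addr_code (40 + a) @ Store 8 (40 + b) # next_pc) s) =
          (mem s)(addr Z r (reg cfg a) := reg cfg b)"
        unfolding ac(4) using ac(2,3) R ab by (auto simp: next_pc_def fun_eq_iff)
      show "sim_rel nr Z r (exec_instr (Store a b) cfg) (blk_exec (addr_code (40 + a) @ Store 8 (40 + b) # next_pc) s) &
          sim_frame nr Z r s (blk_exec (addr_code (40 + a) @ Store 8 (40 + b) # next_pc) s) &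
          reg (blk_exec (addr_code (40 + a) @ Store 8 (40 + b) # next_pc) s) 3 = reg s 3 &
          reg (blk_exec (addr_code (40 + a) @ Store 8 (40 + b) # next_pc) s) 5 = reg s 5"
        unfolding sim_rel_def sim_frame_def eq using R ab by (auto dest: addr_inj)
    qed
  next
    case (JumpZero a l)
    have a: "a < nr" "L = bit_length (reg cfg a)" "reg s (40 + a) = reg cfg a" using i JumpZero L R by auto
    show ?thesis unfolding M_def[symmetric] JumpZero execute.simps
    proof (rule runs_Ite)
      show "runs (Blk next_pc) s (4 * M)
          (%s'. sim_rel nr Z r (exec_instr (JumpZero a l) cfg) s' & sim_frame nr Z r s s' & reg s' 3 = reg s 3 & reg s' 5 = reg s 5)"
        if "reg s (40 + a) ~= 0"
        by (rule runs_Blk) (use that a R rel B LB in \<open>auto simp: defs\<close>)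
      show "runs (Blk [Const 4 l]) s (4 * M)
          (%s'. sim_rel nr Z r (exec_instr (JumpZero a l) cfg) s' & sim_frame nr Z r s s' & reg s' 3 = reg s 3 & reg s' 5 = reg s 5)"
        if "reg s (40 + a) = 0"
        by (rule runs_Blk) (use that a R rel B LB JumpZero in \<open>auto simp: defs\<close>)
      show "bit_length (reg s (40 + a)) + 1 + 4 * M <= 300 * M"
        unfolding a(3) a(2)[symmetric] using LB by linarith
    qed
  next
    case (Jump l)
    show ?thesis unfolding M_def[symmetric] Jump execute.simps
      by (rule runs_Blk) (use R rel B LB Jump in \<open>auto simp: defs\<close>)
  qed
  then show ?thesis by (simp add: M_def)
qed

lemma runs_WhileF: "reg s r = 0 ==> Q s ==> 1 <= b ==> runs (While r c) s b Q"
  unfolding runs_def using exec.WhileF by blast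

lemma runs_WhileT:
  assumes "reg s r ~= 0" "runs c s b1 Q1" "!!s1. Q1 s1 ==> runs (While r c) s1 b2 Q"
    "bit_length (reg s r) + 1 + b1 + b2 <= b"
  shows "runs (While r c) s b Q"
proof -
  obtain K1 s1 where 1: "exec c s K1 s1" "K1 <= b1" "Q1 s1" using assms(2) unfolding runs_def by blast
  obtain K2 s2 where 2: "exec (While r c) s1 K2 s2" "K2 <= b2" "Q s2" using assms(3)[OF 1(3)] unfolding runs_def by blast
  from exec.WhileT[OF assms(1) 1(1) 2(1)] 1(2) 2(2,3) assms(4) show ?thesis
    unfolding runs_def by (intro exI conjI) (assumption, linarith, assumption)
qed

lemma sim_rel_cong:
  assumes "sim_rel nr Z r cfg s" "mem s' = mem s" "!!i. i \<notin> {3} \<union> {5..12} ==> reg s' i = reg s i"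
  shows "sim_rel nr Z r cfg s'"
  using assms by (auto simp: sim_rel_def)

lemma sim_instr:
  assumes rel: "sim_rel nr Z r cfg s" and i: "instr_regs i \<subseteq> {..<nr}" and L: "L = instr_cost i cfg"
    and B: "bit_length (4 * L) <= B" "bit_length Z <= B" "bit_length r <= B"
      "bit_length (pc cfg) <= B" "bit_length (instr_num i) <= B" "bit_length (reg s 3) <= B"
    and t: "reg s 5 = 0"
  shows "runs (sim_instr i) s (1000 * (L * B)) (%s'. sim_frame nr Z r s s' &
    (reg s' 5 = 1 & reg s 3 < 2 * L & reg s' 4 = reg s 4 |
     reg s' 5 = 0 & sim_rel nr Z r (exec_instr i cfg) s' &
       (EX E. L <= E & E <= 2 * L & E <= reg s 3 & reg s' 3 = reg s 3 - E)))"
    (is "runs _ _ _ ?Q")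
proof -
  have B1: "1 <= B" using B bit_length_pos(1) le_trans by blast
  have L1: "1 <= L" unfolding L by (cases i) (auto simp: Suc_le_eq)
  define M where "M = L * B"
  have LB: "1 <= M" "L <= M" "B <= M"
    using mult_le_mono[OF L1 B1] mult_le_mono1[OF L1, of B] mult_le_mono2[OF B1, of L] unfolding M_def by auto
  define Q1 where "Q1 s' \<longleftrightarrow> charged s L s' &
    (ALL a b. i = Load a b --> reg s' 12 = mem cfg (reg cfg b))" for s'
  have 1: "runs (charge i) s (600 * M) Q1"
    using charge[OF rel i L B(1-3)] unfolding Q1_def M_def .
  define Q2 where "Q2 s' \<longleftrightarrow> Q1 s' & reg s' 8 = reg s' 7 - reg s 3" for s'
  have E: "bit_length (reg s1 7) <= B" "reg s1 3 = reg s 3" if "Q1 s1" for s1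
  proof -
    have "bit_length (reg s1 7) <= bit_length (4 * L)"
      using that by (intro bit_length_mono) (auto simp: Q1_def charged_def)
    then show "bit_length (reg s1 7) <= B" using B(1) by linarith
    show "reg s1 3 = reg s 3" using that by (auto simp: Q1_def charged_def)
  qed
  have 2: "runs (Blk [Sub 8 7 3]) s1 (2 * M) Q2" if "Q1 s1" for s1
  proof (rule runs_Blk)
    show "blk_cost [Sub 8 7 3] s1 <= 2 * M" using E[OF that] B(6) LB by simp
    show "Q2 (blk_exec [Sub 8 7 3] s1)" using that unfolding Q2_def Q1_def charged_def by auto
  qed auto
  have 3: "runs (Ite 8 (Blk [Const 5 1]) (Blk [Sub 3 3 7] ;; execute i)) s2 (305 * M) ?Q" if s2: "Q2 s2" for s2
  proof -
    have q1: "Q1 s2" and r8: "reg s2 8 = reg s2 7 - reg s 3" using s2 by (auto simp: Q2_def)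
    have ch: "mem s2 = mem s" "!!i. i \<notin> {7..12} ==> reg s2 i = reg s i" "L <= reg s2 7" "reg s2 7 <= 2 * L"
      using q1 by (auto simp: Q1_def charged_def)
    have fr: "sim_frame nr Z r s s2" using ch by (auto simp: sim_frame_def)
    show ?thesis
    proof (rule runs_Ite)
      assume nz: "reg s2 8 ~= 0"
      show "runs (Blk [Const 5 1]) s2 (302 * M) ?Q"
      proof (rule runs_Blk)
        show "blk_cost [Const 5 1] s2 <= 302 * M" using LB by simp
        show "?Q (blk_exec [Const 5 1] s2)" using ch nz r8 fr unfolding sim_frame_def by auto
      qed auto
    next
      assume z: "reg s2 8 = 0"
      let ?s3 = "blk_exec [Sub 3 3 7] s2"
      have s3: "mem ?s3 = mem s" "reg ?s3 = (reg s2)(3 := reg s 3 - reg s2 7)" using ch by auto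
      have a: "runs (Blk [Sub 3 3 7]) s2 (2 * M) (%s'. s' = ?s3)"
        by (rule runs_Blk) (use E[OF q1] B(6) LB in auto)
      have rel3: "sim_rel nr Z r cfg ?s3"
        by (rule sim_rel_cong[OF rel]) (use s3 ch in auto)
      have ld: "reg ?s3 12 = mem cfg (reg cfg b)" if "i = Load a b" for a b
        using q1 that s3 by (auto simp: Q1_def)
      have fr3: "sim_frame nr Z r s ?s3" using fr s3 ch by (auto simp: sim_frame_def)
      have b: "runs (execute i) ?s3 (300 * M) ?Q"
      proof (rule runs_mono[OF execute[OF rel3 i L B(2-5) ld, folded M_def] le_refl])
        fix s' assume s': "sim_rel nr Z r (exec_instr i cfg) s' & sim_frame nr Z r ?s3 s' &
          reg s' 3 = reg ?s3 3 & reg s' 5 = reg ?s3 5"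
        have "reg s' 5 = 0" using s' s3 ch t by simp
        moreover have "reg s' 3 = reg s 3 - reg s2 7" using s' ch(2)[of 3] by simp
        moreover have "reg s2 7 <= reg s 3" using z r8 by simp
        ultimately show "?Q s'" using sim_frame_trans[OF fr3] s' ch by blast
      qed
      show "runs (Blk [Sub 3 3 7] ;; execute i) s2 (302 * M) ?Q"
        by (rule runs_Seq[OF a, where ?b2.0 = "300 * M"]) (use b in auto)
    next
      have "bit_length (reg s2 8) <= bit_length (reg s2 7)" unfolding r8 by (intro bit_length_mono) simp
      then show "bit_length (reg s2 8) + 1 + 302 * M <= 305 * M" using E[OF q1] LB by linarith
    qed
  qed
  have "runs (sim_instr i) s (1000 * M) ?Q"
    unfolding sim_instr_def
  proof (rule runs_Seq[OF 1])
    fix s1 assume "Q1 s1"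
    from runs_Seq[OF 2[OF this] 3 le_refl]
    show "runs (Blk [Sub 8 7 3] ;; Ite 8 (Blk [Const 5 1]) (Blk [Sub 3 3 7] ;; execute i)) s1 (2 * M + 305 * M) ?Q" .
  qed simp
  then show ?thesis by (simp add: M_def)
qed

lemma dispatch:
  assumes rel: "sim_rel nr Z r cfg s"
    and B: "bit_length (pc cfg) <= B" and M: "B <= M"
    and run: "!!s'. sim_rel nr Z r cfg s' ==> reg s' 3 = reg s 3 ==> reg s' 5 = reg s 5 ==>
      sim_frame nr Z r s s' ==> runs (sim_instr i) s' b Q"
  shows "l <= pc cfg ==> pc cfg - l < length is ==> is ! (pc cfg - l) = i ==>
    runs (dispatch l is) s (length is * (12 * M) + b) Q"
  using rel run
proof (induction l "is" arbitrary: s rule: dispatch.induct)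
  case (2 l j "is")
  have B1: "1 <= B" using B bit_length_pos(1) le_trans by blast
  let ?is = "[Const 8 l, Sub 9 4 8, Sub 8 8 4, Add 8 8 9]"
  let ?s1 = "blk_exec ?is s"
  let ?p = "pc cfg"
  have r4: "reg s 4 = ?p" using 2 by (simp add: sim_rel_def)
  have s1: "mem ?s1 = mem s" "reg ?s1 = (reg s)(9 := ?p - l, 8 := (l - ?p) + (?p - l))"
    using r4 by (auto simp: fun_eq_iff)
  have bl: "bit_length l <= B" "bit_length (?p - l) <= B" "bit_length (l - ?p) <= B"
    using 2(2) B bit_length_mono[of l ?p] bit_length_mono[of "?p - l" ?p] bit_length_mono[of "l - ?p" ?p] B1 by simp_all
  have a: "runs (Blk ?is) s (7 * M) (%s'. s' = ?s1)"
  proof (rule runs_Blk)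
    have "blk_cost ?is s = bit_length l + (bit_length ?p + bit_length l) + (bit_length l + bit_length ?p) +
      (bit_length (l - ?p) + bit_length (?p - l))" using r4 by simp
    then show "blk_cost ?is s <= 7 * M" using bl B M by linarith
  qed auto
  have rel1: "sim_rel nr Z r cfg ?s1" by (rule sim_rel_cong[OF 2(5)]) (use s1 in auto)
  have fr1: "sim_frame nr Z r s ?s1" using s1 by (auto simp: sim_frame_def)
  have run1: "runs (sim_instr i) s' b Q"
    if "sim_rel nr Z r cfg s'" "reg s' 3 = reg ?s1 3" "reg s' 5 = reg ?s1 5" "sim_frame nr Z r ?s1 s'" for s'
    by (rule 2(6)[OF that(1)]) (use that s1 sim_frame_trans[OF fr1] in auto)
  have e8: "reg ?s1 8 = ?p - l" using 2(2) s1 by simp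
  have "runs (Ite 8 (dispatch (Suc l) is) (sim_instr j)) ?s1 (2 * M + (length is * (12 * M) + b)) Q"
  proof (rule runs_Ite)
    assume nz: "reg ?s1 8 ~= 0"
    have lt: "l < ?p" using nz unfolding e8 by linarith
    show "runs (dispatch (Suc l) is) ?s1 (length is * (12 * M) + b) Q"
    proof (rule 2(1)[OF _ _ _ rel1 run1])
      show "Suc l <= ?p" "?p - Suc l < length is" using lt 2(3) by auto
      have "?p - l = Suc (?p - Suc l)" using lt by simp
      then show "is ! (?p - Suc l) = i" using 2(4) by simp
    qed
  next
    assume z: "reg ?s1 8 = 0"
    then have "l = ?p" unfolding e8 using 2(2) by linarith
    then have "j = i" using 2(4) by simp
    then show "runs (sim_instr j) ?s1 (length is * (12 * M) + b) Q"
      using run1[OF rel1 refl refl sim_frame_refl] by (auto intro: runs_mono)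
  next
    have "bit_length (reg ?s1 8) <= B" unfolding e8 by (rule bl)
    then show "bit_length (reg ?s1 8) + 1 + (length is * (12 * M) + b) <= 2 * M + (length is * (12 * M) + b)"
      using M B1 by linarith
  qed
  note ite = this
  show ?case unfolding dispatch.simps
  proof (rule runs_Seq[OF a])
    fix s1 assume "s1 = ?s1"
    then show "runs (Ite 8 (dispatch (Suc l) is) (sim_instr j)) s1 (2 * M + (length is * (12 * M) + b)) Q"
      using ite by simp
  qed simp
qed simp

section \<open>A complete run with a clock\<close>

definition sim_body :: "program => com" where
  "sim_body p = dispatch 0 p ;; Blk [Const 8 (length p), Sub 6 8 4] ;; Ite 5 (Blk [Const 6 0]) (Blk [])"

definition sim_start :: "program => nat => instr list" where
  "sim_start p nr = map (%i. Const (40 + i) 0) [0..<nr] @ [Const 4 0, Const 5 0, Const 8 (length p), Sub 6 8 4]"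

text \<open>Register 6 holds the distance of the simulated program counter from the end of the
  program, which is 0 when the run has halted; a time-out sets it to 0 as well.\<close>

definition sim :: "program => nat => com" where
  "sim p nr = Blk (sim_start p nr) ;; While 6 (sim_body p)"

text \<open>\<open>b0\<close> bounds the bit lengths of the inputs and the constants of the program.
  \<open>B\<close> bounds the bit lengths of clock values, of the base and number of the run and of
  program lines; it is the overhead factor of the simulation.\<close>

locale simulation =
  fixes p :: program and nr :: nat and xs :: "nat list" and b0 Z r B budget :: nat
  assumes regs: "!!i. i \<in> set p ==> instr_regs i \<subseteq> {..<nr}" and nr: "1 <= nr"
    and b0: "1 <= b0" "!!x. x \<in> set xs ==> bit_length x <= b0" "!!i. i \<in> set p ==> bit_length (instr_num i) <= b0"
    and B: "bit_length (8 * (b0 + budget)) <= B" "bit_length Z <= B" "bit_length r <= B"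
      "bit_length (length p) <= B" "!!i. i \<in> set p ==> bit_length (instr_num i) <= B"
begin

definition cfg :: "nat => config" where
  "cfg k = (step p ^^ k) (init xs)"

definition rc :: "nat => nat" where
  "rc k = run_cost p xs k"

lemma rc_Suc: "~ halted p (cfg k) ==> rc (Suc k) = rc k + instr_cost (p ! pc (cfg k)) (cfg k)"
  by (simp add: rc_def run_cost_def step_cost_def cfg_def)

lemma cfg_Suc: "~ halted p (cfg k) ==> cfg (Suc k) = exec_instr (p ! pc (cfg k)) (cfg k)"
  by (simp add: cfg_def step_def)

lemma halted_Suc: "halted p (cfg k) ==> cfg (Suc k) = cfg k & rc (Suc k) = rc k"
  by (simp add: cfg_def step_def rc_def run_cost_def step_cost_def)

lemma rc_mono: "i <= j ==> rc i <= rc j"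
  unfolding rc_def run_cost_def by (rule sum_mono2) auto

lemma halted_mono: "halted p (cfg i) ==> i <= j ==> halted p (cfg j)"
  by (induction j) (auto simp: le_Suc_eq halted_Suc)

lemma instr_p: "~ halted p (cfg k) ==> p ! pc (cfg k) \<in> set p"
  by (simp add: halted_def)

text \<open>An instruction is charged the lengths of its operands, and its result is no longer than
  these together; so the longest number grows by at most the cost.\<close>

lemma bits: "(ALL i. bit_length (reg (cfg k) i) <= b0 + rc k) & (ALL a. bit_length (mem (cfg k) a) <= b0 + rc k)"
proof (induction k)
  case 0
  have "bit_length (mem (init xs) a) <= b0" for a
    using b0(1) b0(2)[of "xs ! a"] by (auto simp: init_def)
  then show ?case using b0(1) by (auto simp: cfg_def init_def trans_le_add1)
next
  case (Suc k)
  show ?case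
  proof (cases "halted p (cfg k)")
    case True then show ?thesis using Suc halted_Suc by simp
  next
    case False
    let ?i = "p ! pc (cfg k)" and ?c = "cfg k"
    let ?L = "instr_cost ?i ?c"
    have old: "bit_length (reg ?c i) <= b0 + (rc k + ?L)" "bit_length (mem ?c a) <= b0 + (rc k + ?L)" for i a
      using Suc by (auto intro: order.trans)
    have new: "bit_length (x + y) <= b0 + (rc k + (bit_length x + bit_length y))"
      "bit_length (x - y) <= b0 + (rc k + (bit_length x + bit_length y))"
      "bit_length (x * y) <= b0 + (rc k + (bit_length x + bit_length y))"
      "bit_length (x div y) <= b0 + (rc k + (bit_length x + bit_length y))" for x y
      using bit_length_add[of x y] bit_length_mult[of x y] bit_length_mono[of "x - y" x]
        bit_length_mono[of "x div y" x] by (auto intro: trans_le_add2 trans_le_add1 order.trans)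
    show ?thesis unfolding rc_Suc[OF False] cfg_Suc[OF False]
      using old new by (cases ?i) auto
  qed
qed

lemma cost_bound:
  assumes "~ halted p (cfg k)"
  shows "instr_cost (p ! pc (cfg k)) (cfg k) <= 2 * (b0 + rc k)"
proof -
  define X where "X = b0 + rc k"
  have "bit_length (reg (cfg k) i) <= X" "bit_length (mem (cfg k) a) <= X" for i a
    using bits[of k] by (auto simp: X_def)
  moreover have "bit_length (instr_num (p ! pc (cfg k))) <= X" "1 <= X"
    using b0(1) b0(3)[OF instr_p[OF assms]] by (auto simp: X_def)
  ultimately have "instr_cost (p ! pc (cfg k)) (cfg k) <= X + X"
    by (cases "p ! pc (cfg k)") (auto intro: add_le_mono trans_le_add1)
  then show ?thesis by (simp add: X_def)
qed

text \<open>A time-out shows only that the budget is less than twice the cost of a halting run,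
  because a charge may be twice the true cost.\<close>

definition finished :: "config => bool" where
  "finished s' \<longleftrightarrow> reg s' 5 = 0 & (EX k. halted p (cfg k) & reg s' 40 = reg (cfg k) 0 & bit_length (reg s' 40) <= b0 + budget) |
     reg s' 5 = 1 & (ALL k. halted p (cfg k) --> budget < 2 * rc k)"

definition step_const :: nat where
  "step_const = length p * 12 + 1010"

lemma sim_body:
  assumes rel: "sim_rel nr Z r (cfg k) s" and nh: "~ halted p (cfg k)" and t: "reg s 5 = 0"
    and clk: "rc k + reg s 3 <= budget"
  defines "L \<equiv> instr_cost (p ! pc (cfg k)) (cfg k)"
  shows "runs (sim_body p) s (step_const * (L * B)) (%s'. sim_frame nr Z r s s' &
    (reg s' 5 = 1 & reg s' 6 = 0 & reg s 3 < 2 * L |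
     reg s' 5 = 0 & reg s' 6 = length p - pc (cfg (Suc k)) & sim_rel nr Z r (cfg (Suc k)) s' &
       (EX E. L <= E & E <= 2 * L & E <= reg s 3 & reg s' 3 = reg s 3 - E)))"
    (is "runs _ _ _ ?Q")
proof -
  let ?i = "p ! pc (cfg k)"
  have B1: "1 <= B" using B(2) bit_length_pos(1) le_trans by blast
  have L1: "1 <= L" unfolding L_def by (cases ?i) (auto simp: Suc_le_eq)
  define M where "M = L * B"
  have LB: "1 <= M" "L <= M" "B <= M"
    using mult_le_mono[OF L1 B1] mult_le_mono1[OF L1, of B] mult_le_mono2[OF B1, of L] unfolding M_def by auto
  have pcl: "pc (cfg k) < length p" using nh by (simp add: halted_def)
  have bpc: "bit_length (pc (cfg k)) <= B" using bit_length_mono[of "pc (cfg k)" "length p"] pcl B(4) by linarith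
  have "4 * L <= 8 * (b0 + budget)" using cost_bound[OF nh] clk unfolding L_def distrib_left by linarith
  then have B4: "bit_length (4 * L) <= B" using bit_length_mono B(1) le_trans by blast
  have bclk: "bit_length (reg s 3) <= B"
  proof -
    have "reg s 3 <= 8 * (b0 + budget)" using clk unfolding distrib_left by linarith
    then show ?thesis using bit_length_mono B(1) le_trans by blast
  qed
  define Q1 where "Q1 s' \<longleftrightarrow> sim_frame nr Z r s s' &
    (reg s' 5 = 1 & reg s 3 < 2 * L & reg s' 4 = pc (cfg k) |
     reg s' 5 = 0 & sim_rel nr Z r (cfg (Suc k)) s' &
       (EX E. L <= E & E <= 2 * L & E <= reg s 3 & reg s' 3 = reg s 3 - E))" for s'
  have run: "runs (sim_instr ?i) s' (1000 * M) Q1"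
    if s': "sim_rel nr Z r (cfg k) s'" "reg s' 3 = reg s 3" "reg s' 5 = reg s 5" "sim_frame nr Z r s s'" for s'
  proof (rule runs_mono[OF sim_instr[OF s'(1) regs[OF instr_p[OF nh]] L_def[THEN meta_eq_to_obj_eq] B4 B(2,3) bpc B(5)[OF instr_p[OF nh]]], folded M_def])
    show "bit_length (reg s' 3) <= B" "reg s' 5 = 0" using s' bclk t by auto
    fix s'' assume *: "sim_frame nr Z r s' s'' &
      (reg s'' 5 = 1 & reg s' 3 < 2 * L & reg s'' 4 = reg s' 4 |
       reg s'' 5 = 0 & sim_rel nr Z r (exec_instr ?i (cfg k)) s'' &
       (EX E>=L. E <= 2 * L & E <= reg s' 3 & reg s'' 3 = reg s' 3 - E))"
    have "sim_frame nr Z r s s''" using * sim_frame_trans[OF s'(4)] by blast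
    moreover have "reg s' 4 = pc (cfg k)" using s'(1) by (simp add: sim_rel_def)
    ultimately show "Q1 s''" using * s'(2) unfolding Q1_def cfg_Suc[OF nh] by auto
  qed auto
  have 1: "runs (dispatch 0 p) s (length p * (12 * M) + 1000 * M) Q1"
    by (rule dispatch[OF rel bpc LB(3) run]) (use pcl in auto)
  have pc4: "bit_length (reg s1 4) <= B" if q: "Q1 s1" for s1
  proof (cases "reg s1 5 = 0")
    case True
    then have r4: "reg s1 4 = pc (cfg (Suc k))" using q unfolding Q1_def sim_rel_def by auto
    have "pc (cfg (Suc k)) = Suc (pc (cfg k)) | pc (cfg (Suc k)) = instr_num ?i"
      unfolding cfg_Suc[OF nh] by (cases ?i) auto
    then show ?thesis
    proof
      assume "pc (cfg (Suc k)) = Suc (pc (cfg k))"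
      then show ?thesis using pcl bit_length_mono[of "Suc (pc (cfg k))" "length p"] B(4) r4 by simp
    qed (use B(5)[OF instr_p[OF nh]] r4 in simp)
  next
    case False then show ?thesis using q bpc unfolding Q1_def by auto
  qed
  define Q2 where "Q2 s' \<longleftrightarrow> Q1 s' & reg s' 6 = length p - reg s' 4" for s'
  have 2: "runs (Blk [Const 8 (length p), Sub 6 8 4]) s1 (3 * M) Q2" if q: "Q1 s1" for s1
  proof (rule runs_Blk)
    show "blk_cost [Const 8 (length p), Sub 6 8 4] s1 <= 3 * M" using pc4[OF q] B(4) LB by simp
    let ?s2 = "blk_exec [Const 8 (length p), Sub 6 8 4] s1"
    have s2: "mem ?s2 = mem s1" "reg ?s2 = (reg s1)(8 := length p, 6 := length p - reg s1 4)" by auto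
    have "sim_rel nr Z r c s1 ==> sim_rel nr Z r c ?s2" for c
      by (erule sim_rel_cong) (use s2 in auto)
    moreover have "sim_frame nr Z r s1 ?s2" using s2 by (auto simp: sim_frame_def)
    ultimately have "Q1 ?s2" using q sim_frame_trans s2 unfolding Q1_def by auto
    then show "Q2 ?s2" unfolding Q2_def using s2 by simp
  qed auto
  have 3: "runs (Ite 5 (Blk [Const 6 0]) (Blk [])) s2 (3 * M) ?Q" if q: "Q2 s2" for s2
  proof (rule runs_Ite)
    have q1: "Q1 s2" and r6: "reg s2 6 = length p - reg s2 4" using q by (auto simp: Q2_def)
    show "runs (Blk [Const 6 0]) s2 M ?Q" if nz: "reg s2 5 ~= 0"
    proof (rule runs_Blk)
      have "sim_frame nr Z r s2 (blk_exec [Const 6 0] s2)" by (auto simp: sim_frame_def)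
      then show "?Q (blk_exec [Const 6 0] s2)"
        using q1 nz sim_frame_trans unfolding Q1_def by auto
    qed (use LB in auto)
    show "runs (Blk []) s2 M ?Q" if z: "reg s2 5 = 0"
      by (rule runs_Blk) (use q1 z r6 in \<open>auto simp: Q1_def sim_rel_def\<close>)
    have "reg s2 5 <= 1" using q1 unfolding Q1_def by auto
    then have "bit_length (reg s2 5) <= 1" using bit_length_mono[of "reg s2 5" 1] by simp
    then show "bit_length (reg s2 5) + 1 + M <= 3 * M" using LB by linarith
  qed
  have "runs (sim_body p) s (step_const * M) ?Q"
    unfolding sim_body_def
  proof (rule runs_Seq[OF 1])
    fix s1 assume "Q1 s1"
    from runs_Seq[OF 2[OF this] 3 le_refl]
    show "runs (Blk [Const 8 (length p), Sub 6 8 4] ;; Ite 5 (Blk [Const 6 0]) (Blk [])) s1 (3 * M + 3 * M) ?Q" .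
  next
    have "step_const * M = length p * (12 * M) + 1010 * M" by (simp add: step_const_def algebra_simps)
    then show "length p * (12 * M) + 1000 * M + (3 * M + 3 * M) <= step_const * M" by linarith
  qed
  then show ?thesis by (simp add: M_def)
qed

text \<open>The clock falls by at least the true cost and at most twice that cost, which the two
  inequalities with \<open>budget\<close> record. The work for an instruction is paid from its
  charge, except for the last one, which may exceed the clock; its cost is at most
  \<open>2 * (b0 + budget)\<close>, whence this extra term.\<close>

lemma sim_loop:
  "sim_rel nr Z r (cfg k) s ==> reg s 5 = 0 ==> reg s 6 = length p - pc (cfg k) ==>
    rc k + reg s 3 <= budget ==> budget <= reg s 3 + 2 * rc k ==> clk = reg s 3 ==>
    runs (While 6 (sim_body p)) s ((step_const + 3) * (B * (clk + 2 * (b0 + budget))) + 2)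
      (%s'. sim_frame nr Z r s s' & finished s')"
proof (induction clk arbitrary: k s rule: less_induct)
  case (less clk)
  note s = less.prems
  have B1: "1 <= B" using B(2) bit_length_pos(1) le_trans by blast
  show ?case
  proof (cases "halted p (cfg k)")
    case True
    then have 6: "reg s 6 = 0" using s(3) by (simp add: halted_def)
    have 40: "reg s 40 = reg (cfg k) 0" using s(1) nr unfolding sim_rel_def by (metis add_0_right less_eq_Suc_le One_nat_def)
    have "bit_length (reg (cfg k) 0) <= b0 + rc k" using bits by blast
    moreover have "b0 + rc k <= b0 + budget" using s(4) by linarith
    ultimately have "bit_length (reg s 40) <= b0 + budget" unfolding 40 by (rule le_trans)
    with 40 have "reg s 40 = reg (cfg k) 0 & bit_length (reg s 40) <= b0 + budget" by blast
    then have "finished s" unfolding finished_def using True s(2) by blast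
    then show ?thesis using 6 by (intro runs_WhileF) (auto simp: sim_frame_refl)
  next
    case False
    define L where "L = instr_cost (p ! pc (cfg k)) (cfg k)"
    have L1: "1 <= L" unfolding L_def by (cases "p ! pc (cfg k)") (auto simp: Suc_le_eq)
    have LX: "L <= 2 * (b0 + budget)" using cost_bound[OF False] s(4) unfolding L_def distrib_left by linarith
    have nz: "reg s 6 ~= 0" using False s(3) by (simp add: halted_def)
    have b6: "bit_length (reg s 6) <= B"
      using bit_length_mono[of "reg s 6" "length p"] s(3) B(4) by simp
    define Q1 where "Q1 s' \<longleftrightarrow> sim_frame nr Z r s s' &
      (reg s' 5 = 1 & reg s' 6 = 0 & reg s 3 < 2 * L |
       reg s' 5 = 0 & reg s' 6 = length p - pc (cfg (Suc k)) & sim_rel nr Z r (cfg (Suc k)) s' &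
         (EX E. L <= E & E <= 2 * L & E <= reg s 3 & reg s' 3 = reg s 3 - E))" for s'
    have body: "runs (sim_body p) s (step_const * (L * B)) Q1"
      using sim_body[OF s(1) False s(2,4)] unfolding Q1_def L_def .
    let ?K = "step_const + 3" and ?X = "2 * (b0 + budget)"
    have LBB: "B <= L * B" using mult_le_mono1[OF L1, of B] by simp
    have rest: "runs (While 6 (sim_body p)) s1 (?K * (B * (clk - L + ?X)) + 2)
        (%s'. sim_frame nr Z r s s' & finished s')" if q: "Q1 s1" and "L <= clk" for s1
    proof (cases "reg s1 5 = 0")
      case True
      then obtain E where E: "L <= E" "E <= 2 * L" "E <= clk" "reg s1 3 = clk - E"
        "reg s1 6 = length p - pc (cfg (Suc k))" "sim_rel nr Z r (cfg (Suc k)) s1" and fr: "sim_frame nr Z r s s1"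
        using q s(6) unfolding Q1_def by auto
      have rcS: "rc (Suc k) = rc k + L" using rc_Suc[OF False] by (simp add: L_def)
      have "runs (While 6 (sim_body p)) s1 (?K * (B * (clk - E + ?X)) + 2) (%s'. sim_frame nr Z r s1 s' & finished s')"
        by (rule less.IH[where k = "Suc k"]) (use E True L1 rcS s(4-6) in auto)
      moreover have "?K * (B * (clk - E + ?X)) <= ?K * (B * (clk - L + ?X))"
        using E by (intro mult_le_mono2) linarith
      ultimately show ?thesis using that(2) by (elim runs_mono) (auto intro: sim_frame_trans[OF fr])
    next
      case False
      then have q': "reg s1 6 = 0" "reg s 3 < 2 * L" "sim_frame nr Z r s s1" using q unfolding Q1_def by auto
      have r5: "reg s1 5 = 1" using q False unfolding Q1_def by auto
      have "finished s1" unfolding finished_def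
      proof (intro disjI2 conjI allI impI)
        fix k' assume k': "halted p (cfg k')"
        have "Suc k <= k'"
        proof (rule ccontr)
          assume "~ Suc k <= k'"
          then show False using halted_mono[OF k', of k] \<open>~ halted p (cfg k)\<close> by simp
        qed
        then have "rc (Suc k) <= rc k'" by (rule rc_mono)
        then show "budget < 2 * rc k'" using rc_Suc[OF \<open>~ halted p (cfg k)\<close>] q'(2) s(5) unfolding L_def by linarith
      qed fact
      then show ?thesis using q' by (intro runs_WhileF) auto
    qed
    have rest': "runs (While 6 (sim_body p)) s1 2 (%s'. sim_frame nr Z r s s' & finished s')"
      if q: "Q1 s1" and lt: "clk < L" for s1
    proof -
      have "reg s1 5 ~= 0" using q lt s(6) unfolding Q1_def by auto
      then have q': "reg s1 6 = 0" "reg s 3 < 2 * L" "sim_frame nr Z r s s1" using q unfolding Q1_def by auto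
      have r5: "reg s1 5 = 1" using q lt s(6) unfolding Q1_def by auto
      have "finished s1" unfolding finished_def
      proof (intro disjI2 conjI allI impI)
        fix k' assume k': "halted p (cfg k')"
        have "Suc k <= k'"
        proof (rule ccontr)
          assume "~ Suc k <= k'"
          then show False using halted_mono[OF k', of k] \<open>~ halted p (cfg k)\<close> by simp
        qed
        then have "rc (Suc k) <= rc k'" by (rule rc_mono)
        then show "budget < 2 * rc k'" using rc_Suc[OF \<open>~ halted p (cfg k)\<close>] q'(2) s(5) unfolding L_def by linarith
      qed fact
      then show ?thesis using q' by (intro runs_WhileF) auto
    qed
    have pay: "bit_length (reg s 6) + 1 + step_const * (L * B) <= ?K * (B * L)"
    proof -
      have "?K * (B * L) = step_const * (L * B) + 3 * (L * B)" by (simp add: algebra_simps)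
      then show ?thesis using b6 LBB B1 by linarith
    qed
    show ?thesis
    proof (cases "L <= clk")
      case True
      have "?K * (B * (clk + ?X)) = ?K * (B * (clk - L + ?X)) + ?K * (B * L)"
      proof -
        have "clk + ?X = (clk - L + ?X) + L" using True by simp
        then show ?thesis by (simp only: distrib_left)
      qed
      then have le: "bit_length (reg s 6) + 1 + step_const * (L * B) + (?K * (B * (clk - L + ?X)) + 2)
          <= ?K * (B * (clk + ?X)) + 2" using pay by linarith
      show ?thesis
        by (rule runs_WhileT[OF nz body _ le]) (use rest True in simp)
    next
      case False
      have "?K * (B * L) <= ?K * (B * (clk + ?X))" using LX by (intro mult_le_mono2) linarith
      then have le: "bit_length (reg s 6) + 1 + step_const * (L * B) + 2 <= ?K * (B * (clk + ?X)) + 2"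
        using pay by linarith
      show ?thesis by (rule runs_WhileT[OF nz body _ le]) (use rest' False in simp)
    qed
  qed
qed

text \<open>The simulation is linear in the budget apart from \<open>b0\<close> and the factor
  \<open>B\<close>, which only has to exceed a few bit lengths; so the exponent in the running time
  of \<open>p\<close> survives.\<close>

theorem sim_run:
  assumes "reg s 1 = Z" "reg s 2 = r" "reg s 3 = budget" "!!a. mem s (addr Z r a) = mem (init xs) a"
  shows "runs (sim p nr) s ((3 * step_const + 20 + nr) * (B * (b0 + budget)))
    (%s'. sim_frame nr Z r s s' & finished s')"
proof -
  have B1: "1 <= B" using B(2) bit_length_pos(1) le_trans by blast
  define Y where "Y = B * (b0 + budget)"
  have Y: "1 <= Y" "B <= Y" using mult_le_mono[OF B1 b0(1)] mult_le_mono[of B B 1 "b0 + budget"] b0(1)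
    mult_le_mono[OF B1, of 1 "b0 + budget"] unfolding Y_def by auto
  define Q1 where "Q1 s' \<longleftrightarrow> sim_frame nr Z r s s' & sim_rel nr Z r (cfg 0) s' & reg s' 5 = 0 &
    reg s' 6 = length p - pc (cfg 0) & reg s' 3 = budget" for s'
  have 1: "runs (Blk (sim_start p nr)) s (nr + 5 * B) Q1"
  proof (rule runs_Blk)
    have ap: "blk_exec (is @ js) s = blk_exec js (blk_exec is s)"
      "blk_cost (is @ js) s = blk_cost is s + blk_cost js (blk_exec is s)" for "is" js s
      by (induction "is" arbitrary: s) auto
    have clr: "mem (blk_exec (map (%i. Const (40 + i) 0) [0..<m]) s) = mem s &
      reg (blk_exec (map (%i. Const (40 + i) 0) [0..<m]) s) =
        (%j. if 40 <= j & j < 40 + m then 0 else reg s j) &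
      blk_cost (map (%i. Const (40 + i) 0) [0..<m]) s = m" for m s
      by (induction m) (auto simp: ap fun_eq_iff)
    show "list_all straight (sim_start p nr)" by (auto simp: sim_start_def list_all_iff)
    have "blk_cost (sim_start p nr) s = nr + (1 + 1 + bit_length (length p) + (bit_length (length p) + 1))"
      unfolding sim_start_def ap using clr[of nr s] by simp
    then show "blk_cost (sim_start p nr) s <= nr + 5 * B" using B(4) B1 by linarith
    have e: "mem (blk_exec (sim_start p nr) s) = mem s"
      "reg (blk_exec (sim_start p nr) s) = (%j. if 40 <= j & j < 40 + nr then 0 else reg s j)
        (4 := 0, 5 := 0, 8 := length p, 6 := length p)"
      unfolding sim_start_def ap using clr[of nr s] by auto
    show "Q1 (blk_exec (sim_start p nr) s)"
      unfolding Q1_def sim_frame_def sim_rel_def e using assms by (auto simp: cfg_def init_def)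
  qed
  show ?thesis unfolding sim_def Y_def[symmetric]
  proof (rule runs_Seq[OF 1])
    fix s1 assume q: "Q1 s1"
    have "runs (While 6 (sim_body p)) s1 ((step_const + 3) * (B * (budget + 2 * (b0 + budget))) + 2)
      (%s'. sim_frame nr Z r s1 s' & finished s')"
      by (rule sim_loop[where k = 0]) (use q in \<open>auto simp: Q1_def rc_def run_cost_def\<close>)
    then show "runs (While 6 (sim_body p)) s1 ((step_const + 3) * (3 * Y) + 2) (%s'. sim_frame nr Z r s s' & finished s')"
    proof (rule runs_mono)
      have "B * (budget + 2 * (b0 + budget)) <= B * (3 * (b0 + budget))" by (intro mult_le_mono2) simp
      also have "... = 3 * Y" by (simp add: Y_def)
      finally show "(step_const + 3) * (B * (budget + 2 * (b0 + budget))) + 2 <= (step_const + 3) * (3 * Y) + 2" by simp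
    qed (use q sim_frame_trans in \<open>auto simp: Q1_def\<close>)
  next
    have "(3 * step_const + 20 + nr) * Y = (step_const + 3) * (3 * Y) + 11 * Y + nr * Y" by (simp add: algebra_simps)
    moreover have "nr * 1 <= nr * Y" using Y(1) by (rule mult_le_mono2)
    ultimately show "nr + 5 * B + ((step_const + 3) * (3 * Y) + 2) <= (3 * step_const + 20 + nr) * Y"
      using Y by linarith
  qed
qed

end

section \<open>Parsing the formula\<close>

text \<open>Parser state: clauses to come, literals of the current clause to come, current clause,
  finished clauses.\<close>

type_synonym parser = "nat \<times> nat \<times> nat list \<times> nat list list"

text \<open>Once no clause is expected any more, all symbols are ignored, so the padding behind the
  formula is harmless. The symbol 0 in place of a length yields an empty clause at once.\<close>

definition parse_step :: "parser => nat => parser" where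
  "parse_step st x = (if fst (snd st) = 0 then
       (if fst st = 0 then st
        else if x = 0 then (fst st - 1, 0, [], [] # snd (snd (snd st)))
        else (fst st, x, [], snd (snd (snd st))))
     else if fst (snd st) = 1 then (fst st - 1, 0, [], (x # fst (snd (snd st))) # snd (snd (snd st)))
     else (fst st, fst (snd st) - 1, x # fst (snd (snd st)), snd (snd (snd st))))"

lemma sz_parse_step: "sz (parse_step st x) <= sz st + 4"
  by (cases st) (auto simp: parse_step_def intro: order.trans[OF sz_pos])

lemma PT_parse: "PT f ==> PT g ==> PT (%e. foldl parse_step (f e, 0, [], []) (g e))"
proof -
  assume f: "PT f" and g: "PT g"
  have sz: "sz (foldl parse_step st xs) <= sz st + 4 * length xs" for st xs
  proof (induction xs arbitrary: st)
    case (Cons x xs)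
    have "sz (foldl parse_step (parse_step st x) xs) <= sz (parse_step st x) + 4 * length xs" by (rule Cons)
    then show ?case using sz_parse_step[of st x] by simp
  qed simp
  show ?thesis
  proof (rule PT_foldl[where b = "%e. 8 + 4 * sz (g e)"])
    show "PT (%e. (f e, 0 :: nat, [] :: nat list, [] :: nat list list))" by (intro PT_rules f)
    show "PT (%z. parse_step (fst (snd z)) (snd (snd z)))" unfolding parse_step_def by (intro PT_rules)
    show "polyb (%e. 8 + 4 * sz (g e))" by (intro polyb_add polyb_mult polyb_const PT_szD g)
    fix e ys zs assume "g e = ys @ zs"
    then have "length ys <= sz (g e)" using sz_list_ge_length[of "g e"] by simp
    then show "sz (foldl parse_step (f e, 0, [], []) ys) <= 8 + 4 * sz (g e)"
      using sz[of "(f e, 0, [], [])" ys] by simp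
  qed fact
qed

lemma parse_clause:
  "ls ~= [] ==> foldl parse_step (m, length ls, cur, F) ls = (m - 1, 0, [], (rev ls @ cur) # F)"
proof (induction ls arbitrary: cur)
  case (Cons l ls)
  then show ?case by (cases ls) (auto simp: parse_step_def)
qed simp

lemma parse_clauses:
  "foldl parse_step (length Cs, 0, [], F) (concat (map (%C. length C # C) Cs)) = (0, 0, [], rev (map rev Cs) @ F)"
proof (induction Cs arbitrary: F)
  case (Cons C Cs)
  have "foldl parse_step (Suc (length Cs), 0, [], F) (length C # C) = (length Cs, 0, [], rev C # F)"
  proof (cases "C = []")
    case True
    then show ?thesis by (simp add: parse_step_def)
  next
    case False
    then have "parse_step (Suc (length Cs), 0, [], F) (length C) = (Suc (length Cs), length C, [], F)"
      by (simp add: parse_step_def)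
    then show ?thesis using parse_clause[OF False, of "Suc (length Cs)" "[]" F] by simp
  qed
  then show ?case using Cons.IH[of "rev C # F"] by simp
qed simp

lemma parse_zeros: "foldl parse_step (0, 0, [], F) (replicate z 0) = (0, 0, [], F)"
  by (induction z) (auto simp: parse_step_def)

text \<open>The entries of \<open>xs\<close> are ignored: the list serves as a ruler. A list of
  length \<open>n\<close> cannot be produced in polynomial time from the number \<open>n\<close>,
  whose size is 1, but the input padded with at least \<open>n\<close> zeros is long enough.\<close>

definition pairs :: "nat list => (nat \<times> nat) list" where
  "pairs xs = snd (foldl (%s _. (Suc (Suc (fst s)), snd s @ [(fst s, Suc (fst s))])) (0, []) xs)"

lemma pairs: "pairs xs = map var_pair [0..<length xs]"
proof -
  have "foldl (%s _. (Suc (Suc (fst s)), snd s @ [(fst s, Suc (fst s))])) (0, []) xs =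
    (2 * length xs, map var_pair [0..<length xs])"
    by (induction xs rule: rev_induct) (auto simp: var_pair_def)
  then show ?thesis by (simp add: pairs_def)
qed

lemma PT_pairs: "PT f ==> PT (%e. pairs (f e))"
proof (rule PT_comp[of pairs])
  have szp: "sz (map var_pair xs) = 1 + 4 * length xs" for xs by (induction xs) (auto simp: var_pair_def)
  have st: "foldl (%s _. (Suc (Suc (fst s)), snd s @ [(fst s, Suc (fst s))])) (0, []) xs =
    (2 * length xs, map var_pair [0..<length xs])" for xs :: "nat list"
    by (induction xs rule: rev_induct) (auto simp: var_pair_def)
  show "PT pairs" unfolding pairs_def
  proof (rule PT_snd, rule PT_foldl[where a = "%_. (0, [])" and g = "%x. x" and b = "%e. 3 + 4 * sz e"
        and f = "%_ s _. (Suc (Suc (fst s)), snd s @ [(fst s, Suc (fst s))])"])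
    show "polyb (%e::nat list. 3 + 4 * sz e)" by (intro polyb_add polyb_mult polyb_const polyb_sz)
    fix e ys zs :: "nat list" assume "e = ys @ zs"
    then have "length ys <= sz e" using sz_list_ge_length[of e] by simp
    then show "sz (foldl (%s _. (Suc (Suc (fst s)), snd s @ [(fst s, Suc (fst s))])) (0, []) ys) <= 3 + 4 * sz e"
      unfolding st by (simp add: szp)
  qed (intro PT_rules)+
qed

text \<open>Selecting from the sorted list \<open>U\<close> of all literals those that occur in
  \<open>C\<close> gives the sorted, repetition-free form of the clause without a sorting
  procedure.\<close>

definition dedup :: "nat list => nat list list => nat list list" where
  "dedup U F = foldl (%acc C. if EX D:set acc. set C \<subseteq> set D & set D \<subseteq> set C then acc
     else filter (%l. l \<in> set C) U # acc) [] F"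

lemma PT_dedup: "PT f ==> PT g ==> PT (%e. dedup (f e) (g e))"
proof -
  assume fg: "PT f" "PT g"
  let ?st = "%U acc C. if EX D:set acc. set C \<subseteq> set D & set D \<subseteq> set C then acc
     else filter (%l. l \<in> set C) U # (acc :: nat list list)"
  have szf: "sz (filter P U) <= sz U" for P and U :: "nat list" by (induction U) auto
  have sz: "sz (foldl (?st U) acc F) <= sz acc + length F * (sz U + 1)" for U acc F
  proof (induction F arbitrary: acc)
    case (Cons C F)
    have "sz (foldl (?st U) (?st U acc C) F) <= sz (?st U acc C) + length F * (sz U + 1)" by (rule Cons)
    moreover have "sz (?st U acc C) <= sz acc + (sz U + 1)" using szf[of "%l. l \<in> set C" U] by auto
    ultimately show ?case by simp
  qed simp
  have "PT (%z. dedup (fst z) (snd z))" unfolding dedup_def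
  proof (rule PT_foldl[where b = "%e. 1 + sz (snd e) * (sz (fst e) + 1)"])
    show "PT (%z. ?st (fst (fst z)) (fst (snd z)) (snd (snd z)))" by (intro PT_rules)
    show "polyb (%e :: nat list \<times> nat list list. 1 + sz (snd e) * (sz (fst e) + 1))"
      by (intro polyb_add polyb_mult polyb_const PT_szD PT_rules)
    fix e :: "nat list \<times> nat list list" and ys zs assume "snd e = ys @ zs"
    then have "length ys <= sz (snd e)" using sz_list_ge_length[of "snd e"] by simp
    then have "length ys * (sz (fst e) + 1) <= sz (snd e) * (sz (fst e) + 1)" by (rule mult_le_mono1)
    then show "sz (foldl (?st (fst e)) [] ys) <= 1 + sz (snd e) * (sz (fst e) + 1)"
      using sz[of "fst e" "[]" ys] by simp
  qed (intro PT_rules)+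
  from PT_comp[OF this PT_pair[OF fg]] show ?thesis by simp
qed

lemma dedup:
  assumes U: "sorted_wrt (<) U"
  shows "ALL C:set F. set C \<subseteq> set U ==> wf_clauses (dedup U F) & clauses (dedup U F) = clauses F"
proof (induction F rule: rev_induct)
  case Nil
  then show ?case by (simp add: dedup_def wf_clauses_def clauses_def)
next
  case (snoc C F)
  let ?G = "dedup U F" and ?C = "filter (%l. l \<in> set C) U"
  have IH: "wf_clauses ?G" "clauses ?G = clauses F" using snoc by auto
  have sC: "set ?C = set C" using snoc.prems by auto
  have step: "dedup U (F @ [C]) = (if EX D:set ?G. set C \<subseteq> set D & set D \<subseteq> set C then ?G else ?C # ?G)"
    unfolding dedup_def by (simp only: foldl_append foldl.simps)
  have "(EX D:set ?G. set C \<subseteq> set D & set D \<subseteq> set C) \<longleftrightarrow> set C \<in> clauses ?G"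
    unfolding clauses_def by auto
  then have step: "dedup U (F @ [C]) = (if set C \<in> clauses ?G then ?G else ?C # ?G)" using step by simp
  have cl: "clauses (F @ [C]) = insert (set C) (clauses F)" by (auto simp: clauses_def)
  show ?case
  proof (cases "set C \<in> clauses ?G")
    case True
    then show ?thesis using IH cl step by auto
  next
    case False
    have "?C \<notin> set ?G"
    proof
      assume "?C \<in> set ?G"
      from imageI[OF this, of set] show False using False unfolding sC clauses_def by simp
    qed
    moreover have "sorted_wrt (<) ?C" using U by (rule sorted_wrt_filter)
    ultimately have "wf_clauses (?C # ?G)" using IH(1) by (auto simp: wf_clauses_def)
    moreover have "clauses (?C # ?G) = insert (set C) (clauses ?G)" using sC by (simp add: clauses_def)
    ultimately show ?thesis using False step IH(2) cl by simp
  qed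
qed

definition prepare_fun :: "nat => nat => nat list => nat list => item \<times> (nat \<times> nat) list \<times> (nat \<times> nat) list" where
  "prepare_fun n m xs fl = (
     (dedup (concat (map (%v. [fst v, snd v]) (filter (%v. fst v div 2 < n) (pairs fl))))
        (snd (snd (snd (foldl parse_step (m, 0, [], []) xs)))),
      filter (%v. fst v div 2 < n & n div 3 <= fst v div 2 - n div 3) (filter (%v. n div 3 <= fst v div 2) (pairs fl)), []),
     filter (%v. fst v div 2 < n div 3) (pairs fl),
     filter (%v. n div 3 <= fst v div 2 & fst v div 2 - n div 3 < n div 3) (pairs fl))"

definition prepare :: "nat list => item \<times> (nat \<times> nat) list \<times> (nat \<times> nat) list" where
  "prepare fl = (case fl of [] => (([], [], []), [], [])
     | n # ys => (case ys of [] => (([], [], []), [], []) | m # xs => prepare_fun n m xs fl))"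

lemma PT_prepare: "PT prepare"
  unfolding prepare_def prepare_fun_def
  by (intro PT_case_list PT_rules PT_dedup PT_parse PT_pairs)

lemma filter_var_pairs: "filter (%v. P (fst v div 2)) (map var_pair xs) = map var_pair (filter P xs)"
  by (simp add: filter_map comp_def var_pair_def)

lemma filter_upt_interval: "b <= m ==> filter (%v. a <= v & v < b) [0..<m] = [a..<b]"
proof (induction m)
  case (Suc m)
  show ?case
  proof (cases "b = Suc m")
    case True
    have *: "filter (%v. a <= v & v < m) [0..<m] = [a..<m]" if "a <= m" for a m
    proof -
      have "[0..<m] = [0..<a] @ [a..<m]" using that upt_add_eq_append[of 0 a "m - a"] by simp
      then show ?thesis by (simp add: filter_empty_conv filter_id_conv)
    qed
    show ?thesis
    proof (cases "a <= Suc m")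
      case True
      from *[OF this] \<open>b = Suc m\<close> show ?thesis by simp
    next
      case False
      then show ?thesis using \<open>b = Suc m\<close> by (auto simp: filter_empty_conv)
    qed
  next
    case False
    then show ?thesis using Suc by simp
  qed
qed simp

lemma prepare_encode:
  assumes \<phi>: "\<phi> \<in> k_cnf k n" and q: "q = n div 3" and z: "n <= z"
    and F: "prepare (encode_cnf n \<phi> @ replicate z 0) = ((F, Vz, zs), Vx, Vy)"
  shows "wf_clauses F" "clauses F = (%C. encode_literal ` set C) ` set \<phi>" "!!C. C \<in> set F ==> length C <= k"
    "clauses F \<subseteq> Pow {..<2 * n}"
    "Vx = map var_pair [0..<q]" "Vy = map var_pair [q..<2 * q]" "Vz = map var_pair [2 * q..<n]" "zs = []"
proof -
  let ?Cs = "map (map encode_literal) \<phi>"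
  let ?xs = "concat (map (%C. length C # C) ?Cs) @ replicate z 0"
  let ?fl = "encode_cnf n \<phi> @ replicate z 0"
  have fl: "?fl = n # length \<phi> # ?xs" by (simp add: encode_cnf_def comp_def)
  have lfl: "n <= length ?fl" using z by simp
  define m where "m = length ?fl"
  have mn: "n <= m" using lfl by (simp add: m_def)
  have pr: "pairs ?fl = map var_pair [0..<m]" by (simp add: pairs m_def)
  have U: "concat (map (%v. [fst v, snd v]) (filter (%v. fst v div 2 < n) (pairs ?fl))) = [0..<2 * n]"
  proof -
    have "filter (%v. v < n) [0..<m] = [0..<n]" using filter_upt_interval[OF mn, of 0] by simp
    moreover have "concat (map (%v. [fst v, snd v]) (map var_pair [0..<n])) = [0..<2 * n]" for n
      by (induction n) (auto simp: var_pair_def)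
    ultimately show ?thesis unfolding pr filter_var_pairs[of "%v. v < n"] by simp
  qed
  have ps: "snd (snd (snd (foldl parse_step (length \<phi>, 0, [], []) ?xs))) = rev (map rev ?Cs)"
    using parse_clauses[of ?Cs "[]"] by (simp add: parse_zeros)
  have st: "prepare ?fl = ((dedup [0..<2 * n] (rev (map rev ?Cs)),
      filter (%v. fst v div 2 < n & q <= fst v div 2 - q) (filter (%v. q <= fst v div 2) (pairs ?fl)), []),
      filter (%v. fst v div 2 < q) (pairs ?fl),
      filter (%v. q <= fst v div 2 & fst v div 2 - q < q) (pairs ?fl))"
    unfolding prepare_def prepare_fun_def U[symmetric] ps[symmetric] q by (simp add: fl)
  have eqs: "F = dedup [0..<2 * n] (rev (map rev ?Cs))"
    "Vz = filter (%v. fst v div 2 < n & q <= fst v div 2 - q) (filter (%v. q <= fst v div 2) (pairs ?fl))" "zs = []"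
    "Vx = filter (%v. fst v div 2 < q) (pairs ?fl)"
    "Vy = filter (%v. q <= fst v div 2 & fst v div 2 - q < q) (pairs ?fl)"
    using F unfolding st by auto
  have lit: "encode_literal l < 2 * n" if "C \<in> set \<phi>" "l \<in> set C" for C l
  proof -
    have "fst l < n" using \<phi> that by (auto simp: k_cnf_def)
    then show ?thesis by (cases "snd l") (auto simp: encode_literal_def)
  qed
  have sub: "ALL C:set (rev (map rev ?Cs)). set C \<subseteq> set [0..<2 * n]" using lit by auto
  have so: "sorted_wrt (<) [0..<2 * n]" by simp
  from dedup[OF so sub] have d: "wf_clauses F" "clauses F = clauses (rev (map rev ?Cs))" using eqs by auto
  show "wf_clauses F" by fact
  show cl: "clauses F = (%C. encode_literal ` set C) ` set \<phi>"
    unfolding d(2) by (simp add: clauses_def image_image)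
  show "clauses F \<subseteq> Pow {..<2 * n}" unfolding cl using lit by auto
  show "length C <= k" if "C \<in> set F" for C
  proof -
    have "set C \<in> clauses F" using that by (simp add: clauses_def)
    then obtain D where D: "D \<in> set \<phi>" "set C = encode_literal ` set D" unfolding cl by auto
    have "length C = card (set C)" using d(1) that sorted_card by (auto simp: wf_clauses_def)
    also have "... <= card (set D)" unfolding D(2) by (rule card_image_le) simp
    also have "... <= length D" by (rule card_length)
    also have "... <= k" using D(1) \<phi> by (auto simp: k_cnf_def)
    finally show ?thesis .
  qed
  have q3: "2 * q <= n" "q <= m" "2 * q <= m" using q mn by auto
  show "Vx = map var_pair [0..<q]"
    using filter_upt_interval[OF q3(2), of 0] unfolding eqs pr filter_var_pairs[of "%v. v < q"] by simp
  have "filter (%v. q <= v & v - q < q) [0..<m] = filter (%v. q <= v & v < 2 * q) [0..<m]"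
    by (rule filter_cong) auto
  then show "Vy = map var_pair [q..<2 * q]"
    unfolding eqs pr filter_var_pairs[of "%v. q <= v & v - q < q"] filter_upt_interval[OF q3(3)] by simp
  have "filter (%v. v < n & q <= v - q) (filter (%v. q <= v) [0..<m]) = filter (%v. 2 * q <= v & v < n) [0..<m]"
    unfolding filter_filter by (rule filter_cong) auto
  then show "Vz = map var_pair [2 * q..<n]"
    unfolding eqs pr filter_var_pairs[of "%v. q <= v"] filter_var_pairs[of "%v. v < n & q <= v - q"]
      filter_upt_interval[OF mn] by simp
  show "zs = []" by fact
qed

lemma lit_true_encode: "lit_true \<sigma> (encode_literal l) \<longleftrightarrow> \<sigma> (fst l) = snd l"
  by (auto simp: lit_true_def encode_literal_def)

lemma item_sat_initial:
  assumes "clauses F = (%C. encode_literal ` set C) ` set \<phi>"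
  shows "item_sat (F, V, []) \<longleftrightarrow> satisfiable \<phi>"
proof -
  have "(ALL C:set F. EX l:set C. lit_true \<sigma> l) \<longleftrightarrow> (ALL S:clauses F. EX l:S. lit_true \<sigma> l)" for \<sigma>
    by (auto simp: clauses_def)
  then show ?thesis unfolding item_sat_def satisfiable_def assms by (simp add: lit_true_encode)
qed

section \<open>The search program\<close>

text \<open>Turns the rounded logarithm into inequalities between powers of integers, which the
  program can test.\<close>

lemma dim_eq:
  assumes "1 <= N" "N ^ c <= 2 ^ d" "d = 0 | 2 ^ (d - 1) < N ^ c"
  shows "nat \<lceil>real c * log 2 (real N)\<rceil> = d"
proof -
  have N: "0 < real N" using assms(1) by simp
  have l: "real c * log 2 (real N) = log 2 (real (N ^ c))" using N by (simp add: log_nat_power)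
  have Nc: "0 < real (N ^ c)" using N by simp
  have "log 2 (real (N ^ c)) <= log 2 (real (2 ^ d))" using assms(2) Nc by (subst log_le_cancel_iff) (auto simp del: of_nat_power)
  then have u: "log 2 (real (N ^ c)) <= real d" by (simp add: log_nat_power)
  have "real d - 1 < log 2 (real (N ^ c))"
  proof (cases "d = 0")
    case True
    have "1 <= N ^ c" using assms(1) by (rule one_le_power)
    then have "real 1 <= real (N ^ c)" by (simp only: of_nat_le_iff)
    then have "0 <= log 2 (real (N ^ c))" using Nc by (simp only: zero_le_log_cancel_iff of_nat_1)
    then show ?thesis using True by simp
  next
    case False
    then have "log 2 (real (2 ^ (d - 1))) < log 2 (real (N ^ c))"
      using assms(3) Nc by (subst log_less_cancel_iff) (auto simp del: of_nat_power)
    moreover have "log 2 (real (2 ^ (d - 1))) = real d - 1" using False by (simp add: log_nat_power)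
    ultimately show ?thesis by simp
  qed
  then have "\<lceil>log 2 (real (N ^ c))\<rceil> = int d" using u by (intro ceiling_unique) auto
  then show ?thesis unfolding l by simp
qed

lemma holds_nat: "holds s k (x :: nat) V \<longleftrightarrow> reg s k = x & x <= V"
  by (auto simp: holds_def enc_nat_def)

text \<open>The programs defined here depend only on \<open>k\<close>, \<open>p\<close>,
  \<open>nr\<close>, \<open>c\<close> and the codes \<open>ce\<close> and \<open>cn\<close>, so one
  program serves all inputs; the other parameters describe a single input and its analysis.
  \<open>Vmax\<close> is to bound all numbers handled by the driver itself, and costs are counted in
  units of its bit length. The second condition on \<open>c\<close> leaves two coordinates for each
  clause of a leaf, since \<open>N >= 2 * 2 ^ q\<close> gives dimension at least
  \<open>c * (q + 1)\<close>.\<close>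

locale driver = items A k n F0 K q for A k n F0 K q +
  fixes p :: program and nr c Z Vmax Te Tn Lmax dmax :: nat
    and ce cn :: com and te :: "item => nat" and tn :: "nat \<times> item \<times> job_ctx => nat" and T :: "nat => nat"
  assumes code_ex: "!!s x V. hp_ok s V ==> holds s (40 + nr) x V ==>
      EX s'. xc ce s (te x) (V + te x) s' & post (40 + nr) s (expand K (params (thresh A) k) x) (V + te x) s'"
    and code_entry: "!!s x V. hp_ok s V ==> holds s (40 + nr) x V ==>
      EX s'. xc cn s (tn x) (V + tn x) s' & post (40 + nr) s (entry x) (V + tn x) s'"
    and te: "!!x. item_inv x ==> te x <= Te"
    and tn: "!!a x N d Nd Nd4 R R2. item_inv x ==>
      tn (a, x, map var_pair [0..<q], map var_pair [q..<2 * q], N, d, Nd, Nd4, R, R2) <= Tn"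
    and regs: "!!i. i \<in> set p ==> instr_regs i \<subseteq> {..<nr}" and nr: "1 <= nr"
    and nums: "!!i. i \<in> set p ==> instr_num i <= Vmax" "length p <= Vmax"
    and c: "1 <= c" "2 * (1 + 2 * n + k * (2 * n * thresh A k)) <= c * (q + 1)"
    and dec: "decides_in_time p (stable_verification (%N. nat \<lceil>real c * log 2 (real N)\<rceil>)) T"
    and Vmax: "2 * (4 * 2 ^ q) ^ c <= Vmax" "Z <= Vmax" "2 * Lmax + 2 <= Vmax" "2 <= Vmax"
    and dmax: "dmax = c * (q + 2)" and Lmax: "Lmax = 2 + 4 * (4 * 2 ^ q * dmax) + 4 * 2 ^ q"
begin

abbreviation "R \<equiv> (2 :: nat) ^ q"
abbreviation "Vx \<equiv> map var_pair [0..<q]"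
abbreviation "Vy \<equiv> map var_pair [q..<2 * q]"
abbreviation "lg \<equiv> bit_length Vmax"

lemma beta: "x <= Vmax ==> bit_length x <= lg" by (rule bit_length_mono)

lemma beta2: "2 <= lg" using beta[OF Vmax(4)] by simp

lemma xc_runs: "xc cd s t V s' ==> t <= t' ==> V <= Vmax ==> Q s' ==> runs cd s (t' * lg) Q"
  using xc_mono[of cd s t V s' t' Vmax] unfolding runs_def xc_def by blast

lemma seq:
  assumes "runs c1 s (t1 * lg) Q1" "!!s1. Q1 s1 ==> runs c2 s1 (t2 * lg) Q" "t1 + t2 <= t"
  shows "runs (c1 ;; c2) s (t * lg) Q"
proof (rule runs_Seq[OF assms(1,2)])
  have "t1 * lg + t2 * lg = (t1 + t2) * lg" by (simp add: distrib_right)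
  also have "... <= t * lg" using assms(3) by (rule mult_le_mono1)
  finally show "t1 * lg + t2 * lg <= t * lg" .
qed

text \<open>
  Register 0 is the heap pointer, 1 and 2 hold the base and the number of the current simulated
  run, 13 the worklist, 14 the size being tried, 15, 16 and 21 the numbers \<open>2 R\<close>, \<open>4 R\<close> and \<open>R\<close>, 17 the
  clock, 18 the answer, 19 and 20 the literal pairs of the first two blocks. The registers of the
  simulated program start at 40.
\<close>

definition core :: "nat => config => nat => nat => nat => item list => bool" where
  "core V s r N bu its \<longleftrightarrow> hp_ok s V & reg s 1 = Z & reg s 2 = r & r <= Vmax &
     holds s 13 its V & holds s 19 Vx V & holds s 20 Vy V & reg s 21 = R & reg s 15 = 2 * R &
     reg s 16 = 4 * R & reg s 14 = N & 2 * R <= N & N < 4 * R & reg s 17 = bu & 1 <= bu & bu <= Vmax & Lmax <= V"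

text \<open>Memory is not cleared between runs. Each run has its own cells, and these are still zero
  when it starts, as \<open>init\<close> demands outside the input.\<close>

definition fresh :: "nat => config => bool" where
  "fresh r s \<longleftrightarrow> (ALL r' a. r <= r' --> mem s (addr Z r' a) = 0)"

lemma fresh_ext: "fresh r s ==> ext m s s' ==> fresh r s'"
  using addr_odd by (auto simp: fresh_def ext_def)

lemma core_ext:
  assumes "core V s r N bu its" "ext m s s'" "22 <= m" "hp_ok s' V'" "V <= V'"
  shows "core V' s' r N bu its"
proof -
  have h: "hp_ok s V" "holds s 13 its V" "holds s 19 Vx V" "holds s 20 Vy V" using assms(1) by (auto simp: core_def)
  have "holds s' 13 its V'" "holds s' 19 Vx V'" "holds s' 20 Vy V'"
    using holds_ext[OF h(2) assms(2) _ _ assms(5)] holds_ext[OF h(3) assms(2) _ _ assms(5)]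
      holds_ext[OF h(4) assms(2) _ _ assms(5)] assms(3) by auto
  moreover have "!!i. 0 < i ==> i < 22 ==> reg s' i = reg s i" using assms(2,3) by (auto simp: ext_def)
  ultimately show ?thesis using assms(1,4,5) unfolding core_def by auto
qed

text \<open>Trees occupy even cells only, so writing an instance or simulating a run, which touches
  odd cells, leaves them intact.\<close>

lemma holds_even:
  "holds s i x V ==> reg s' i = reg s i ==> reg s' 0 = reg s 0 ==> (!!a. even a ==> mem s' a = mem s a) ==> holds s' i x V"
  unfolding holds_def using rep_mono[of "mem s" "reg s 0" "enc x" "reg s i" "reg s 0" "mem s'"] by auto

lemma hp_ok_even:
  "hp_ok s V ==> reg s' 0 = reg s 0 ==> (!!a. even a ==> mem s' a = mem s a) ==> hp_ok s' V"
  unfolding hp_ok_def by auto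

lemma core_even:
  assumes "core V s r N bu its" "!!a. even a ==> mem s' a = mem s a"
    "!!i. i \<in> {0, 1, 2, 13, 14, 15, 16, 17, 19, 20, 21} ==> reg s' i = reg s i"
  shows "core V s' r N bu its"
proof -
  have h: "hp_ok s V" "holds s 13 its V" "holds s 19 Vx V" "holds s 20 Vy V" using assms(1) by (auto simp: core_def)
  have "hp_ok s' V" by (rule hp_ok_even[OF h(1)]) (use assms in auto)
  moreover have "holds s' 13 its V" by (rule holds_even[OF h(2)]) (use assms in auto)
  moreover have "holds s' 19 Vx V" by (rule holds_even[OF h(3)]) (use assms in auto)
  moreover have "holds s' 20 Vy V" by (rule holds_even[OF h(4)]) (use assms in auto)
  ultimately show ?thesis using assms(1,3) unfolding core_def by auto
qed

lemma post_runs: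
  assumes "EX s'. xc cd s t V' s' & post m s y V' s'" "t <= t'" "V' <= Vmax"
  shows "runs cd s (t' * lg) (post m s y V')"
  using assms xc_runs by blast

lemma alloc:
  assumes "hp_ok s V" "holds s i x V" "holds s j y V" "0 < i" "0 < j" "0 < m" "m < u" "i ~= u" "j ~= u" "V + 4 <= Vmax"
  shows "runs (ALLOC m i j u) s (16 * lg) (post m s (x, y) (V + 4))"
  by (rule post_runs[OF ALLOC_rule]) (use assms in auto)

lemma blk:
  assumes "list_all straight is" "blk_cost is s <= t * lg" "Q (blk_exec is s)"
  shows "runs (Blk is) s (t * lg) Q"
  using assms by (rule runs_Blk)

lemma pow_le_Vmax: "N < 4 * R ==> j <= c ==> N ^ j <= Vmax" "N < 4 * R ==> 2 * N ^ c <= Vmax" "4 * R <= Vmax"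
proof -
  have 1: "(4 * R) ^ c <= Vmax" using Vmax(1) by simp
  show "4 * R <= Vmax"
    using 1 c(1) self_le_power[of "4 * R" c] by simp
  show "N ^ j <= Vmax" if "N < 4 * R" "j <= c"
  proof -
    have "N ^ j <= (4 * R) ^ j" using that by (intro power_mono) auto
    also have "... <= (4 * R) ^ c" using that by (intro power_increasing) auto
    finally show ?thesis using 1 by linarith
  qed
  show "2 * N ^ c <= Vmax" if "N < 4 * R"
  proof -
    have "N ^ c <= (4 * R) ^ c" using that by (intro power_mono) auto
    then show ?thesis using Vmax(1) by linarith
  qed
qed

section \<open>The dimension as an integer logarithm\<close>

definition dim_code :: com where
  "dim_code = Blk (Const 29 1 # replicate c (Mul 29 29 14) @ [Const 30 1, Const 22 0, Sub 31 29 30]) ;;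
     While 31 (Blk [Add 30 30 30, Const 32 1, Add 22 22 32, Sub 31 29 30])"

text \<open>The loop doubles register 30 until it reaches \<open>N ^ c\<close>; by
  \<open>dim_eq\<close> the number of doublings is the required dimension. It lies between
  \<open>c * (q + 1)\<close> and \<open>c * (q + 2)\<close> because \<open>N\<close> lies between
  \<open>2 * R\<close> and \<open>4 * R\<close>.\<close>

lemma dim_code:
  assumes "reg s 14 = N" "2 * R <= N" "N < 4 * R"
  shows "runs dim_code s ((2 * c + 20 + 20 * dmax) * lg) (%s'. mem s' = mem s &
    (ALL i. i \<notin> {22} \<union> {29..32} --> reg s' i = reg s i) &
    reg s' 22 = nat \<lceil>real c * log 2 (real N)\<rceil> & reg s' 22 <= dmax & c * (q + 1) <= reg s' 22)"
proof -
  let ?P = "N ^ c"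
  define frame where "frame s' \<longleftrightarrow> mem s' = mem s & (ALL i. i \<notin> {22} \<union> {29..32} --> reg s' i = reg s i)" for s' :: config
  have N1: "1 <= N" using assms(2) by (metis le_trans one_le_numeral one_le_power mult_le_mono nat_mult_1)
  have P1: "1 <= ?P" using N1 by simp
  have dmaxP: "?P <= 2 ^ dmax"
  proof -
    have "?P <= (4 * R) ^ c" using assms(3) by (intro power_mono) auto
    also have "(4 * R) ^ c = 2 ^ dmax"
    proof -
      have "4 * R = 2 ^ (q + 2)" by (simp add: power_add)
      then have "(4 * R) ^ c = (2 ^ (q + 2)) ^ c" by simp
      also have "... = 2 ^ dmax" unfolding dmax power_mult[symmetric] by (simp only: mult.commute)
      finally show ?thesis .
    qed
    finally show ?thesis .
  qed
  have P2: "2 ^ (c * (q + 1)) <= ?P"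
  proof -
    have "(2::nat) ^ (c * (q + 1)) = (2 * R) ^ c" by (metis mult.commute power_Suc power_mult Suc_eq_plus1)
    also have "... <= ?P" using assms(2) by (intro power_mono) auto
    finally show ?thesis .
  qed
  have lec: "2 * ?P <= Vmax" "!!j. j <= c ==> N ^ j <= Vmax" using pow_le_Vmax assms(3) by auto
  have ap: "blk_exec (is @ js) s = blk_exec js (blk_exec is s)"
    "blk_cost (is @ js) s = blk_cost is s + blk_cost js (blk_exec is s)" for "is" js s
    by (induction "is" arbitrary: s) auto
  have mul: "mem (blk_exec (replicate j (Mul 29 29 14)) s') = mem s' &
      reg (blk_exec (replicate j (Mul 29 29 14)) s') = (reg s')(29 := reg s' 29 * N ^ j) &
      blk_cost (replicate j (Mul 29 29 14)) s' <= 2 * j * lg"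
    if "reg s' 14 = N" "reg s' 29 = N ^ i" "i + j <= c" for i j s'
    using that
  proof (induction j arbitrary: s' i)
    case (Suc j)
    let ?s = "exec_instr (Mul 29 29 14) s'"
    have IH: "mem (blk_exec (replicate j (Mul 29 29 14)) ?s) = mem ?s &
      reg (blk_exec (replicate j (Mul 29 29 14)) ?s) = (reg ?s)(29 := reg ?s 29 * N ^ j) &
      blk_cost (replicate j (Mul 29 29 14)) ?s <= 2 * j * lg"
      by (rule Suc.IH[of _ "Suc i"]) (use Suc.prems in auto)
    have "bit_length (N ^ i) <= lg" "bit_length N <= lg"
      using lec(2)[of i] lec(2)[of 1] c(1) Suc.prems(3) by (auto intro: beta)
    then show ?case using IH Suc.prems by (auto simp: fun_eq_iff ac_simps)
  qed auto
  define I where "I i s' \<longleftrightarrow> frame s' & (EX j. reg s' 22 = j & reg s' 29 = ?P & reg s' 30 = 2 ^ j &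
    (j = 0 | 2 ^ (j - 1) < ?P) & j + i = dmax & reg s' 31 = ?P - 2 ^ j)" for i and s' :: config
  let ?init = "Const 29 1 # replicate c (Mul 29 29 14) @ [Const 30 1, Const 22 0, Sub 31 29 30]"
  have 1: "runs (Blk ?init) s ((2 * c + 10) * lg) (I dmax)"
  proof (rule blk)
    let ?s0 = "exec_instr (Const 29 1) s"
    have m: "mem (blk_exec (replicate c (Mul 29 29 14)) ?s0) = mem s &
      reg (blk_exec (replicate c (Mul 29 29 14)) ?s0) = (reg s)(29 := ?P) &
      blk_cost (replicate c (Mul 29 29 14)) ?s0 <= 2 * c * lg"
      using mul[of ?s0 0 c] assms(1) by (auto simp: fun_eq_iff)
    have "blk_cost ?init s = 1 + blk_cost (replicate c (Mul 29 29 14)) ?s0 + (1 + 1 + (bit_length ?P + 1))"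
      using m by (simp add: ap)
    then show "blk_cost ?init s <= (2 * c + 10) * lg"
      using m beta[of ?P] lec(2)[of c] beta2 unfolding distrib_right by linarith
    show "I dmax (blk_exec ?init s)" unfolding I_def frame_def
      using m by (auto simp: ap intro!: exI[of _ 0])
  qed (auto simp: list_all_iff)
  let ?body = "[Add 30 30 30, Const 32 1, Add 22 22 32, Sub 31 29 30]"
  have 2: "runs (While 31 (Blk ?body)) s1 (dmax * (2 * lg + 8 * lg) + 1) (%s'. EX i. I i s' & reg s' 31 = 0)"
    if "I dmax s1" for s1
  proof (rule runs_While[where I = I, OF that])
    fix i s' assume I: "I i s'" and nz: "reg s' 31 ~= 0"
    obtain j where j: "reg s' 22 = j" "reg s' 29 = ?P" "reg s' 30 = 2 ^ j" "j + i = dmax" "reg s' 31 = ?P - 2 ^ j"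
      and fr: "frame s'" using I unfolding I_def by blast
    have lt: "2 ^ j < ?P" using nz j(5) by simp
    then have "(2::nat) ^ j < 2 ^ dmax" using dmaxP by linarith
    then have jd: "j < dmax" by (simp add: power_strict_increasing_iff)
    then obtain i' where i': "i = Suc i'" using j(4) by (cases i) auto
    have PV: "?P <= Vmax" using lec(1) by linarith
    have b: "bit_length (2 ^ j) <= lg" "bit_length (2 ^ j + 2 ^ j) <= lg" "bit_length ?P <= lg" "bit_length (?P - 2 ^ j) <= lg"
      using lt lec(1) PV by (auto intro!: beta)
    have "j < 2 ^ j" by simp
    then have "j <= Vmax" using lt PV by linarith
    then have bj: "bit_length j <= lg" by (rule beta)
    have "blk_cost ?body s' = 2 * bit_length (2 ^ j) + 1 + (bit_length j + 1) + (bit_length ?P + bit_length (2 ^ j + 2 ^ j))"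
      using j by simp
    then have "blk_cost ?body s' <= 8 * lg" using b bj beta2 by linarith
    moreover have "I i' (blk_exec ?body s')" unfolding I_def frame_def
      using fr j lt i' by (auto simp: frame_def mult_2 intro!: exI[of _ "Suc j"])
    ultimately have "runs (Blk ?body) s' (8 * lg) (%s'. EX j<i. I j s')"
      using i' by (intro runs_Blk) auto
    moreover have "bit_length (reg s' 31) + 1 <= 2 * lg" using j(5) b(4) beta2 by simp
    ultimately show "bit_length (reg s' 31) + 1 <= 2 * lg & runs (Blk ?body) s' (8 * lg) (%s'. EX j<i. I j s')" by blast
  qed blast
  show ?thesis unfolding dim_code_def
  proof (rule seq[OF 1])
    fix s1 assume "I dmax s1"
    note w = 2[OF this]
    show "runs (While 31 (Blk ?body)) s1 ((10 * dmax + 1) * lg) (%s'. mem s' = mem s &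
      (ALL i. i \<notin> {22} \<union> {29..32} --> reg s' i = reg s i) &
      reg s' 22 = nat \<lceil>real c * log 2 (real N)\<rceil> & reg s' 22 <= dmax & c * (q + 1) <= reg s' 22)"
    proof (rule runs_mono[OF w])
      show "dmax * (2 * lg + 8 * lg) + 1 <= (10 * dmax + 1) * lg" using beta2 by (simp add: algebra_simps)
      fix s' assume "EX i. I i s' & reg s' 31 = 0"
      then obtain i j where j: "reg s' 22 = j" "j = 0 | 2 ^ (j - 1) < ?P" "j + i = dmax" "?P <= 2 ^ j" "frame s'"
        unfolding I_def by auto
      have "nat \<lceil>real c * log 2 (real N)\<rceil> = j" by (rule dim_eq[OF N1 j(4,2)])
      moreover have "(2::nat) ^ (c * (q + 1)) <= 2 ^ j" using P2 j(4) by linarith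
      then have "c * (q + 1) <= j" by simp
      ultimately show "mem s' = mem s & (ALL i. i \<notin> {22} \<union> {29..32} --> reg s' i = reg s i) &
        reg s' 22 = nat \<lceil>real c * log 2 (real N)\<rceil> & reg s' 22 <= dmax & c * (q + 1) <= reg s' 22"
        using j by (auto simp: frame_def)
    qed
  qed simp
qed

end

context driver begin

section \<open>Writing an instance into memory\<close>

definition env_code :: com where
  "env_code = Blk [Mul 23 14 22, Add 24 23 23, Add 24 24 24, Const 28 0, Add 28 28 15] ;;
     ALLOC 28 21 28 39 ;; ALLOC 28 24 28 39 ;; ALLOC 28 23 28 39 ;; ALLOC 28 22 28 39 ;;
     ALLOC 28 14 28 39 ;; ALLOC 28 20 28 39 ;; ALLOC 28 19 28 39 ;; ALLOC 28 27 28 39"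

lemma Nd_le: "N < 4 * R ==> d <= dmax ==> 4 * (N * d) + N + 2 <= Lmax"
proof -
  assume "N < 4 * R" "d <= dmax"
  then have "N * d <= 4 * R * dmax" by (intro mult_le_mono) auto
  then show ?thesis using \<open>N < 4 * R\<close> unfolding Lmax by linarith
qed

lemma R_le_Lmax: "4 * R <= Lmax" unfolding Lmax by simp

definition env :: "item => nat => nat => item \<times> job_ctx" where
  "env it N d = (it, Vx, Vy, N, d, N * d, 4 * (N * d), R, 2 * R)"

lemma env_code:
  assumes core: "core V s r N bu its" and it: "holds s 27 it V" and d: "reg s 22 = d" "d <= dmax"
    and V: "V + 32 <= Vmax"
  shows "runs env_code s (140 * lg) (%s'. ext 23 s s' & reg s' 25 = reg s 25 & hp_ok s' (V + 32) &
    holds s' 28 (env it N d) (V + 32) & reg s' 24 = 4 * (N * d))"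
proof -
  have N: "2 * R <= N" "N < 4 * R" "reg s 14 = N" "reg s 21 = R" "reg s 15 = 2 * R" "Lmax <= V"
    and h: "hp_ok s V" "holds s 19 Vx V" "holds s 20 Vy V" using core by (auto simp: core_def)
  have le: "4 * (N * d) + N + 2 <= V" using Nd_le[OF N(2) d(2)] N(6) by linarith
  have dV: "d <= V"
  proof (cases "N = 0")
    case False
    then have "d <= N * d" by simp
    then show ?thesis using le by linarith
  next
    case True
    then show ?thesis using N(1) by simp
  qed
  have Vm: "V <= Vmax" using V by simp
  have RV: "4 * R <= V" using R_le_Lmax N(6) by linarith
  let ?is = "[Mul 23 14 22, Add 24 23 23, Add 24 24 24, Const 28 0, Add 28 28 15]"
  let ?s1 = "blk_exec ?is s"
  have s1: "mem ?s1 = mem s" "reg ?s1 = (reg s)(23 := N * d, 24 := 4 * (N * d), 28 := 2 * R)"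
    using N d by (auto simp: fun_eq_iff)
  have 1: "runs (Blk ?is) s (10 * lg) (%s'. s' = ?s1)"
  proof (rule blk)
    have "bit_length N <= lg" "bit_length d <= lg" "bit_length (N * d) <= lg" "bit_length (N * d + N * d) <= lg"
      "bit_length (2 * R) <= lg" using le dV RV Vm by (intro beta; linarith)+
    then show "blk_cost ?is s <= 10 * lg" using N d beta2 by simp
  qed auto
  have h1: "hp_ok ?s1 V" by (rule hp_ok_even[OF h(1)]) (use s1 in auto)
  have hs: "holds ?s1 21 R V" "holds ?s1 24 (4 * (N * d)) V" "holds ?s1 23 (N * d) V" "holds ?s1 22 d V"
    "holds ?s1 14 N V" "holds ?s1 28 (2 * R) V"
    using s1 N d le dV RV by (auto simp: holds_nat)
  have hv: "holds ?s1 20 Vy V" "holds ?s1 19 Vx V" "holds ?s1 27 it V"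
    by (rule holds_even[OF h(3)] holds_even[OF h(2)] holds_even[OF it]; use s1 in simp)+
  define Pz where "Pz = (%m. %s'. ext 28 ?s1 s' & hp_ok s' (V + m))"
  have st: "runs (ALLOC 28 j 28 39) s' (16 * lg) (%s''. Pz (m + 4) s'' & holds s'' 28 (x, t) (V + (m + 4)))"
    if "Pz m s' & holds s' 28 t (V + m)" "holds ?s1 j x V" "0 < j" "j < 28" "m <= 28"
    for j m s' and x :: "'x::heap_data" and t :: "'y::heap_data"
  proof -
    have e: "ext 28 ?s1 s'" "hp_ok s' (V + m)" "holds s' 28 t (V + m)" using that by (auto simp: Pz_def)
    have "holds s' j x (V + m)" by (rule holds_ext[OF that(2) e(1)]) (use that in auto)
    then have "runs (ALLOC 28 j 28 39) s' (16 * lg) (post 28 s' (x, t) (V + m + 4))"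
      by (rule alloc[OF e(2) _ e(3)]) (use that V in auto)
    then show ?thesis
    proof (rule runs_mono)
      fix s'' assume p: "post 28 s' (x, t) (V + m + 4) s''"
      have "ext 28 ?s1 s''" by (rule ext_trans[OF e(1)]) (use p in \<open>simp only: post_def\<close>)
      with p show "Pz (m + 4) s'' & holds s'' 28 (x, t) (V + (m + 4))"
        unfolding post_def Pz_def add.assoc by blast
    qed simp
  qed
  have 0: "Pz 0 ?s1 & holds ?s1 28 (2 * R) (V + 0)" using h1 hs by (simp add: Pz_def ext_refl)
  have t: "runs (ALLOC 28 21 28 39 ;; ALLOC 28 24 28 39 ;; ALLOC 28 23 28 39 ;; ALLOC 28 22 28 39 ;;
     ALLOC 28 14 28 39 ;; ALLOC 28 20 28 39 ;; ALLOC 28 19 28 39 ;; ALLOC 28 27 28 39) ?s1 (128 * lg)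
     (%s'. Pz 32 s' & holds s' 28 (env it N d) (V + 32))"
    unfolding env_def
    apply (rule seq[OF st[OF 0 hs(1)], where ?t2.0 = 112], simp_all)
    apply (rule seq[OF st[OF _ hs(2)], where ?t2.0 = 96], assumption, simp_all)
    apply (rule seq[OF st[OF _ hs(3)], where ?t2.0 = 80], assumption, simp_all)
    apply (rule seq[OF st[OF _ hs(4)], where ?t2.0 = 64], assumption, simp_all)
    apply (rule seq[OF st[OF _ hs(5)], where ?t2.0 = 48], assumption, simp_all)
    apply (rule seq[OF st[OF _ hv(1)], where ?t2.0 = 32], assumption, simp_all)
    apply (rule seq[OF st[OF _ hv(2)], where ?t2.0 = 16], assumption, simp_all)
    apply (rule runs_mono[OF st[OF _ hv(3)]], assumption, simp_all)
    done
  show ?thesis unfolding env_code_def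
  proof (rule seq[OF 1, where ?t2.0 = 128])
    fix s' assume "s' = ?s1"
    show "runs (ALLOC 28 21 28 39 ;; ALLOC 28 24 28 39 ;; ALLOC 28 23 28 39 ;; ALLOC 28 22 28 39 ;;
     ALLOC 28 14 28 39 ;; ALLOC 28 20 28 39 ;; ALLOC 28 19 28 39 ;; ALLOC 28 27 28 39) s' (128 * lg)
      (%s'. ext 23 s s' & reg s' 25 = reg s 25 & hp_ok s' (V + 32) & holds s' 28 (env it N d) (V + 32) & reg s' 24 = 4 * (N * d))"
      unfolding \<open>s' = ?s1\<close>
    proof (rule runs_mono[OF t le_refl])
      fix s'' assume P: "Pz 32 s'' & holds s'' 28 (env it N d) (V + 32)"
      then have e: "ext 28 ?s1 s''" unfolding Pz_def by blast
      have e23: "ext 23 s s''"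
        by (rule ext_trans[OF _ ext_mono[OF e]]) (use s1 in \<open>auto simp: ext_def\<close>)
      have "reg s'' 25 = reg ?s1 25" "reg s'' 24 = reg ?s1 24" using e unfolding ext_def by simp_all
      then have "reg s'' 25 = reg s 25" "reg s'' 24 = 4 * (N * d)" unfolding s1(2) by simp_all
      with P e23 show "ext 23 s s'' & reg s'' 25 = reg s 25 & hp_ok s'' (V + 32) &
        holds s'' 28 (env it N d) (V + 32) & reg s'' 24 = 4 * (N * d)"
        unfolding Pz_def by blast
    qed
  qed simp
qed

text \<open>The instance has exponentially many symbols, so no polynomial tree function can return
  it. It is written from the last position down to 0, one call of \<open>entry\<close> computing
  each symbol.\<close>

definition build_body :: com where
  "build_body = Blk [Const 29 1, Sub 26 26 29] ;; ALLOC (40 + nr) 26 28 (40 + nr + 1) ;; cn ;;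
     Blk (addr_code 26 @ [Store 8 (40 + nr)])"

definition build_code :: com where
  "build_code = Blk [Const 29 2, Add 26 24 14, Add 26 26 29] ;; While 26 build_body"

lemma build_code:
  assumes core: "core V s r N bu its" and fr: "fresh r s" and it: "item_inv it"
    and env: "holds s 28 (env it N d) V" and rest: "holds s 25 rest V"
    and d: "d <= dmax" "reg s 24 = 4 * (N * d)" and len: "len = 2 + 4 * (N * d) + N"
    and V: "V + Lmax * (Tn + 4) <= Vmax"
  shows "runs build_code s ((20 + Lmax * (Tn + 400)) * lg) (%s'. core (V + Lmax * (Tn + 4)) s' r N bu its &
    fresh (r + 1) s' & holds s' 25 rest (V + Lmax * (Tn + 4)) & reg s' 18 = reg s 18 &
    (ALL b. mem s' (addr Z r b) = (if b < len then entry (b, env it N d) else 0)))"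
proof -
  have N: "2 * R <= N" "N < 4 * R" "reg s 14 = N" "Lmax <= V" "reg s 1 = Z" "reg s 2 = r" "r <= Vmax"
    and h: "hp_ok s V" using core by (auto simp: core_def)
  have lenL: "len <= Lmax" using Nd_le[OF N(2) d(1)] len by linarith
  \<comment> \<open>Each symbol raises the bound on the numbers in use by at most
    \<open>Tn + 4\<close>: 4 for allocating the argument pair and \<open>Tn\<close> for the
    call.\<close>
  let ?W = "%i. V + (len - i) * (Tn + 4)"
  have Wle: "?W i <= V + Lmax * (Tn + 4)" for i
    using mult_le_mono1[of "len - i" Lmax "Tn + 4"] lenL by simp
  then have WV: "?W i <= Vmax" for i using V le_trans by blast
  have VV: "V <= Vmax" using V by simp
  define I where "I i s' \<longleftrightarrow> reg s' 26 = i & i <= len & core (?W i) s' r N bu its & fresh (r + 1) s' &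
    holds s' 28 (env it N d) (?W i) & holds s' 25 rest (?W i) & reg s' 18 = reg s 18 &
    (ALL b. mem s' (addr Z r b) = (if i <= b & b < len then entry (b, env it N d) else 0))" for i s'
  have 1: "runs (Blk [Const 29 2, Add 26 24 14, Add 26 26 29]) s (10 * lg) (I len)"
  proof (rule blk)
    have "bit_length (4 * (N * d)) <= lg" "bit_length N <= lg" "bit_length (4 * (N * d) + N) <= lg"
      using lenL len N(4) VV by (intro beta; linarith)+
    then show "blk_cost [Const 29 2, Add 26 24 14, Add 26 26 29] s <= 10 * lg" using d N beta2 by simp
    let ?s1 = "blk_exec [Const 29 2, Add 26 24 14, Add 26 26 29] s"
    have s1: "mem ?s1 = mem s" "reg ?s1 = (reg s)(29 := 2, 26 := len)" using d N len by (auto simp: fun_eq_iff)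
    have "core (?W len) ?s1 r N bu its" unfolding diff_self_eq_0 mult_0 add_0_right
      by (rule core_even[OF core]) (use s1 in auto)
    moreover have "holds ?s1 28 (env it N d) (?W len)" "holds ?s1 25 rest (?W len)"
      unfolding diff_self_eq_0 mult_0 add_0_right
      by (rule holds_even[OF env] holds_even[OF rest]; use s1 in simp)+
    ultimately show "I len ?s1" unfolding I_def using s1 fr by (auto simp: fresh_def)
  qed auto
  let ?kb = "40 + nr"
  have body: "runs build_body s' ((Tn + 300) * lg) (%s''. EX j<i. I j s'')" if I: "I i s'" and nz: "reg s' 26 ~= 0" for i s'
  proof -
    obtain a where a: "i = Suc a" using I nz unfolding I_def by (cases i) auto
    have c': "core (?W i) s' r N bu its" "fresh (r + 1) s'" "reg s' 26 = Suc a" "Suc a <= len"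
      "holds s' 28 (env it N d) (?W i)" "holds s' 25 rest (?W i)"
      "!!b. mem s' (addr Z r b) = (if i <= b & b < len then entry (b, env it N d) else 0)"
      using I unfolding I_def a by auto
    have hp': "hp_ok s' (?W i)" and zr: "reg s' 1 = Z" "reg s' 2 = r" using c'(1) by (auto simp: core_def)
    have aV: "Suc a <= V" using c'(4) lenL N(4) by linarith
    have ba: "bit_length (Suc a) <= lg" "bit_length a <= lg" using aV VV by (intro beta; linarith)+
    let ?s1 = "blk_exec [Const 29 1, Sub 26 26 29] s'"
    have s1: "mem ?s1 = mem s'" "reg ?s1 = (reg s')(29 := 1, 26 := a)" using c'(3) by (auto simp: fun_eq_iff)
    have 1: "runs (Blk [Const 29 1, Sub 26 26 29]) s' (4 * lg) (%x. x = ?s1)"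
      by (rule blk) (use c'(3) ba beta2 in auto)
    have h1: "hp_ok ?s1 (?W i)" by (rule hp_ok_even[OF hp']) (use s1 in auto)
    have e1: "holds ?s1 28 (env it N d) (?W i)" by (rule holds_even[OF c'(5)]) (use s1 in auto)
    have a1: "holds ?s1 26 a (?W i)" using s1 aV by (simp add: holds_nat)
    have Wi: "?W a = ?W i + (Tn + 4)"
    proof -
      have "len - a = Suc (len - i)" using c'(4) a by simp
      then show ?thesis by simp
    qed
    have WW: "?W i <= ?W a" unfolding Wi by simp
    have 2: "runs (ALLOC ?kb 26 28 (?kb + 1)) ?s1 (16 * lg) (post ?kb ?s1 (a, env it N d) (?W i + 4))"
      by (rule alloc[OF h1 a1 e1]) (use WV[of a] Wi in auto)
    have tn': "tn (a, env it N d) <= Tn" unfolding env_def by (rule tn[OF it])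
    have 3: "runs cn s2 (Tn * lg) (%x. post ?kb ?s1 (entry (a, env it N d)) (?W a) x)"
      if "post ?kb ?s1 (a, env it N d) (?W i + 4) s2" for s2
    proof -
      have p2: "ext ?kb ?s1 s2" "hp_ok s2 (?W i + 4)" "holds s2 ?kb (a, env it N d) (?W i + 4)"
        using that by (auto simp: post_def)
      have "runs cn s2 (Tn * lg) (post ?kb s2 (entry (a, env it N d)) (?W i + 4 + tn (a, env it N d)))"
        by (rule post_runs[OF code_entry[OF p2(2,3)] tn']) (use WV[of a] Wi tn' in linarith)
      then show ?thesis
      proof (rule runs_mono)
        fix x assume "post ?kb s2 (entry (a, env it N d)) (?W i + 4 + tn (a, env it N d)) x"
        then have "post ?kb ?s1 (entry (a, env it N d)) (?W i + 4 + tn (a, env it N d)) x" by (rule post_ext[OF p2(1)])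
        then show "post ?kb ?s1 (entry (a, env it N d)) (?W a) x" by (rule post_mono) (use tn' Wi in simp)
      qed simp
    qed
    have 4: "runs (Blk (addr_code 26 @ [Store 8 ?kb])) s3 (220 * lg) (%s''. EX j<i. I j s'')"
      if p3: "post ?kb ?s1 (entry (a, env it N d)) (?W a) s3" for s3
    proof -
      have e3: "ext ?kb ?s1 s3" "hp_ok s3 (?W a)" "holds s3 ?kb (entry (a, env it N d)) (?W a)"
        using p3 by (auto simp: post_def)
      have r3: "!!j. 0 < j ==> j < ?kb ==> reg s3 j = reg ?s1 j" using e3(1) by (auto simp: ext_def)
      have v: "reg s3 ?kb = entry (a, env it N d)" "reg s3 ?kb <= Vmax"
        using e3(3) WV[of a] by (auto simp: holds_nat intro: order.trans)
      have ax: "reg s3 26 = a" "reg s3 1 = Z" "reg s3 2 = r"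
      proof -
        have "reg s3 26 = reg ?s1 26" "reg s3 1 = reg ?s1 1" "reg s3 2 = reg ?s1 2" by (rule r3; simp)+
        then show "reg s3 26 = a" "reg s3 1 = Z" "reg s3 2 = r" unfolding s1(2) using zr by simp_all
      qed
      have core3: "core (?W a) s3 r N bu its"
      proof (rule core_ext[OF _ e3(1) _ e3(2)])
        show "core (?W i) ?s1 r N bu its" by (rule core_even[OF c'(1)]) (use s1 in auto)
      qed (use Wi in auto)
      have m3: "mem s3 (addr Z r' b) = mem s' (addr Z r' b)" for r' b
        using e3(1) s1 addr_odd[of Z r' b] by (simp add: ext_def)
      let ?is = "addr_code 26 @ [Store 8 ?kb]"
      let ?s4 = "blk_exec ?is s3"
      have j12: "(12::nat) <= 26" by simp
      note ac = addr_code(1)[OF j12, where js = "[Store 8 ?kb]" and s = s3]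
        addr_code(2)[OF j12, where s = s3] addr_code(3)[OF j12, where s = s3]
        addr_code(4)[OF j12, where js = "[Store 8 ?kb]" and s = s3] addr_code(5)[OF j12]
      have s4: "mem ?s4 = (mem s3)(addr Z r a := entry (a, env it N d))"
        "reg ?s4 = (reg s3)(8 := addr Z r a, 9 := 1)"
        unfolding ac(4) using ac(2,3) ax v by auto
      show ?thesis
      proof (rule blk)
        show "list_all straight ?is" using ac(5) by simp
        have "blk_cost [Store 8 ?kb] (blk_exec (addr_code 26) s3) = bit_length (addr Z r a) + bit_length (reg s3 ?kb)"
          using ac(2) ax by simp
        then have "blk_cost ?is s3 <= 60 * (bit_length a + bit_length r + bit_length Z) +
            (10 * (bit_length a + bit_length r + bit_length Z) + bit_length (reg s3 ?kb))"
          using ac(1) ax bit_length_addr[of Z r a] by simp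
        also have "... <= 60 * (lg + lg + lg) + (10 * (lg + lg + lg) + lg)"
          by (intro add_le_mono mult_le_mono2 ba beta v N Vmax)
        finally show "blk_cost ?is s3 <= 220 * lg" by simp
        have ev: "!!x. even x ==> mem ?s4 x = mem s3 x" using s4(1) addr_odd[of Z r a] by auto
        have "core (?W a) ?s4 r N bu its" by (rule core_even[OF core3 ev]) (use s4(2) in auto)
        moreover have "holds ?s4 28 (env it N d) (?W a)"
        proof (rule holds_even[OF _ _ _ ev])
          show "holds s3 28 (env it N d) (?W a)" by (rule holds_ext[OF e1 e3(1) _ _ WW]) simp_all
        qed (use s4(2) in auto)
        moreover have "holds ?s4 25 rest (?W a)"
        proof (rule holds_even[OF _ _ _ ev])
          have "holds ?s1 25 rest (?W i)" by (rule holds_even[OF c'(6)]) (use s1 in auto)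
          then show "holds s3 25 rest (?W a)" by (rule holds_ext[OF _ e3(1) _ _ WW]) simp_all
        qed (use s4(2) in auto)
        moreover have "fresh (r + 1) ?s4" unfolding fresh_def
        proof (intro allI impI)
          fix r' b assume "r + 1 <= r'"
          then have "r' ~= r" by simp
          then have "addr Z r' b ~= addr Z r a" using addr_inj by blast
          then show "mem ?s4 (addr Z r' b) = 0" using s4(1) m3 c'(2) \<open>r + 1 <= r'\<close> by (simp add: fresh_def)
        qed
        moreover have "mem ?s4 (addr Z r b) = (if a <= b & b < len then entry (b, env it N d) else 0)" for b
        proof (cases "b = a")
          case True then show ?thesis using s4(1) c'(4) by simp
        next
          case False
          then have "addr Z r b ~= addr Z r a" using addr_inj by blast
          then show ?thesis using s4(1) m3 c'(7)[of b] False a by auto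
        qed
        moreover have "reg s3 18 = reg ?s1 18" by (rule r3) simp_all
        then have "reg s3 18 = reg s' 18" unfolding s1(2) by simp
        then have "reg ?s4 26 = a" "reg ?s4 18 = reg s 18"
          unfolding s4(2) using ax(1) I unfolding I_def by simp_all
        moreover have "a <= len" using c'(4) by simp
        ultimately have "I a ?s4" unfolding I_def by blast
        then show "EX j<i. I j ?s4" using a by blast
      qed
    qed
    have s23: "runs (cn ;; Blk (addr_code 26 @ [Store 8 ?kb])) s2 ((Tn + 220) * lg) (%s''. EX j<i. I j s'')"
      if "post ?kb ?s1 (a, env it N d) (?W i + 4) s2" for s2
      by (rule seq[OF 3[OF that] 4]) auto
    have s12: "runs (ALLOC ?kb 26 28 (?kb + 1) ;; cn ;; Blk (addr_code 26 @ [Store 8 ?kb])) ?s1 ((Tn + 240) * lg) (%s''. EX j<i. I j s'')"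
      by (rule seq[OF 2 s23]) auto
    show ?thesis unfolding build_body_def
      by (rule seq[OF 1, where ?t2.0 = "Tn + 240"]) (use s12 in auto)
  qed
  have 2: "runs (While 26 build_body) s1 (len * (2 * lg + (Tn + 300) * lg) + 1) (%s'. I 0 s')" if "I len s1" for s1
  proof (rule runs_While[where I = I, OF that])
    fix i s' assume I: "I i s'" and nz: "reg s' 26 ~= 0"
    have "reg s' 26 <= Vmax" using I lenL N(4) VV unfolding I_def by linarith
    then have "bit_length (reg s' 26) + 1 <= 2 * lg" using beta beta2 by fastforce
    then show "bit_length (reg s' 26) + 1 <= 2 * lg & runs build_body s' ((Tn + 300) * lg) (%s'. EX j<i. I j s')"
      using body[OF I nz] by blast
  qed (auto simp: I_def)
  show ?thesis unfolding build_code_def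
  proof (rule seq[OF 1])
    fix s1 assume "I len s1"
    from 2[OF this] show "runs (While 26 build_body) s1 ((1 + Lmax * (Tn + 400)) * lg)
      (%s'. core (V + Lmax * (Tn + 4)) s' r N bu its &
    fresh (r + 1) s' & holds s' 25 rest (V + Lmax * (Tn + 4)) & reg s' 18 = reg s 18 &
    (ALL b. mem s' (addr Z r b) = (if b < len then entry (b, env it N d) else 0)))"
    proof (rule runs_mono)
      have "len * (2 * lg + (Tn + 300) * lg) = len * ((Tn + 302) * lg)" by (simp add: algebra_simps)
      also have "... <= Lmax * ((Tn + 400) * lg)" by (intro mult_le_mono lenL) auto
      also have "... = (Lmax * (Tn + 400)) * lg" by simp
      finally show "len * (2 * lg + (Tn + 300) * lg) + 1 <= (1 + Lmax * (Tn + 400)) * lg"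
        using beta2 unfolding distrib_right[of 1] by linarith
      fix s' assume I0: "I 0 s'"
      have c0: "core (?W 0) s' r N bu its" "holds s' 25 rest (?W 0)" using I0 by (auto simp: I_def)
      have "core (V + Lmax * (Tn + 4)) s' r N bu its"
        by (rule core_ext[OF c0(1) ext_refl[of 22]]) (use c0 Wle[of 0] hp_ok_mono in \<open>auto simp: core_def\<close>)
      then show "core (V + Lmax * (Tn + 4)) s' r N bu its & fresh (r + 1) s' & holds s' 25 rest (V + Lmax * (Tn + 4)) &
        reg s' 18 = reg s 18 & (ALL b. mem s' (addr Z r b) = (if b < len then entry (b, env it N d) else 0))"
        using I0 holds_mono[OF c0(2) Wle[of 0]] unfolding I_def by auto
    qed
  qed simp
qed

end

context driver begin

lemma holds_ext': "holds s i x V ==> ext m s s' ==> reg s' i = reg s i ==> V <= V' ==> holds s' i x V'"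
  using rep_mono[of "mem s" "reg s 0" "enc x" "reg s i" "reg s' 0" "mem s'"] by (auto simp: holds_def ext_def)

lemma core_upd:
  assumes "core V s r N bu its" "!!a. even a ==> mem s' a = mem s a"
    "!!i. i \<in> {0, 1, 15, 16, 19, 20, 21} ==> reg s' i = reg s i"
    "reg s' 2 = r'" "r' <= Vmax" "reg s' 14 = N'" "2 * R <= N'" "N' < 4 * R"
    "reg s' 17 = bu'" "1 <= bu'" "bu' <= Vmax" "holds s' 13 its' V"
  shows "core V s' r' N' bu' its'"
proof -
  have h: "hp_ok s V" "holds s 19 Vx V" "holds s 20 Vy V" using assms(1) by (auto simp: core_def)
  have "hp_ok s' V" by (rule hp_ok_even[OF h(1)]) (use assms(2,3) in auto)
  moreover have "holds s' 19 Vx V" by (rule holds_even[OF h(2)]) (use assms(2,3) in auto)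
  moreover have "holds s' 20 Vy V" by (rule holds_even[OF h(3)]) (use assms(2,3) in auto)
  ultimately show ?thesis using assms(1,3-12) unfolding core_def by auto
qed

section \<open>Solving one leaf\<close>

definition simc :: nat where "simc = 3 * (length p * 12 + 1010) + 20 + nr"

definition job_code :: com where
  "job_code = dim_code ;; env_code ;; build_code ;; Blk [Const 3 0, Add 3 3 17] ;; sim p nr ;;
     Blk [Const 29 1, Add 2 2 29]"

definition job_time :: "nat => nat" where
  "job_time bu = (2 * c + 20 + 20 * dmax) + 140 + (20 + Lmax * (Tn + 400)) + 20 + simc * (4 * (lg + bu))"

definition job_heap :: nat where "job_heap = 32 + Lmax * (Tn + 4)"

text \<open>The verdict is negated, as a blocking pair is a satisfying assignment: \<open>p\<close>
  accepts exactly if the leaf is unsatisfiable. The lower bound on \<open>d\<close> leaves two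
  coordinates for each of the clauses counted by \<open>job_live\<close>.\<close>

lemma run_sim:
  assumes core: "core V s r N bu its" and d: "d = nat \<lceil>real c * log 2 (real N)\<rceil>" "d <= dmax" "c * (q + 1) <= d"
    and it: "item_inv it" "ex it = []" and s3: "reg s 3 = bu"
    and m: "!!b. mem s (addr Z r b) = (if b < 2 + 4 * (N * d) + N then entry (b, env it N d) else 0)"
  shows "runs (sim p nr) s ((simc * (4 * (lg + bu))) * lg) (%s'. sim_frame nr Z r s s' &
    (reg s' 5 = 0 & (reg s' 40 ~= 0 \<longleftrightarrow> ~ item_sat it) & bit_length (reg s' 40) <= lg + bu | reg s' 5 = 1 & bu < 2 * T N))"
proof -
  have N: "2 * R <= N" "N < 4 * R" "Lmax <= V" "reg s 1 = Z" "reg s 2 = r" "r <= Vmax" "bu <= Vmax"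
    using core by (auto simp: core_def)
  define L where "L = live (fst it)"
  define M where "M = job_market R (snd (snd it)) Vx Vy L"
  define xs where "xs = encode_matching_instance N d (M, job_match R (2 * R))"
  have cd: "2 * (1 + 2 * n + k * (2 * n * thresh A k)) <= d" using c(2) d(3) by linarith
  have "length L <= 1 + 2 * n + k * (2 * n * thresh A k)" unfolding L_def by (rule job_live[OF it])
  then have dL: "2 * length L <= d"
    using mult_le_mono2[of "length L" "1 + 2 * n + k * (2 * n * thresh A k)" 2] cd by (blast intro: le_trans)
  have d2: "2 <= d" by (rule le_trans[OF _ cd]) simp
  have len: "length xs = 2 + 4 * (N * d) + N" by (simp add: xs_def length_encode_instance)
  have nth: "xs ! a = entry (a, env it N d)" if "a < length xs" for a
    unfolding xs_def M_def L_def env_def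
    by (rule nth_encode_instance) (use that d2 len in auto)
  have mi: "mem s (addr Z r a) = mem (init xs) a" for a
    unfolding m using nth len by (simp add: init_def)
  have xle: "x <= Vmax" if xin: "x \<in> set xs" for x
  proof -
    obtain a where a: "a < length xs" "x = xs ! a" using xin unfolding in_set_conv_nth by blast
    have "x <= N + d + a + 1" unfolding a(2) nth[OF a(1)] env_def by (rule entry_le) (use N in auto)
    also have "... <= 2 * Lmax"
    proof -
      have "0 < R" by simp
      then have "0 < N" using N(1) by linarith
      then have "d <= N * d" by simp
      then show ?thesis using a(1) len Nd_le[OF N(2) d(2)] by linarith
    qed
    also have "... <= Vmax" using Vmax(3) by linarith
    finally show ?thesis .
  qed
  have beB: "bit_length lg <= lg"
    using bit_length_le_iff[of lg lg] beta2 by simp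
  have S: "simulation p nr xs lg Z r (4 * lg) bu"
  proof
    show "bit_length (8 * (lg + bu)) <= 4 * lg"
    proof -
      have "bit_length 8 <= 4" by (subst bit_length_le_iff) auto
      then show ?thesis
        using bit_length_mult[of 8 "lg + bu"] bit_length_add[of lg bu] beB beta[OF N(7)] beta2 by linarith
    qed
    show "bit_length (instr_num i) <= lg" if "i \<in> set p" for i by (rule beta[OF nums(1)[OF that]])
    show "bit_length (instr_num i) <= 4 * lg" if "i \<in> set p" for i using beta[OF nums(1)[OF that]] by linarith
    show "bit_length Z <= 4 * lg" "bit_length r <= 4 * lg" "bit_length (length p) <= 4 * lg"
      using beta[OF Vmax(2)] beta[OF N(6)] beta[OF nums(2)] by linarith+
  qed (use regs nr beta2 beta[OF xle] in auto)
  interpret S: simulation p nr xs lg Z r "4 * lg" bu by (rule S)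
  have sat: "stable N d M (job_match R (2 * R)) \<longleftrightarrow> ~ item_sat it"
    unfolding M_def job_stable[OF N(1) dL d2] job_sat[OF it] L_def[symmetric]
    by (auto simp: clause_sat_def)
  have "(M, job_match R (2 * R)) \<in> instances (stable_verification (%N. nat \<lceil>real c * log 2 (real N)\<rceil>)) N"
    using job_match_perfect[OF N(1)] job_market_boolean by (simp add: stable_verification_def M_def)
  then have "decides_input p xs (T N) (~ item_sat it)"
    using dec unfolding decides_in_time_def sat[symmetric] xs_def d(1)
    by (auto simp: stable_verification_def)
  then obtain kk where kk: "halted p (S.cfg kk)" "S.rc kk <= T N" "reg (S.cfg kk) 0 ~= 0 \<longleftrightarrow> ~ item_sat it"
    unfolding decides_input_def S.cfg_def S.rc_def by blast
  \<comment> \<open>The hypothesis on \<open>p\<close> and the simulation each provide some moment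
    at which the run has halted; halted configurations are fixed points, so both see the same
    one.\<close>
  have uniq: "S.cfg j = S.cfg kk" if "halted p (S.cfg j)" for j
  proof -
    have *: "S.cfg (i + l) = S.cfg i" if "halted p (S.cfg i)" for i l
      by (induction l) (use S.halted_Suc S.halted_mono[OF that] in auto)
    show ?thesis using *[OF that, of "kk - j"] *[OF kk(1), of "j - kk"] by (cases "j <= kk") auto
  qed
  have "runs (sim p nr) s ((3 * S.step_const + 20 + nr) * (4 * lg * (lg + bu)))
    (%s'. sim_frame nr Z r s s' & S.finished s')"
    by (rule S.sim_run) (use N s3 mi in auto)
  then show ?thesis
  proof (rule runs_mono)
    show "(3 * S.step_const + 20 + nr) * (4 * lg * (lg + bu)) <= simc * (4 * (lg + bu)) * lg"
      by (simp add: simc_def S.step_const_def algebra_simps)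
    fix s' assume *: "sim_frame nr Z r s s' & S.finished s'"
    have "reg s' 5 = 0 & (reg s' 40 ~= 0 \<longleftrightarrow> ~ item_sat it) & bit_length (reg s' 40) <= lg + bu | reg s' 5 = 1 & bu < 2 * T N"
    proof (cases "reg s' 5 = 0")
      case True
      then obtain j where "halted p (S.cfg j)" "reg s' 40 = reg (S.cfg j) 0" "bit_length (reg s' 40) <= lg + bu" using * unfolding S.finished_def by auto
      then show ?thesis using True uniq kk(3) by metis
    next
      case False
      then have "bu < 2 * S.rc kk" "reg s' 5 = 1" using * kk(1) unfolding S.finished_def by auto
      then show ?thesis using kk(2) by linarith
    qed
    then show "sim_frame nr Z r s s' &
      (reg s' 5 = 0 & (reg s' 40 ~= 0 \<longleftrightarrow> ~ item_sat it) & bit_length (reg s' 40) <= lg + bu | reg s' 5 = 1 & bu < 2 * T N)" using * by blast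
  qed
qed

text \<open>Incrementing the number of the run abandons the cells of the finished one, whence
  \<open>fresh (r + 1)\<close>.\<close>

lemma job_code:
  assumes core: "core V s r N bu its" and fr: "fresh r s" and it: "item_inv it" "ex it = []"
    and h: "holds s 27 it V" "holds s 25 rest V" and V: "V + job_heap <= Vmax" and r: "r + 1 <= Vmax"
  shows "runs job_code s (job_time bu * lg) (%s'. core (V + job_heap) s' (r + 1) N bu its & fresh (r + 1) s' &
    holds s' 25 rest (V + job_heap) & reg s' 18 = reg s 18 &
    (reg s' 5 = 0 & (reg s' 40 ~= 0 \<longleftrightarrow> ~ item_sat it) & bit_length (reg s' 40) <= lg + bu | reg s' 5 = 1 & bu < 2 * T N))"
    (is "runs _ _ _ ?Q")
proof -
  have N: "2 * R <= N" "N < 4 * R" "reg s 14 = N" using core by (auto simp: core_def)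
  define d where "d = nat \<lceil>real c * log 2 (real N)\<rceil>"
  define Q1 where "Q1 s1 \<longleftrightarrow> core V s1 r N bu its & fresh r s1 & holds s1 27 it V & holds s1 25 rest V &
    reg s1 18 = reg s 18 & reg s1 22 = d & d <= dmax & c * (q + 1) <= d" for s1 :: config
  define Q2 where "Q2 s2 \<longleftrightarrow> core (V + 32) s2 r N bu its & fresh r s2 & holds s2 28 (env it N d) (V + 32) &
    holds s2 25 rest (V + 32) & reg s2 18 = reg s 18 & reg s2 24 = 4 * (N * d)" for s2 :: config
  define Q3 where "Q3 s3 \<longleftrightarrow> core (V + job_heap) s3 r N bu its & fresh (r + 1) s3 &
    holds s3 25 rest (V + job_heap) & reg s3 18 = reg s 18 &
    (ALL b. mem s3 (addr Z r b) = (if b < 2 + 4 * (N * d) + N then entry (b, env it N d) else 0))" for s3 :: config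
  define Q5 where "Q5 s5 \<longleftrightarrow> core (V + job_heap) s5 r N bu its & fresh (r + 1) s5 &
    holds s5 25 rest (V + job_heap) & reg s5 18 = reg s 18 &
    (reg s5 5 = 0 & (reg s5 40 ~= 0 \<longleftrightarrow> ~ item_sat it) & bit_length (reg s5 40) <= lg + bu | reg s5 5 = 1 & bu < 2 * T N)" for s5 :: config
  have 1: "runs dim_code s ((2 * c + 20 + 20 * dmax) * lg) Q1"
  proof (rule runs_mono[OF dim_code[OF N(3,1,2)]])
    fix s1 :: config assume *: "mem s1 = mem s & (ALL i. i \<notin> {22} \<union> {29..32} --> reg s1 i = reg s i) &
      reg s1 22 = nat \<lceil>real c * log 2 (real N)\<rceil> & reg s1 22 <= dmax & c * (q + 1) <= reg s1 22"
    have "core V s1 r N bu its" by (rule core_even[OF core]) (use * in auto)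
    moreover have "fresh r s1" using fr * by (simp add: fresh_def)
    moreover have "holds s1 27 it V" by (rule holds_even[OF h(1)]) (use * in auto)
    moreover have "holds s1 25 rest V" by (rule holds_even[OF h(2)]) (use * in auto)
    ultimately show "Q1 s1" unfolding Q1_def d_def using * by auto
  qed simp
  have 2: "runs env_code s1 (140 * lg) Q2" if q1: "Q1 s1" for s1
  proof -
    have a: "core V s1 r N bu its" "fresh r s1" "holds s1 27 it V" "holds s1 25 rest V"
      "reg s1 18 = reg s 18" "reg s1 22 = d" "d <= dmax" using q1 unfolding Q1_def by auto
    have V32: "V + 32 <= Vmax" using V by (simp add: job_heap_def)
    show ?thesis
    proof (rule runs_mono[OF env_code[OF a(1,3,6,7) V32]])
      fix s2 assume *: "ext 23 s1 s2 & reg s2 25 = reg s1 25 & hp_ok s2 (V + 32) &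
        holds s2 28 (env it N d) (V + 32) & reg s2 24 = 4 * (N * d)"
      then have e: "ext 23 s1 s2" by blast
      have "core (V + 32) s2 r N bu its" by (rule core_ext[OF a(1) e]) (use * in auto)
      moreover have "fresh r s2" by (rule fresh_ext[OF a(2) e])
      moreover have "holds s2 25 rest (V + 32)" by (rule holds_ext'[OF a(4) e]) (use * in auto)
      moreover have "reg s2 18 = reg s1 18" using e unfolding ext_def by simp
      ultimately show "Q2 s2" unfolding Q2_def using * a(5) by simp
    qed simp
  qed
  have 3: "runs build_code s2 ((20 + Lmax * (Tn + 400)) * lg) Q3" if q2: "Q2 s2" and dd: "d <= dmax" for s2
  proof -
    have a: "core (V + 32) s2 r N bu its" "fresh r s2" "holds s2 28 (env it N d) (V + 32)"
      "holds s2 25 rest (V + 32)" "reg s2 18 = reg s 18" "reg s2 24 = 4 * (N * d)" using q2 unfolding Q2_def by auto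
    have VV: "V + 32 + Lmax * (Tn + 4) <= Vmax" using V by (simp add: job_heap_def)
    have eq: "V + job_heap = V + 32 + Lmax * (Tn + 4)" by (simp add: job_heap_def)
    show ?thesis unfolding Q3_def eq
      by (rule runs_mono[OF build_code[OF a(1,2) it(1) a(3,4) dd a(6) refl VV]]) (use a(5) in auto)
  qed
  have 4: "runs (Blk [Const 3 0, Add 3 3 17]) s3 (4 * lg) (%s4. Q3 s4 & reg s4 3 = bu)" if q3: "Q3 s3" for s3
  proof -
    let ?s = "blk_exec [Const 3 0, Add 3 3 17] s3"
    have a: "core (V + job_heap) s3 r N bu its" "holds s3 25 rest (V + job_heap)" using q3 unfolding Q3_def by auto
    have bu: "reg s3 17 = bu" "bu <= Vmax" using a(1) by (auto simp: core_def)
    have s': "mem ?s = mem s3" "reg ?s = (reg s3)(3 := bu)" using bu by (auto simp: fun_eq_iff)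
    have "core (V + job_heap) ?s r N bu its" by (rule core_even[OF a(1)]) (use s' in auto)
    moreover have "holds ?s 25 rest (V + job_heap)" by (rule holds_even[OF a(2)]) (use s' in auto)
    moreover have "fresh (r + 1) ?s" using q3 s'(1) unfolding Q3_def fresh_def by simp
    moreover have "reg ?s 18 = reg s3 18" "reg ?s 3 = bu" unfolding s'(2) by simp_all
    ultimately have "Q3 ?s & reg ?s 3 = bu" using q3 s'(1) unfolding Q3_def by simp
    moreover have "blk_cost [Const 3 0, Add 3 3 17] s3 <= 4 * lg" using bu beta[OF bu(2)] beta2 by simp
    ultimately show ?thesis by (intro blk) auto
  qed
  have 5: "runs (sim p nr) s4 ((simc * (4 * (lg + bu))) * lg) Q5" if q4: "Q3 s4 & reg s4 3 = bu"
    and dd: "d <= dmax" "c * (q + 1) <= d" for s4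
  proof -
    have a: "core (V + job_heap) s4 r N bu its" "fresh (r + 1) s4" "holds s4 25 rest (V + job_heap)"
      "reg s4 18 = reg s 18" "reg s4 3 = bu"
      "!!b. mem s4 (addr Z r b) = (if b < 2 + 4 * (N * d) + N then entry (b, env it N d) else 0)"
      using q4 unfolding Q3_def by auto
    show ?thesis
    proof (rule runs_mono[OF run_sim[OF a(1) d_def dd it a(5,6)]])
      fix s5 assume *: "sim_frame nr Z r s4 s5 &
        (reg s5 5 = 0 & (reg s5 40 ~= 0 \<longleftrightarrow> ~ item_sat it) & bit_length (reg s5 40) <= lg + bu | reg s5 5 = 1 & bu < 2 * T N)"
      then have f: "!!j. j \<notin> {3..12} \<union> {40..<40 + nr} ==> reg s5 j = reg s4 j"
        "!!A. A \<notin> range (addr Z r) ==> mem s5 A = mem s4 A" unfolding sim_frame_def by blast+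
      have ev: "mem s5 A = mem s4 A" if "even A" for A
        by (rule f(2)) (use that addr_odd in auto)
      have "core (V + job_heap) s5 r N bu its" by (rule core_even[OF a(1) ev]) (auto intro!: f(1))
      moreover have "fresh (r + 1) s5" unfolding fresh_def
      proof (intro allI impI)
        fix r' b assume r': "r + 1 <= r'"
        have "addr Z r' b \<notin> range (addr Z r)"
        proof
          assume "addr Z r' b \<in> range (addr Z r)"
          then obtain b' where "addr Z r' b = addr Z r b'" by blast
          then show False using addr_inj r' by (metis Suc_eq_plus1 not_less_eq_eq order_refl)
        qed
        then have "mem s5 (addr Z r' b) = mem s4 (addr Z r' b)" by (rule f(2))
        then show "mem s5 (addr Z r' b) = 0" using a(2) r' unfolding fresh_def by simp
      qed
      moreover have "holds s5 25 rest (V + job_heap)" by (rule holds_even[OF a(3) _ _ ev]) (auto intro!: f(1))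
      moreover have "reg s5 18 = reg s4 18" by (rule f(1)) simp
      ultimately show "Q5 s5" unfolding Q5_def using * a(4) by simp
    qed simp
  qed
  have 6: "runs (Blk [Const 29 1, Add 2 2 29]) s5 (4 * lg) ?Q" if q5: "Q5 s5" for s5
  proof -
    let ?s = "blk_exec [Const 29 1, Add 2 2 29] s5"
    have a: "core (V + job_heap) s5 r N bu its" "holds s5 25 rest (V + job_heap)" using q5 unfolding Q5_def by auto
    have rr: "reg s5 2 = r" using a(1) by (auto simp: core_def)
    have s': "mem ?s = mem s5" "reg ?s = (reg s5)(29 := 1, 2 := r + 1)" using rr by (auto simp: fun_eq_iff)
    have h13: "holds ?s 13 its (V + job_heap)"
      by (rule holds_even[of s5]) (use a(1) s' in \<open>auto simp: core_def\<close>)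
    have "core (V + job_heap) ?s (r + 1) N bu its"
      by (rule core_upd[OF a(1)]) (use s' r h13 a(1) in \<open>auto simp: core_def\<close>)
    moreover have "holds ?s 25 rest (V + job_heap)" by (rule holds_even[OF a(2)]) (use s' in auto)
    moreover have "fresh (r + 1) ?s" using q5 s'(1) unfolding Q5_def fresh_def by simp
    moreover have "reg ?s 18 = reg s5 18" "reg ?s 5 = reg s5 5" "reg ?s 40 = reg s5 40" unfolding s'(2) by simp_all
    ultimately have "?Q ?s" using q5 unfolding Q5_def by simp
    moreover have "blk_cost [Const 29 1, Add 2 2 29] s5 <= 4 * lg" using rr beta[of r] r beta2 by simp
    ultimately show ?thesis by (intro blk) auto
  qed
  define u where "u = simc * (4 * (lg + bu))"
  define l where "l = Lmax * (Tn + 400)"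
  show ?thesis unfolding job_code_def
  proof (rule seq[OF 1])
    fix s1 assume q1: "Q1 s1"
    then have dd: "d <= dmax" "c * (q + 1) <= d" by (auto simp: Q1_def)
    have s5: "runs (sim p nr) s4 (u * lg) Q5" if "Q3 s4 & reg s4 3 = bu" for s4
      unfolding u_def by (rule 5[OF that dd])
    have 56: "runs (sim p nr ;; Blk [Const 29 1, Add 2 2 29]) s4 ((u + 4) * lg) ?Q" if "Q3 s4 & reg s4 3 = bu" for s4
      by (rule seq[OF s5[OF that] 6 le_refl])
    have 46: "runs (Blk [Const 3 0, Add 3 3 17] ;; sim p nr ;; Blk [Const 29 1, Add 2 2 29]) s3 ((u + 8) * lg) ?Q"
      if "Q3 s3" for s3 by (rule seq[OF 4[OF that] 56]; (assumption | linarith))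
    have s3: "runs build_code s2 ((20 + l) * lg) Q3" if "Q2 s2" for s2 unfolding l_def by (rule 3[OF that dd(1)])
    have 36: "runs (build_code ;; Blk [Const 3 0, Add 3 3 17] ;; sim p nr ;; Blk [Const 29 1, Add 2 2 29]) s2
      ((28 + l + u) * lg) ?Q" if "Q2 s2" for s2 by (rule seq[OF s3[OF that] 46]; (assumption | linarith))
    show "runs (env_code ;; build_code ;; Blk [Const 3 0, Add 3 3 17] ;; sim p nr ;; Blk [Const 29 1, Add 2 2 29]) s1
      ((168 + l + u) * lg) ?Q" by (rule seq[OF 2[OF q1] 36]; (assumption | linarith))
  qed (simp add: job_time_def u_def l_def)
qed

end

lemma holds_Cons: "holds s i (x # xs) V \<longleftrightarrow> holds s i (x, xs) V"
  by (simp add: holds_def enc_prod_def)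

lemma mod_Suc_step:
  fixes m \<tau> :: nat
  assumes "0 < m"
  shows "Suc (\<tau> mod m) < m ==> Suc \<tau> mod m = Suc (\<tau> mod m) & Suc \<tau> div m = \<tau> div m"
    and "~ Suc (\<tau> mod m) < m ==> Suc \<tau> mod m = 0 & Suc \<tau> div m = Suc (\<tau> div m)"
proof -
  have l: "\<tau> mod m < m" using assms by simp
  show "Suc (\<tau> mod m) < m ==> Suc \<tau> mod m = Suc (\<tau> mod m) & Suc \<tau> div m = \<tau> div m"
    by (simp add: mod_Suc div_Suc)
  show "~ Suc (\<tau> mod m) < m ==> Suc \<tau> mod m = 0 & Suc \<tau> div m = Suc (\<tau> div m)"
    using l by (auto simp: mod_Suc div_Suc)
qed

context driver begin

section \<open>The worklist and the clock\<close>

definition load_code :: com where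
  "load_code = Blk [Load 27 13, Const 29 2, Add 29 29 13, Load 25 29] ;; MOV (40 + nr) 27 ;; ce"

definition branch_code :: com where
  "branch_code = Blk [Load 29 (40 + nr), Const 30 2, Add 30 30 (40 + nr), Load 30 30, Load 30 30] ;;
     ALLOC 31 29 25 39 ;; ALLOC 32 30 31 39 ;; Blk [Const 13 0, Add 13 13 32]"

text \<open>After a time-out the item stays on the worklist and the next size is tried; beyond the
  last size the search restarts at \<open>2 * R\<close> with a doubled clock. A run that ends in
  time removes the item if it accepts; otherwise the formula is satisfiable, so the answer is set
  and the worklist emptied.\<close>

definition next_code :: com where
  "next_code = Ite 5 (Blk [Const 29 1, Add 14 14 29, Sub 29 16 14] ;;
       Ite 29 (Blk []) (Blk [Const 14 0, Add 14 14 15, Add 17 17 17]))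
     (Ite 40 (Blk [Const 13 0, Add 13 13 25]) (Blk [Const 18 1, Const 13 0]))"

text \<open>An empty list of children is the atom 0, so testing register \<open>40 + nr\<close>
  recognises the leaves.\<close>

definition loop_code :: com where
  "loop_code = load_code ;; Ite (40 + nr) branch_code (job_code ;; next_code)"

lemma load_code:
  assumes core: "core V s r N bu (it # its)" and inv: "item_inv it" and V: "V + Te <= Vmax"
  shows "runs load_code s ((Te + 20) * lg) (%s'. ext 25 s s' & hp_ok s' (V + Te) & holds s' 27 it (V + Te) &
    holds s' 25 its (V + Te) & holds s' (40 + nr) (ex it) (V + Te))"
proof -
  let ?kb = "40 + nr"
  have h: "hp_ok s V" "holds s 13 (it, its) V" using core by (auto simp: core_def holds_Cons)
  note pr = holds_Pr[OF h(2,1), unfolded fst_conv snd_conv]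
  have VV: "V <= Vmax" using V by simp
  let ?is = "[Load 27 13, Const 29 2, Add 29 29 13, Load 25 29]"
  let ?s1 = "blk_exec ?is s"
  have s1: "mem ?s1 = mem s" "reg ?s1 = (reg s)(27 := mem s (reg s 13), 29 := reg s 13 + 2, 25 := mem s (reg s 13 + 2))"
    by (auto simp: fun_eq_iff)
  have 1: "runs (Blk ?is) s (10 * lg) (%x. x = ?s1)"
  proof (rule blk)
    have "bit_length (reg s 13) <= lg" "bit_length (reg s 13 + 2) <= lg" "bit_length (2 + reg s 13) <= lg"
      "bit_length (mem s (reg s 13)) <= lg" "bit_length (mem s (reg s 13 + 2)) <= lg"
      "bit_length (mem s (2 + reg s 13)) <= lg"
      using pr VV by (intro beta; simp add: add.commute)+
    then show "blk_cost ?is s <= 10 * lg" using beta2 by simp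
  qed auto
  have h1: "hp_ok ?s1 V" by (rule hp_ok_even[OF h(1)]) (use s1 in auto)
  have r1: "holds ?s1 27 it V" "holds ?s1 25 its V" unfolding holds_def s1 using pr by simp_all
  have 2: "runs (MOV ?kb 27) ?s1 (4 * lg) (post ?kb ?s1 it V)"
    by (rule post_runs[OF MOV_rule[OF h1 r1(1)]]) (use VV in auto)
  have 3: "runs ce s2 (Te * lg) (%s'. ext 25 s s' & hp_ok s' (V + Te) & holds s' 27 it (V + Te) &
    holds s' 25 its (V + Te) & holds s' ?kb (ex it) (V + Te))" if p: "post ?kb ?s1 it V s2" for s2
  proof -
    have p2: "ext ?kb ?s1 s2" "hp_ok s2 V" "holds s2 ?kb it V" using p by (auto simp: post_def)
    have "runs ce s2 (Te * lg) (post ?kb s2 (ex it) (V + te it))"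
      by (rule post_runs[OF code_ex[OF p2(2,3)] te[OF inv]]) (use V te[OF inv] in linarith)
    then show ?thesis
    proof (rule runs_mono)
      fix x assume "post ?kb s2 (ex it) (V + te it) x"
      then have px: "post ?kb ?s1 (ex it) (V + Te) x"
        using post_mono[OF post_ext[OF p2(1)], of "ex it" "V + te it" x "V + Te"] te[OF inv] by simp
      then have e: "ext ?kb ?s1 x" by (simp add: post_def)
      have "ext 25 s ?s1" using s1 by (auto simp: ext_def)
      then have "ext 25 s x" by (rule ext_trans) (rule ext_mono[OF e], simp)
      moreover have "holds x 27 it (V + Te)" "holds x 25 its (V + Te)"
        by (rule holds_ext[OF r1(1) e] holds_ext[OF r1(2) e]; simp)+
      ultimately show "ext 25 s x & hp_ok x (V + Te) & holds x 27 it (V + Te) &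
        holds x 25 its (V + Te) & holds x ?kb (ex it) (V + Te)" using px by (simp add: post_def)
    qed simp
  qed
  have 4: "runs (MOV ?kb 27 ;; ce) ?s1 ((Te + 4) * lg) (%s'. ext 25 s s' & hp_ok s' (V + Te) & holds s' 27 it (V + Te) &
    holds s' 25 its (V + Te) & holds s' ?kb (ex it) (V + Te))" by (rule seq[OF 2 3]; (assumption | linarith))
  show ?thesis unfolding load_code_def
    by (rule seq[OF 1, where ?t2.0 = "Te + 4"]) (use 4 in auto)
qed

lemma branch_code:
  assumes core: "core V s r N bu its" and fr: "fresh r s"
    and h: "holds s 25 rest V" "holds s (40 + nr) [e0, e1] V" and V: "V + 8 <= Vmax"
  shows "runs branch_code s (60 * lg) (%s'. core (V + 8) s' r N bu (e1 # e0 # rest) & fresh r s' & reg s' 18 = reg s 18)"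
proof -
  let ?kb = "40 + nr"
  have h0: "hp_ok s V" using core by (simp add: core_def)
  have h2: "holds s ?kb (e0, [e1]) V" using h(2) by (simp add: holds_Cons)
  note pr = holds_Pr[OF h2 h0, unfolded fst_conv snd_conv]
  let ?a = "mem s (reg s ?kb + 2)"
  have pr2: "0 < ?a" "even ?a" "?a + 2 < reg s 0" "rep (mem s) (reg s 0) (enc e1) (mem s ?a)"
    using pr(8) by simp_all
  have hp: "reg s 0 <= V" "!!a. a < reg s 0 ==> even a ==> mem s a <= V" using h0 by (auto simp: hp_ok_def)
  have ma: "mem s ?a <= V" by (rule hp(2)) (use pr2 in auto)
  have VV: "V <= Vmax" using V by simp
  let ?is = "[Load 29 ?kb, Const 30 2, Add 30 30 ?kb, Load 30 30, Load 30 30]"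
  let ?s1 = "blk_exec ?is s"
  have s1: "mem ?s1 = mem s" "reg ?s1 = (reg s)(29 := mem s (reg s ?kb), 30 := mem s ?a)"
    by (auto simp: fun_eq_iff add.commute)
  have 1: "runs (Blk ?is) s (14 * lg) (%x. x = ?s1)"
  proof (rule blk)
    have "bit_length (reg s ?kb) <= lg" "bit_length (reg s ?kb + 2) <= lg" "bit_length (mem s (reg s ?kb)) <= lg"
      "bit_length ?a <= lg" "bit_length (mem s ?a) <= lg"
      using pr ma VV by (intro beta; simp)+
    moreover have "blk_cost ?is s = (bit_length (reg s ?kb) + bit_length (mem s (reg s ?kb))) + 2 + (2 + bit_length (reg s ?kb))
      + (bit_length (reg s ?kb + 2) + bit_length ?a) + (bit_length ?a + bit_length (mem s ?a))"
      by (simp add: add.commute)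
    ultimately show "blk_cost ?is s <= 14 * lg" using beta2 by linarith
  qed auto
  have e1: "ext 22 s ?s1" using s1 by (auto simp: ext_def)
  have h1: "hp_ok ?s1 V" by (rule hp_ok_even[OF h0]) (use s1 in auto)
  have r1: "holds ?s1 29 e0 V" "holds ?s1 30 e1 V" unfolding holds_def s1 using pr pr2 ma by simp_all
  have r2: "holds ?s1 25 rest V" by (rule holds_even[OF h(1)]) (use s1 in auto)
  have r18: "reg ?s1 18 = reg s 18" unfolding s1 by simp
  have 2: "runs (ALLOC 31 29 25 39) ?s1 (16 * lg) (post 31 ?s1 (e0 # rest) (V + 4))"
    unfolding post_def holds_Cons
    by (rule alloc[OF h1 r1(1) r2, of 31 39, unfolded post_def]) (use V in auto)
  let ?Q3 = "%s3. ext 31 ?s1 s3 & hp_ok s3 (V + 8) & holds s3 32 (e1 # e0 # rest) (V + 8)"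
  have 3: "runs (ALLOC 32 30 31 39) s2 (16 * lg) ?Q3" if p: "post 31 ?s1 (e0 # rest) (V + 4) s2" for s2
  proof -
    have p2: "ext 31 ?s1 s2" "hp_ok s2 (V + 4)" "holds s2 31 (e0 # rest) (V + 4)" using p by (auto simp: post_def)
    have h30: "holds s2 30 e1 (V + 4)" by (rule holds_ext[OF r1(2) p2(1)]) auto
    have "runs (ALLOC 32 30 31 39) s2 (16 * lg) (post 32 s2 (e1, e0 # rest) (V + 4 + 4))"
      by (rule alloc[OF p2(2) h30 p2(3)]) (use V in auto)
    then show ?thesis
    proof (rule runs_mono)
      fix x assume p: "post 32 s2 (e1, e0 # rest) (V + 4 + 4) x"
      then have e: "ext 32 s2 x" by (simp only: post_def)
      have "ext 31 ?s1 x" by (rule ext_trans[OF p2(1)]) (rule ext_mono[OF e], simp)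
      then show "?Q3 x" using p unfolding post_def holds_Cons[of x 32] by (simp only: add.assoc) simp
    qed simp
  qed
  have 4: "runs (Blk [Const 13 0, Add 13 13 32]) s3 (4 * lg)
    (%s'. core (V + 8) s' r N bu (e1 # e0 # rest) & fresh r s' & reg s' 18 = reg s 18)" if q3: "?Q3 s3" for s3
  proof -
    let ?s = "blk_exec [Const 13 0, Add 13 13 32] s3"
    have e3: "ext 22 s s3" by (rule ext_trans[OF e1]) (rule ext_mono[of 31], use q3 in auto)
    have c3: "core (V + 8) s3 r N bu its" by (rule core_ext[OF core e3]) (use q3 in auto)
    have s': "mem ?s = mem s3" "reg ?s = (reg s3)(13 := reg s3 32)" by (auto simp: fun_eq_iff)
    have h13: "holds ?s 13 (e1 # e0 # rest) (V + 8)" using q3 unfolding holds_def s' by simp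
    have "core (V + 8) ?s r N bu (e1 # e0 # rest)"
      by (rule core_upd[OF c3]) (use s' h13 c3 in \<open>auto simp: core_def\<close>)
    moreover have "fresh r ?s" using fresh_ext[OF fr e3] s'(1) by (simp add: fresh_def)
    moreover have "reg s3 18 = reg s 18" using e3 unfolding ext_def by simp
    moreover have "reg s3 32 <= Vmax" using q3 V by (auto simp: holds_def)
    ultimately show ?thesis using beta[of "reg s3 32"] beta2 s'(2) by (intro blk) auto
  qed
  have 5: "runs (ALLOC 32 30 31 39 ;; Blk [Const 13 0, Add 13 13 32]) s2 (20 * lg)
    (%s'. core (V + 8) s' r N bu (e1 # e0 # rest) & fresh r s' & reg s' 18 = reg s 18)"
    if "post 31 ?s1 (e0 # rest) (V + 4) s2" for s2 by (rule seq[OF 3[OF that] 4]; (assumption | linarith))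
  have 6: "runs (ALLOC 31 29 25 39 ;; ALLOC 32 30 31 39 ;; Blk [Const 13 0, Add 13 13 32]) ?s1 (36 * lg)
    (%s'. core (V + 8) s' r N bu (e1 # e0 # rest) & fresh r s' & reg s' 18 = reg s 18)"
    by (rule seq[OF 2 5]; (assumption | linarith))
  show ?thesis unfolding branch_code_def
    by (rule seq[OF 1, where ?t2.0 = 36]) (use 6 in auto)
qed

lemma next_code:
  assumes core: "core V s r N bu its" and fr: "fresh r s" and h: "holds s 25 rest V"
    and bu: "reg s 5 ~= 0 ==> ~ N + 1 < 4 * R ==> 2 * bu <= Vmax" and V: "V <= Vmax" and b: "reg s 5 <= 1" "reg s 5 = 0 ==> bit_length (reg s 40) <= lg + bu"
  shows "runs next_code s ((60 + lg + bu) * lg) (%s'. fresh r s' &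
    (if reg s 5 ~= 0 then (if N + 1 < 4 * R then core V s' r (N + 1) bu its else core V s' r (2 * R) (2 * bu) its) & reg s' 18 = reg s 18
     else if reg s 40 ~= 0 then core V s' r N bu rest & reg s' 18 = reg s 18
     else core V s' r N bu [] & reg s' 18 = 1))" (is "runs _ _ _ ?Q")
proof -
  have N: "2 * R <= N" "N < 4 * R" "reg s 14 = N" "reg s 15 = 2 * R" "reg s 16 = 4 * R" "reg s 17 = bu" "1 <= bu" "bu <= Vmax"
    "r <= Vmax" "reg s 2 = r" "holds s 13 its V" using core by (auto simp: core_def)
  have R4: "4 * R <= Vmax" by (rule pow_le_Vmax(3))
  have bits: "bit_length N <= lg" "bit_length (N + 1) <= lg" "bit_length (2 * R) <= lg" "bit_length (4 * R) <= lg" "bit_length bu <= lg"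
    using N R4 by (intro beta; linarith)+
  let ?is = "[Const 29 1, Add 14 14 29, Sub 29 16 14]"
  let ?s1 = "blk_exec ?is s"
  have s1: "mem ?s1 = mem s" "reg ?s1 = (reg s)(14 := N + 1, 29 := 4 * R - (N + 1))" using N by (auto simp: fun_eq_iff)
  have T: "runs (Blk ?is ;; Ite 29 (Blk []) (Blk [Const 14 0, Add 14 14 15, Add 17 17 17])) s ((30 + lg + bu) * lg) ?Q" if t: "reg s 5 ~= 0"
  proof (rule seq)
    show "runs (Blk ?is) s (6 * lg) (%x. x = ?s1)"
    proof (rule blk)
      show "blk_cost ?is s <= 6 * lg" using N bits beta2 by simp
    qed auto
    fix x assume x: "x = ?s1"
    have h13: "holds ?s1 13 its V" by (rule holds_even[OF N(11)]) (use s1 in auto)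
    show "runs (Ite 29 (Blk []) (Blk [Const 14 0, Add 14 14 15, Add 17 17 17])) x (10 * lg) ?Q" unfolding x
    proof (rule runs_Ite)
      have "bit_length (4 * R - (N + 1)) <= lg" using R4 by (intro beta) linarith
      then have "bit_length (reg ?s1 29) <= lg" unfolding s1 by simp
      then show "bit_length (reg ?s1 29) + 1 + 8 * lg <= 10 * lg" using beta2 by linarith
      assume "reg ?s1 29 ~= 0"
      then have lt: "N + 1 < 4 * R" unfolding s1 by simp
      have "core V ?s1 r (N + 1) bu its" by (rule core_upd[OF core]) (use s1 N lt h13 in auto)
      moreover have "fresh r ?s1" using fr s1(1) by (simp add: fresh_def)
      moreover have "reg ?s1 18 = reg s 18" unfolding s1 by simp
      ultimately have "?Q ?s1" using t lt by simp
      then show "runs (Blk []) ?s1 (8 * lg) ?Q" by (intro blk) auto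
    next
      assume "reg ?s1 29 = 0"
      then have nlt: "~ N + 1 < 4 * R" unfolding s1 by simp
      let ?s2 = "blk_exec [Const 14 0, Add 14 14 15, Add 17 17 17] ?s1"
      have s2: "mem ?s2 = mem s" "reg ?s2 = (reg s)(14 := 2 * R, 17 := 2 * bu, 29 := 4 * R - (N + 1))"
        using N by (auto simp: fun_eq_iff)
      have h13: "holds ?s2 13 its V" by (rule holds_even[OF N(11)]) (use s2 in auto)
      have "core V ?s2 r (2 * R) (2 * bu) its" by (rule core_upd[OF core]) (use s2 N h13 bu[OF t nlt] in auto)
      moreover have "fresh r ?s2" using fr s2(1) by (simp add: fresh_def)
      moreover have "reg ?s2 18 = reg s 18" unfolding s2 by simp
      ultimately have "?Q ?s2" using t nlt by simp
      moreover have "blk_cost [Const 14 0, Add 14 14 15, Add 17 17 17] ?s1 <= 8 * lg" using N bits beta2 by simp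
      ultimately show "runs (Blk [Const 14 0, Add 14 14 15, Add 17 17 17]) ?s1 (8 * lg) ?Q" by (intro blk) auto
    qed
  qed simp
  have F: "runs (Ite 40 (Blk [Const 13 0, Add 13 13 25]) (Blk [Const 18 1, Const 13 0])) s ((30 + lg + bu) * lg) ?Q" if f: "~ reg s 5 ~= 0"
  proof (rule runs_Ite)
    define M where "M = (lg + bu) * lg"
    have "(lg + bu) * 1 <= M" unfolding M_def using beta2 by (intro mult_le_mono2) linarith
    then have "lg + bu <= M" by (simp only: mult_1_right)
    moreover have "bit_length (reg s 40) <= lg + bu" using b(2) f by simp
    ultimately have m: "bit_length (reg s 40) <= M" by linarith
    have eq: "(30 + lg + bu) * lg = 30 * lg + M" unfolding M_def by (simp only: add.assoc distrib_right)
    show "bit_length (reg s 40) + 1 + 4 * lg <= (30 + lg + bu) * lg"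
      unfolding eq using m beta2 by linarith
    assume t: "reg s 40 ~= 0"
    let ?s1 = "blk_exec [Const 13 0, Add 13 13 25] s"
    have s1: "mem ?s1 = mem s" "reg ?s1 = (reg s)(13 := reg s 25)" by (auto simp: fun_eq_iff)
    have h13: "holds ?s1 13 rest V" using h unfolding holds_def s1 by simp
    have "core V ?s1 r N bu rest" by (rule core_upd[OF core]) (use s1 N h13 in auto)
    moreover have "fresh r ?s1" using fr s1(1) by (simp add: fresh_def)
    moreover have "reg ?s1 18 = reg s 18" unfolding s1 by simp
    ultimately have "?Q ?s1" using t f by simp
    moreover have "reg s 25 <= Vmax" using h V by (auto simp: holds_def)
    then have "blk_cost [Const 13 0, Add 13 13 25] s <= 4 * lg" using beta[of "reg s 25"] beta2 by simp
    ultimately show "runs (Blk [Const 13 0, Add 13 13 25]) s (4 * lg) ?Q" by (intro blk) auto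
  next
    assume t: "reg s 40 = 0"
    let ?s1 = "blk_exec [Const 18 1, Const 13 0] s"
    have s1: "mem ?s1 = mem s" "reg ?s1 = (reg s)(18 := 1, 13 := 0)" by (auto simp: fun_eq_iff)
    have h13: "holds ?s1 13 ([] :: item list) V" unfolding holds_def s1 by simp
    have "core V ?s1 r N bu []" by (rule core_upd[OF core]) (use s1 N h13 in auto)
    moreover have "fresh r ?s1" using fr s1(1) by (simp add: fresh_def)
    moreover have "reg ?s1 18 = 1" unfolding s1 by simp
    ultimately have "?Q ?s1" using t f by simp
    moreover have "blk_cost [Const 18 1, Const 13 0] s <= 4 * lg" using beta2 by simp
    ultimately show "runs (Blk [Const 18 1, Const 13 0]) s (4 * lg) ?Q" by (intro blk) auto
  qed
  show ?thesis unfolding next_code_def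
  proof (rule runs_Ite[where ?b1.0 = "(30 + lg + bu) * lg"])
    have "bit_length (reg s 5) <= 1" using bit_length_mono[OF b(1)] by simp
    then show "bit_length (reg s 5) + 1 + (30 + lg + bu) * lg <= (60 + lg + bu) * lg"
      using beta2 unfolding add.assoc distrib_right[of 30] distrib_right[of 60] by linarith
  qed (use T F in auto)
qed

definition step_time :: "nat => nat" where
  "step_time bu = Te + 100 + job_time bu + (60 + lg + bu)"

definition step_heap :: nat where "step_heap = Te + 8 + job_heap"

lemma job_time_mono: "bu <= bu' ==> job_time bu <= job_time bu'"
  unfolding job_time_def by (intro add_mono mult_le_mono) auto

text \<open>A single number \<open>\<tau>\<close>, the count of time-outs so far, determines the
  current size and clock; \<open>\<tau>s\<close> is the count at which size \<open>Ns\<close> meets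
  a clock that suffices for it. From there no run times out, and a successful run keeps size and
  clock for the next leaf. So at most \<open>\<tau>s\<close> passes are lost, and they are added to
  the number \<open>m\<close> of nodes.\<close>

theorem main_loop:
  fixes Ls Ns m :: nat
  defines "\<tau>s \<equiv> Ls * (2 * R) + (Ns - 2 * R)"
  assumes Ns: "2 * R <= Ns" "Ns < 4 * R" "2 * T Ns <= 2 ^ Ls" "2 ^ Ls <= Vmax"
    and core: "core V s 0 (2 * R) 1 [it0]" and fr: "fresh 0 s" and a18: "reg s 18 = 0"
    and inv: "item_inv it0" and tr: "tree ex it0 m"
    and VV: "V + (m + \<tau>s) * step_heap <= Vmax" "m + \<tau>s <= Vmax"
  shows "runs (While 13 loop_code) s (((m + \<tau>s) * (step_time (2 ^ Ls) + 2) + 1) * lg)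
    (%s'. reg s' 18 = of_bool (item_sat it0))"
proof -
  \<comment> \<open>The variant \<open>i\<close> counts the unexplored nodes below the worklist plus
    the time-outs still possible. It also limits the heap, which is never collected and grows by at
    most \<open>step_heap\<close> per pass, and the number of runs.\<close>
  define I where "I i s \<longleftrightarrow> (EX V r \<tau> its ms. core V s r (2 * R + \<tau> mod (2 * R)) (2 ^ (\<tau> div (2 * R))) its &
    fresh r s & \<tau> <= \<tau>s & (ALL it:set its. item_inv it) & list_all2 (tree ex) its ms &
    i = sum_list ms + (\<tau>s - \<tau>) & V + i * step_heap <= Vmax & r + i <= Vmax &
    (reg s 18 = 0 & (item_sat it0 \<longleftrightarrow> (EX it:set its. item_sat it)) | reg s 18 = 1 & item_sat it0 & its = []))"
    for i and s :: config
  have R0: "0 < 2 * R" by simp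
  have \<tau>div: "2 ^ (\<tau> div (2 * R)) <= (2::nat) ^ Ls" if "\<tau> <= \<tau>s" for \<tau>
  proof -
    have "\<tau> < (Ls + 1) * (2 * R)" using that Ns(1,2) unfolding \<tau>s_def distrib_right by linarith
    then have "\<tau> div (2 * R) < Ls + 1" using R0 by (subst div_less_iff_less_mult) auto
    then show ?thesis by (intro power_increasing) auto
  qed
  have \<tau>s: "2 * R + \<tau>s mod (2 * R) = Ns" "\<tau>s div (2 * R) = Ls"
  proof -
    have l: "Ns - 2 * R < 2 * R" using Ns(1,2) by linarith
    have "\<tau>s mod (2 * R) = Ns - 2 * R" using l by (simp add: \<tau>s_def)
    then show "2 * R + \<tau>s mod (2 * R) = Ns" using Ns(1) by simp
    show "\<tau>s div (2 * R) = Ls" using l R0 unfolding \<tau>s_def by (subst div_mult_self3) auto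
  qed
  have body: "runs loop_code s (step_time (2 ^ Ls) * lg) (%s'. EX j<i. I j s')" if I: "I i s" and nz: "reg s 13 ~= 0" for i s
  proof -
    obtain V r \<tau> its0 ms0 where c0: "core V s r (2 * R + \<tau> mod (2 * R)) (2 ^ (\<tau> div (2 * R))) its0"
      and fr: "fresh r s" and \<tau>: "\<tau> <= \<tau>s" and inv0: "ALL it:set its0. item_inv it" and tr0: "list_all2 (tree ex) its0 ms0"
      and i: "i = sum_list ms0 + (\<tau>s - \<tau>)" and V: "V + i * step_heap <= Vmax" and r: "r + i <= Vmax"
      and ans0: "reg s 18 = 0 & (item_sat it0 \<longleftrightarrow> (EX it:set its0. item_sat it)) | reg s 18 = 1 & item_sat it0 & its0 = []"
      using I unfolding I_def by blast
    define N where "N = 2 * R + \<tau> mod (2 * R)"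
    define bu :: nat where "bu = 2 ^ (\<tau> div (2 * R))"
    have ne: "its0 ~= []"
    proof
      assume "its0 = []"
      then have "reg s 13 = 0" using c0 by (simp add: core_def holds_def)
      then show False using nz by simp
    qed
    then obtain it its where its0: "its0 = it # its" by (cases its0) auto
    obtain m1 ms where ms0: "ms0 = m1 # ms" and t1: "tree ex it m1" and trs: "list_all2 (tree ex) its ms"
      using tr0 unfolding its0 by (cases ms0) auto
    have c: "core V s r N bu (it # its)" using c0 unfolding its0 N_def bu_def .
    have inv: "item_inv it" "ALL it:set its. item_inv it" using inv0 its0 by auto
    have a18: "reg s 18 = 0" and sat: "item_sat it0 \<longleftrightarrow> item_sat it | (EX it:set its. item_sat it)"
      using ans0 its0 by auto
    have m1: "1 <= m1" using t1 by cases auto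
    have im: "i = m1 + sum_list ms + (\<tau>s - \<tau>)" using i ms0 by simp
    have "i ~= 0" using m1 im by linarith
    then obtain i' where i': "i = Suc i'" using not0_implies_Suc by blast
    have V': "V + step_heap + i' * step_heap <= Vmax" using V unfolding i' by simp
    then have VG: "V + step_heap <= Vmax" by linarith
    have rV: "r + 1 <= Vmax" using r i' by linarith
    have VTe: "V + Te <= Vmax" using VG unfolding step_heap_def by linarith
    have bu: "bu <= 2 ^ Ls" "1 <= bu" unfolding bu_def using \<tau>div[OF \<tau>] by simp_all
    let ?Q = "%s'. EX j<i. I j s'"
    \<comment> \<open>In each of the four outcomes (branching, time-out, rejected leaf, satisfiable
      leaf) it remains to exhibit the new worklist and count with a smaller variant; the heap and
      run bounds follow here once and for all.\<close>
    have new: "?Q s'" if cc: "core W s' r' (2 * R + \<tau>' mod (2 * R)) (2 ^ (\<tau>' div (2 * R))) its'" and ff: "fresh r' s'"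
      and tt: "\<tau>' <= \<tau>s" "ALL it:set its'. item_inv it" "list_all2 (tree ex) its' ms'"
        "sum_list ms' + (\<tau>s - \<tau>') <= i'" and W: "W <= V + step_heap" and r': "r' <= r + 1"
      and an: "reg s' 18 = 0 & (item_sat it0 \<longleftrightarrow> (EX it:set its'. item_sat it)) | reg s' 18 = 1 & item_sat it0 & its' = []"
      for W s' r' \<tau>' its' ms'
    proof -
      define j where "j = sum_list ms' + (\<tau>s - \<tau>')"
      have ji: "j <= i'" using tt(4) by (simp add: j_def)
      have "W + j * step_heap <= Vmax" using V' W mult_le_mono1[OF ji, of step_heap] by linarith
      moreover have "r' + j <= Vmax" using r i' r' ji by linarith
      ultimately have "I j s'" unfolding I_def j_def using cc ff tt(1,2,3) an by blast
      then show ?thesis using ji i' by (intro exI[of _ j]) auto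
    qed
    let ?Ql = "%s'. ext 25 s s' & hp_ok s' (V + Te) & holds s' 27 it (V + Te) &
      holds s' 25 its (V + Te) & holds s' (40 + nr) (ex it) (V + Te)"
    have 1: "runs load_code s ((Te + 20) * lg) ?Ql" by (rule load_code[OF c inv(1) VTe])
    have 2: "runs (Ite (40 + nr) branch_code (job_code ;; next_code)) s1 ((70 + job_time bu + (60 + lg + bu)) * lg) ?Q"
      if q: "?Ql s1" for s1
    proof (rule runs_Ite)
      have e: "ext 25 s s1" using q by blast
      have c1: "core (V + Te) s1 r N bu (it # its)" by (rule core_ext[OF c e]) (use q in auto)
      have f1: "fresh r s1" by (rule fresh_ext[OF fr e])
      have a1: "reg s1 18 = 0" using e a18 unfolding ext_def by simp
      have kb: "reg s1 (40 + nr) <= Vmax" using q VTe by (auto simp: holds_def)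
      show "bit_length (reg s1 (40 + nr)) + 1 + (60 + job_time bu + (60 + lg + bu)) * lg <= (70 + job_time bu + (60 + lg + bu)) * lg"
        using beta[OF kb] beta2 unfolding add.assoc distrib_right[of 60] distrib_right[of 70] by linarith
      {
        assume kbn: "reg s1 (40 + nr) ~= 0"
        have "ex it ~= []"
        proof
          assume "ex it = []"
          then have "reg s1 (40 + nr) = 0" using q by (simp add: holds_def)
          then show False using kbn by simp
        qed
        then obtain e0 e1 where ee: "ex it = [e0, e1]" using expand_length[OF inv(1)] by blast
        have "runs branch_code s1 (60 * lg) ?Q"
        proof (rule runs_mono[OF branch_code[OF c1 f1, of its e0 e1]])
          show "holds s1 25 its (V + Te)" using q by blast
          show "holds s1 (40 + nr) [e0, e1] (V + Te)" using q unfolding ee by blast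
          show "V + Te + 8 <= Vmax" using VG unfolding step_heap_def by linarith
          fix s' assume s': "core (V + Te + 8) s' r N bu (e1 # e0 # its) & fresh r s' & reg s' 18 = reg s1 18"
          note es = expand_sat[OF inv(1) ee]
          obtain ma mb where mab: "tree ex e0 ma" "tree ex e1 mb" "m1 = ma + mb + 1"
            using t1 ee by (cases) auto
          show "?Q s'"
          proof (rule new[where its' = "e1 # e0 # its" and ms' = "mb # ma # ms" and \<tau>' = \<tau>])
            show "core (V + Te + 8) s' r (2 * R + \<tau> mod (2 * R)) (2 ^ (\<tau> div (2 * R))) (e1 # e0 # its)"
              using s' unfolding N_def bu_def by blast
            show "sum_list (mb # ma # ms) + (\<tau>s - \<tau>) <= i'" using im i' mab(3) by simp
            show "V + Te + 8 <= V + step_heap" unfolding step_heap_def by linarith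
            show "list_all2 (tree ex) (e1 # e0 # its) (mb # ma # ms)" using mab trs by simp
            show "reg s' 18 = 0 & (item_sat it0 \<longleftrightarrow> (EX it:set (e1 # e0 # its). item_sat it)) |
              reg s' 18 = 1 & item_sat it0 & e1 # e0 # its = []" using s' a1 sat es(3) by auto
          qed (use s' \<tau> inv es in auto)
        qed simp
        then show "runs branch_code s1 ((60 + job_time bu + (60 + lg + bu)) * lg) ?Q"
          by (rule runs_mono) (auto intro: mult_le_mono1)
      }
      assume kbz: "reg s1 (40 + nr) = 0"
      have leaf: "ex it = []"
      proof (rule ccontr)
        assume "ex it ~= []"
        then obtain e0 e1 where ee: "ex it = [e0, e1]" using expand_length[OF inv(1)] by blast
        have "holds s1 (40 + nr) (e0, [e1]) (V + Te)" using q unfolding ee holds_Cons by blast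
        then have "0 < reg s1 (40 + nr)" by (rule holds_Pr(1)) (use q in blast)
        then show False using kbz by simp
      qed
      have VJ: "V + Te + job_heap <= Vmax" using VG unfolding step_heap_def by linarith
      have 27: "holds s1 27 it (V + Te)" and 25: "holds s1 25 its (V + Te)" using q by blast+
      note job = job_code[OF c1 f1 inv(1) leaf 27 25 VJ rV]
      have nx: "runs next_code s2 ((60 + lg + bu) * lg) ?Q"
        if j: "core (V + Te + job_heap) s2 (r + 1) N bu (it # its) & fresh (r + 1) s2 &
          holds s2 25 its (V + Te + job_heap) & reg s2 18 = reg s1 18 &
          (reg s2 5 = 0 & (reg s2 40 ~= 0 \<longleftrightarrow> ~ item_sat it) & bit_length (reg s2 40) <= lg + bu |
           reg s2 5 = 1 & bu < 2 * T N)" for s2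
      proof -
        let ?W = "V + Te + job_heap"
        have j1: "core ?W s2 (r + 1) N bu (it # its)" "fresh (r + 1) s2" "holds s2 25 its ?W" "reg s2 18 = 0"
          using j a1 by auto
        have WW: "?W <= V + step_heap" unfolding step_heap_def by linarith
        \<comment> \<open>At \<open>\<tau> = \<tau>s\<close> the size is \<open>Ns\<close> and the
          clock is at least \<open>2 * T Ns\<close>, which contradicts what a time-out
          implies.\<close>
        have \<tau>lt: "\<tau> < \<tau>s" if "reg s2 5 ~= 0"
        proof (rule ccontr)
          assume "~ \<tau> < \<tau>s"
          then have eq: "\<tau> = \<tau>s" using \<tau> by simp
          then have "N = Ns" "bu = 2 ^ Ls" using \<tau>s unfolding N_def bu_def by auto
          moreover have "bu < 2 * T N" using j that by auto
          ultimately show False using Ns(3) by simp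
        qed
        have bu2: "2 * bu <= Vmax" if "reg s2 5 ~= 0" "~ N + 1 < 4 * R"
        proof -
          have "~ Suc (\<tau> mod (2 * R)) < 2 * R" using that(2) unfolding N_def by linarith
          then have "Suc \<tau> div (2 * R) = Suc (\<tau> div (2 * R))" using mod_Suc_step(2)[OF R0] by blast
          then have "2 * bu = 2 ^ (Suc \<tau> div (2 * R))" unfolding bu_def by simp
          also have "... <= 2 ^ Ls" by (rule \<tau>div) (use \<tau>lt[OF that(1)] in simp)
          finally show ?thesis using Ns(4) by linarith
        qed
        show ?thesis
        proof (rule runs_mono[OF next_code[OF j1(1,2,3)]])
          show "reg s2 5 ~= 0 ==> ~ N + 1 < 4 * R ==> 2 * bu <= Vmax" by (rule bu2)
          show "?W <= Vmax" by (rule VJ)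
          show "reg s2 5 <= 1" "reg s2 5 = 0 ==> bit_length (reg s2 40) <= lg + bu" using j by auto
          fix s' assume s': "fresh (r + 1) s' &
            (if reg s2 5 ~= 0 then (if N + 1 < 4 * R then core ?W s' (r + 1) (N + 1) bu (it # its)
               else core ?W s' (r + 1) (2 * R) (2 * bu) (it # its)) & reg s' 18 = reg s2 18
             else if reg s2 40 ~= 0 then core ?W s' (r + 1) N bu its & reg s' 18 = reg s2 18
             else core ?W s' (r + 1) N bu [] & reg s' 18 = 1)"
          show "?Q s'"
          proof (cases "reg s2 5 ~= 0")
            case True
            have cs: "core ?W s' (r + 1) (2 * R + Suc \<tau> mod (2 * R)) (2 ^ (Suc \<tau> div (2 * R))) (it # its)"
            proof (cases "N + 1 < 4 * R")
              case T2: True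
              then have "Suc (\<tau> mod (2 * R)) < 2 * R" unfolding N_def by linarith
              from mod_Suc_step(1)[OF R0 this] show ?thesis using s' True T2 unfolding N_def bu_def by simp
            next
              case F2: False
              then have "~ Suc (\<tau> mod (2 * R)) < 2 * R" unfolding N_def by linarith
              from mod_Suc_step(2)[OF R0 this] show ?thesis using s' True F2 unfolding bu_def by simp
            qed
            show ?thesis
            proof (rule new[OF cs, where ms' = "m1 # ms"])
              show "sum_list (m1 # ms) + (\<tau>s - Suc \<tau>) <= i'" using im i' \<tau>lt[OF True] by simp
              show "list_all2 (tree ex) (it # its) (m1 # ms)" using t1 trs by simp
              show "reg s' 18 = 0 & (item_sat it0 \<longleftrightarrow> (EX it:set (it # its). item_sat it)) |
                reg s' 18 = 1 & item_sat it0 & it # its = []" using s' True j1(4) sat by auto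
            qed (use s' \<tau>lt[OF True] inv WW in auto)
          next
            case F: False
            have is5: "reg s2 40 ~= 0 \<longleftrightarrow> ~ item_sat it" using j F by auto
            show ?thesis
            proof (cases "reg s2 40 ~= 0")
              case True
              then have cs: "core ?W s' (r + 1) (2 * R + \<tau> mod (2 * R)) (2 ^ (\<tau> div (2 * R))) its"
                using s' F unfolding N_def bu_def by simp
              show ?thesis
              proof (rule new[OF cs, where ms' = ms])
                show "sum_list ms + (\<tau>s - \<tau>) <= i'" using im i' m1 by simp
                show "reg s' 18 = 0 & (item_sat it0 \<longleftrightarrow> (EX it:set its. item_sat it)) |
                  reg s' 18 = 1 & item_sat it0 & its = []" using s' True F j1(4) sat is5 by auto
              qed (use s' \<tau> inv WW trs in auto)
            next
              case False
              then have cs: "core ?W s' (r + 1) (2 * R + \<tau> mod (2 * R)) (2 ^ (\<tau> div (2 * R))) []"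
                using s' F unfolding N_def bu_def by simp
              show ?thesis
              proof (rule new[OF cs, where ms' = "[]"])
                show "sum_list [] + (\<tau>s - \<tau>) <= i'" using im i' m1 by simp
                show "reg s' 18 = 0 & (item_sat it0 \<longleftrightarrow> (EX it:set []. item_sat it)) |
                  reg s' 18 = 1 & item_sat it0 & [] = ([] :: item list)" using s' False F sat is5 by auto
              qed (use s' \<tau> WW in auto)
            qed
          qed
        qed simp
      qed
      have "runs (job_code ;; next_code) s1 ((job_time bu + (60 + lg + bu)) * lg) ?Q"
        by (rule seq[OF job nx le_refl])
      then show "runs (job_code ;; next_code) s1 ((60 + job_time bu + (60 + lg + bu)) * lg) ?Q"
        by (rule runs_mono) (auto intro: mult_le_mono1)
    qed
    show ?thesis unfolding loop_code_def
      by (rule seq[OF 1 2]) (use job_time_mono[OF bu(1)] bu(1) in \<open>auto simp: step_time_def\<close>)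
  qed
  have I0: "I (m + \<tau>s) s"
  proof -
    have "core V s 0 (2 * R + 0 mod (2 * R)) (2 ^ (0 div (2 * R))) [it0]" using core by simp
    moreover have "list_all2 (tree ex) [it0] [m]" using tr by simp
    moreover have "m + \<tau>s = sum_list [m] + (\<tau>s - 0)" by simp
    moreover have "ALL it:set [it0]. item_inv it" using inv by simp
    moreover have "reg s 18 = 0 & (item_sat it0 \<longleftrightarrow> (EX it:set [it0]. item_sat it))" using a18 by simp
    moreover have "0 + (m + \<tau>s) <= Vmax" using VV(2) by simp
    ultimately show ?thesis unfolding I_def using fr VV(1) le0 by blast
  qed
  have "runs (While 13 loop_code) s ((m + \<tau>s) * (2 * lg + step_time (2 ^ Ls) * lg) + 1) (%s'. reg s' 18 = of_bool (item_sat it0))"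
  proof (rule runs_While[where I = I, OF I0])
    fix i s assume I: "I i s" and nz: "reg s 13 ~= 0"
    have "reg s 13 <= Vmax" using I unfolding I_def core_def holds_def by (auto intro: order_trans)
    then have "bit_length (reg s 13) + 1 <= 2 * lg" using beta[of "reg s 13"] beta2 by linarith
    then show "bit_length (reg s 13) + 1 <= 2 * lg & runs loop_code s (step_time (2 ^ Ls) * lg) (%s'. EX j<i. I j s')"
      using body[OF I nz] by blast
  next
    fix i s assume I: "I i s" and z: "reg s 13 = 0"
    then obtain V r N bu its where c: "core V s r N bu its" and
      a: "reg s 18 = 0 & (item_sat it0 \<longleftrightarrow> (EX it:set its. item_sat it)) | reg s 18 = 1 & item_sat it0 & its = []"
      unfolding I_def by blast
    have "its = []"
    proof (rule ccontr)
      assume "its ~= []"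
      then obtain it its' where "its = it # its'" by (cases its) auto
      then have h: "hp_ok s V" "holds s 13 (it, its') V" using c by (auto simp: core_def holds_Cons)
      show False using holds_Pr(1)[OF h(2,1)] z by simp
    qed
    then show "reg s 18 = of_bool (item_sat it0)" using a by auto
  qed
  then show ?thesis
  proof (rule runs_mono)
    have "(m + \<tau>s) * (2 * lg + step_time (2 ^ Ls) * lg) = ((m + \<tau>s) * (step_time (2 ^ Ls) + 2)) * lg"
      by (simp add: algebra_simps)
    then show "(m + \<tau>s) * (2 * lg + step_time (2 ^ Ls) * lg) + 1 <= ((m + \<tau>s) * (step_time (2 ^ Ls) + 2) + 1) * lg"
      using beta2 unfolding distrib_right[of _ 1] by linarith
  qed
qed

end

context driver begin

section \<open>Reading the input and starting the search\<close>

definition read_code :: com where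
  "read_code = Blk [Load 2 1, Const 3 1, Load 3 3, Const 4 (k + 1), Mul 3 3 4, Add 3 3 2, Const 4 2, Add 1 3 4,
      Add 0 1 1, Const 26 0, Add 26 26 1, Const 27 0] ;;
     While 26 (Blk [Const 29 1, Sub 26 26 29, Load 28 26] ;; ALLOC 30 28 27 39 ;; Blk [Const 27 0, Add 27 27 30])"

definition unpack_code :: com where
  "unpack_code = Blk [Load 27 (40 + nr), Const 29 2, Add 29 29 (40 + nr), Load 29 29, Load 19 29, Const 30 2,
      Add 29 29 30, Load 20 29, Const 28 0] ;;
     ALLOC 31 27 28 39 ;; Blk [Const 13 0, Add 13 13 31, Const 30 3, Div 30 2 30, Const 21 1] ;;
     While 30 (Blk [Add 21 21 21, Const 29 1, Sub 30 30 29]) ;;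
     Blk [Add 15 21 21, Add 16 15 15, Const 14 0, Add 14 14 15, Const 17 1, Const 18 0, Const 2 0]"

text \<open>\<open>Z\<close> is computed from the header: room for \<open>k\<close> literals and a
  length per clause, for the header itself, and \<open>n\<close> further cells as padding. The heap
  starts at \<open>2 * Z\<close> and all simulated cells lie above that, so the input below
  \<open>Z\<close> is undisturbed while it is copied into a list; cells behind the input read as
  0.\<close>

lemma read_code:
  assumes xs: "2 <= length xs" "xs ! 0 = n" "Z = xs ! 1 * (k + 1) + n + 2" "length xs <= Z" "!!x. x \<in> set xs ==> x <= V0"
    and V0: "2 * Z <= V0" "k + 1 <= V0" "V0 + 4 * Z <= Vmax"
  shows "runs read_code (init xs) ((40 + 40 * Z) * lg) (%s. hp_ok s (V0 + 4 * Z) & reg s 1 = Z & reg s 2 = n &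
    fresh 0 s & holds s 27 (xs @ replicate (Z - length xs) 0) (V0 + 4 * Z))"
proof -
  let ?A = "[Load 2 1, Const 3 1, Load 3 3, Const 4 (k + 1), Mul 3 3 4, Add 3 3 2, Const 4 2, Add 1 3 4,
      Add 0 1 1, Const 26 0, Add 26 26 1, Const 27 0]"
  let ?fl = "xs @ replicate (Z - length xs) 0"
  let ?s0 = "blk_exec ?A (init xs)"
  define mm where "mm = xs ! 1"
  have m01: "mem (init xs) 0 = n" "mem (init xs) (Suc 0) = mm" using xs(1,2) by (auto simp: init_def mm_def)
  have r0: "reg (init xs) = (%_. 0)" by (simp add: init_def)
  have Zm: "Z = mm * (k + 1) + n + 2" using xs(3) by (simp add: mm_def)
  have s0: "mem ?s0 = mem (init xs)" "reg ?s0 = (%_. 0)(0 := 2 * Z, 1 := Z, 2 := n, 3 := mm * (k + 1) + n, 4 := 2, 26 := Z)"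
    using Zm by (simp_all add: r0 m01 fun_eq_iff)
  have V0m: "V0 <= Vmax" using V0(3) by simp
  have mV: "mm <= V0" using xs(1,5) unfolding mm_def by (metis Suc_1 Suc_le_eq nth_mem)
  have memle: "mem (init xs) a <= V0" for a using xs(5)[of "xs ! a"] by (auto simp: init_def)
  define W where "W i = V0 + 4 * (Z - i)" for i
  define I where "I i s \<longleftrightarrow> reg s 26 = i & i <= Z & ext 26 ?s0 s & hp_ok s (W i) &
    holds s 27 (map (mem (init xs)) [i..<Z]) (W i)" for i and s :: config
  have hp0: "hp_ok ?s0 V0" unfolding hp_ok_def s0 using V0(1) Zm memle by simp
  have 1: "runs (Blk ?A) (init xs) (40 * lg) (I Z)"
  proof (rule blk)
    have "mm * (k + 1) <= V0" "mm * (k + 1) + n <= V0" "n <= V0" "Z <= V0" using Zm V0(1) by linarith+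
    then have "bit_length mm <= lg" "bit_length n <= lg" "bit_length (k + 1) <= lg" "bit_length (mm * (k + 1)) <= lg"
      "bit_length (mm * (k + 1) + n) <= lg" "bit_length Z <= lg"
      using V0 V0m mV by (intro beta; linarith)+
    moreover have "blk_cost ?A (init xs) = (1 + bit_length n) + 1 + (1 + bit_length mm) + bit_length (k + 1) +
      (bit_length mm + bit_length (k + 1)) + (bit_length (mm * (k + 1)) + bit_length n) + 2 +
      (bit_length (mm * (k + 1) + n) + 2) + (bit_length Z + bit_length Z) + 1 + (1 + bit_length Z) + 1"
      unfolding Zm by (simp add: r0 m01)
    ultimately show "blk_cost ?A (init xs) <= 40 * lg" using beta2 by linarith
    have r26: "reg ?s0 26 = Z" "reg ?s0 27 = 0" unfolding s0(2) by simp_all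
    have "holds ?s0 27 (map (mem (init xs)) [Z..<Z]) V0" unfolding holds_def r26 by simp
    then show "I Z ?s0" unfolding I_def W_def using r26(1) hp0 ext_refl[of 26 ?s0]
      by (simp only: diff_self_eq_0 mult_0_right add_0_right order_refl simp_thms)
  qed (auto simp: list_all_iff)
  have body: "runs (Blk [Const 29 1, Sub 26 26 29, Load 28 26] ;; ALLOC 30 28 27 39 ;; Blk [Const 27 0, Add 27 27 30]) s
      (30 * lg) (%s'. EX j<i. I j s')" if I: "I i s" and nz: "reg s 26 ~= 0" for i s
  proof -
    have "i ~= 0" using I nz unfolding I_def by auto
    then obtain a where a: "i = Suc a" using not0_implies_Suc by blast
    have b: "reg s 26 = Suc a" "Suc a <= Z" "ext 26 ?s0 s" "hp_ok s (W i)" "holds s 27 (map (mem (init xs)) [i..<Z]) (W i)"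
      using I unfolding I_def a by auto
    have Wa: "W a = W i + 4" using b(2) unfolding W_def a by simp
    have WV: "W j <= Vmax" for j using V0(3) unfolding W_def by simp
    have aV: "Suc a <= V0" "a <= V0" using b(2) V0(1) by linarith+
    have ma: "mem s a = mem (init xs) a"
    proof -
      have "a < 2 * Z" using b(2) by linarith
      then have "a < reg ?s0 0" unfolding s0(2) by simp
      then have "mem s a = mem ?s0 a" using b(3) unfolding ext_def by blast
      then show ?thesis unfolding s0(1) .
    qed
    let ?s1 = "blk_exec [Const 29 1, Sub 26 26 29, Load 28 26] s"
    have s1: "mem ?s1 = mem s" "reg ?s1 = (reg s)(29 := 1, 26 := a, 28 := mem (init xs) a)"
      using b(1) ma by (auto simp: fun_eq_iff)
    have bits: "bit_length (Suc a) <= lg" "bit_length a <= lg" "bit_length (mem (init xs) a) <= lg"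
      using aV V0m memle[of a] by (intro beta; linarith)+
    have 1: "runs (Blk [Const 29 1, Sub 26 26 29, Load 28 26]) s (6 * lg) (%x. x = ?s1)"
      by (rule blk) (use b(1) ma bits beta2 in auto)
    have h1: "hp_ok ?s1 (W i)" by (rule hp_ok_even[OF b(4)]) (use s1 in auto)
    have h27: "holds ?s1 27 (map (mem (init xs)) [i..<Z]) (W i)" by (rule holds_even[OF b(5)]) (use s1 in auto)
    have h28: "holds ?s1 28 (mem (init xs) a) (W i)" using s1 memle[of a] by (simp add: holds_nat W_def trans_le_add1)
    have 2: "runs (ALLOC 30 28 27 39) ?s1 (16 * lg) (post 30 ?s1 (mem (init xs) a, map (mem (init xs)) [i..<Z]) (W i + 4))"
      by (rule alloc[OF h1 h28 h27]) (use WV[of a] Wa in auto)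
    have 3: "runs (Blk [Const 27 0, Add 27 27 30]) s2 (4 * lg) (%s'. EX j<i. I j s')"
      if p: "post 30 ?s1 (mem (init xs) a, map (mem (init xs)) [i..<Z]) (W i + 4) s2" for s2
    proof -
      have e: "ext 30 ?s1 s2" "hp_ok s2 (W a)" "holds s2 30 (mem (init xs) a # map (mem (init xs)) [i..<Z]) (W a)"
        using p unfolding post_def Wa holds_Cons by auto
      let ?u = "blk_exec [Const 27 0, Add 27 27 30] s2"
      have s': "mem ?u = mem s2" "reg ?u = (reg s2)(27 := reg s2 30)" by (auto simp: fun_eq_iff)
      have "reg s2 26 = reg ?s1 26" using e(1) unfolding ext_def by simp
      then have r26: "reg ?u 26 = a" unfolding s1(2) s'(2) by simp
      have s01: "ext 26 s ?s1" using s1 by (auto simp: ext_def)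
      have s12: "ext 26 ?s1 s2" by (rule ext_mono[OF e(1)]) simp
      have s02: "ext 26 ?s0 s2" by (rule ext_trans[OF ext_trans[OF b(3) s01] s12])
      have "ext 26 s2 ?u" using s' by (auto simp: ext_def)
      with s02 have e26: "ext 26 ?s0 ?u" by (rule ext_trans)
      have "[a..<Z] = a # [i..<Z]" using b(2) a by (simp add: upt_conv_Cons)
      then have "holds ?u 27 (map (mem (init xs)) [a..<Z]) (W a)" using e(3) unfolding holds_def s' by simp
      moreover have "hp_ok ?u (W a)" by (rule hp_ok_even[OF e(2)]) (use s' in auto)
      ultimately have "I a ?u" unfolding I_def using r26 e26 b(2) by simp
      moreover have "reg s2 30 <= Vmax" using e(3) WV[of a] by (auto simp: holds_def)
      then have "blk_cost [Const 27 0, Add 27 27 30] s2 <= 4 * lg" using beta[of "reg s2 30"] beta2 by simp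
      ultimately show ?thesis using a by (intro blk) auto
    qed
    have 4: "runs (ALLOC 30 28 27 39 ;; Blk [Const 27 0, Add 27 27 30]) ?s1 (20 * lg) (%s'. EX j<i. I j s')"
      by (rule seq[OF 2 3]; (assumption | linarith))
    show ?thesis by (rule seq[OF 1, where ?t2.0 = 20]) (use 4 in auto)
  qed
  have 2: "runs (While 26 (Blk [Const 29 1, Sub 26 26 29, Load 28 26] ;; ALLOC 30 28 27 39 ;; Blk [Const 27 0, Add 27 27 30])) s
    (Z * (2 * lg + 30 * lg) + 1) (I 0)" if "I Z s" for s
  proof (rule runs_While[where I = I, OF that])
    fix i s assume I: "I i s" and nz: "reg s 26 ~= 0"
    have "reg s 26 <= Vmax" using I V0(1) V0m unfolding I_def by linarith
    then have "bit_length (reg s 26) + 1 <= 2 * lg" using beta[of "reg s 26"] beta2 by linarith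
    then show "bit_length (reg s 26) + 1 <= 2 * lg & runs (Blk [Const 29 1, Sub 26 26 29, Load 28 26] ;; ALLOC 30 28 27 39 ;;
      Blk [Const 27 0, Add 27 27 30]) s (30 * lg) (%s'. EX j<i. I j s')" using body[OF I nz] by blast
  qed (simp add: I_def)
  have fl: "map (mem (init xs)) [0..<Z] = ?fl"
    by (rule nth_equalityI) (use xs(4) in \<open>auto simp: init_def nth_append\<close>)
  show ?thesis unfolding read_code_def
  proof (rule seq[OF 1])
    fix s assume "I Z s"
    from 2[OF this] show "runs (While 26 (Blk [Const 29 1, Sub 26 26 29, Load 28 26] ;; ALLOC 30 28 27 39 ;;
      Blk [Const 27 0, Add 27 27 30])) s ((32 * Z + 1) * lg) (%s. hp_ok s (V0 + 4 * Z) & reg s 1 = Z & reg s 2 = n &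
      fresh 0 s & holds s 27 ?fl (V0 + 4 * Z))"
    proof (rule runs_mono)
      show "Z * (2 * lg + 30 * lg) + 1 <= (32 * Z + 1) * lg" using beta2 unfolding distrib_right by simp
      fix s' assume I0: "I 0 s'"
      then have e: "ext 26 ?s0 s'" by (simp add: I_def)
      have "reg s' 1 = reg ?s0 1" "reg s' 2 = reg ?s0 2" using e unfolding ext_def by simp_all
      then have "reg s' 1 = Z" "reg s' 2 = n" unfolding s0(2) by simp_all
      moreover have "fresh 0 s'" unfolding fresh_def
      proof (intro allI impI)
        fix r a
        have "mem s' (addr Z r a) = mem ?s0 (addr Z r a)" using e addr_odd unfolding ext_def by blast
        also have "... = 0" unfolding s0(1) using xs(4) by (simp add: init_def addr_def)
        finally show "mem s' (addr Z r a) = 0" .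
      qed
      moreover have "hp_ok s' (V0 + 4 * Z)" "holds s' 27 ?fl (V0 + 4 * Z)" using I0 unfolding I_def W_def fl by simp_all
      ultimately show "hp_ok s' (V0 + 4 * Z) & reg s' 1 = Z & reg s' 2 = n & fresh 0 s' & holds s' 27 ?fl (V0 + 4 * Z)" by blast
    qed
  qed (use xs(3) in linarith)
qed

lemma unpack_code:
  fixes it0 :: item
  assumes h: "hp_ok s V" "holds s (40 + nr) (it0, Vx, Vy) V" and r: "reg s 1 = Z" "reg s 2 = n" "fresh 0 s"
    and q3: "q = n div 3" and V: "V + 4 <= Vmax" "Lmax <= V" "n <= V"
  shows "runs unpack_code s ((80 + 10 * q) * lg) (%s'. core (V + 4) s' 0 (2 * R) 1 [it0] & fresh 0 s' & reg s' 18 = 0)"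
proof -
  let ?kb = "40 + nr"
  note p1 = holds_Pr[OF h(2,1), unfolded fst_conv snd_conv]
  define a where "a = mem s (reg s ?kb + 2)"
  have p2: "0 < a" "even a" "a + 2 < reg s 0" "rep (mem s) (reg s 0) (enc Vx) (mem s a)"
    "rep (mem s) (reg s 0) (enc Vy) (mem s (a + 2))" using p1(8) by (simp_all add: enc_prod_def a_def)
  have hp: "reg s 0 <= V" "!!a. a < reg s 0 ==> even a ==> mem s a <= V" using h(1) by (auto simp: hp_ok_def)
  have ma: "mem s a <= V" "mem s (a + 2) <= V" by (rule hp(2); use p2 in simp)+
  have VV: "V <= Vmax" using V by simp
  have R4: "4 * R <= Vmax" by (rule pow_le_Vmax(3))
  let ?A = "[Load 27 ?kb, Const 29 2, Add 29 29 ?kb, Load 29 29, Load 19 29, Const 30 2, Add 29 29 30, Load 20 29, Const 28 0]"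
  let ?s1 = "blk_exec ?A s"
  have s1: "mem ?s1 = mem s"
    "reg ?s1 = (reg s)(27 := mem s (reg s ?kb), 29 := a + 2, 19 := mem s a, 20 := mem s (a + 2), 30 := 2, 28 := 0)"
    by (auto simp: fun_eq_iff a_def add.commute)
  have 1: "runs (Blk ?A) s (30 * lg) (%x. x = ?s1)"
  proof (rule blk)
    have "bit_length (reg s ?kb) <= lg" "bit_length (reg s ?kb + 2) <= lg" "bit_length (mem s (reg s ?kb)) <= lg"
      "bit_length a <= lg" "bit_length (mem s a) <= lg" "bit_length (a + 2) <= lg" "bit_length (mem s (a + 2)) <= lg"
      using p1 p2 ma hp(1) VV by (intro beta; simp add: a_def)+
    moreover have "blk_cost ?A s = (bit_length (reg s ?kb) + bit_length (mem s (reg s ?kb))) + 2 + (2 + bit_length (reg s ?kb))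
      + (bit_length (reg s ?kb + 2) + bit_length a) + (bit_length a + bit_length (mem s a)) + 2 + (bit_length a + 2) +
      (bit_length (a + 2) + bit_length (mem s (a + 2))) + 1"
      by (simp add: add.commute a_def)
    ultimately show "blk_cost ?A s <= 30 * lg" using beta2 by linarith
  qed auto
  have h1: "hp_ok ?s1 V" by (rule hp_ok_even[OF h(1)]) (use s1 in auto)
  have hs: "holds ?s1 27 it0 V" "holds ?s1 28 ([] :: item list) V" "holds ?s1 19 Vx V" "holds ?s1 20 Vy V"
    unfolding holds_def s1 using p1 p2 ma by simp_all
  have f1: "fresh 0 ?s1" using r(3) s1(1) by (simp add: fresh_def)
  have 2: "runs (ALLOC 31 27 28 39) ?s1 (16 * lg) (post 31 ?s1 [it0] (V + 4))"
    unfolding post_def holds_Cons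
    by (rule alloc[OF h1 hs(1,2), of 31 39, unfolded post_def]) (use V in auto)
  define F where "F s' \<longleftrightarrow> hp_ok s' (V + 4) & reg s' 1 = Z & holds s' 19 Vx (V + 4) & holds s' 20 Vy (V + 4) &
    holds s' 13 [it0] (V + 4) & fresh 0 s'" for s' :: config
  have F_frame: "F s''" if "F s'" "mem s'' = mem s'" "!!i. i \<in> {0, 1, 13, 19, 20} ==> reg s'' i = reg s' i" for s' s''
    using that unfolding F_def hp_ok_def holds_def fresh_def by simp
  define I where "I i s' \<longleftrightarrow> F s' & i <= q & reg s' 30 = i & reg s' 21 = 2 ^ (q - i)" for i and s' :: config
  let ?B = "[Const 13 0, Add 13 13 31, Const 30 3, Div 30 2 30, Const 21 1]"
  have 3: "runs (Blk ?B) s2 (10 * lg) (I q)" if p: "post 31 ?s1 [it0] (V + 4) s2" for s2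
  proof -
    have e: "ext 31 ?s1 s2" "hp_ok s2 (V + 4)" "holds s2 31 [it0] (V + 4)" using p by (auto simp: post_def)
    have r2: "!!i. 0 < i ==> i < 31 ==> reg s2 i = reg ?s1 i" using e(1) by (auto simp: ext_def)
    have "reg s2 2 = reg ?s1 2" "reg s2 1 = reg ?s1 1" by (rule r2; simp)+
    then have r2n: "reg s2 2 = n" "reg s2 1 = Z" using r unfolding s1(2) by simp_all
    have hv: "holds s2 19 Vx (V + 4)" "holds s2 20 Vy (V + 4)" by (rule holds_ext[OF hs(3) e(1)] holds_ext[OF hs(4) e(1)]; simp)+
    let ?s = "blk_exec ?B s2"
    have s': "mem ?s = mem s2" "reg ?s = (reg s2)(13 := reg s2 31, 30 := q, 21 := 1)" using r2n q3 by (auto simp: fun_eq_iff)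
    have "F ?s" unfolding F_def hp_ok_def holds_def fresh_def
      using e(2,3) hv r2n fresh_ext[OF f1 e(1)] unfolding s' hp_ok_def holds_def fresh_def by simp
    then have "I q ?s" unfolding I_def s' by simp
    moreover have "bit_length 3 <= lg" "bit_length n <= lg" "bit_length (reg s2 31) <= lg"
      using e(3) V R4 Lmax by (intro beta; simp add: holds_def)+
    then have "blk_cost ?B s2 <= 10 * lg" using r2n beta2 by simp
    ultimately show ?thesis by (intro blk) auto
  qed
  let ?C = "[Add 21 21 21, Const 29 1, Sub 30 30 29]"
  have 4: "runs (While 30 (Blk ?C)) s3 (q * (2 * lg + 6 * lg) + 1) (I 0)" if "I q s3" for s3
  proof (rule runs_While[where I = I, OF that])
    fix i s' assume I: "I i s'" and nz: "reg s' 30 ~= 0"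
    have "i ~= 0" using I nz unfolding I_def by auto
    then obtain b where b: "i = Suc b" using not0_implies_Suc by blast
    have i: "F s'" "Suc b <= q" "reg s' 30 = Suc b" "reg s' 21 = 2 ^ (q - Suc b)" using I unfolding I_def b by auto
    have "2 ^ (q - Suc b) <= R" by (intro power_increasing) auto
    moreover have "q < R" by simp
    ultimately have bits: "bit_length (2 ^ (q - Suc b)) <= lg" "bit_length (Suc b) <= lg"
      using R4 i(2) by (intro beta; linarith)+
    let ?s = "blk_exec ?C s'"
    have s': "mem ?s = mem s'" "reg ?s = (reg s')(21 := 2 ^ (q - Suc b) + 2 ^ (q - Suc b), 29 := 1, 30 := b)"
      using i by (auto simp: fun_eq_iff)
    have "q - b = Suc (q - Suc b)" using i(2) by simp
    then have "reg ?s 30 = b" "reg ?s 21 = 2 ^ (q - b)" unfolding s'(2) by (simp_all add: mult_2)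
    moreover have "F ?s" by (rule F_frame[OF i(1) s'(1)]) (use s'(2) in auto)
    ultimately have "I b ?s" unfolding I_def using i(2) by simp
    moreover have "blk_cost ?C s' <= 6 * lg" using i bits beta2 by simp
    ultimately have "runs (Blk ?C) s' (6 * lg) (%s'. EX j<i. I j s')" using b by (intro blk) auto
    moreover have "bit_length (reg s' 30) + 1 <= 2 * lg" using i(3) bits beta2 by simp
    ultimately show "bit_length (reg s' 30) + 1 <= 2 * lg & runs (Blk ?C) s' (6 * lg) (%s'. EX j<i. I j s')" by blast
  qed (simp add: I_def)
  have s4: "runs (While 30 (Blk ?C)) s3 ((8 * q + 1) * lg) (I 0)" if "I q s3" for s3
    by (rule runs_mono[OF 4[OF that]]) (use beta2 in \<open>simp_all add: distrib_right\<close>)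
  let ?D = "[Add 15 21 21, Add 16 15 15, Const 14 0, Add 14 14 15, Const 17 1, Const 18 0, Const 2 0]"
  let ?Q = "%s'. core (V + 4) s' 0 (2 * R) 1 [it0] & fresh 0 s' & reg s' 18 = 0"
  have 5: "runs (Blk ?D) s4 (12 * lg) ?Q" if "I 0 s4" for s4
  proof -
    have i: "F s4" "reg s4 21 = R" using that unfolding I_def by auto
    let ?s = "blk_exec ?D s4"
    have s': "mem ?s = mem s4" "reg ?s = (reg s4)(15 := 2 * R, 16 := 4 * R, 14 := 2 * R, 17 := 1, 18 := 0, 2 := 0)"
      using i by (auto simp: fun_eq_iff)
    have "F ?s" by (rule F_frame[OF i(1) s'(1)]) (use s'(2) in auto)
    then have "?Q ?s" unfolding F_def core_def using s'(2) i(2) V(2) Vmax(4) by simp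
    moreover have "bit_length R <= lg" "bit_length (R + R) <= lg" using R4 by (intro beta; linarith)+
    then have "blk_cost ?D s4 <= 12 * lg" using i(2) beta2 by simp
    ultimately show ?thesis by (intro blk) auto
  qed
  have 6: "runs (While 30 (Blk ?C) ;; Blk ?D) s3 ((8 * q + 13) * lg) ?Q" if "I q s3" for s3
    by (rule seq[OF s4[OF that] 5]; (assumption | linarith))
  have 7: "runs (Blk ?B ;; While 30 (Blk ?C) ;; Blk ?D) s2 ((8 * q + 23) * lg) ?Q" if "post 31 ?s1 [it0] (V + 4) s2" for s2
    by (rule seq[OF 3[OF that] 6]; (assumption | linarith))
  have 8: "runs (ALLOC 31 27 28 39 ;; Blk ?B ;; While 30 (Blk ?C) ;; Blk ?D) ?s1 ((8 * q + 39) * lg) ?Q"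
    by (rule seq[OF 2 7]; (assumption | linarith))
  show ?thesis unfolding unpack_code_def
    by (rule seq[OF 1, where ?t2.0 = "8 * q + 39"]) (use 8 in auto)
qed

definition driver_code :: "com => com" where
  "driver_code cp = read_code ;; MOV (40 + nr) 27 ;; cp ;; unpack_code ;; While 13 loop_code ;; Blk [Const 0 0, Add 0 0 18]"

lemma driver_code:
  fixes it0 :: item and Ls Ns m :: nat and cp :: com and tp :: "nat list => nat"
  assumes xs: "2 <= length xs" "xs ! 0 = n" "Z = xs ! 1 * (k + 1) + n + 2" "length xs <= Z" "!!x. x \<in> set xs ==> x <= V0"
    and V0: "2 * Z <= V0" "k + 1 <= V0" "Lmax <= V0"
    and cp: "!!s x V. hp_ok s V ==> holds s (40 + nr) x V ==>
      EX s'. xc cp s (tp x) (V + tp x) s' & post (40 + nr) s (prepare x) (V + tp x) s'"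
    and prep: "prepare (xs @ replicate (Z - length xs) 0) = (it0, Vx, Vy)" "tp (xs @ replicate (Z - length xs) 0) <= Tp"
    and q3: "q = n div 3" and inv: "item_inv it0" and tr: "tree ex it0 m"
    and Ns: "2 * R <= Ns" "Ns < 4 * R" "2 * T Ns <= 2 ^ Ls" "2 ^ Ls <= Vmax"
    and VV: "V0 + 4 * Z + Tp + 4 + (m + (Ls * (2 * R) + (Ns - 2 * R))) * step_heap <= Vmax"
      "m + (Ls * (2 * R) + (Ns - 2 * R)) <= Vmax"
  shows "decides_input (compile 0 (driver_code cp)) xs
    ((200 + 40 * Z + Tp + 10 * q + (m + (Ls * (2 * R) + (Ns - 2 * R))) * (step_time (2 ^ Ls) + 2)) * lg) (item_sat it0)"
proof -
  let ?fl = "xs @ replicate (Z - length xs) 0" and ?kb = "40 + nr"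
  let ?M = "m + (Ls * (2 * R) + (Ns - 2 * R))"
  define G where "G = ?M * step_heap"
  define H where "H = ?M * (step_time (2 ^ Ls) + 2)"
  have vv: "V0 + 4 * Z + Tp + 4 + G <= Vmax" using VV(1) by (simp only: G_def)
  then have vz: "V0 + 4 * Z <= Vmax" by linarith
  let ?Q1 = "%s. hp_ok s (V0 + 4 * Z) & reg s 1 = Z & reg s 2 = n & fresh 0 s & holds s 27 ?fl (V0 + 4 * Z)"
  let ?Q = "%s. reg s 0 ~= 0 \<longleftrightarrow> item_sat it0"
  have 1: "runs read_code (init xs) ((40 + 40 * Z) * lg) ?Q1"
    by (rule read_code[OF xs V0(1,2) vz])
  have 2: "runs (MOV ?kb 27) s (4 * lg) (%s1. post ?kb s ?fl (V0 + 4 * Z) s1)" if "?Q1 s" for s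
    by (rule post_runs[OF MOV_rule]) (use that vz in auto)
  let ?V1 = "V0 + 4 * Z + Tp"
  let ?Q3 = "%s. hp_ok s ?V1 & holds s ?kb (it0, Vx, Vy) ?V1 & reg s 1 = Z & reg s 2 = n & fresh 0 s"
  have 3: "runs cp s1 (Tp * lg) ?Q3" if q: "?Q1 s" and p: "post ?kb s ?fl (V0 + 4 * Z) s1" for s s1
  proof -
    have p1: "ext ?kb s s1" "hp_ok s1 (V0 + 4 * Z)" "holds s1 ?kb ?fl (V0 + 4 * Z)" using p by (auto simp: post_def)
    have "runs cp s1 (Tp * lg) (post ?kb s1 (prepare ?fl) (V0 + 4 * Z + tp ?fl))"
      by (rule post_runs[OF cp[OF p1(2,3)] prep(2)]) (use vv prep(2) in linarith)
    then show ?thesis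
    proof (rule runs_mono)
      fix x assume "post ?kb s1 (prepare ?fl) (V0 + 4 * Z + tp ?fl) x"
      then have "post ?kb s (it0, Vx, Vy) (V0 + 4 * Z + tp ?fl) x" unfolding prep(1) by (rule post_ext[OF p1(1)])
      then have px: "post ?kb s (it0, Vx, Vy) ?V1 x" by (rule post_mono) (use prep(2) in simp)
      then have e: "ext ?kb s x" by (simp add: post_def)
      have "reg x 1 = reg s 1" "reg x 2 = reg s 2" using e unfolding ext_def by simp_all
      then show "?Q3 x" using px q fresh_ext[OF _ e, of 0] by (simp add: post_def)
    qed simp
  qed
  have nV: "n <= ?V1" using xs(3) V0(1) by linarith
  have 4: "runs unpack_code s2 ((80 + 10 * q) * lg) (%s'. core (?V1 + 4) s' 0 (2 * R) 1 [it0] & fresh 0 s' & reg s' 18 = 0)"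
    if "?Q3 s2" for s2
    by (rule unpack_code) (use that q3 vv V0(3) nV in auto)
  have 5: "runs (While 13 loop_code) s3 ((H + 1) * lg) (%s'. reg s' 18 = of_bool (item_sat it0))"
    if "core (?V1 + 4) s3 0 (2 * R) 1 [it0] & fresh 0 s3 & reg s3 18 = 0" for s3
    unfolding H_def by (rule main_loop[OF Ns _ _ _ inv tr VV]) (use that in auto)
  have 6: "runs (Blk [Const 0 0, Add 0 0 18]) s4 (4 * lg) ?Q" if "reg s4 18 = of_bool (item_sat it0)" for s4
    by (rule blk) (use that beta2 in \<open>auto simp: of_bool_def\<close>)
  have 56: "runs (While 13 loop_code ;; Blk [Const 0 0, Add 0 0 18]) s3 ((H + 5) * lg) ?Q"
    if "core (?V1 + 4) s3 0 (2 * R) 1 [it0] & fresh 0 s3 & reg s3 18 = 0" for s3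
    by (rule seq[OF 5[OF that] 6]; (assumption | linarith))
  have 46: "runs (unpack_code ;; While 13 loop_code ;; Blk [Const 0 0, Add 0 0 18]) s2 ((85 + 10 * q + H) * lg) ?Q"
    if "?Q3 s2" for s2 by (rule seq[OF 4[OF that] 56]; (assumption | linarith))
  have 36: "runs (cp ;; unpack_code ;; While 13 loop_code ;; Blk [Const 0 0, Add 0 0 18]) s1 ((Tp + 85 + 10 * q + H) * lg) ?Q"
    if "?Q1 s" and "post ?kb s ?fl (V0 + 4 * Z) s1" for s s1 by (rule seq[OF 3[OF that] 46]; (assumption | linarith))
  have 26: "runs (MOV ?kb 27 ;; cp ;; unpack_code ;; While 13 loop_code ;; Blk [Const 0 0, Add 0 0 18]) s ((Tp + 89 + 10 * q + H) * lg) ?Q"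
    if q1: "?Q1 s" for s by (rule seq[OF 2[OF q1] 36[OF q1]]; (assumption | linarith))
  have "runs (driver_code cp) (init xs) ((200 + 40 * Z + Tp + 10 * q + H) * lg) ?Q"
    unfolding driver_code_def by (rule seq[OF 1 26]; (assumption | linarith))
  then obtain K s' where "exec (driver_code cp) (init xs) K s'" "K <= (200 + 40 * Z + Tp + 10 * q + H) * lg" "?Q s'"
    unfolding runs_def by blast
  then show ?thesis unfolding H_def by (rule exec_decides)
qed

end

section \<open>Choice of the constants\<close>

text \<open>For arguments from 2 on, constants and constant factors can be absorbed into the
  exponent, so a bare power suffices.\<close>

definition pol :: "(nat => nat) => bool" where
  "pol f \<longleftrightarrow> (EX D. ALL E>=2. f E <= E ^ D)"

lemma pol_id: "pol (%E. E)"
  unfolding pol_def by (rule exI[of _ 1]) simp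

lemma pol_const: "pol (%E. c)"
  unfolding pol_def
proof (intro exI[of _ c] allI impI)
  fix E :: nat assume "2 <= E"
  then have "2 ^ c <= E ^ c" by (intro power_mono) auto
  moreover have "c < 2 ^ c" by simp
  ultimately show "c <= E ^ c" by linarith
qed

lemma pol_mult: "pol f ==> pol g ==> pol (%E. f E * g E)"
proof -
  assume "pol f" "pol g"
  then obtain D1 D2 where "ALL E>=2. f E <= E ^ D1" "ALL E>=2. g E <= E ^ D2" unfolding pol_def by blast
  then have "ALL E>=2. f E * g E <= E ^ (D1 + D2)" by (auto simp: power_add intro: mult_le_mono)
  then show ?thesis unfolding pol_def by blast
qed

lemma pol_add: "pol f ==> pol g ==> pol (%E. f E + g E)"
proof -
  assume "pol f" "pol g"
  then obtain D1 D2 where D: "ALL E>=2. f E <= E ^ D1" "ALL E>=2. g E <= E ^ D2" unfolding pol_def by blast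
  have "f E + g E <= E ^ (Suc (D1 + D2))" if E: "2 <= E" for E
  proof -
    have "E ^ D1 <= E ^ (D1 + D2)" "E ^ D2 <= E ^ (D1 + D2)" using E by (intro power_increasing; simp)+
    then have "f E + g E <= 2 * E ^ (D1 + D2)" using D E by (metis add_le_mono le_trans mult_2)
    also have "... <= E * E ^ (D1 + D2)" using E by (rule mult_le_mono1)
    finally show ?thesis by simp
  qed
  then show ?thesis unfolding pol_def by blast
qed

lemma pol_power: "pol f ==> pol (%E. f E ^ m)"
  by (induction m) (auto intro: pol_const[of 1, simplified] pol_mult)

lemmas pol_intros = pol_id pol_const pol_mult pol_add pol_power

section \<open>Weights that keep the branching tree small\<close>

lemma sparse_const_poly: "EX C. ALL A>=1. sparse_const A i <= C * A ^ C"
proof (induction i)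
  case 0
  have "ALL A>=1. sparse_const A 0 <= 2 * A ^ 2" by auto
  then show ?case by blast
next
  case (Suc i)
  then obtain C where C: "ALL A>=1. sparse_const A i <= C * A ^ C" by blast
  define P where "P = 2 * (i + 3) * C\<^sup>2"
  have "sparse_const A (Suc i) <= (P + (2 * C + 1)) * A ^ (P + (2 * C + 1))" if A: "1 <= A" for A
  proof -
    have e: "(C * A ^ C)\<^sup>2 = C\<^sup>2 * A ^ (2 * C)"
      by (simp only: power_mult_distrib power_mult[symmetric] mult.commute[of C 2])
    have "(sparse_const A i)\<^sup>2 <= (C * A ^ C)\<^sup>2" using C A by (intro power_mono) auto
    then have "2 * A * (i + 3) * (sparse_const A i)\<^sup>2 <= 2 * A * (i + 3) * (C * A ^ C)\<^sup>2" by (rule mult_le_mono2)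
    then have "sparse_const A (Suc i) <= 2 * A * (i + 3) * (C * A ^ C)\<^sup>2" by (simp only: sparse_const.simps)
    also have "... = P * (A * A ^ (2 * C))" unfolding e P_def by (simp only: ac_simps)
    also have "... = P * A ^ (2 * C + 1)" by simp
    also have "... <= (P + (2 * C + 1)) * A ^ (P + (2 * C + 1))"
      by (rule mult_le_mono[OF le_add1 power_increasing[OF le_add2 A]])
    finally show ?thesis .
  qed
  then show ?case by blast
qed

text \<open>For fixed \<open>k\<close> the sum is polynomial in \<open>A\<close>, so its logarithm
  is negligible compared with \<open>A\<close>; this is what the choice of the weights
  exploits.\<close>

lemma sum_sparse_const_poly: "EX C. ALL A>=1. 1 + (\<Sum>i<k. sparse_const A i) <= C * A ^ C"
proof (induction k)
  case 0
  have "ALL A>=1. 1 + (\<Sum>i<0. sparse_const A i) <= 1 * A ^ 1" by auto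
  then show ?case by blast
next
  case (Suc k)
  then obtain C1 where C1: "ALL A>=1. 1 + (\<Sum>i<k. sparse_const A i) <= C1 * A ^ C1" by blast
  obtain C2 where C2: "ALL A>=1. sparse_const A k <= C2 * A ^ C2" using sparse_const_poly by blast
  have "1 + (\<Sum>i<Suc k. sparse_const A i) <= (C1 + C2) * A ^ (C1 + C2)" if A: "1 <= A" for A
  proof -
    have "A ^ C1 <= A ^ (C1 + C2)" "A ^ C2 <= A ^ (C1 + C2)" using A by (intro power_increasing; simp)+
    then have "C1 * A ^ C1 + C2 * A ^ C2 <= (C1 + C2) * A ^ (C1 + C2)"
      unfolding distrib_right by (rule add_mono[OF mult_le_mono2 mult_le_mono2])
    moreover have "1 + (\<Sum>i<k. sparse_const A i) <= C1 * A ^ C1" "sparse_const A k <= C2 * A ^ C2"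
      using C1 C2 A by blast+
    then have "1 + (\<Sum>i<k. sparse_const A i) + sparse_const A k <= C1 * A ^ C1 + C2 * A ^ C2" by (rule add_mono)
    moreover have "1 + (\<Sum>i<Suc k. sparse_const A i) = 1 + (\<Sum>i<k. sparse_const A i) + sparse_const A k"
      by (simp only: sum.lessThan_Suc add.assoc)
    ultimately show ?thesis by (simp only: le_trans)
  qed
  then show ?case by blast
qed

text \<open>Crude but linear in \<open>x\<close>: in the branching condition it leaves room for a
  second summand up to \<open>x / 4\<close>.\<close>

lemma two_powr_minus_le:
  fixes x :: real
  assumes "0 <= x" "x <= 1" shows "2 powr - x <= 1 - x / 4"
proof -
  define y where "y = x * ln 2"
  have l: "1 / 2 <= ln (2::real)" "ln (2::real) <= 1" using ln_le_minus_one[of "1 / 2 :: real"] ln_le_minus_one[of "2 :: real"] by (auto simp: ln_div)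
  have y: "x / 2 <= y" "y <= 1" using assms l mult_left_mono[OF l(1) assms(1)] mult_mono[of x 1 "ln 2" 1] by (auto simp: y_def)
  have y0: "0 <= y" using y assms by linarith
  have "2 powr - x = inverse (exp y)" by (simp add: powr_def y_def exp_minus)
  also have "... <= inverse (1 + y)" using y0 by (intro le_imp_inverse_le exp_ge_add_one_self) linarith
  also have "... <= 1 - y / 2"
  proof -
    have "y * y <= y * 1" using y y0 by (intro mult_left_mono)
    then have "1 <= (1 - y / 2) * (1 + y)" by (simp add: algebra_simps)
    then show ?thesis using y0 by (simp add: inverse_eq_divide pos_divide_le_eq)
  qed
  finally show ?thesis using y by linarith
qed

text \<open>Since \<open>thresh A i = A * sparse_const A i\<close>, the maximal potential is at most
  \<open>n * (S * wH + k * wP / A)\<close>. Here \<open>wH = d / (2 * S)\<close> makes the first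
  part \<open>d / 2\<close>, and the branching condition then admits
  \<open>wP = log 2 (4 / wH)\<close>. As \<open>S\<close> is polynomial in \<open>A\<close>, this
  \<open>wP\<close> grows only logarithmically with \<open>A\<close>, and a large \<open>A\<close>
  brings the second part below \<open>d / 2\<close>.\<close>

lemma sparse_weights:
  assumes \<delta>: "0 < \<delta>"
  shows "EX A wH wP. 1 <= A & 0 < wH & 0 < wP & 2 powr - wH + 2 powr - wP <= 1 &
    (ALL n. sparsification.psi_max A k n wH wP <= \<delta> * real n)"
proof -
  define d where "d = min \<delta> 1"
  have d: "0 < d" "d <= 1" "d <= \<delta>" using \<delta> by (auto simp: d_def)
  obtain C where C: "ALL A>=1. 1 + (\<Sum>i<k. sparse_const A i) <= C * A ^ C" using sum_sparse_const_poly by blast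
  have C0: "1 <= C" using C[rule_format, of 1] by simp
  \<comment> \<open>With \<open>S\<close> bounded by \<open>C * A ^ C\<close>, the function at
    \<open>x = A\<close> is the bound on \<open>k * wP / A\<close> obtained below.\<close>
  have "((%x::real. real k * log 2 (8 * real C / d) / x + real k * (real C / ln 2) * (ln x / x)) \<longlongrightarrow> 0 + real k * (real C / ln 2) * 0) at_top"
    by (intro tendsto_intros ln_x_over_x_tendsto_0 tendsto_divide_0[OF tendsto_const] filterlim_at_top_imp_at_infinity filterlim_ident)
  then have "eventually (%x::real. real k * log 2 (8 * real C / d) / x + real k * (real C / ln 2) * (ln x / x) < d / 2) at_top"
    by (rule order_tendstoD(2)) (use d in auto)
  then obtain x0 where x0: "!!x. x0 <= x ==> real k * log 2 (8 * real C / d) / x + real k * (real C / ln 2) * (ln x / x) < d / 2"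
    unfolding eventually_at_top_linorder by blast
  define A where "A = nat \<lceil>max x0 1\<rceil>"
  have A: "1 <= A" "x0 <= real A" unfolding A_def by linarith+
  define S where "S = real (1 + (\<Sum>i<k. sparse_const A i))"
  have S1: "1 <= S" unfolding S_def by (simp add: sum_nonneg)
  have S2: "S <= real C * real A ^ C" unfolding S_def using C[rule_format, OF A(1)]
    by (metis of_nat_le_iff of_nat_mult of_nat_power)
  define wH where "wH = d / (2 * S)"
  define wP where "wP = log 2 (4 / wH)"
  have wH: "0 < wH" "wH <= 1" using d S1 by (auto simp: wH_def divide_simps)
  have wP0: "0 < wP" unfolding wP_def using wH by (simp add: divide_simps)
  have pw: "2 powr - wP = wH / 4" unfolding wP_def using wH by (simp add: powr_minus)
  have sum1: "2 powr - wH + 2 powr - wP <= 1" unfolding pw using two_powr_minus_le[of wH] wH by simp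
  have small: "real k * wP / real A <= d / 2"
  proof -
    have "4 / wH = 8 * S / d" using S1 d by (simp add: wH_def)
    also have "... <= 8 * (real C * real A ^ C) / d" using S2 d by (intro divide_right_mono mult_left_mono) auto
    finally have "wP <= log 2 (8 * (real C * real A ^ C) / d)" unfolding wP_def using wH A C0 d
      by (subst log_le_cancel_iff) auto
    also have "... = log 2 ((8 * real C / d) * real A ^ C)" by (simp add: ac_simps)
    also have "... = log 2 (8 * real C / d) + real C * log 2 (real A)"
      using C0 d A by (subst log_mult) (auto simp: log_nat_power)
    finally have "real k * wP / real A <= real k * (log 2 (8 * real C / d) + real C * log 2 (real A)) / real A"
      by (intro divide_right_mono mult_left_mono) auto
    also have "... = real k * log 2 (8 * real C / d) / real A + real k * (real C / ln 2) * (ln (real A) / real A)"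
      by (simp add: log_def add_divide_distrib distrib_left)
    also have "... < d / 2" by (rule x0[OF A(2)])
    finally show ?thesis by simp
  qed
  have "sparsification.psi_max A k n wH wP <= \<delta> * real n" for n
  proof -
    have sp: "sparsification A n {..<2 * n}" using A(1) by unfold_locales auto
    have b0: "sparse_const A i ~= 0" for i using A(1) by (induction i) auto
    \<comment> \<open>The number of added clauses and the threshold share the factor
      \<open>sparse_const A i\<close>, so the petal part of each summand reduces to
      \<open>wP / A\<close>.\<close>
    have "sparsification.psi_max A k n wH wP = (\<Sum>i=1..<k. real n * (real (sparse_const A i) * wH + wP / real A))"
      unfolding sparsification.psi_max_def[OF sp] thresh_def
      by (intro sum.cong refl) (use b0 A(1) in \<open>simp add: field_simps\<close>)
    also have "... = real n * ((\<Sum>i=1..<k. real (sparse_const A i)) * wH + real (k - 1) * (wP / real A))"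
      by (simp add: sum_distrib_left[symmetric] sum.distrib sum_distrib_right[symmetric])
    also have "... <= real n * (S * wH + real k * (wP / real A))"
    proof -
      have "(\<Sum>i=1..<k. real (sparse_const A i)) <= (\<Sum>i<k. real (sparse_const A i))" by (intro sum_mono2) auto
      also have "... <= S" by (simp add: S_def)
      finally show ?thesis using wH wP0 by (intro mult_left_mono add_mono mult_right_mono) auto
    qed
    also have "... <= real n * d"
    proof -
      have "S * wH = d / 2" using S1 by (simp add: wH_def)
      moreover have "real k * (wP / real A) <= d / 2" using small by simp
      ultimately have "S * wH + real k * (wP / real A) <= d" by linarith
      then show ?thesis by (rule mult_left_mono) simp
    qed
    also have "... <= \<delta> * real n" using mult_right_mono[OF d(3), of "real n"] by (simp add: mult.commute)
    finally show ?thesis .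
  qed
  then show ?thesis using A(1) wH(1) wP0 sum1 by blast
qed

section \<open>Sizes of encoded formulas and bounds on registers\<close>

lemma length_k_cnf:
  assumes "\<phi> \<in> k_cnf k n" shows "length \<phi> <= (k + 1) * (2 * n + 1) ^ k"
proof -
  let ?L = "{..<n} \<times> (UNIV :: bool set)"
  have c: "card ?L = 2 * n" by (simp add: card_cartesian_product)
  have fin: "finite {xs. set xs \<subseteq> ?L & length xs <= k}" by (rule finite_lists_length_le) simp
  have "length \<phi> = card (set \<phi>)" using assms by (simp add: k_cnf_def distinct_card)
  also have "... <= card {xs. set xs \<subseteq> ?L & length xs <= k}"
  proof (rule card_mono[OF fin], rule subsetI)
    fix C assume "C \<in> set \<phi>"
    then have C: "length C <= k" "ALL l:set C. fst l < n" using assms by (auto simp: k_cnf_def)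
    have "set C \<subseteq> ?L"
    proof
      fix l assume "l \<in> set C"
      then have "fst l < n" using C(2) by blast
      then show "l \<in> ?L" by (simp add: mem_Times_iff)
    qed
    then show "C \<in> {xs. set xs \<subseteq> ?L & length xs <= k}" using C(1) by simp
  qed
  also have "... = (\<Sum>i\<le>k. (2 * n) ^ i)" by (subst card_lists_length_le) (simp_all add: c)
  also have "... <= (\<Sum>i\<le>k. (2 * n + 1) ^ k)"
  proof (rule sum_mono)
    fix i assume "i \<in> {..k}"
    then have "(2 * n + 1) ^ i <= (2 * n + 1) ^ k" by (intro power_increasing) auto
    moreover have "(2 * n) ^ i <= (2 * n + 1) ^ i" by (rule power_mono) auto
    ultimately show "(2 * n) ^ i <= (2 * n + 1) ^ k" by linarith
  qed
  finally show ?thesis by simp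
qed

lemma length_concat_le: "(!!x. x \<in> set xs ==> length x <= m) ==> length (concat xs) <= length xs * m"
proof (induction xs)
  case (Cons a xs)
  have "length (concat xs) <= length xs * m" by (rule Cons.IH) (use Cons.prems in auto)
  moreover have "length a <= m" using Cons.prems by simp
  ultimately show ?case by simp
qed simp

lemma encode_cnf_bounds:
  assumes "\<phi> \<in> k_cnf k n"
  shows "2 <= length (encode_cnf n \<phi>)" "encode_cnf n \<phi> ! 0 = n" "encode_cnf n \<phi> ! 1 = length \<phi>"
    "length (encode_cnf n \<phi>) <= length \<phi> * (k + 1) + 2"
    "!!x. x \<in> set (encode_cnf n \<phi>) ==> x <= 2 * n + length \<phi> + k"
proof -
  show "2 <= length (encode_cnf n \<phi>)" "encode_cnf n \<phi> ! 0 = n" "encode_cnf n \<phi> ! 1 = length \<phi>"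
    by (auto simp: encode_cnf_def)
  have "length (concat (map (%C. length C # map encode_literal C) \<phi>)) <= length (map (%C. length C # map encode_literal C) \<phi>) * (k + 1)"
    by (rule length_concat_le) (use assms in \<open>auto simp: k_cnf_def\<close>)
  then show "length (encode_cnf n \<phi>) <= length \<phi> * (k + 1) + 2" by (simp add: encode_cnf_def)
  have lit: "encode_literal l <= 2 * n" if "C \<in> set \<phi>" "l \<in> set C" for C l
  proof -
    have "fst l < n" using assms that by (auto simp: k_cnf_def)
    then show ?thesis by (cases "snd l") (auto simp: encode_literal_def)
  qed
  have len: "length C <= k" if "C \<in> set \<phi>" for C using assms that by (auto simp: k_cnf_def)
  fix x assume "x \<in> set (encode_cnf n \<phi>)"
  then have "x = n | x = length \<phi> | (EX C:set \<phi>. x = length C | (EX l:set C. x = encode_literal l))"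
    by (simp add: encode_cnf_def image_iff)
  then show "x <= 2 * n + length \<phi> + k"
  proof (elim disjE bexE)
    fix C assume C: "C \<in> set \<phi>" "x = length C"
    then show ?thesis using len[OF C(1)] by linarith
  next
    fix C l assume C: "C \<in> set \<phi>" "l \<in> set C" "x = encode_literal l"
    then show ?thesis using lit[OF C(1,2)] by linarith
  qed linarith+
qed

lemma regs_bounded: "EX nr>=1. ALL i:set p. instr_regs i \<subseteq> {..<nr :: nat}"
proof -
  have fin: "finite (instr_regs i)" for i by (cases i) auto
  have "finite (\<Union>i\<in>set p. instr_regs i)" using fin by auto
  from finite_nat_set_iff_bounded[THEN iffD1, OF this] obtain m
    where m: "ALL x:(\<Union>i\<in>set p. instr_regs i). x < m" by (rule exE)
  have "instr_regs i \<subseteq> {..<Suc m}" if "i \<in> set p" for i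
  proof
    fix x assume "x \<in> instr_regs i"
    then have "x < m" using m that by simp
    then show "x \<in> {..<Suc m}" by simp
  qed
  then show ?thesis by (intro exI[of _ "Suc m"]) simp
qed

section \<open>The lower bound\<close>

lemma exp_beats_poly:
  fixes a c' K :: real
  assumes a: "0 < a" and c: "0 < c'" and K: "0 < K"
  shows "EX n1. ALL n>=n1. K * real (2 * n + 8) ^ D < c' * 2 powr (a * real n)"
proof -
  define b where "b = a * ln 2"
  have b: "0 < b" using a by (simp add: b_def)
  define G where "G = K * (10 / b) ^ D"
  have G: "0 < G" using K b by (simp add: G_def)
  have "((%x::real. x ^ D / exp x) \<longlongrightarrow> 0) at_top" by (rule tendsto_power_div_exp_0)
  then have "eventually (%x::real. x ^ D / exp x < c' / G) at_top"
    by (rule order_tendstoD(2)) (use c G in simp)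
  then obtain x0 where x0: "!!x. x0 <= x ==> x ^ D / exp x < c' / G" unfolding eventually_at_top_linorder by blast
  have "K * real (2 * n + 8) ^ D < c' * 2 powr (a * real n)" if n: "nat \<lceil>max 1 (x0 / b)\<rceil> <= n" for n
  proof -
    have n1: "1 <= real n" "x0 / b <= real n" using n by linarith+
    define x where "x = b * real n"
    have "x0 <= x" using n1(2) b by (simp add: x_def pos_divide_le_eq mult.commute)
    then have l: "x ^ D / exp x < c' / G" by (rule x0)
    have e: "2 powr (a * real n) = exp x" by (simp add: powr_def x_def b_def ac_simps)
    have "real (2 * n + 8) <= (10 / b) * x" using n1(1) b by (simp add: x_def)
    then have "real (2 * n + 8) ^ D <= ((10 / b) * x) ^ D" by (intro power_mono) auto
    then have "K * real (2 * n + 8) ^ D <= K * ((10 / b) * x) ^ D" using K by (intro mult_left_mono) auto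
    also have "... = G * x ^ D" by (simp only: G_def power_mult_distrib mult.assoc)
    also have "... < c' * exp x" using l G by (simp add: divide_simps mult.commute)
    finally show ?thesis by (simp only: e)
  qed
  then show ?thesis by blast
qed

lemma decides_input_mono: "decides_input p xs t b ==> t <= t' ==> decides_input p xs t' b"
  unfolding decides_input_def by (meson le_trans)

lemma bit_length_le_Suc: "bit_length x <= x + 1"
proof -
  have "x < 2 ^ x" by simp
  also have "(2::nat) ^ x <= 2 ^ (x + 1)" by (rule power_increasing) auto
  finally show ?thesis using bit_length_le_iff[of "x + 1" x] by simp
qed

lemma bit_length_exp: "x <= 2 ^ e ==> bit_length x <= e + 1"
proof -
  assume x: "x <= 2 ^ e"
  have "(2::nat) ^ e < 2 ^ (e + 1)" by simp
  then have "x < 2 ^ (e + 1)" using x by (rule le_less_trans[rotated])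
  then show ?thesis using bit_length_le_iff[of "e + 1" x] by simp
qed

lemma polyb_obtain:
  assumes "polyb t" obtains C where "!!x S. sz x <= S ==> t x <= C * S ^ C"
proof -
  obtain C where C: "!!x. t x <= C * sz x ^ C" using assms unfolding polyb_def by blast
  have "t x <= C * S ^ C" if "sz x <= S" for x S
    using C[of x] mult_le_mono2[OF power_mono[OF that, of C], of C] by (simp add: le_trans)
  then show ?thesis using that by blast
qed

lemma sz_nat_list: "sz (xs :: nat list) = 2 * length xs + 1" by (induction xs) auto

lemma sz_var_pairs: "sz (map var_pair xs) = 4 * length xs + 1" by (induction xs) (auto simp: var_pair_def)

text \<open>The program \<open>P\<close> and the exponent \<open>D\<close> are fixed before the
  input. The time is the number of passes, about \<open>M\<close> nodes and
  \<open>2 ^ (n div 3)\<close> time-outs, times the price of a pass, about an instance of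
  \<open>2 ^ (n div 3)\<close> rows and a clock of \<open>2 ^ L\<close>. The number \<open>E\<close>
  dominates \<open>n\<close>, \<open>L\<close> and the logarithm of \<open>M\<close> and serves to
  express all polynomial factors as one power.\<close>

lemma reduction:
  fixes A c k :: nat and wH wP :: real
  assumes dec: "decides_in_time p (stable_verification (%N. nat \<lceil>real c * log 2 (real N)\<rceil>)) T"
    and A: "1 <= A" and c: "1 <= c" "!!n. 2 * (1 + 2 * n + k * (2 * n * thresh A k)) <= c * (n div 3 + 1)"
    and w: "0 < wH" "0 < wP" "2 powr - wH + 2 powr - wP <= 1"
  shows "EX P D. ALL n \<phi> Ns L M E. \<phi> \<in> k_cnf k n --> 2 * 2 ^ (n div 3) <= Ns --> Ns < 4 * 2 ^ (n div 3) --> 2 * T Ns <= 2 ^ L -->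
    2 powr (sparsification.psi_max A k n wH wP) * 2 ^ (n - 2 * (n div 3) + 1) <= real M -->
    2 <= E --> n <= E --> L <= E --> M <= 2 ^ E -->
    decides_input P (encode_cnf n \<phi>) (E ^ D * ((M + 2 ^ (n div 3)) * (2 ^ (n div 3) + 2 ^ L))) (satisfiable \<phi>)"
proof -
  obtain nr where nr: "1 <= nr" "ALL i:set p. instr_regs i \<subseteq> {..<nr}" using regs_bounded by blast
  obtain te where te: "CT (expand (2 ^ k) (params (thresh A) k)) te" "polyb te" using PT_expand unfolding PT_def by blast
  obtain tn where tn: "CT entry tn" "polyb tn" using PT_entry unfolding PT_def by blast
  obtain tp where tp: "CT prepare tp" "polyb tp" using PT_prepare unfolding PT_def by blast
  have kb: "0 < 40 + nr" by simp
  obtain ce where ce: "!!s x V. hp_ok s V ==> holds s (40 + nr) x V ==>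
      EX s'. xc ce s (te x) (V + te x) s' & post (40 + nr) s (expand (2 ^ k) (params (thresh A) k) x) (V + te x) s'"
    using CT_E[OF te(1) kb] by blast
  obtain cn where cn: "!!s x V. hp_ok s V ==> holds s (40 + nr) x V ==>
      EX s'. xc cn s (tn x) (V + tn x) s' & post (40 + nr) s (entry x) (V + tn x) s'"
    using CT_E[OF tn(1) kb] by blast
  obtain cp where cp: "!!s x V. hp_ok s V ==> holds s (40 + nr) x V ==>
      EX s'. xc cp s (tp x) (V + tp x) s' & post (40 + nr) s (prepare x) (V + tp x) s'"
    using CT_E[OF tp(1) kb] by blast
  obtain Ce where Ce: "!!x S. sz x <= S ==> te x <= Ce * S ^ Ce" using polyb_obtain[OF te(2)] by blast
  obtain Cn where Cn: "!!x S. sz x <= S ==> tn x <= Cn * S ^ Cn" using polyb_obtain[OF tn(2)] by blast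
  obtain Cp where Cp: "!!x S. sz x <= S ==> tp x <= Cp * S ^ Cp" using polyb_obtain[OF tp(2)] by blast
  define P where "P = compile 0 (driver.driver_code k p nr c ce cn cp)"
  define NP where "NP = sum_list (map instr_num p)"
  define sc where "sc = 3 * (length p * 12 + 1010) + 20 + nr"
  \<comment> \<open>From here on the quantities of the analysis are bounded by functions of
    \<open>E\<close> alone: \<open>zE\<close> stands for \<open>Z\<close>, \<open>iE\<close> for the
    size of an item, \<open>lE\<close> for \<open>Lmax\<close> divided by \<open>R\<close>,
    \<open>bE\<close> for the bit length of \<open>Vmax\<close>, and \<open>sE\<close> for the price
    of a pass divided by \<open>W\<close>. Only their being polynomial in \<open>E\<close>
    matters.\<close>
  define zE where "zE E = ((k + 1) * (2 * E + 1) ^ k) * (k + 1) + E + 2" for E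
  define iE where "iE E = 1 + (k + 1) * (2 * E + 1) ^ k * (2 * k + 2) + (1 + 4 * E) + (1 + 2 * E) + 2" for E
  define TeE where "TeE E = Ce * iE E ^ Ce" for E
  define TnE where "TnE E = Cn * (iE E + 8 * E + 18) ^ Cn" for E
  define TpE where "TpE E = Cp * (2 * zE E + 1) ^ Cp" for E
  define lE where "lE E = 6 + 16 * (c * (E + 2))" for E
  define blE where "blE E = (E + 1) + (lE E + 1)" for E
  define bE where "bE E = (2 + (E + 2) * c) + (blE E + 4) + (length p + NP + 1) + (E + 1) +
    ((6 * zE E + k + TpE E + 6) + blE E + ((2 * E + 4) + (E + 1) + (TeE E + 42 + blE E + (TnE E + 5))))" for E
  define sE where "sE E = TeE E + 162 + (bE E + 1) + (2 * c + 200 + 20 * (c * (E + 2))) + lE E * (TnE E + 400) + sc * (4 * (bE E + 1))" for E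
  define gE where "gE E = 200 + 40 * zE E + TpE E + 10 * E" for E
  define fE where "fE E = (gE E + (2 * E + 2) * sE E) * bE E" for E
  have pz: "pol zE" unfolding zE_def by (intro pol_intros)
  have pi: "pol iE" unfolding iE_def by (intro pol_intros)
  have pTe: "pol TeE" unfolding TeE_def by (intro pol_intros pi)
  have pTn: "pol TnE" unfolding TnE_def by (intro pol_intros pi)
  have pTp: "pol TpE" unfolding TpE_def by (intro pol_intros pz)
  have pl: "pol lE" unfolding lE_def by (intro pol_intros)
  have pbl: "pol blE" unfolding blE_def by (intro pol_intros pl)
  have pb: "pol bE" unfolding bE_def by (intro pol_intros pz pTp pTe pTn pbl)
  have ps: "pol sE" unfolding sE_def by (intro pol_intros pb pTe pTn pl)
  have "pol fE" unfolding fE_def gE_def by (intro pol_intros pb ps pz pTp)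
  then obtain D where D: "!!E. 2 <= E ==> fE E <= E ^ D" unfolding pol_def by blast
  have "decides_input P (encode_cnf n \<phi>) (E ^ D * ((M + 2 ^ (n div 3)) * (2 ^ (n div 3) + 2 ^ L))) (satisfiable \<phi>)"
    if \<phi>: "\<phi> \<in> k_cnf k n" and Ns: "2 * 2 ^ (n div 3) <= Ns" "Ns < 4 * 2 ^ (n div 3)" and L: "2 * T Ns <= 2 ^ L"
      and M: "2 powr (sparsification.psi_max A k n wH wP) * 2 ^ (n - 2 * (n div 3) + 1) <= real M"
      and E: "2 <= E" "n <= E" "L <= E" "M <= 2 ^ E" for n \<phi> Ns L M E
  proof -
    define q where "q = n div 3"
    have q2: "2 * q <= n" and qE: "q <= E" using E(2) by (auto simp: q_def)
    define Z where "Z = length \<phi> * (k + 1) + n + 2"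
    define xs where "xs = encode_cnf n \<phi>"
    note xb = encode_cnf_bounds[OF \<phi>, folded xs_def]
    have lenZ: "length xs <= Z" and nZ: "n <= Z - length xs" using xb(4) by (auto simp: Z_def)
    let ?fl = "xs @ replicate (Z - length xs) 0"
    obtain F Vz zs Vx Vy where pr: "prepare ?fl = ((F, Vz, zs), Vx, Vy)" by (metis prod.exhaust)
    note pe = prepare_encode[OF \<phi> q_def nZ, folded xs_def, OF pr]
    have it: "items A k n (clauses F) (2 ^ k) q"
      by unfold_locales (use A pe(4) q2 in auto)
    interpret it: items A k n "clauses F" "2 ^ k" q by (rule it)
    define it0 where "it0 = (F, Vz, zs)"
    have inv0: "it.item_inv it0" unfolding it0_def
      by (rule it.item_invI[where m = "2 * q"]) (use pe q2 it.inv_init in auto)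
    obtain m where m: "tree it.ex it0 m" "m <= M"
    proof -
      obtain m where t: "tree it.ex it0 m" and le: "real m <= 2 powr (it.psi_max wH wP - it.psi wH wP (clauses (fst it0))) *
          2 ^ (length (fst (snd it0)) + 1) - 1" using it.tree_bound[OF w inv0] by blast
      have "0 <= it.psi wH wP (clauses (fst it0))" unfolding it.psi_def using w by (intro sum_nonneg mult_nonneg_nonneg) auto
      then have "2 powr (it.psi_max wH wP - it.psi wH wP (clauses (fst it0))) <= 2 powr (it.psi_max wH wP)" by simp
      moreover have "length (fst (snd it0)) = n - 2 * q" by (simp add: it0_def pe(7))
      ultimately have "real m <= 2 powr (it.psi_max wH wP) * 2 ^ (n - 2 * q + 1) - 1"
        using le by (smt (verit) mult_right_mono zero_le_power)
      then have "real m <= real M" using M unfolding q_def by linarith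
      then show ?thesis using that t by simp
    qed
    define R where "R = (2::nat) ^ q"
    define dmax where "dmax = c * (q + 2)"
    define Lmax where "Lmax = 2 + 4 * (4 * 2 ^ q * dmax) + 4 * 2 ^ q"
    define V0 where "V0 = 2 * Z + (k + 1) + Lmax"
    define \<tau>s where "\<tau>s = L * (2 * 2 ^ q) + (Ns - 2 * 2 ^ q)"
    define sh where "sh = TeE E + 8 + (32 + Lmax * (TnE E + 4))"
    \<comment> \<open>One summand for each kind of number to be bounded: the power
      \<open>N ^ c\<close>, the positions and symbols of an instance, the constants of
      \<open>p\<close>, the clock, and the heap pointer after all passes. All of them are at most
      exponential in a polynomial of \<open>E\<close>, so the bit length is polynomial.\<close>
    define Vmax where "Vmax = 2 * (4 * 2 ^ q) ^ c + (2 * Lmax + 2) + (length p + NP) + 2 ^ L +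
      (6 * Z + k + TpE E + 5 + Lmax + (M + \<tau>s) * (sh + 1))"
    have ZE: "Z <= zE E"
    proof -
      have "length \<phi> <= (k + 1) * (2 * n + 1) ^ k" by (rule length_k_cnf[OF \<phi>])
      also have "... <= (k + 1) * (2 * E + 1) ^ k" using E(2) by (intro mult_le_mono2 power_mono) auto
      finally show ?thesis unfolding Z_def zE_def using E(2) by (intro add_mono mult_le_mono1) auto
    qed
    have isz: "sz x <= iE E" if "it.item_inv x" for x
    proof -
      have "sz x <= it.item_size" by (rule it.sz_item[OF that])
      also have "... <= iE E" unfolding it.item_size_def iE_def
        using E(2) by (intro add_mono mult_le_mono mult_le_mono2 power_mono) auto
      finally show ?thesis .
    qed
    have te': "te x <= TeE E" if "it.item_inv x" for x unfolding TeE_def by (rule Ce[OF isz[OF that]])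
    have tn': "tn (a, x, map var_pair [0..<q], map var_pair [q..<2 * q], N, d, Nd, Nd4, R, R2) <= TnE E"
      if "it.item_inv x" for a x N d Nd Nd4 R R2
      unfolding TnE_def by (rule Cn) (use isz[OF that] qE in \<open>simp add: sz_var_pairs\<close>)
    have tp': "tp ?fl <= TpE E" unfolding TpE_def by (rule Cp) (use ZE lenZ in \<open>simp add: sz_nat_list\<close>)
    have nump: "instr_num i <= NP" if "i \<in> set p" for i
      unfolding NP_def using that by (simp add: member_le_sum_list)
    have num: "instr_num i <= Vmax" if "i \<in> set p" for i using nump[OF that] unfolding Vmax_def by linarith
    have c2: "2 * (1 + 2 * n + k * (2 * n * thresh A k)) <= c * (q + 1)" unfolding q_def by (rule c(2))
    have Vm: "2 * (4 * 2 ^ q) ^ c <= Vmax" "Z <= Vmax" "2 * Lmax + 2 <= Vmax" "2 <= Vmax" "length p <= Vmax" "2 ^ L <= Vmax"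
      unfolding Vmax_def by linarith+
    have dr: "driver A k n (clauses F) (2 ^ k) q p nr c Z Vmax (TeE E) (TnE E) Lmax dmax ce cn te tn T"
      using ce cn te' tn' nr num Vm c(1) c2 dec Lmax_def dmax_def
      by (intro driver.intro driver_axioms.intro it) blast+
    interpret dr: driver A k n "clauses F" "2 ^ k" q p nr c Z Vmax "TeE E" "TnE E" Lmax dmax ce cn te tn T by (rule dr)
    define lg where "lg = bit_length Vmax"
    have sh: "dr.step_heap = sh" by (simp add: dr.step_heap_def dr.job_heap_def sh_def)
    have vv: "V0 + 4 * Z + TpE E + 4 + (m + \<tau>s) * sh <= Vmax" "m + \<tau>s <= Vmax"
    proof -
      have a: "(m + \<tau>s) * sh <= (M + \<tau>s) * (sh + 1)" using m(2) by (intro mult_le_mono) auto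
      have "(m + \<tau>s) * 1 <= (M + \<tau>s) * (sh + 1)" using m(2) by (intro mult_le_mono) auto
      then have b: "m + \<tau>s <= (M + \<tau>s) * (sh + 1)" by (simp only: mult_1_right)
      define X where "X = (M + \<tau>s) * (sh + 1)"
      define Y where "Y = (m + \<tau>s) * sh"
      have Vx: "6 * Z + k + TpE E + 5 + Lmax + X <= Vmax" unfolding Vmax_def X_def by linarith
      show "V0 + 4 * Z + TpE E + 4 + (m + \<tau>s) * sh <= Vmax" using a Vx unfolding V0_def X_def[symmetric] Y_def[symmetric] by linarith
      show "m + \<tau>s <= Vmax" using b Vx unfolding X_def[symmetric] by linarith
    qed
    have dec1: "decides_input P xs ((200 + 40 * Z + TpE E + 10 * q + (m + \<tau>s) * (dr.step_time (2 ^ L) + 2)) * lg) (item_sat it0)"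
      unfolding P_def lg_def \<tau>s_def
    proof (rule dr.driver_code[OF xb(1,2) _ lenZ _ _ _ _ cp _ tp' q_def inv0 m(1)])
      show "Z = xs ! 1 * (k + 1) + n + 2" unfolding xb(3) Z_def ..
      show "x <= V0" if "x \<in> set xs" for x using xb(5)[OF that] unfolding V0_def Z_def by simp
      show "2 * Z <= V0" "k + 1 <= V0" "Lmax <= V0" unfolding V0_def by linarith+
      show "prepare ?fl = (it0, map var_pair [0..<q], map var_pair [q..<2 * q])" using pr pe(5,6) by (simp add: it0_def)
      show "2 * 2 ^ q <= Ns" "Ns < 4 * 2 ^ q" using Ns by (simp_all add: q_def)
      show "V0 + 4 * Z + TpE E + 4 + (m + (L * (2 * 2 ^ q) + (Ns - 2 * 2 ^ q))) * dr.step_heap <= Vmax"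
        using vv(1) unfolding sh \<tau>s_def .
      show "m + (L * (2 * 2 ^ q) + (Ns - 2 * 2 ^ q)) <= Vmax" using vv(2) unfolding \<tau>s_def .
    qed (assumption | rule L | rule Vm(6))+
    have sat: "item_sat it0 \<longleftrightarrow> satisfiable \<phi>" unfolding it0_def pe(8) by (rule item_sat_initial[OF pe(2)])
    have RE: "R <= 2 ^ E" unfolding R_def using qE by (intro power_increasing) auto
    have R1: "1 <= R" by (simp add: R_def)
    have dE: "dmax <= c * (E + 2)" unfolding dmax_def using qE by simp
    have LmE: "Lmax <= R * lE E"
    proof -
      have "Lmax = 2 + R * (16 * dmax) + R * 4" by (simp add: Lmax_def R_def)
      also have "... <= R * 2 + R * (16 * (c * (E + 2))) + R * 4" using R1 dE by (intro add_mono mult_le_mono2) auto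
      also have "... = R * lE E" by (simp only: lE_def distrib_left[symmetric]) simp
      finally show ?thesis .
    qed
    have bl: "bit_length Lmax <= blE E"
      using bit_length_mono[OF LmE] bit_length_mult[of R "lE E"] bit_length_exp[OF RE] bit_length_le_Suc[of "lE E"]
      unfolding blE_def by linarith
    have \<tau>R: "\<tau>s <= (2 * E + 2) * R"
    proof -
      have "L * (2 * R) <= E * (2 * R)" using E(3) by (rule mult_le_mono1)
      moreover have "Ns - 2 * R <= 2 * R" using Ns by (simp add: R_def q_def)
      moreover have "(2 * E + 2) * R = E * (2 * R) + 2 * R" by (simp add: algebra_simps)
      ultimately show ?thesis unfolding \<tau>s_def R_def[symmetric] by linarith
    qed
    have b: "lg <= bE E"
    proof -
      have 1: "bit_length (2 * (4 * 2 ^ q) ^ c) <= 2 + (E + 2) * c"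
      proof -
        have "(4::nat) * 2 ^ q = 2 ^ (q + 2)" by (simp add: power_add)
        then have "2 * ((4::nat) * 2 ^ q) ^ c = 2 ^ Suc ((q + 2) * c)" by (simp only: power_mult power_Suc)
        also have "... <= 2 ^ (1 + (E + 2) * c)" using qE by (intro power_increasing) auto
        finally show ?thesis using bit_length_exp by fastforce
      qed
      have 2: "bit_length (2 * Lmax + 2) <= blE E + 4"
        using bit_length_add[of "2 * Lmax" 2] bit_length_mult[of 2 Lmax] bl by simp
      have 3: "bit_length (length p + NP) <= length p + NP + 1" by (rule bit_length_le_Suc)
      have 4: "bit_length (2 ^ L) <= E + 1" by (rule bit_length_exp) (use E(3) in \<open>simp add: power_increasing\<close>)
      have 5: "bit_length (6 * Z + k + TpE E + 5) <= 6 * zE E + k + TpE E + 6"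
        using bit_length_le_Suc[of "6 * Z + k + TpE E + 5"] ZE by linarith
      have 6: "bit_length (M + \<tau>s) <= (2 * E + 4) + (E + 1)"
      proof -
        have "(2 * E + 2) * R <= (2 * E + 2) * 2 ^ E" using RE by (rule mult_le_mono2)
        moreover have "(2 * E + 3) * 2 ^ E = (2 * E + 2) * 2 ^ E + (2::nat) ^ E" by (simp add: algebra_simps)
        ultimately have "M + \<tau>s <= (2 * E + 3) * 2 ^ E" using \<tau>R E(4) by linarith
        then have "bit_length (M + \<tau>s) <= bit_length (2 * E + 3) + bit_length (2 ^ E)"
          using bit_length_mono bit_length_mult le_trans by blast
        moreover have "bit_length (2 ^ E) <= E + 1" by (rule bit_length_exp) simp
        ultimately show ?thesis using bit_length_le_Suc[of "2 * E + 3"] by linarith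
      qed
      have 7: "bit_length (sh + 1) <= TeE E + 42 + blE E + (TnE E + 5)"
      proof -
        have eq: "sh + 1 = TeE E + 41 + Lmax * (TnE E + 4)" by (simp add: sh_def)
        show ?thesis unfolding eq
          using bit_length_add[of "TeE E + 41" "Lmax * (TnE E + 4)"] bit_length_mult[of Lmax "TnE E + 4"]
            bl bit_length_le_Suc[of "TeE E + 41"] bit_length_le_Suc[of "TnE E + 4"] by linarith
      qed
      define x1 x2 x3 x4 x5 x6 where "x1 = (2::nat) * (4 * 2 ^ q) ^ c" and "x2 = 2 * Lmax + 2" and "x3 = length p + NP"
        and "x4 = (2::nat) ^ L" and "x5 = 6 * Z + k + TpE E + 5" and "x6 = (M + \<tau>s) * (sh + 1)"
      have V: "Vmax = x1 + x2 + x3 + x4 + (x5 + Lmax + x6)" unfolding Vmax_def x1_def x2_def x3_def x4_def x5_def x6_def ..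
      have "bit_length (x1 + x2 + x3 + x4 + (x5 + Lmax + x6)) <= bit_length x1 + bit_length x2 + bit_length x3 +
          bit_length x4 + (bit_length x5 + bit_length Lmax + bit_length x6)"
        using bit_length_add[of "x1 + x2 + x3 + x4" "x5 + Lmax + x6"] bit_length_add[of "x1 + x2 + x3" x4]
          bit_length_add[of "x1 + x2" x3] bit_length_add[of x1 x2] bit_length_add[of "x5 + Lmax" x6] bit_length_add[of x5 Lmax]
        by linarith
      moreover have "bit_length x6 <= bit_length (M + \<tau>s) + bit_length (sh + 1)" unfolding x6_def by (rule bit_length_mult)
      ultimately show ?thesis unfolding lg_def bE_def V
        using 1 2 3 4 5 6 7 bl unfolding x1_def[symmetric] x2_def[symmetric] x3_def[symmetric] x4_def[symmetric] x5_def[symmetric]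
        by linarith
    qed
    \<comment> \<open>Common unit for the price of a pass: the number of rows of an instance plus
      the largest clock.\<close>
    define W where "W = R + 2 ^ L"
    have W: "1 <= W" "R <= W" "2 ^ L <= W" using R1 by (auto simp: W_def)
    have st: "dr.step_time (2 ^ L) + 2 <= W * sE E"
    proof -
      have x: "x <= W * x" for x using W(1) by simp
      have bb: "lg + 2 ^ L <= W * (bE E + 1)" using b x[of "bE E"] W(3) unfolding distrib_left by linarith
      have l: "Lmax * (TnE E + 400) <= W * (lE E * (TnE E + 400))"
        using mult_le_mono1[OF le_trans[OF LmE mult_le_mono1[OF W(2)]], of "TnE E + 400"] by (simp only: mult.assoc)
      have s: "sc * (4 * (lg + 2 ^ L)) <= W * (sc * (4 * (bE E + 1)))"
        using mult_le_mono2[OF mult_le_mono2[OF bb, of 4], of sc] by (simp only: ac_simps)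
      have eq: "dr.step_time (2 ^ L) + 2 = (TeE E + 162) + (lg + 2 ^ L) + (2 * c + 200 + 20 * dmax) + Lmax * (TnE E + 400) +
          sc * (4 * (lg + 2 ^ L))"
        unfolding dr.step_time_def dr.job_time_def dr.simc_def sc_def[symmetric] lg_def by simp
      have d: "2 * c + 200 + 20 * dmax <= 2 * c + 200 + 20 * (c * (E + 2))" using dE by linarith
      have "dr.step_time (2 ^ L) + 2 <= W * (TeE E + 162) + W * (bE E + 1) + W * (2 * c + 200 + 20 * (c * (E + 2))) +
          W * (lE E * (TnE E + 400)) + W * (sc * (4 * (bE E + 1)))"
        unfolding eq by (intro add_mono l s bb x order_trans[OF d x])
      then show ?thesis by (simp only: sE_def distrib_left add.assoc)
    qed
    have ms: "m + \<tau>s <= (M + R) * (2 * E + 2)"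
    proof -
      have "M * 1 <= M * (2 * E + 2)" by (rule mult_le_mono2) simp
      moreover have "(M + R) * (2 * E + 2) = M * (2 * E + 2) + (2 * E + 2) * R" by (simp only: distrib_right mult.commute)
      ultimately show ?thesis using m(2) \<tau>R by linarith
    qed
    have g: "200 + 40 * Z + TpE E + 10 * q <= gE E" unfolding gE_def using ZE qE by linarith
    define U where "U = (M + R) * W"
    have U1: "1 <= U" unfolding U_def using mult_le_mono[of 1 "M + R" 1 W] R1 W(1) by simp
    have "(200 + 40 * Z + TpE E + 10 * q + (m + \<tau>s) * (dr.step_time (2 ^ L) + 2)) * lg <= (gE E * U + ((2 * E + 2) * sE E) * U) * bE E"
    proof (rule mult_le_mono[OF add_mono b])
      show "200 + 40 * Z + TpE E + 10 * q <= gE E * U" using g mult_le_mono2[OF U1, of "gE E"] by (simp add: le_trans)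
      have "(m + \<tau>s) * (dr.step_time (2 ^ L) + 2) <= ((M + R) * (2 * E + 2)) * (W * sE E)" by (rule mult_le_mono[OF ms st])
      also have "... = ((2 * E + 2) * sE E) * U" unfolding U_def by (simp only: ac_simps)
      finally show "(m + \<tau>s) * (dr.step_time (2 ^ L) + 2) <= ((2 * E + 2) * sE E) * U" .
    qed
    also have "... = fE E * U" unfolding fE_def distrib_right[of "gE E" "(2 * E + 2) * sE E" U, symmetric] by (simp only: ac_simps)
    also have "... <= E ^ D * U" by (rule mult_le_mono1[OF D[OF E(1)]])
    finally have "decides_input P xs (E ^ D * U) (satisfiable \<phi>)" using decides_input_mono dec1 unfolding sat by blast
    then show ?thesis unfolding U_def W_def R_def q_def xs_def .
  qed
  then show ?thesis by blast
qed

text \<open>As \<open>n <= 3 * (n div 3 + 1)\<close>, a number of coordinates linear in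
  \<open>n\<close> is covered by a multiple of \<open>n div 3 + 1\<close> that depends only on
  \<open>k\<close> and the threshold; this multiple becomes the constant \<open>c\<close>.\<close>

lemma job_dimension: "2 * (1 + 2 * n + k * (2 * n * \<theta>)) <= 2 * (7 + 6 * k * \<theta>) * (n div 3 + 1 :: nat)"
proof -
  define u where "u = n div 3 + 1"
  have u: "1 <= u" "n <= 3 * u" by (auto simp: u_def)
  have "k * (2 * n * \<theta>) <= k * (2 * (3 * u) * \<theta>)" using u(2) by (intro mult_le_mono2 mult_le_mono1)
  also have "... = 6 * k * \<theta> * u" by simp
  finally have X: "k * (2 * n * \<theta>) <= 6 * k * \<theta> * u" .
  have "1 + 2 * n <= 7 * u" using u by linarith
  from mult_le_mono2[OF add_mono[OF this X]]
  have "2 * (1 + 2 * n + k * (2 * n * \<theta>)) <= 2 * (7 * u + 6 * k * \<theta> * u)" .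
  then show ?thesis unfolding u_def[symmetric] by (simp only: distrib_right mult.assoc)
qed

lemma power_of_two_between: "EX L. x <= 2 ^ L & 2 ^ L <= 2 * x + (1::nat)"
proof (cases "x = 0")
  case True
  then show ?thesis by (intro exI[of _ 0]) simp
next
  case False
  have "2 ^ floor_log x <= x" "x <= 2 * 2 ^ floor_log x"
    using False floor_log_exp2_le[of x] floor_log_exp2_gt[of x] by auto
  then show ?thesis by (intro exI[of _ "Suc (floor_log x)"]) auto
qed

text \<open>The exponents are \<open>e / 12 * n + q\<close> for the number of passes and
  \<open>q * (2 - e)\<close> for the price of one. With \<open>q = n / 3\<close> they add up to
  \<open>(1 - e / 4) * n\<close>; constant factors are collected in \<open>2 ^ 12\<close>.\<close>

lemma cost_exponent:
  fixes e :: real and q N T L M D :: nat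
  defines "n \<equiv> 3 * q"
  assumes e: "0 < e" "e <= 1" and N: "2 * 2 ^ q <= N" "N < 4 * 2 ^ q"
    and T: "real T <= real N powr (2 - e)" and L: "2 ^ L <= 2 * (2 * T) + 1"
    and M: "real M <= 2 powr (e / 12 * real n) * 2 ^ (q + 1) + 1"
  shows "L <= 2 * n + 8" "M <= 2 ^ (2 * n + 8)"
    "real ((2 * n + 8) ^ D * ((M + 2 ^ q) * (2 ^ q + 2 ^ L))) <= 2 ^ 12 * real (2 * n + 8) ^ D * 2 powr ((1 - e / 4) * real n)"
proof -
  have N1: "1 <= real N" using N(1) by (metis le_trans one_le_numeral one_le_power mult_le_mono nat_mult_1 of_nat_1 of_nat_le_iff)
  have Nl: "real N <= 2 powr (real q + 2)"
  proof -
    have "real N <= real (4 * 2 ^ q)" using N(2) by linarith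
    then show ?thesis by (simp add: powr_add powr_realpow)
  qed
  have T2: "real T <= 2 powr (real q * (2 - e) + 4)"
  proof -
    have "real N powr (2 - e) <= (2 powr (real q + 2)) powr (2 - e)" using Nl e by (intro powr_mono2) auto
    also have "... = 2 powr ((real q + 2) * (2 - e))" by (simp add: powr_powr)
    also have "... <= 2 powr (real q * (2 - e) + 4)" using e by (intro powr_mono) (auto simp: algebra_simps)
    finally show ?thesis using T by linarith
  qed
  have p0: "1 <= 2 powr (real q * (2 - e))" using e by (intro ge_one_powr_ge_zero) auto
  have L2: "real (2 ^ L) <= 2 powr (real q * (2 - e) + 7) - 2 powr (real q * (2 - e))"
  proof -
    have "real (2 ^ L) <= real (2 * (2 * T) + 1)" using L by (simp only: of_nat_le_iff)
    also have "... = 4 * real T + 1" by simp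
    also have "... <= 4 * (16 * 2 powr (real q * (2 - e))) + 2 powr (real q * (2 - e))" using T2 p0 by (simp add: powr_add)
    also have "... <= 128 * 2 powr (real q * (2 - e)) - 2 powr (real q * (2 - e))" by simp
    finally show ?thesis by (simp add: powr_add)
  qed
  have Lq: "L <= 2 * q + 7"
  proof -
    have "2 powr real L = real (2 ^ L)" by (simp add: powr_realpow)
    also have "... <= 2 powr (real q * (2 - e) + 7)" using L2 p0 by linarith
    also have "... <= 2 powr (real (2 * q + 7))" using e by (intro powr_mono) (auto simp: algebra_simps)
    finally have "real L <= real (2 * q + 7)" by (simp only: powr_le_cancel_iff[of 2])
    then show ?thesis by (simp only: of_nat_le_iff)
  qed
  then show "L <= 2 * n + 8" by (simp add: n_def)
  have q1: "1 <= 2 powr (e / 12 * real n + real q)" using e by (intro ge_one_powr_ge_zero) auto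
  have M2: "real M <= 3 * 2 powr (e / 12 * real n + real q)"
  proof -
    have "2 powr (e / 12 * real n) * 2 ^ (q + 1) = 2 * 2 powr (e / 12 * real n + real q)" by (simp add: powr_add powr_realpow)
    then show ?thesis using M q1 by linarith
  qed
  show "M <= 2 ^ (2 * n + 8)"
  proof -
    have "3 * 2 powr (e / 12 * real n + real q) <= 2 powr (e / 12 * real n + real q + 2)" by (simp add: powr_add)
    also have "... <= 2 powr (real (2 * n + 8))"
    proof (rule powr_mono)
      have "e / 12 * real n <= 1 * real n" using e by (intro mult_right_mono) auto
      then show "e / 12 * real n + real q + 2 <= real (2 * n + 8)" by (simp add: n_def)
    qed simp
    also have "... = real (2 ^ (2 * n + 8))" by (subst powr_realpow) auto
    finally have "real M <= real (2 ^ (2 * n + 8))" using M2 by linarith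
    then show ?thesis by (simp only: of_nat_le_iff)
  qed
  have a: "real (M + 2 ^ q) <= 4 * 2 powr (e / 12 * real n + real q)"
  proof -
    have "real (2 ^ q) = 2 powr (real q)" by (simp add: powr_realpow)
    also have "... <= 2 powr (e / 12 * real n + real q)" using e by (intro powr_mono) auto
    finally show ?thesis using M2 by simp
  qed
  have b: "real (2 ^ q + 2 ^ L) <= 2 powr (real q * (2 - e) + 7)"
  proof -
    have "real (2 ^ q) = 2 powr (real q)" by (simp add: powr_realpow)
    also have "... <= 2 powr (real q * (2 - e))"
    proof (rule powr_mono)
      have "real q * 1 <= real q * (2 - e)" using e by (intro mult_left_mono) auto
      then show "real q <= real q * (2 - e)" by simp
    qed simp
    finally show ?thesis using L2 by simp
  qed
  have "real ((2 * n + 8) ^ D * ((M + 2 ^ q) * (2 ^ q + 2 ^ L))) = real (2 * n + 8) ^ D * (real (M + 2 ^ q) * real (2 ^ q + 2 ^ L))"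
    by (simp only: of_nat_mult of_nat_power)
  also have "... <= real (2 * n + 8) ^ D * (4 * 2 powr (e / 12 * real n + real q) * 2 powr (real q * (2 - e) + 7))"
    by (intro mult_left_mono mult_mono a b) auto
  also have "4 * 2 powr (e / 12 * real n + real q) * 2 powr (real q * (2 - e) + 7) = 512 * 2 powr ((1 - e / 4) * real n)"
  proof -
    have "e / 12 * real n + real q + real q * (2 - e) = (1 - e / 4) * real n" by (simp add: n_def algebra_simps)
    then have "2 powr ((1 - e / 4) * real n) = 2 powr (e / 12 * real n + real q) * 2 powr (real q * (2 - e))"
      by (simp only: powr_add[symmetric])
    moreover have "2 powr (real q * (2 - e) + 7) = 128 * 2 powr (real q * (2 - e))" by (simp add: powr_add)
    ultimately show ?thesis by simp
  qed
  also have "real (2 * n + 8) ^ D * (512 * 2 powr ((1 - e / 4) * real n)) <=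
      real (2 * n + 8) ^ D * (2 ^ 12 * 2 powr ((1 - e / 4) * real n))" by (intro mult_left_mono mult_right_mono) auto
  also have "... = 2 ^ 12 * real (2 * n + 8) ^ D * 2 powr ((1 - e / 4) * real n)" by simp
  finally show "real ((2 * n + 8) ^ D * ((M + 2 ^ q) * (2 ^ q + 2 ^ L))) <= 2 ^ 12 * real (2 * n + 8) ^ D * 2 powr ((1 - e / 4) * real n)" .
qed

theorem theorem8:
  assumes SETH
  shows "\<forall>\<epsilon>::real. \<epsilon> > 0 \<longrightarrow>
    (\<exists>c::real. c > 0 \<and>
      requires_time (stable_verification (\<lambda>n. nat \<lceil>c * log 2 (real n)\<rceil>))
        (\<lambda>n. real n powr (2 - \<epsilon>)))"
proof (intro allI impI)
  fix \<epsilon> :: real assume \<epsilon>: "\<epsilon> > 0"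
  \<comment> \<open>A time below \<open>N powr (2 - \<epsilon>)\<close> is below
    \<open>N powr (2 - e)\<close> too. With \<open>e <= 1\<close> the exponent is at least 1, so
    writing an instance with \<open>N\<close> rows costs no more, up to polynomial factors, than
    verifying it.\<close>
  define e where "e = min \<epsilon> 1"
  have e: "0 < e" "e <= 1" "e <= \<epsilon>" using \<epsilon> by (auto simp: e_def)
  have "e / 6 > 0" using e by simp
  \<comment> \<open>Of the gain \<open>e / 3\<close> in the exponent from the shorter runs,
    \<open>e / 12\<close> is spent on sparsification and \<open>e / 12\<close> on the polynomial
    factor; \<open>e / 6\<close> remains to contradict SETH.\<close>
  then obtain k where sat: "requires_time (k_SAT k) (%n. 2 powr ((1 - e / 6) * real n))"
    using assms unfolding SETH_def by blast
  have "0 < e / 12" using e by simp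
  from sparse_weights[OF this, of k] obtain A wH wP where A: "1 <= A" and w: "0 < wH" "0 < wP" "2 powr - wH + 2 powr - wP <= 1"
    and psi: "!!n. sparsification.psi_max A k n wH wP <= e / 12 * real n" by blast
  define c where "c = 2 * (7 + 6 * k * thresh A k)"
  have c: "1 <= c" "!!n. 2 * (1 + 2 * n + k * (2 * n * thresh A k)) <= c * (n div 3 + 1)"
    unfolding c_def using job_dimension by simp_all
  have "requires_time (stable_verification (%n. nat \<lceil>real c * log 2 (real n)\<rceil>)) (%n. real n powr (2 - \<epsilon>))"
    unfolding requires_time_def
  proof (intro allI impI, rule ccontr)
    fix p T assume dec: "decides_in_time p (stable_verification (%n. nat \<lceil>real c * log 2 (real n)\<rceil>)) T"
      and no: "(%n. real (T n)) \<notin> \<Omega>(%n. real n powr (2 - \<epsilon>))"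
    have "~ eventually (%N. real N powr (2 - \<epsilon>) <= real (T N)) at_top"
    proof
      assume "eventually (%N. real N powr (2 - \<epsilon>) <= real (T N)) at_top"
      then have "(%n. real (T n)) \<in> \<Omega>(%n. real n powr (2 - \<epsilon>))"
        by (intro landau_omega.bigI[of 1]) simp_all
      then show False using no by contradiction
    qed
    \<comment> \<open>Failure of the lower bound with constant 1 yields arbitrarily large good
      sizes, with no information about where they lie.\<close>
    then have io: "EX N>=N0. real (T N) < real N powr (2 - \<epsilon>)" for N0
      unfolding eventually_at_top_linorder by (auto simp: not_le)
    obtain P D where red: "!!n \<phi> Ns L M E. \<phi> \<in> k_cnf k n ==> 2 * 2 ^ (n div 3) <= Ns ==> Ns < 4 * 2 ^ (n div 3) ==>
        2 * T Ns <= 2 ^ L ==> 2 powr (sparsification.psi_max A k n wH wP) * 2 ^ (n - 2 * (n div 3) + 1) <= real M ==>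
        2 <= E ==> n <= E ==> L <= E ==> M <= 2 ^ E ==>
        decides_input P (encode_cnf n \<phi>) (E ^ D * ((M + 2 ^ (n div 3)) * (2 ^ (n div 3) + 2 ^ L))) (satisfiable \<phi>)"
      using reduction[OF dec A c w] by blast
    define ok where "ok n t \<longleftrightarrow> (ALL \<phi>:k_cnf k n. decides_input P (encode_cnf n \<phi>) t (satisfiable \<phi>))" for n t
    \<comment> \<open>SETH speaks about time bounds valid for all \<open>n\<close>, so
      \<open>P\<close> must have one even where no good size is available: any size works once the
      clock is large. The least bound \<open>Ts\<close> is small at the particular \<open>n\<close>
      chosen below.\<close>
    have "EX t. ok n t" for n
    proof -
      define Ns where "Ns = (2::nat) * 2 ^ (n div 3)"
      define L where "L = 2 * T Ns"
      define M where "M = nat \<lceil>2 powr (sparsification.psi_max A k n wH wP) * 2 ^ (n - 2 * (n div 3) + 1)\<rceil>"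
      have "M < 2 ^ M" by simp
      also have "(2::nat) ^ M <= 2 ^ (n + L + M + 2)" by (intro power_increasing) auto
      finally have ME: "M <= 2 ^ (n + L + M + 2)" by simp
      have "ok n ((n + L + M + 2) ^ D * ((M + 2 ^ (n div 3)) * (2 ^ (n div 3) + 2 ^ L)))" unfolding ok_def
      proof
        fix \<phi> assume "\<phi> \<in> k_cnf k n"
        then show "decides_input P (encode_cnf n \<phi>) ((n + L + M + 2) ^ D * ((M + 2 ^ (n div 3)) * (2 ^ (n div 3) + 2 ^ L))) (satisfiable \<phi>)"
        proof (rule red[where Ns = Ns])
          show "2 powr (sparsification.psi_max A k n wH wP) * 2 ^ (n - 2 * (n div 3) + 1) <= real M" unfolding M_def by (rule real_nat_ceiling_ge)
          show "2 * T Ns <= 2 ^ L" unfolding L_def by (simp add: less_imp_le)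
        qed (use ME in \<open>auto simp: Ns_def\<close>)
      qed
      then show ?thesis by blast
    qed
    define Ts where "Ts n = (LEAST t. ok n t)" for n
    have Ts: "ok n (Ts n)" for n unfolding Ts_def by (rule LeastI_ex) fact
    have Ts_le: "ok n t ==> Ts n <= t" for n t unfolding Ts_def by (rule Least_le)
    have "decides_in_time P (k_SAT k) Ts" using Ts by (simp add: decides_in_time_def k_SAT_def ok_def)
    then have "(%n. real (Ts n)) \<in> \<Omega>(%n. 2 powr ((1 - e / 6) * real n))" using sat unfolding requires_time_def by blast
    then obtain c1 where c1: "0 < c1" "eventually (%n. norm (real (Ts n)) >= c1 * norm (2 powr ((1 - e / 6) * real n))) at_top"
      by (rule landau_omega.bigE)
    then obtain n0 where n0: "!!n. n0 <= n ==> c1 * 2 powr ((1 - e / 6) * real n) <= real (Ts n)"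
      unfolding eventually_at_top_linorder by auto
    have "0 < e / 12" using e by simp
    from exp_beats_poly[OF this c1(1), of "2 ^ 12" D] obtain n1 where
      n1: "!!n. n1 <= n ==> 2 ^ 12 * real (2 * n + 8) ^ D < c1 * 2 powr (e / 12 * real n)" by auto
    obtain N where N: "2 ^ (n0 + n1 + 2) <= N" "real (T N) < real N powr (2 - \<epsilon>)" using io by blast
    \<comment> \<open>Then \<open>2 * 2 ^ q <= N < 4 * 2 ^ q\<close>, so for formulas with
      \<open>n = 3 * q\<close> variables the search meets the good size \<open>N\<close>. Every
      large number lies in such an interval, hence large \<open>N\<close> lead to large
      \<open>n\<close>.\<close>
    define q where "q = floor_log N - 1"
    define n where "n = 3 * q"
    have "(2::nat) ^ 2 <= 2 ^ (n0 + n1 + 2)" by (rule power_increasing) auto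
    from le_trans[OF this N(1)] have N4: "4 <= N" by simp
    have fl: "n0 + n1 + 2 <= floor_log N"
    proof -
      have "floor_log (2 ^ (n0 + n1 + 2)) <= floor_log N" using N(1) floor_log_mono by (simp only: mono_def)
      then show ?thesis by (simp only: floor_log_power)
    qed
    then have qs: "floor_log N = Suc q" "n0 <= n" "n1 <= n" by (auto simp: q_def n_def)
    have n3: "n div 3 = q" "n - 2 * q = q" by (simp_all add: n_def)
    have Nq: "2 * 2 ^ q <= N" "N < 4 * 2 ^ q"
      using floor_log_exp2_le[of N] floor_log_exp2_gt[of N] N4 by (simp_all add: qs(1))
    have TN: "real (T N) <= real N powr (2 - e)"
    proof -
      have "real N powr (2 - \<epsilon>) <= real N powr (2 - e)" using N4 e by (intro powr_mono) auto
      then show ?thesis using N(2) by linarith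
    qed
    obtain L where L: "2 * T N <= 2 ^ L" "2 ^ L <= 2 * (2 * T N) + 1" using power_of_two_between by blast
    define M where "M = nat \<lceil>2 powr (sparsification.psi_max A k n wH wP) * 2 ^ (q + 1)\<rceil>"
    have M1: "2 powr (sparsification.psi_max A k n wH wP) * 2 ^ (q + 1) <= real M" unfolding M_def by (rule real_nat_ceiling_ge)
    have M2: "real M <= 2 powr (e / 12 * real n) * 2 ^ (q + 1) + 1"
    proof -
      have "2 powr (sparsification.psi_max A k n wH wP) * 2 ^ (q + 1) <= 2 powr (e / 12 * real n) * 2 ^ (q + 1)"
        using psi[of n] by (intro mult_right_mono) auto
      moreover have "0 <= 2 powr (sparsification.psi_max A k n wH wP) * 2 ^ (q + 1)" by simp
      ultimately show ?thesis unfolding M_def by linarith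
    qed
    note ce = cost_exponent[OF e(1,2) Nq TN L(2) M2[unfolded n_def], folded n_def]
    have "ok n ((2 * n + 8) ^ D * ((M + 2 ^ q) * (2 ^ q + 2 ^ L)))" unfolding ok_def
    proof
      fix \<phi> assume \<phi>: "\<phi> \<in> k_cnf k n"
      show "decides_input P (encode_cnf n \<phi>) ((2 * n + 8) ^ D * ((M + 2 ^ q) * (2 ^ q + 2 ^ L))) (satisfiable \<phi>)"
        by (rule red[OF \<phi>, unfolded n3, OF Nq L(1) M1 _ _ ce(1,2)]) simp_all
    qed
    then have "Ts n <= (2 * n + 8) ^ D * ((M + 2 ^ q) * (2 ^ q + 2 ^ L))" by (rule Ts_le)
    then have "real (Ts n) <= real ((2 * n + 8) ^ D * ((M + 2 ^ q) * (2 ^ q + 2 ^ L)))" by (simp only: of_nat_le_iff)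
    also have "... <= 2 ^ 12 * real (2 * n + 8) ^ D * 2 powr ((1 - e / 4) * real n)" by (rule ce(3))
    also have "... < c1 * 2 powr (e / 12 * real n) * 2 powr ((1 - e / 4) * real n)"
      using n1[OF qs(3)] by (intro mult_strict_right_mono) auto
    also have "... = c1 * 2 powr ((1 - e / 6) * real n)"
    proof -
      have "e / 12 * real n + (1 - e / 4) * real n = (1 - e / 6) * real n" by (simp add: algebra_simps)
      then have "2 powr ((1 - e / 6) * real n) = 2 powr (e / 12 * real n) * 2 powr ((1 - e / 4) * real n)"
        by (simp only: powr_add[symmetric])
      then show ?thesis by simp
    qed
    finally show False using n0[OF qs(2)] by linarith
  qed
  then show "EX c::real. c > 0 & requires_time (stable_verification (%n. nat \<lceil>c * log 2 (real n)\<rceil>)) (%n. real n powr (2 - \<epsilon>))"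
    using c(1) by (intro exI[of _ "real c"]) simp
qed

end
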